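(* Let $q\in(0,1)$, let $n$ be a positive integer, and let $a_1,\dots,a_{n-1},b_1,\dots,b_{n-1}\in\mathbb C$ satisfy $a_i\ne0$ for all $i$, $a_i/a_j\notin q^{\mathbb Z}$ for $1\le i\ne j\le n-1$, and $b_l\notin\{0\}\cup q^{-\mathbb N}$ for $1\le l\le n-1$. Let $\lambda\in\mathbb C^*$ with $\lambda\notin-a_iq^{\mathbb Z}$ for $1\le i\le n-1$, and let $z\in\mathbb C^*$ with $z\notin q^{\mathbb Z}$ and $z\notin-\frac{\prod_{l=1}^{n-1}b_l}{\lambda\prod_{l=1}^{n-1}a_l}q^{\mathbb Z}$. Then \begin{align*} &{}_n\varphi_{n-1}(a_1,\dots,a_{n-1},0;b_1,\dots,b_{n-1};q,z)\\ =&\sum_{i=1}^{n-1}\frac{(a_1,\dots,\widehat{a_i},\dots,a_{n-1},b_1/a_i,\dots,b_{n-1}/a_i;q)_\infty}{(b_1,\dots,b_{n-1},a_1/a_i,\dots,\widehat{a_i/a_i},\dots,a_{n-1}/a_i;q)_\infty}\,\frac{\theta_q(-a_iz)}{\theta_q(-z)}\,z^{\log_qa_i}\,f_q^{(\infty)}(z,\lambda)_i\\ &+\frac{(a_1,\dots,a_{n-1};q)_\infty}{(b_1,\dots,b_{n-1};q)_\infty}\,\frac{\prod_{s=1}^{n-1}\theta_q\Big(\prod_{l=1}^{n-1}a_l\big/\big(\lambda\prod_{l=1,l\ne s}^{n-1}b_l\big)\Big)}{\prod_{s=1}^{n-1}\theta_q\Big(a_s\prod_{l=1}^{n-1}a_l\big/\big(\lambda\prod_{l=1}^{n-1}b_l\big)\Big)}\,\frac{\theta_q\Big(\lambda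 z\prod_{l=1}^{n-1}b_l\big/\prod_{l=1}^{n-1}a_l\Big)}{\theta_q(\lambda z)}\,\frac{\prod_{l=1}^{n-1}z^{\log_qb_l}}{\prod_{l=1}^{n-1}z^{\log_qa_l}}\,f_q^{(\infty)}(z)_n, \end{align*} where the series ${}_n\varphi_{n-1}(a_1,\dots,a_{n-1},0;b_1,\dots,b_{n-1};q,z)$ is a solution around the origin, and $f_q^{(\infty)}(z,\lambda)_1,\dots,f_q^{(\infty)}(z,\lambda)_{n-1},f_q^{(\infty)}(z)_n$ (defined in the context) is a fundamental system of meromorphic solutions around infinity, of the confluent hypergeometric $q$-difference equation $$z\prod_{l=1}^{n-1}(1-a_l\sigma_q)y(z)=(1-\sigma_q)\prod_{l=1}^{n-1}\Big(1-\frac{b_l}q\sigma_q\Big)y(z),\qquad \sigma_qy(z)=y(qz).$$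
   Context: Notation: $\mathbb N=\{0,1,2,\dots\}$; $(a;q)_0=1$, $(a;q)_k=\prod_{l=0}^{k-1}(1-aq^l)$, $(a;q)_\infty=\prod_{l\ge0}(1-aq^l)$, $(a_1,\dots,a_m;q)_\infty=\prod_i(a_i;q)_\infty$; $\theta_q(z)=\sum_{m\in\mathbb Z}q^{m(m-1)/2}z^m$. A hat over a term means that it is omitted. $\log_q x=\log x/\log q$, and $\log_q(a_l/b_l)$ means $\log_qa_l-\log_qb_l$; a branch of $\log z$ is fixed and used for all powers of $z$. Basic hypergeometric series: ${}_n\varphi_m(a_1,\dots,a_n;b_1,\dots,b_m;q,z)=\sum_{k\ge0}\frac{\prod_{l=1}^n(a_l;q)_k}{(q;q)_k\prod_{l=1}^m(b_l;q)_k}\big[(-1)^kq^{k(k-1)/2}\big]^{1+m-n}z^k$. For $m=n-1$ it converges for $|z|<1$ and denotes also its meromorphic continuation. $q$-Borel sum: for $\hat f=\sum_{k\ge0}c_kz^{-k}$ put $(\hat{\mathcal B}_{q;1}\hat f)(\xi)=\sum_kc_kq^{k(k-1)/2}\xi^k$, and, with $\hat{\mathcal B}_{q;1}\hat f$ continued analytically along the direction of $\lambda$, put $(\mathcal L^{[\lambda;q]}_{q;1}\hat{\mathcal B}_{q;1}\hat f)(z)=\sum_{m\in\mathbb Z}\frac{(\hat{\mathcal B}_{q;1}\hat f)(\lambda q^m)}{\theta_q(\lambda q^mz)}$. Solutions at infinity: for $1\le i\le n-1$, $$f_q^{(\infty)}(z,\lambda)_i=z^{-\log_qa_i}\,\big(\mathcal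 L^{[\lambda;q]}_{q;1}\hat{\mathcal B}_{q;1}\hat h_i\big)(z),\qquad \hat h_i(z)={}_n\varphi_{n-2}\Big(a_i,\tfrac{a_iq}{b_1},\dots,\tfrac{a_iq}{b_{n-1}};\tfrac{a_iq}{a_1},\dots,\widehat{\tfrac{a_iq}{a_i}},\dots,\tfrac{a_iq}{a_{n-1}};q,\tfrac{\prod_{l=1}^{n-1}b_l}{a_iz\prod_{l=1}^{n-1}a_l}\Big),$$ where $\hat h_i$ is a formal power series in $z^{-1}$; this sum is defined for $\lambda\in\mathbb C^*$ outside $-a_i\frac{\prod_{l=1}^{n-1} a_l}{\prod_{l=1}^{n-1} b_l}q^{\mathbb Z}$. And $$f_q^{(\infty)}(z)_n=h_q(z)_n\,\frac{z^{\sum_{l=1}^{n-1}\log_q(a_l/b_l)}}{(z;q)_\infty},$$ where $h_q(z)_n=1+c_1z^{-1}+c_2z^{-2}+\cdots$ is the unique power series in $z^{-1}$ with constant term $1$ making $f_q^{(\infty)}(z)_n$ a solution of the $q$-difference equation; it converges near $z=\infty$ and is continued meromorphically through the equation.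
   Formalization: Besides the printed conditions, it is assumed that λ ∉ −a_i(∏a_l/∏b_l)q^ℤ (the context's condition for f(z,λ)_i) and that λz ∉ −q^ℤ; at the excluded points θ_q(λz) or another theta denominator vanishes and the right-hand side is undefined. *)

theory Defs
  imports "HOL-Complex_Analysis.Complex_Analysis"
begin

section \<open>q-Pochhammer symbols and the theta function\<close>

definition qpoch :: "complex \<Rightarrow> real \<Rightarrow> nat \<Rightarrow> complex" where
  "qpoch a q k = (\<Prod>l<k. 1 - a * of_real q ^ l)"

definition qpoch_inf :: "complex \<Rightarrow> real \<Rightarrow> complex" where
  "qpoch_inf a q = (\<Prod>l. 1 - a * of_real q ^ l)"

definition qtheta :: "real \<Rightarrow> complex \<Rightarrow> complex" where
  "qtheta q z = (\<Sum>\<^sub>\<infinity>m\<in>(UNIV :: int set). of_real q powi (m * (m - 1) div 2) * z powi m)"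

definition qZ :: "real \<Rightarrow> complex set" where
  "qZ q = range (\<lambda>m::int. of_real q powi m)"

definition q_minusN :: "real \<Rightarrow> complex set" where
  "q_minusN q = range (\<lambda>k::nat. of_real q powi (- int k))"


section \<open>Branches of the logarithm\<close>

text \<open>
  The branch of \<open>log\<close> with argument in \<open>(\<phi> - \<pi>, \<phi> + \<pi>]\<close>. It is holomorphic on \<open>slit_plane \<phi>\<close>,
  and \<open>blog \<phi> (q * z) = blog \<phi> z + ln q\<close> for all \<open>z \<noteq> 0\<close> and \<open>q > 0\<close>.
\<close>

definition blog :: "real \<Rightarrow> complex \<Rightarrow> complex" where
  "blog \<phi> z = Ln (z * cis (- \<phi>)) + \<i> * of_real \<phi>"

definition slit_plane :: "real \<Rightarrow> complex set" where
  "slit_plane \<phi> = {z. z * cis (- \<phi>) \<notin> \<real>\<^sub>\<le>\<^sub>0}"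

definition qlog :: "real \<Rightarrow> real \<Rightarrow> complex \<Rightarrow> complex" where
  "qlog \<phi> q x = blog \<phi> x / of_real (ln q)"

definition bpow :: "real \<Rightarrow> complex \<Rightarrow> complex \<Rightarrow> complex" where
  "bpow \<phi> z s = exp (s * blog \<phi> z)"


section \<open>Basic hypergeometric series\<close>

text \<open>
  The sum of a convergent power series, continued meromorphically to the whole plane.
  The condition \<^const>\<open>nicely_meromorphic_on\<close> (removable singularities are removed, the
  value at a pole is \<open>0\<close>) makes the continuation unique as a function.
\<close>

definition mero_sum :: "complex fps \<Rightarrow> complex \<Rightarrow> complex" where
  "mero_sum F = (THE g. g nicely_meromorphic_on UNIV \<and> g has_fps_expansion F)"

text \<open>
  Numerator and denominator parameters are given as lists. The series is that of
  \<open>\<phi>(as; bs; q, c * X)\<close> as a formal power series in \<open>X\<close>. The exponent \<open>1 + m - n\<close> may be negative.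
\<close>

definition bhs_fps :: "complex list \<Rightarrow> complex list \<Rightarrow> real \<Rightarrow> complex \<Rightarrow> complex fps" where
  "bhs_fps as bs q c = Abs_fps (\<lambda>k.
     (\<Prod>x\<leftarrow>as. qpoch x q k) / (qpoch (of_real q) q k * (\<Prod>x\<leftarrow>bs. qpoch x q k))
     * ((- 1) ^ k * of_real q ^ (k * (k - 1) div 2)) powi (1 + int (length bs) - int (length as))
     * c ^ k)"

definition bhs :: "complex list \<Rightarrow> complex list \<Rightarrow> real \<Rightarrow> complex \<Rightarrow> complex" where
  "bhs as bs q = mero_sum (bhs_fps as bs q 1)"


section \<open>q-Borel summation\<close>

text \<open>
  A formal power series in \<open>1/z\<close> is represented by the \<open>fps\<close> of its coefficients. Its q-Borel
  transform is continued meromorphically, since the q-Laplace transform only samples it on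
  the discrete spiral \<open>lam * q\<^sup>m\<close>, and the ray through \<open>lam\<close> may contain poles off this spiral.
\<close>

definition qborel :: "real \<Rightarrow> complex fps \<Rightarrow> complex fps" where
  "qborel q F = Abs_fps (\<lambda>k. fps_nth F k * of_real q ^ (k * (k - 1) div 2))"

definition qlaplace :: "real \<Rightarrow> complex \<Rightarrow> (complex \<Rightarrow> complex) \<Rightarrow> complex \<Rightarrow> complex" where
  "qlaplace q lam g z =
     (\<Sum>\<^sub>\<infinity>m\<in>(UNIV :: int set). g (lam * of_real q powi m) / qtheta q (lam * of_real q powi m * z))"

definition qborel_sum :: "real \<Rightarrow> complex \<Rightarrow> complex fps \<Rightarrow> complex \<Rightarrow> complex" where
  "qborel_sum q lam F = qlaplace q lam (mero_sum (qborel q F))"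


section \<open>The confluent hypergeometric q-difference equation\<close>

text \<open>\<open>qdiff_op q cs\<close> is the product of the operators \<open>1 - c * \<sigma>\<close> for \<open>c\<close> in the list \<open>cs\<close>.\<close>

definition qdiff_op :: "real \<Rightarrow> complex list \<Rightarrow> (complex \<Rightarrow> complex) \<Rightarrow> complex \<Rightarrow> complex" where
  "qdiff_op q cs y = foldr (\<lambda>c y z. y z - c * y (of_real q * z)) cs y"

definition confluent_eq ::
    "real \<Rightarrow> nat \<Rightarrow> (nat \<Rightarrow> complex) \<Rightarrow> (nat \<Rightarrow> complex) \<Rightarrow> (complex \<Rightarrow> complex) \<Rightarrow> complex \<Rightarrow> bool" where
  "confluent_eq q n a b y z \<longleftrightarrow>
     z * qdiff_op q (map a [1..<n]) y z
       = qdiff_op q (1 # map (\<lambda>l. b l / of_real q) [1..<n]) y z"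

text \<open>
  Meromorphic functions have arbitrary values at their poles, so identities between them are
  required outside a subset that is sparse in the domain \<open>S\<close>.
\<close>

definition mero_solution ::
    "real \<Rightarrow> nat \<Rightarrow> (nat \<Rightarrow> complex) \<Rightarrow> (nat \<Rightarrow> complex) \<Rightarrow> complex set \<Rightarrow> (complex \<Rightarrow> complex) \<Rightarrow> bool" where
  "mero_solution q n a b S y \<longleftrightarrow>
     y meromorphic_on S \<and> (\<forall>\<^sub>\<approx>z\<in>S. confluent_eq q n a b y z)"

text \<open>
  The equation has order \<open>n\<close>. A fundamental system consists of \<open>n\<close> solutions that are linearly
  independent over the field of \<open>\<sigma>\<close>-invariant meromorphic functions.
\<close>

definition fundamental_system ::
    "real \<Rightarrow> nat \<Rightarrow> (nat \<Rightarrow> complex) \<Rightarrow> (nat \<Rightarrow> complex) \<Rightarrow> complex set \<Rightarrow> (nat \<Rightarrow> complex \<Rightarrow> complex) \<Rightarrow> bool" where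
  "fundamental_system q n a b S f \<longleftrightarrow>
     (\<forall>i\<in>{1..n}. mero_solution q n a b S (f i)) \<and>
     (\<forall>p. (\<forall>i\<in>{1..n}. p i meromorphic_on S \<and> (\<forall>\<^sub>\<approx>z\<in>S. p i (of_real q * z) = p i z)) \<longrightarrow>
          (\<forall>\<^sub>\<approx>z\<in>S. (\<Sum>i=1..n. p i z * f i z) = 0) \<longrightarrow>
          (\<forall>i\<in>{1..n}. \<forall>\<^sub>\<approx>z\<in>S. p i z = 0))"


section \<open>Solutions at infinity\<close>

text \<open>The parameters \<open>a 1, \<dots>, a (n - 1)\<close> and \<open>b 1, \<dots>, b (n - 1)\<close> are indexed by \<open>{1..<n}\<close>.\<close>

definition h_hat :: "real \<Rightarrow> nat \<Rightarrow> (nat \<Rightarrow> complex) \<Rightarrow> (nat \<Rightarrow> complex) \<Rightarrow> nat \<Rightarrow> complex fps" where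
  "h_hat q n a b i = bhs_fps
     (a i # map (\<lambda>l. a i * of_real q / b l) [1..<n])
     (map (\<lambda>l. a i * of_real q / a l) (filter (\<lambda>l. l \<noteq> i) [1..<n]))
     q
     ((\<Prod>l\<in>{1..<n}. b l) / (a i * (\<Prod>l\<in>{1..<n}. a l)))"

definition f_inf ::
    "real \<Rightarrow> real \<Rightarrow> nat \<Rightarrow> (nat \<Rightarrow> complex) \<Rightarrow> (nat \<Rightarrow> complex) \<Rightarrow> complex \<Rightarrow> nat \<Rightarrow> complex \<Rightarrow> complex" where
  "f_inf \<phi> q n a b lam i z = bpow \<phi> z (- qlog \<phi> q (a i)) * qborel_sum q lam (h_hat q n a b i) z"

definition last_factor ::
    "real \<Rightarrow> real \<Rightarrow> nat \<Rightarrow> (nat \<Rightarrow> complex) \<Rightarrow> (nat \<Rightarrow> complex) \<Rightarrow> complex \<Rightarrow> complex" where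
  "last_factor \<phi> q n a b z =
     bpow \<phi> z (\<Sum>l\<in>{1..<n}. qlog \<phi> q (a l) - qlog \<phi> q (b l)) / qpoch_inf z q"

definition h_last_fps ::
    "real \<Rightarrow> real \<Rightarrow> nat \<Rightarrow> (nat \<Rightarrow> complex) \<Rightarrow> (nat \<Rightarrow> complex) \<Rightarrow> complex fps" where
  "h_last_fps \<phi> q n a b = (THE c. fps_nth c 0 = 1 \<and> fps_conv_radius c > 0 \<and>
     (\<exists>R>0. mero_solution q n a b (slit_plane \<phi> \<inter> {z. norm z > R})
              (\<lambda>z. eval_fps c (1 / z) * last_factor \<phi> q n a b z)))"

definition f_inf_last ::
    "real \<Rightarrow> real \<Rightarrow> nat \<Rightarrow> (nat \<Rightarrow> complex) \<Rightarrow> (nat \<Rightarrow> complex) \<Rightarrow> complex \<Rightarrow> complex" where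
  "f_inf_last \<phi> q n a b z = mero_sum (h_last_fps \<phi> q n a b) (1 / z) * last_factor \<phi> q n a b z"

end

theory Submission
  imports Defs
begin

text \<open>
  Let \<open>c\<close> be the quotient of the products of the \<open>a\<^sub>l\<close> and of the \<open>b\<^sub>l\<close>. For a sequence \<open>x\<close> of at most
  exponential growth put \<open>T x z = \<Sum> q\<^bsup>m(m-1)/2\<^esup> z\<^sup>m x\<^sub>m\<close>. All solutions have the form \<open>E(z) T x z\<close> with an
  elementary factor \<open>E\<close>, and the \<open>q\<close>-difference equation becomes a recursion for \<open>x\<close>. For the solutions
  \<open>f\<^sub>i\<close> the sequence samples the \<open>q\<close>-Borel transform on a spiral, and for \<open>f\<^sub>n\<close> it has one-sided support.

  For generic parameters, the Mittag-Leffler expansion of \<open>\<Prod> (b\<^sub>l x; q)\<^sub>\<infinity> / (a\<^sub>l x; q)\<^sub>\<infinity>\<close> writes the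
  solution at the origin through \<open>f\<^sub>1, \<dots>, f\<^sub>n\<^sub>-\<^sub>1\<close> with \<open>\<lambda>\<close> on one particular spiral. Changing the spiral
  costs a multiple of \<open>f\<^sub>n\<close>; this reduces to an identity between two Appell-Lerch sums, and the
  multiples add up by a partial fraction expansion of theta quotients. The remaining parameters are
  reached by scaling all \<open>a\<^sub>l\<close> by a factor that tends to \<open>1\<close>, and the identity, first obtained for \<open>|z| < 1\<close>,
  is continued by the \<open>q\<close>-difference equation. Linear independence follows from the behaviour of the
  solutions along the spirals \<open>z q\<^bsup>-k\<^esup>\<close>.
\<close>

section \<open>q-Pochhammer symbols\<close>

text \<open>An index shift of the sequence becomes the dilation z -> q z under \<open>T\<close>, so
  one recursion \<open>RecS t\<close> serves all solutions, with t recording the spiral on which a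
  Borel transform is sampled. Its leading coefficient q^M - 1/t never vanishes for t outside q^Z. At
  t = 1 it vanishes only at M = 0, which permits a solution supported on m <= 0, unique up to a
  factor. It is the sequence of f_n and, up to a geometric weight and a factor, the sequence of
  residues of each Borel transform. Hence for every i the jump between two spirals is a multiple of
  the same function \<open>T sseq (- (c * z))\<close>. The particular spiral is that of 1/c, because
  the residues of the product contain (1/c)^l. It must avoid q^Z, and this is the main genericity
  condition. Scaling all a_l by e replaces c by e^(n-1) c; lambda is multiplied by e^n so that the
  sampled spirals stay fixed. For n = 1 scaling leaves c = 1, and that case is Euler's product. The
  identity \<open>star\<close>, free of logarithms and of denominators in z, is the form in which
  these limits are taken.\<close>

lemma tannery_infsum:
 fixes f :: "'b \<Rightarrow> 'a \<Rightarrow> complex"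
 assumes g: "g summable_on UNIV"
  and lim: "\<And>x. ((%e. f e x) \<longlongrightarrow> h x) F"
  and bd: "\<forall>\<^sub>F e in F. \<forall>x. norm (f e x) \<le> g x"
  and nb: "F \<noteq> bot"
 shows "(%x. norm (h x)) summable_on UNIV"
  and "((%e. infsum (f e) UNIV) \<longlongrightarrow> infsum h UNIV) F"
proof -
 have hg: "norm (h x) \<le> g x" for x
  by (rule tendsto_upperbound[OF tendsto_norm[OF lim] _ nb]) (use bd in eventually_elim, auto)
 have g0: "g x \<ge> 0" for x using hg[of x] norm_ge_zero[of "h x"] by linarith
 show hs: "(%x. norm (h x)) summable_on UNIV"
  by (rule Infinite_Sum.abs_summable_on_comparison_test'[OF g]) (use hg in auto)
 \<comment> \<open>Uniform smallness of the tails: anything dominated by \<open>g\<close>, in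
   particular each \<open>f e\<close> and the limit \<open>h\<close>, differs from its finite
   partial sum by at most the tail of \<open>g\<close>.\<close>
 have key: "norm (infsum k UNIV - sum k S) \<le> infsum g (-S)"
  if k: "\<And>x. norm (k x) \<le> g x" and S: "finite S" for k :: "'a \<Rightarrow> complex" and S
 proof -
  have ks: "(%x. norm (k x)) summable_on UNIV"
   by (rule Infinite_Sum.abs_summable_on_comparison_test'[OF g]) (use k in auto)
  have k1: "k summable_on UNIV" using ks by (rule abs_summable_summable)
  have k2: "k summable_on (-S)" using k1 by (rule summable_on_subset_banach) auto
  have g2: "g summable_on (-S)" using g by (rule summable_on_subset_banach) auto
  have "infsum k (S \<union> (-S)) = infsum k S + infsum k (-S)"
   by (rule infsum_Un_disjoint) (use k2 S in auto)
  hence "infsum k UNIV - sum k S = infsum k (-S)" using S by simp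
  moreover have "norm (infsum k (-S)) \<le> infsum g (-S)"
   by (rule norm_infsum_le[OF has_sum_infsum[OF k2] has_sum_infsum[OF g2]]) (use k in auto)
  ultimately show ?thesis by simp
 qed
 show "((%e. infsum (f e) UNIV) \<longlongrightarrow> infsum h UNIV) F"
 proof (rule tendstoI)
  fix r :: real assume r: "r > 0"
  obtain S where S: "finite S" "dist (sum g S) (infsum g UNIV) \<le> r/4"
   using infsum_finite_approximation[OF g, of "r/4"] r by auto
  have g2: "g summable_on (-S)" using g by (rule summable_on_subset_banach) auto
  have "infsum g (S \<union> (-S)) = infsum g S + infsum g (-S)"
   by (rule infsum_Un_disjoint) (use g2 S in auto)
  hence tail: "infsum g (-S) \<le> r/4" using S by (simp add: dist_real_def)
  have "((%e. sum (f e) S) \<longlongrightarrow> sum h S) F" by (intro tendsto_sum lim)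
  hence "\<forall>\<^sub>F e in F. dist (sum (f e) S) (sum h S) < r/4" using r by (intro tendstoD) auto
  thus "\<forall>\<^sub>F e in F. dist (infsum (f e) UNIV) (infsum h UNIV) < r" using bd
  proof eventually_elim
   case (elim e)
   have "norm (infsum (f e) UNIV - sum (f e) S) \<le> r/4" using key[of "f e" S] elim(2) S(1) tail by force
   moreover have "norm (infsum h UNIV - sum h S) \<le> r/4" using key[of h S] hg S(1) tail by force
   ultimately have "norm ((infsum (f e) UNIV - sum (f e) S) + (sum (f e) S - sum h S) - (infsum h UNIV - sum h S)) \<le> r/4 + norm (sum (f e) S - sum h S) + r/4"
    by (meson add_mono norm_triangle_ineq4 norm_triangle_ineq order_trans order_refl)
   thus ?case using elim(1) r unfolding dist_norm by (simp add: algebra_simps)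
  qed
 qed
qed

lemma uncountable_ball_complex: "r > 0 ==> uncountable (ball (z::complex) r)"
 by (simp add: uncountable_ball)

locale qbase =
 fixes q :: real
 assumes q0: "0 < q" and q1: "q < 1"
begin

abbreviation Q :: complex where "Q \<equiv> of_real q"
abbreviation qp :: "complex \<Rightarrow> nat \<Rightarrow> complex" where "qp a k \<equiv> qpoch a q k"
abbreviation qi :: "complex \<Rightarrow> complex" where "qi a \<equiv> qpoch_inf a q"
abbreviation th :: "complex \<Rightarrow> complex" where "th z \<equiv> qtheta q z"

lemma q_nz [simp]: "q \<noteq> 0" using q0 by simp
lemma Q_nz: "Q \<noteq> 0" by simp
lemma norm_Q [simp]: "norm Q = q" using q0 by simp
lemma Q_pow_ne1: "k > 0 ==> Q ^ k \<noteq> 1"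
proof
 assume "k > 0" "Q ^ k = 1"
 hence "norm (Q ^ k) = 1" by simp
 hence "q ^ k = 1" using q0 by (simp add: norm_power)
 moreover have "q ^ k < 1" using q0 q1 \<open>k>0\<close> by (simp add: power_Suc_less_one power_less_one_iff)
 ultimately show False by simp
qed
lemma qpow_to_0: "(%k. q ^ k) \<longlonglongrightarrow> 0" using q0 q1 by (intro LIMSEQ_realpow_zero) auto
lemma Qpow_to_0: "(%k. Q ^ k) \<longlonglongrightarrow> 0" using q0 q1 by (intro LIMSEQ_power_zero) auto
lemma qpow_le1: "q ^ k \<le> 1" using q0 q1 by (simp add: power_le_one)

lemma summable_qpow: "summable (%l. norm (a * Q ^ l))"
 using q0 q1 by (auto simp: norm_mult norm_power intro!: summable_mult summable_geometric)

lemma qi_conv: "convergent_prod (%l. 1 - a * Q ^ l)"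
proof -
 have "abs_convergent_prod (%l. 1 - a * Q ^ l)"
  unfolding abs_convergent_prod_conv_summable using summable_qpow[of a] by simp
 thus ?thesis by (rule abs_convergent_prod_imp_convergent_prod)
qed

lemma qp_lim: "(%k. qp a k) \<longlonglongrightarrow> qi a"
proof -
 have "(%n. qp a (Suc n)) \<longlonglongrightarrow> qi a"
  using convergent_prod_LIMSEQ[OF qi_conv[of a]] unfolding qpoch_def qpoch_inf_def lessThan_Suc_atMost .
 thus ?thesis by (simp only: filterlim_sequentially_Suc)
qed

lemma qp_0 [simp]: "qp a 0 = 1" by (simp add: qpoch_def)
lemma qp_zero [simp]: "qp 0 k = 1" by (simp add: qpoch_def)
lemma qi_zero [simp]: "qi 0 = 1" by (simp add: qpoch_inf_def)
lemma qp_Suc: "qp a (Suc k) = qp a k * (1 - a * Q ^ k)" by (simp add: qpoch_def)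
lemma qp_add: "qp a (j + k) = qp a j * qp (a * Q ^ j) k"
 by (induction k) (simp_all add: qp_Suc power_add mult_ac)
lemma qp_Suc': "qp a (Suc k) = (1 - a) * qp (a * Q) k"
 using qp_add[of a 1 k] by (simp add: qp_Suc)

lemma qi_split: "qi a = qp a k * qi (a * Q ^ k)"
proof -
 have "(%n. qp a (k + n)) \<longlonglongrightarrow> qi a"
  using LIMSEQ_ignore_initial_segment[OF qp_lim[of a], of k] by (simp add: add.commute)
 moreover have "(%n. qp a (k + n)) \<longlonglongrightarrow> qp a k * qi (a * Q ^ k)"
  unfolding qp_add by (intro tendsto_intros qp_lim)
 ultimately show ?thesis by (rule LIMSEQ_unique)
qed
lemma qi_rec: "qi a = (1 - a) * qi (a * Q)"
 using qi_split[of a 1] by (simp add: qp_Suc)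

lemma qp_eq_0_iff: "qp a k = 0 \<longleftrightarrow> (\<exists>l<k. a * Q ^ l = 1)"
 by (auto simp: qpoch_def)
lemma qi_eq_0_iff: "qi a = 0 \<longleftrightarrow> (\<exists>l. a * Q ^ l = 1)"
proof
 assume "qi a = 0"
 show "\<exists>l. a * Q ^ l = 1"
 proof (rule ccontr)
  assume "\<not> ?thesis"
  hence "qi a \<noteq> 0" unfolding qpoch_inf_def by (intro prodinf_nonzero qi_conv) auto
  with \<open>qi a = 0\<close> show False by simp
 qed
next
 assume "\<exists>l. a * Q ^ l = 1"
 then obtain l where "a * Q ^ l = 1" by auto
 hence "qp a (Suc l) = 0" by (simp add: qp_Suc)
 thus "qi a = 0" using qi_split[of a "Suc l"] by simp
qed

lemma q_minusN_iff: "a \<in> q_minusN q \<longleftrightarrow> (\<exists>l. a * Q ^ l = 1)"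
proof -
 have "a = Q powi (- int l) \<longleftrightarrow> a * Q ^ l = 1" for l
  by (simp add: power_int_minus field_simps)
 thus ?thesis unfolding q_minusN_def by auto
qed
lemma qi_nz: "a \<notin> q_minusN q ==> qi a \<noteq> 0"
 by (simp add: qi_eq_0_iff q_minusN_iff)
lemma qp_nz: "a \<notin> q_minusN q ==> qp a k \<noteq> 0"
 by (auto simp add: qp_eq_0_iff q_minusN_iff)
lemma small_notin_q_minusN: "norm a < 1 ==> a \<notin> q_minusN q"
proof
 assume a: "norm a < 1" "a \<in> q_minusN q"
 then obtain l where "a * Q ^ l = 1" by (auto simp: q_minusN_iff)
 hence "norm a * q ^ l = 1" using q0 by (metis norm_mult norm_one norm_power norm_Q)
 moreover have "norm a * q ^ l \<le> norm a * 1" using q0 q1 by (intro mult_left_mono power_le_one) auto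
 ultimately show False using a by simp
qed
lemma q_minusN_mult: "a \<notin> q_minusN q ==> a * Q ^ k \<notin> q_minusN q"
proof
 assume "a \<notin> q_minusN q" "a * Q ^ k \<in> q_minusN q"
 then obtain l where "a * Q ^ k * Q ^ l = 1" by (auto simp: q_minusN_iff)
 hence "a * Q ^ (k + l) = 1" by (simp add: power_add mult_ac)
 with \<open>a \<notin> q_minusN q\<close> show False by (auto simp: q_minusN_iff)
qed
lemma zero_notin_q_minusN [simp]: "0 \<notin> q_minusN q" by (simp add: q_minusN_iff)
lemma Q_notin_q_minusN: "Q ^ Suc k \<notin> q_minusN q"
proof (rule small_notin_q_minusN)
 have "q ^ Suc k < 1" using q0 q1 by (intro power_Suc_less_one) auto
 thus "norm (Q ^ Suc k) < 1" using q0 by (simp add: norm_power del: power_Suc)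
qed
lemma Q_notin_q_minusN' [simp]: "Q \<notin> q_minusN q" using Q_notin_q_minusN[of 0] by simp

lemma qi_holomorphic: "qi holomorphic_on UNIV"
proof (rule holomorphic_uniform_sequence[where f = "%n a. qp a n"])
 show "(%a. qp a n) holomorphic_on UNIV" for n
  unfolding qpoch_def by (intro holomorphic_intros)
next
 fix x :: complex
 have "uniform_limit (cball x 1) (%n a. qp a n) qi sequentially"
 proof -
  have "uniformly_convergent_on (cball x 1) (%n a. qp a n)"
   unfolding qpoch_def
  proof (rule uniformly_convergent_on_prod')
   show "uniformly_convergent_on (cball x 1) (%N a. \<Sum>n<N. norm (1 - a * Q ^ n - 1))"
   proof (rule Weierstrass_m_test'_ev)
    show "\<forall>\<^sub>F n in sequentially. \<forall>a\<in>cball x 1. norm (norm (1 - a * Q ^ n - 1)) \<le> (norm x + 1) * q ^ n"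
    proof (intro always_eventually allI ballI)
     fix n a assume "a \<in> cball x 1"
     hence "norm a \<le> norm x + 1" 
      using norm_triangle_ineq2[of a x] by (simp add: dist_norm norm_minus_commute)
     thus "norm (norm (1 - a * Q ^ n - 1)) \<le> (norm x + 1) * q ^ n"
      using q0 by (simp add: norm_mult norm_power mult_right_mono)
    qed
    show "summable (%n. (norm x + 1) * q ^ n)"
     using q0 q1 by (intro summable_mult summable_geometric) auto
   qed
  qed (auto intro!: continuous_intros)
  then obtain l where l: "uniform_limit (cball x 1) (%n a. qp a n) l sequentially"
   by (auto simp: uniformly_convergent_on_def)
  have "l a = qi a" if "a \<in> cball x 1" for a
   using tendsto_uniform_limitI[OF l that] qp_lim[of a] LIMSEQ_unique by blast
  with l show ?thesis by (metis (mono_tags, lifting) uniform_limit_cong')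
 qed
 thus "\<exists>d>0. cball x d \<subseteq> UNIV \<and> uniform_limit (cball x d) (%n a. qp a n) qi sequentially"
  by (intro exI[of _ 1]) auto
qed auto

lemma qi_holo [holomorphic_intros]: "f holomorphic_on S ==> (%z. qi (f z)) holomorphic_on S"
 using holomorphic_on_compose[of f S qi] holomorphic_on_subset[OF qi_holomorphic] by (auto simp: o_def)
lemma qi_isCont: "isCont qi a"
 using qi_holomorphic holomorphic_on_imp_continuous_on continuous_on_eq_continuous_at open_UNIV by blast
lemma qi_tendsto [tendsto_intros]: "(f \<longlongrightarrow> a) F ==> ((%x. qi (f x)) \<longlongrightarrow> qi a) F"
 by (rule isCont_tendsto_compose[OF qi_isCont])

text \<open>Uniform in k, since 1 + x <= exp x and the geometric series bounds the exponent.\<close>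

lemma qp_bound: "norm a \<le> R ==> norm (qp a k) \<le> exp (R / (1 - q))"
proof -
 assume R: "norm a \<le> R"
 have R0: "R \<ge> 0" using R norm_ge_zero order_trans by blast
 have "norm (qp a k) = (\<Prod>l<k. norm (1 - a * Q ^ l))" by (simp add: qpoch_def prod_norm)
 also have "\<dots> \<le> (\<Prod>l<k. 1 + R * q ^ l)"
 proof (intro prod_mono conjI norm_ge_zero)
  fix l
  have "norm (1 - a * Q ^ l) \<le> 1 + norm a * q ^ l"
   using norm_triangle_ineq4[of 1 "a * Q ^ l"] q0 by (simp add: norm_mult norm_power)
  also have "\<dots> \<le> 1 + R * q ^ l" using R q0 by (simp add: mult_right_mono)
  finally show "norm (1 - a * Q ^ l) \<le> 1 + R * q ^ l" .
 qed
 also have "\<dots> \<le> exp (\<Sum>l<k. R * q ^ l)"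
  by (intro prod_le_exp_sum) (use R0 q0 in auto)
 also have "\<dots> \<le> exp (R / (1 - q))"
 proof -
  have "(\<Sum>l<k. q ^ l) \<le> 1 / (1 - q)"
   using q0 q1 sum_le_suminf[of "%l. q^l" "{..<k}"] by (simp add: summable_geometric suminf_geometric)
  hence "R * (\<Sum>l<k. q ^ l) \<le> R * (1 / (1 - q))" using R0 by (rule mult_left_mono)
  thus ?thesis by (simp add: sum_distrib_left)
 qed
 finally show ?thesis .
qed

text \<open>The limit \<open>qi b\<close> is nonzero, which settles all large k; the finitely many
  remaining symbols are nonzero one by one. It controls the denominators of all hypergeometric
  coefficients.\<close>

lemma qp_lower: assumes "b \<notin> q_minusN q" shows "\<exists>d>0. \<forall>k. d \<le> norm (qp b k)"
proof -
 have lim: "(%k. norm (qp b k)) \<longlonglongrightarrow> norm (qi b)" by (intro tendsto_intros qp_lim)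
 have "\<forall>\<^sub>F k in sequentially. norm (qp b k) > norm (qi b) / 2"
  using lim qi_nz[OF assms] by (intro order_tendstoD(1)) auto
 then obtain K where K: "\<And>k. k \<ge> K ==> norm (qp b k) > norm (qi b) / 2"
  by (auto simp: eventually_sequentially)
 define d where "d = Min (insert (norm (qi b) / 2) ((%k. norm (qp b k)) ` {..<K}))"
 have "d > 0" unfolding d_def using qi_nz[OF assms] qp_nz[OF assms] by (subst Min_gr_iff) auto
 moreover have "d \<le> norm (qp b k)" for k
 proof (cases "k < K")
  case True thus ?thesis unfolding d_def by (intro Min_le) auto
 next
  case False
  have "d \<le> norm (qi b) / 2" unfolding d_def by (intro Min_le) auto
  thus ?thesis using K[of k] False by auto
 qed
 ultimately show ?thesis by blast
qed

text \<open>A solution of g(q x) = (1 - x) g(x) is determined by its value at 0: iterate towards 0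
  along the orbit of y and use continuity there.\<close>

lemma qfun_eq:
 assumes "isCont g 0" and "\<And>k. g (y * Q ^ Suc k) = (1 - y * Q ^ k) * g (y * Q ^ k)"
 shows "g 0 = qi y * g y"
proof -
 have "g (y * Q ^ k) = qp y k * g y" for k
  by (induction k) (simp_all add: assms(2) qp_Suc del: power_Suc)
 hence "(%k. g (y * Q ^ k)) \<longlonglongrightarrow> qi y * g y" by (simp add: tendsto_mult_right qp_lim)
 moreover have "(%k. g (y * Q ^ k)) \<longlonglongrightarrow> g 0"
  by (rule isCont_tendsto_compose[OF assms(1)]) (intro tendsto_mult_right_zero Qpow_to_0)
 ultimately show ?thesis by (metis LIMSEQ_unique)
qed

end

section \<open>Gaussian sums and the theta function\<close>

context qbase begin

definition tri :: "int \<Rightarrow> int" where "tri m = m * (m - 1) div 2"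

lemma tri2: "2 * tri m = m * (m - 1)"
 unfolding tri_def by (intro dvd_mult_div_cancel) auto
lemma tri_add: "tri (m + k) = tri m + tri k + m * k"
 using tri2[of "m+k"] tri2[of m] tri2[of k] by (simp add: algebra_simps)
lemma tri_0 [simp]: "tri 0 = 0" by (simp add: tri_def)
lemma tri_1 [simp]: "tri 1 = 0" by (simp add: tri_def)
lemma tri_1m: "tri (1 - m) = tri m"
 using tri2[of "1-m"] tri2[of m] by (simp add: algebra_simps)
lemma tri_minus: "tri (- m) = tri m + m"
 using tri2[of "-m"] tri2[of m] by (simp add: algebra_simps)
lemma tri_nat: "tri (int k) = int (k * (k - 1) div 2)"
 unfolding tri_def by (cases k) (auto simp: zdiv_int algebra_simps)
lemma nat_tri_Suc: "Suc k * (Suc k - 1) div 2 = k * (k - 1) div 2 + k"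
proof -
 have "int (Suc k * (Suc k - 1) div 2) = int (k * (k - 1) div 2 + k)"
  using tri_add[of "int k" 1] tri_nat[of "Suc k"] tri_nat[of k] by (simp add: add.commute)
 thus ?thesis by linarith
qed
lemma gauss_summable_nat: assumes "R \<ge> 0" shows "summable (%k. q ^ (k * (k - 1) div 2) * R ^ k)"
proof -
 have "(%k. q ^ k * R) \<longlonglongrightarrow> 0" by (intro tendsto_mult_left_zero qpow_to_0)
 hence "\<forall>\<^sub>F k in sequentially. q ^ k * R < 1/2" by (rule order_tendstoD) simp
 then obtain N where N: "\<And>k. k \<ge> N ==> q ^ k * R < 1/2" by (auto simp: eventually_sequentially)
 show ?thesis
 proof (rule summable_ratio_test[of "1/2" N])
  fix k assume "N \<le> k"
  have "norm (q ^ (Suc k * (Suc k - 1) div 2) * R ^ Suc k) = q ^ (k * (k - 1) div 2) * R ^ k * (q ^ k * R)"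
   using q0 assms unfolding nat_tri_Suc by (simp add: power_add)
  also have "\<dots> \<le> q ^ (k * (k - 1) div 2) * R ^ k * (1/2)"
   using N[OF \<open>N \<le> k\<close>] q0 assms by (intro mult_left_mono) auto
  finally show "norm (q ^ (Suc k * (Suc k - 1) div 2) * R ^ Suc k) \<le> 1/2 * norm (q ^ (k * (k - 1) div 2) * R ^ k)"
   using q0 assms by simp
 qed simp
qed

text \<open>Both halves of the integers are compared with the same one-sided series; on the negative
  side \<open>tri (- k)\<close> exceeds \<open>tri k\<close> by k, which only helps.\<close>

lemma gauss_summable: assumes "R \<ge> 1" shows "(%m::int. q powi tri m * R ^ nat \<bar>m\<bar>) summable_on UNIV"
proof -
 let ?f = "%m::int. q powi tri m * R ^ nat \<bar>m\<bar>"
 let ?g = "%k. q ^ (k * (k - 1) div 2) * R ^ k"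
 have s: "?g summable_on UNIV"
  using gauss_summable_nat[of R] assms q0 by (intro summable_nonneg_imp_summable_on) auto
 have f1: "?f \<circ> int = ?g" by (auto simp: tri_nat fun_eq_iff)
 have "?f summable_on range int"
  by (subst summable_on_reindex) (use s f1 in auto)
 moreover have "?f summable_on range (%k. - int k)"
 proof (subst summable_on_reindex)
  show "?f \<circ> (%k. - int k) summable_on UNIV"
  proof (rule summable_on_comparison_test[OF s])
   fix k
   have "q powi tri (- int k) = q ^ (k * (k - 1) div 2) * q ^ k"
    using q0 by (simp add: tri_minus power_int_add tri_nat)
   moreover have "q ^ (k * (k - 1) div 2) * q ^ k \<le> q ^ (k * (k - 1) div 2) * 1"
    using q0 qpow_le1 by (intro mult_left_mono) auto
   ultimately show "(?f \<circ> (%k. - int k)) k \<le> ?g k"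
    using assms by (simp add: mult_right_mono)
  qed (use q0 assms in auto)
 qed (auto simp: inj_on_def)
 ultimately have "?f summable_on (range int \<union> range (%k. - int k))" by (rule summable_on_union)
 also have "range int \<union> range (%k. - int k) = UNIV"
 proof -
  have "m \<in> range int \<union> range (%k. - int k)" for m
   by (cases "m \<ge> 0") (auto intro: image_eqI[of _ _ "nat m"] image_eqI[of _ _ "nat (-m)"])
  thus ?thesis by auto
 qed
 finally show ?thesis .
qed

text \<open>The Gaussian weight of \<open>T\<close> beats every K^|m|, and this class is stable
  under shifts, products and geometric weights. Using |m| treats both ends at once.\<close>

definition tempered :: "(int \<Rightarrow> complex) \<Rightarrow> bool" where
 "tempered x \<longleftrightarrow> (\<exists>C K. K \<ge> 1 \<and> (\<forall>m. norm (x m) \<le> C * K ^ nat \<bar>m\<bar>))"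

definition T :: "(int \<Rightarrow> complex) \<Rightarrow> complex \<Rightarrow> complex" where
 "T x z = (\<Sum>\<^sub>\<infinity>m. Q powi tri m * z powi m * x m)"

lemma th_T: "th z = T (%_. 1) z"
 by (simp add: qtheta_def T_def tri_def)

lemma norm_powi_le:
 fixes z :: complex
 assumes "z \<noteq> 0" "norm z \<le> L" "1 / L \<le> norm z" "L \<ge> 1"
 shows "norm (z powi m) \<le> L ^ nat \<bar>m\<bar>"
proof (cases "m \<ge> 0")
 case True
 thus ?thesis using assms by (auto simp: norm_power power_int_def power_mono)
next
 case False
 have "inverse (norm z) \<le> L" using assms by (simp add: field_simps)
 hence "inverse (norm z) ^ nat (-m) \<le> L ^ nat (-m)" by (intro power_mono) auto
 thus ?thesis using False by (simp add: norm_power norm_inverse power_int_def)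
qed

lemma T_term_bound:
 assumes "z \<noteq> 0" "norm z \<le> L" "1 / L \<le> norm z" "L \<ge> 1" "K \<ge> 1" "norm (x m) \<le> C * K ^ nat \<bar>m\<bar>"
 shows "norm (Q powi tri m * z powi m * x m) \<le> C * (q powi tri m * (L * K) ^ nat \<bar>m\<bar>)"
proof -
 have "norm (Q powi tri m * z powi m * x m) = q powi tri m * norm (z powi m) * norm (x m)"
  using q0 by (simp add: norm_mult norm_power_int)
 also have "\<dots> \<le> q powi tri m * L ^ nat \<bar>m\<bar> * (C * K ^ nat \<bar>m\<bar>)"
  using q0 assms norm_powi_le[OF assms(1-4), of m]
  by (intro mult_mono mult_nonneg_nonneg) auto
 finally show ?thesis by (simp add: power_mult_distrib mult_ac)
qed

lemma powi_bounds_exist: "z \<noteq> 0 ==> \<exists>L\<ge>1. norm (z::complex) \<le> L \<and> 1 / L \<le> norm z"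
proof (intro exI[of _ "max 1 (max (norm z) (1 / norm z))"] conjI)
 assume z: "z \<noteq> 0"
 let ?L = "max 1 (max (norm z) (1 / norm z))"
 have "1 / norm z \<le> ?L" by simp
 hence "1 / ?L \<le> 1 / (1 / norm z)" using z by (intro divide_left_mono) (auto simp: less_max_iff_disj)
 thus "1 / ?L \<le> norm z" by simp
qed auto

lemma gauss_summable': "R \<ge> 1 ==> (%m::int. C * (q powi tri m * R ^ nat \<bar>m\<bar>)) summable_on UNIV"
 by (intro summable_on_cmult_right gauss_summable)

lemma T_abs_summable:
 assumes "tempered x" "z \<noteq> 0"
 shows "(%m. norm (Q powi tri m * z powi m * x m)) summable_on UNIV"
proof -
 obtain C K where K: "K \<ge> 1" "\<And>m. norm (x m) \<le> C * K ^ nat \<bar>m\<bar>" using assms by (auto simp: tempered_def)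
 obtain L where L: "L \<ge> 1" "norm z \<le> L" "1 / L \<le> norm z" using powi_bounds_exist[OF assms(2)] by auto
 have "L * K \<ge> 1" using L K by (simp add: mult_ge1_I)
 thus ?thesis
  by (intro Infinite_Sum.abs_summable_on_comparison_test'[OF gauss_summable'[of "L*K" C]] T_term_bound)
   (use assms L K in auto)
qed

lemma T_summable: "tempered x ==> z \<noteq> 0 ==> (%m. Q powi tri m * z powi m * x m) summable_on UNIV"
 by (rule abs_summable_summable[OF T_abs_summable])

text \<open>Joint continuity of \<open>T\<close> in the sequence and in the point. The growth bound
  has to be uniform along the filter; then the terms have a common Gaussian majorant.\<close>

lemma T_tendsto:
 assumes x: "\<And>m. ((%e. x e m) \<longlongrightarrow> y m) F" and z: "(z \<longlongrightarrow> w) F" "w \<noteq> 0" and K: "K \<ge> 1"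
  and bd: "\<forall>\<^sub>F e in F. \<forall>m. norm (x e m) \<le> C * K ^ nat \<bar>m\<bar>" and nb: "F \<noteq> bot"
 shows "((%e. T (x e) (z e)) \<longlongrightarrow> T y w) F"
proof -
 obtain L where L: "L \<ge> 1" "norm w \<le> L" "1 / L \<le> norm w" using powi_bounds_exist[OF z(2)] by auto
 have ev: "\<forall>\<^sub>F e in F. norm (z e) < 2 * L" "\<forall>\<^sub>F e in F. 1 / (2 * L) < norm (z e)"
 proof -
  have l: "((%e. norm (z e)) \<longlongrightarrow> norm w) F" by (intro tendsto_norm z)
  show "\<forall>\<^sub>F e in F. norm (z e) < 2 * L" using L by (intro order_tendstoD(2)[OF l]) auto
  have "1 / (2 * L) < 1 / L" using L by (simp add: field_simps)
  thus "\<forall>\<^sub>F e in F. 1 / (2 * L) < norm (z e)" using L by (intro order_tendstoD(1)[OF l]) auto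
 qed
 have "\<forall>\<^sub>F e in F. \<forall>m. norm (Q powi tri m * z e powi m * x e m) \<le> C * (q powi tri m * (2 * L * K) ^ nat \<bar>m\<bar>)"
  using bd ev
 proof eventually_elim
  case (elim e)
  have nz: "z e \<noteq> 0" using elim(3) L by (auto simp: field_simps)
  show ?case using nz elim L K by (intro allI T_term_bound) auto
 qed
 moreover have "2 * L * K \<ge> 1" using L K by (simp add: mult_ge1_I)
 ultimately show ?thesis unfolding T_def
  by (intro tannery_infsum(2)[OF gauss_summable'[of "2*L*K" C]] tendsto_intros x z nb)
qed

lemma T_holomorphic: assumes "tempered x" shows "T x holomorphic_on -{0}"
proof (rule holomorphic_uniform_sequence[where f = "%n z. \<Sum>m=-int n..int n. Q powi tri m * z powi m * x m"])
 show "open (-{0::complex})" by auto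
 show "(%z. \<Sum>m=-int n..int n. Q powi tri m * z powi m * x m) holomorphic_on -{0}" for n
  by (intro holomorphic_intros) auto
 fix z0 :: complex assume "z0 \<in> -{0}"
 hence z0: "z0 \<noteq> 0" by simp
 obtain C K where K: "K \<ge> 1" "\<And>m. norm (x m) \<le> C * K ^ nat \<bar>m\<bar>" using assms by (auto simp: tempered_def)
 obtain L where L: "L \<ge> 1" "norm z0 \<le> L" "1 / L \<le> norm z0" using powi_bounds_exist[OF z0] by auto
 \<comment> \<open>On this disc both |z| and 1/|z| stay below 2 L, so one Gaussian majorant serves
   all its points.\<close>
 define d where "d = norm z0 / 2"
 have d: "d > 0" using z0 by (simp add: d_def)
 have bz: "z \<noteq> 0 \<and> norm z \<le> 2 * L \<and> 1 / (2 * L) \<le> norm z" if "z \<in> cball z0 d" for z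
 proof -
  have "norm (z0 - z) \<le> norm z0 / 2" using that by (simp add: dist_norm d_def)
  hence "norm z \<ge> norm z0 / 2" "norm z \<le> 2 * norm z0"
   using norm_triangle_ineq2[of z0 z] norm_triangle_ineq2[of z z0] z0 by (auto simp: norm_minus_commute)
  moreover have "norm z0 / 2 \<ge> 1 / (2 * L)" using L by simp
  ultimately show ?thesis using L z0 by auto
 qed
 let ?M = "%m::int. C * (q powi tri m * (2 * L * K) ^ nat \<bar>m\<bar>)"
 have ge: "2 * L * K \<ge> 1" using L K by (simp add: mult_ge1_I)
 have lim: "filterlim (%n. {-int n..int n}) (finite_subsets_at_top UNIV) sequentially"
  unfolding filterlim_finite_subsets_at_top
 proof (intro allI impI)
  fix X :: "int set" assume X: "finite X \<and> X \<subseteq> UNIV"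
  define N where "N = nat (Max (insert 0 (abs ` X)))"
  have "\<bar>x\<bar> \<le> int N" if "x \<in> X" for x
   using X that unfolding N_def by (auto simp: intro!: Max_ge)
  hence "X \<subseteq> {-int n..int n}" if "n \<ge> N" for n using that by (force simp: abs_le_iff)
  thus "\<forall>\<^sub>F n in sequentially. finite {-int n..int n} \<and> X \<subseteq> {-int n..int n} \<and> {-int n..int n} \<subseteq> UNIV"
   by (intro eventually_sequentiallyI[of N]) auto
 qed
 have "uniform_limit (cball z0 d) (%X z. \<Sum>m\<in>X. Q powi tri m * z powi m * x m) (T x) (finite_subsets_at_top UNIV)"
  unfolding T_def
  by (rule Weierstrass_m_test_general[OF _ gauss_summable'[OF ge, of C]])
   (use bz L K in \<open>auto intro!: T_term_bound\<close>)
 hence "uniform_limit (cball z0 d) (%n z. \<Sum>m=-int n..int n. Q powi tri m * z powi m * x m) (T x) sequentially"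
  by (rule filterlim_compose[OF _ lim])
 moreover have "cball z0 d \<subseteq> -{0}" 
 proof
  fix z assume "z \<in> cball z0 d"
  thus "z \<in> -{0}" using bz[of z] by simp
 qed
 ultimately show "\<exists>d>0. cball z0 d \<subseteq> -{0} \<and>
  uniform_limit (cball z0 d) (%n z. \<Sum>m=-int n..int n. Q powi tri m * z powi m * x m) (T x) sequentially"
  using d by blast
qed

lemma tempered_const [simp]: "tempered (%_. c)"
 unfolding tempered_def by (intro exI[of _ "norm c"] exI[of _ 1]) auto

text \<open>This follows from \<open>tri (m + k) = tri m + tri k + m * k\<close>: the cross term m k
  is absorbed by dilating z by q^k. Theta quasi-periodicity is the case of a constant
  sequence.\<close>

lemma T_shift: "z \<noteq> 0 ==> T (%m. x (m - k)) z = Q powi tri k * z powi k * T x (Q powi k * z)"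
proof -
 assume z: "z \<noteq> 0"
 have "T (%m. x (m - k)) z = (\<Sum>\<^sub>\<infinity>m. Q powi tri (m + k) * z powi (m + k) * x m)"
  unfolding T_def
  by (rule infsum_reindex_bij_witness[of _ "%m. m + k" "%m. m - k"]) auto
 also have "\<dots> = (\<Sum>\<^sub>\<infinity>m. (Q powi tri k * z powi k) * (Q powi tri m * (Q powi k * z) powi m * x m))"
  using z by (intro infsum_cong) 
   (simp add: tri_add power_int_add power_int_mult_distrib power_int_mult[symmetric] mult_ac)
 finally show ?thesis by (simp add: infsum_cmult_right' T_def)
qed

lemma T_shift1: "z \<noteq> 0 ==> T (%m. x (m - 1)) z = z * T x (Q * z)"
 using T_shift[of z x 1] by simp

lemma T_scale: "T (%m. r powi m * x m) z = T x (r * z)"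
 unfolding T_def by (simp add: power_int_mult_distrib mult_ac)

lemma T_cmult: "T (%m. c * x m) z = c * T x z"
 unfolding T_def by (subst infsum_cmult_right'[symmetric]) (simp add: mult_ac)

lemma T_diff: "tempered x ==> tempered y ==> z \<noteq> 0 ==> T (%m. x m - y m) z = T x z - T y z"
proof -
 assume a: "tempered x" "tempered y" "z \<noteq> 0"
 have "T (%m. x m - y m) z = (\<Sum>\<^sub>\<infinity>m. Q powi tri m * z powi m * x m + - (Q powi tri m * z powi m * y m))"
  unfolding T_def by (simp add: algebra_simps)
 also have "\<dots> = T x z + (\<Sum>\<^sub>\<infinity>m. - (Q powi tri m * z powi m * y m))"
  unfolding T_def by (intro infsum_add T_summable a) (use T_summable[of y z] a in \<open>simp add: summable_on_uminus\<close>)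
 finally show ?thesis by (simp add: infsum_uminus T_def)
qed

lemma T_add: "tempered x ==> tempered y ==> z \<noteq> 0 ==> T (%m. x m + y m) z = T x z + T y z"
 unfolding T_def distrib_left by (intro infsum_add T_summable)

lemma tempered_add: assumes "tempered x" "tempered y" shows "tempered (%m. x m + y m)"
proof -
 obtain C K where K: "K \<ge> 1" "\<And>m. norm (x m) \<le> C * K ^ nat \<bar>m\<bar>" using assms by (auto simp: tempered_def)
 obtain D M where M: "M \<ge> 1" "\<And>m. norm (y m) \<le> D * M ^ nat \<bar>m\<bar>" using assms by (auto simp: tempered_def)
 have CD: "C \<ge> 0" "D \<ge> 0" using order_trans[OF norm_ge_zero K(2)[of 0]] order_trans[OF norm_ge_zero M(2)[of 0]] by auto
 have "norm (x m + y m) \<le> (C + D) * (max K M) ^ nat \<bar>m\<bar>" for m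
 proof -
  have "C * K ^ nat \<bar>m\<bar> \<le> C * max K M ^ nat \<bar>m\<bar>" "D * M ^ nat \<bar>m\<bar> \<le> D * max K M ^ nat \<bar>m\<bar>"
   using K(1) M(1) CD by (auto intro!: mult_left_mono power_mono)
  thus ?thesis using K(2)[of m] M(2)[of m] norm_triangle_ineq[of "x m" "y m"] by (simp add: distrib_right)
 qed
 thus ?thesis unfolding tempered_def using K(1) by (intro exI[of _ "C + D"] exI[of _ "max K M"]) auto
qed

lemma T_sum: "finite I ==> (\<And>i. i \<in> I ==> tempered (x i)) ==> z \<noteq> 0 ==>
  T (%m. \<Sum>i\<in>I. x i m) z = (\<Sum>i\<in>I. T (x i) z)"
proof (induction I rule: finite_induct)
 case (insert a I)
 have "tempered (%m. \<Sum>i\<in>I. x i m)"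
  using insert.hyps(1) insert.prems(1)
 proof (induction I rule: finite_induct)
  case (insert b J)
  thus ?case by (auto intro!: tempered_add)
 qed (use tempered_const[of 0] in simp)
 thus ?case using insert by (simp add: T_add)
qed (simp add: T_def)

lemma th_shift: "z \<noteq> 0 ==> th z = Q powi tri k * z powi k * th (Q powi k * z)"
 using T_shift[of z "%_. 1" k] by (simp add: th_T)
lemma th_Q: "z \<noteq> 0 ==> th z = z * th (Q * z)"
 using th_shift[of z 1] by simp
lemma th_Q': "z \<noteq> 0 ==> th (Q * z) = th z / z"
 using th_Q[of z] by simp

lemma th_inv: "z \<noteq> 0 ==> th z = z * th (1 / z)"
proof -
 assume z: "z \<noteq> 0"
 have "th z = (\<Sum>\<^sub>\<infinity>m. Q powi tri (1 - m) * z powi (1 - m))"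
  unfolding th_T T_def
  by (rule infsum_reindex_bij_witness[of _ "%m. 1 - m" "%m. 1 - m"]) auto
 also have "\<dots> = (\<Sum>\<^sub>\<infinity>m. z * (Q powi tri m * (1 / z) powi m))"
  using z by (intro infsum_cong) (simp add: tri_1m power_int_diff power_int_divide_distrib)
 finally show ?thesis by (simp add: infsum_cmult_right' th_T T_def)
qed

lemma th_holo: "th holomorphic_on -{0}"
 using T_holomorphic[OF tempered_const[of 1]] by (simp add: th_T[abs_def])
lemma th_holomorphic [holomorphic_intros]:
 "f holomorphic_on S ==> (\<And>z. z \<in> S ==> f z \<noteq> 0) ==> (%z. th (f z)) holomorphic_on S"
 using holomorphic_on_compose_gen[of f S th "-{0}"] th_holo by (force simp: o_def)
lemma th_isCont: "z \<noteq> 0 ==> isCont th z"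
 using th_holo holomorphic_on_imp_continuous_on continuous_on_eq_continuous_at[of "-{0}" th] by auto
lemma th_tendsto [tendsto_intros]: "(f \<longlongrightarrow> a) F ==> a \<noteq> 0 ==> ((%x. th (f x)) \<longlongrightarrow> th a) F"
 by (rule isCont_tendsto_compose[OF th_isCont])

end

text \<open>Riemann's theorem at all points of \<open>P\<close> simultaneously. Filling the points
  of \<open>P\<close> with limits gives one global function that agrees with every local
  extension.\<close>

lemma removable_discrete:
 assumes S: "open S" and hol: "f holomorphic_on (S - P)"
  and disc: "\<And>x. x \<in> S ==> \<forall>\<^sub>F y in at x. y \<notin> P"
  and lim: "\<And>p. p \<in> S ==> p \<in> P ==> ((%x. (x - p) * f x) \<longlongrightarrow> 0) (at p)"
 shows "\<exists>g. g holomorphic_on S \<and> (\<forall>x\<in>S - P. g x = f x)"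
proof -
 define g where "g = (%x. if x \<in> P then Lim (at x) f else f x)"
 have "\<exists>r>0. g holomorphic_on ball x r" if x: "x \<in> S" for x
 proof -
  have "\<forall>\<^sub>F y in at x. y \<notin> P \<and> y \<in> S"
   using disc[OF x] eventually_at_in_open'[OF S x] by eventually_elim auto
  then obtain r where r: "r > 0" "\<And>y. y \<noteq> x ==> dist y x < r ==> y \<notin> P \<and> y \<in> S"
   by (auto simp: eventually_at)
  have sub: "ball x r - {x} \<subseteq> S - P" using r by (auto simp: dist_commute)
  show ?thesis
  proof (cases "x \<in> P")
   case False
   have "ball x r \<subseteq> S - P" using sub False x by auto
   hence "f holomorphic_on ball x r" by (rule holomorphic_on_subset[OF hol])
   moreover have "g holomorphic_on ball x r \<longleftrightarrow> f holomorphic_on ball x r"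
    using \<open>ball x r \<subseteq> S - P\<close> by (intro holomorphic_cong) (auto simp: g_def)
   ultimately show ?thesis using r by blast
  next
   case True
   have "f holomorphic_on (ball x r - {x})" by (rule holomorphic_on_subset[OF hol sub])
   moreover have "x \<in> interior (ball x r)" using r by simp
   ultimately obtain h where h: "h holomorphic_on ball x r" "\<And>z. z \<in> ball x r - {x} ==> h z = f z"
    using holomorphic_on_extend_lim[of f "ball x r" x] lim[OF x True] by blast
   have "isCont h x"
    using h(1) r holomorphic_on_imp_continuous_on continuous_on_eq_continuous_at[of "ball x r" h] by auto
   hence "(h \<longlongrightarrow> h x) (at x)" by (simp add: isCont_def)
   moreover have "\<forall>\<^sub>F y in at x. h y = f y"
    using eventually_at_in_open[of "ball x r" x] r h(2) by (auto elim!: eventually_mono)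
   ultimately have "(f \<longlongrightarrow> h x) (at x)" using tendsto_cong by force
   hence "Lim (at x) f = h x" by (intro tendsto_Lim) auto
   hence "g z = h z" if "z \<in> ball x r" for z
    using that h(2)[of z] sub True by (cases "z = x") (auto simp: g_def)
   hence "g holomorphic_on ball x r \<longleftrightarrow> h holomorphic_on ball x r"
    by (intro holomorphic_cong) auto
   thus ?thesis using r h by blast
  qed
 qed
 hence "g field_differentiable at x" if "x \<in> S" for x
  using that by (meson centre_in_ball holomorphic_on_imp_differentiable_at open_ball)
 hence "g holomorphic_on S"
  using field_differentiable_at_within holomorphic_on_def by blast
 moreover have "\<forall>x\<in>S - P. g x = f x" by (auto simp: g_def)
 ultimately show ?thesis by blast
qed

section \<open>The q-binomial theorem, the Jacobi triple product and the zeros of theta\<close>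

context qbase begin

text \<open>The Gaussian binomial coefficient; the value 0 for j > M makes the Pascal rule hold at j
  = M.\<close>

definition qb :: "nat \<Rightarrow> nat \<Rightarrow> complex" where
 "qb M j = (if j \<le> M then qp Q M / (qp Q j * qp Q (M - j)) else 0)"

lemma qpQ_nz [simp]: "qp Q k \<noteq> 0" by (rule qp_nz) simp
lemma qiQ_nz [simp]: "qi Q \<noteq> 0" by (rule qi_nz) simp
lemma qb_0 [simp]: "qb M 0 = 1" by (simp add: qb_def)
lemma qb_self [simp]: "qb M M = 1" by (simp add: qb_def)

lemma qb_pascal: assumes "j \<le> M" shows "qb (Suc M) (Suc j) = qb M (Suc j) + Q ^ (M - j) * qb M j"
proof (cases "j = M")
 case True thus ?thesis by (simp add: qb_def)
next
 case False
 define i where "i = M - Suc j"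
 have M: "M = Suc (i + j)" using False assms by (simp add: i_def)
 have nz: "1 - Q * Q ^ i \<noteq> 0" "1 - Q * Q ^ j \<noteq> 0" using Q_pow_ne1[of "Suc i"] Q_pow_ne1[of "Suc j"] by auto
 have A: "qp Q i \<noteq> 0" "qp Q j \<noteq> 0" by simp_all
 have "qb (Suc M) (Suc j) = qp Q M * (1 - Q * Q ^ M) / (qp Q j * (1 - Q * Q ^ j) * (qp Q i * (1 - Q * Q ^ i)))"
  by (simp add: qb_def M qp_Suc)
 moreover have "qb M (Suc j) = qp Q M / (qp Q j * (1 - Q * Q ^ j) * qp Q i)"
  by (simp add: qb_def M qp_Suc)
 moreover have "qb M j = qp Q M / (qp Q j * (qp Q i * (1 - Q * Q ^ i)))"
  by (simp add: qb_def M qp_Suc)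
 moreover have "1 - Q * Q ^ M = (1 - Q * Q ^ i) + Q ^ (M - j) * (1 - Q * Q ^ j)"
  by (simp add: M power_add algebra_simps)
 moreover have "P * w / (x * v * (y * u)) = P / (x * v * y) + t * (P / (x * (y * u)))"
  if "w = u + t * v" "u \<noteq> 0" "v \<noteq> 0" "x \<noteq> 0" "y \<noteq> 0" for P w x v y u t :: complex
  using that by (simp add: field_simps)
 ultimately show ?thesis using nz A by presburger
qed

lemma q_binomial: "qp (- y) M = (\<Sum>j\<le>M. Q ^ (j * (j - 1) div 2) * qb M j * y ^ j)"
proof (induction M)
 case (Suc M)
 let ?c = "%M j. Q ^ (j * (j - 1) div 2) * qb M j * y ^ j"
 have step: "?c (Suc M) (Suc j) = ?c M (Suc j) + y * Q ^ M * ?c M j" if "j \<le> M" for j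
 proof -
  have "Q ^ (Suc j * (Suc j - 1) div 2) * Q ^ (M - j) = Q ^ (j * (j - 1) div 2) * Q ^ M"
   using that unfolding nat_tri_Suc by (simp flip: power_add)
  thus ?thesis unfolding qb_pascal[OF that] by (simp add: algebra_simps)
 qed
 have z: "?c M (Suc M) = 0" by (simp add: qb_def)
 have "(\<Sum>j\<le>Suc M. ?c (Suc M) j) = ?c (Suc M) 0 + (\<Sum>j\<le>M. ?c (Suc M) (Suc j))"
  by (rule sum.atMost_Suc_shift)
 also have "(\<Sum>j\<le>M. ?c (Suc M) (Suc j)) = (\<Sum>j\<le>M. ?c M (Suc j)) + y * Q ^ M * (\<Sum>j\<le>M. ?c M j)"
  unfolding sum_distrib_left sum.distrib[symmetric] by (intro sum.cong step) auto
 also have "?c (Suc M) 0 + ((\<Sum>j\<le>M. ?c M (Suc j)) + y * Q ^ M * (\<Sum>j\<le>M. ?c M j)) =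
   (\<Sum>j\<le>Suc M. ?c M j) + y * Q ^ M * (\<Sum>j\<le>M. ?c M j)"
  by (subst sum.atMost_Suc_shift) simp
 also have "(\<Sum>j\<le>Suc M. ?c M j) = (\<Sum>j\<le>M. ?c M j)" using z by simp
 finally show ?case using Suc by (simp add: qp_Suc algebra_simps)
qed simp

text \<open>Each factor is rewritten by 1 + x q^(-l) = x q^(-l) (1 + q^l / x); the powers of q
  collect to a triangular exponent.\<close>

lemma qp_reverse: "x \<noteq> 0 ==> qp (- x / Q ^ M) M * Q powi tri (- int M) = x ^ M * qp (- Q / x) M"
proof (induction M)
 case (Suc M)
 have t: "tri (- int (Suc M)) = tri (- int M) + int (Suc M)"
  using tri_add[of "- int M" "-1"] tri_minus[of 1] by (simp add: algebra_simps)
 have "qp (- x / Q ^ Suc M) (Suc M) = (1 + x / Q ^ Suc M) * qp (- x / Q ^ M) M"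
  by (simp add: qp_Suc' field_simps)
 moreover have "Q powi tri (- int (Suc M)) = Q powi tri (- int M) * Q ^ Suc M"
  unfolding t by (subst power_int_add) (auto simp del: of_nat_Suc)
 ultimately have "qp (- x / Q ^ Suc M) (Suc M) * Q powi tri (- int (Suc M)) =
  ((1 + x / Q ^ Suc M) * Q ^ Suc M) * (qp (- x / Q ^ M) M * Q powi tri (- int M))" by (simp add: mult_ac)
 also have "(1 + x / Q ^ Suc M) * Q ^ Suc M = x * (1 + Q / x * Q ^ M)"
  using Suc.prems by (simp add: field_simps)
 finally show ?case using Suc by (simp add: qp_Suc mult_ac)
qed simp

text \<open>The q-binomial theorem applied to (-x q^(-M); q) with 2 M factors, the first half of
  which is turned over by \<open>qp_reverse\<close>. Centring the summation index at M gives a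
  bilateral sum.\<close>

lemma triple_finite:
 assumes "x \<noteq> 0"
 shows "qp (- x) M * qp (- Q / x) M =
  (\<Sum>j=-int M..int M. Q powi tri j * x powi j * qb (2 * M) (nat (j + int M)))"
proof -
 have "x ^ M * (qp (- x) M * qp (- Q / x) M) = Q powi tri (- int M) * (qp (- x / Q ^ M) M * qp (- x) M)"
  using qp_reverse[OF assms, of M] by (simp add: mult_ac)
 also have "qp (- x / Q ^ M) M * qp (- x) M = qp (- (x / Q ^ M)) (2 * M)"
  using qp_add[of "- x / Q ^ M" M M] by (simp add: mult_2)
 also have "Q powi tri (- int M) * \<dots> =
   (\<Sum>k\<le>2*M. Q powi tri (- int M) * (Q ^ (k * (k - 1) div 2) * qb (2*M) k * (x / Q ^ M) ^ k))"
  by (simp add: q_binomial sum_distrib_left)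
 also have "\<dots> = (\<Sum>k\<le>2*M. x ^ M * (Q powi tri (int k - int M) * x powi (int k - int M) * qb (2 * M) k))"
 proof (intro sum.cong refl)
  fix k
  have "tri (int k - int M) = tri (int k) + tri (- int M) - int k * int M"
   using tri_add[of "int k" "- int M"] by simp
  hence "Q powi tri (int k - int M) = Q powi tri (- int M) * Q ^ (k * (k - 1) div 2) / Q ^ (k * M)"
   by (simp add: power_int_diff power_int_add tri_nat flip: of_nat_mult)
  moreover have "x powi (int k - int M) = x ^ k / x ^ M" using assms by (simp add: power_int_diff)
  ultimately show "Q powi tri (- int M) * (Q ^ (k * (k - 1) div 2) * qb (2*M) k * (x / Q ^ M) ^ k) =
   x ^ M * (Q powi tri (int k - int M) * x powi (int k - int M) * qb (2 * M) k)"
   using assms by (simp add: power_divide power_mult mult.commute[of k M])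
 qed
 also have "\<dots> = (\<Sum>j=-int M..int M. x ^ M * (Q powi tri j * x powi j * qb (2 * M) (nat (j + int M))))"
  by (rule sum.reindex_bij_witness[of _ "%j. nat (j + int M)" "%k. int k - int M"]) auto
 finally have "x ^ M * (qp (- x) M * qp (- Q / x) M) =
   x ^ M * (\<Sum>j=-int M..int M. Q powi tri j * x powi j * qb (2 * M) (nat (j + int M)))"
  by (simp add: sum_distrib_left)
 thus ?thesis using assms by simp
qed

text \<open>The Jacobi triple product, as the limit M -> infinity of its finite form.\<close>

theorem th_product: assumes "x \<noteq> 0" shows "th x = qi Q * qi (- x) * qi (- Q / x)"
proof -
 \<comment> \<open>Central q-binomial coefficients, extended by 0, so that the finite sum is a value
   of \<open>T\<close>. They tend to 1 / (q; q)_infinity and are bounded by \<open>B\<close>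
   uniformly in M and j.\<close>
 define h where "h = (%M j. if \<bar>j\<bar> \<le> int M then qb (2 * M) (nat (j + int M)) else 0)"
 obtain d where d: "d > 0" "\<And>k. d \<le> norm (qp Q k)" using qp_lower[of Q] by auto
 define B where "B = exp (1 / (1 - q)) / (d * d)"
 have "(%M. T (h M) x) \<longlonglongrightarrow> T (%_. 1 / qi Q) x"
 proof (rule T_tendsto)
  fix j :: int
  have "(%M. qp Q (2 * M) / (qp Q (nat (j + int M)) * qp Q (nat (int M - j)))) \<longlonglongrightarrow> qi Q / (qi Q * qi Q)"
  proof (intro tendsto_intros)
   have f: "filterlim (%M. nat (j + int M)) sequentially sequentially" "filterlim (%M. nat (int M - j)) sequentially sequentially"
    "filterlim (%M::nat. 2 * M) sequentially sequentially"
   proof -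
    show "filterlim (%M. nat (j + int M)) sequentially sequentially"
     unfolding filterlim_at_top
    proof
     fix Z show "\<forall>\<^sub>F M in sequentially. Z \<le> nat (j + int M)"
      by (rule eventually_sequentiallyI[of "nat (int Z - j)"]) auto
    qed
    show "filterlim (%M. nat (int M - j)) sequentially sequentially"
     unfolding filterlim_at_top
    proof
     fix Z show "\<forall>\<^sub>F M in sequentially. Z \<le> nat (int M - j)"
      by (rule eventually_sequentiallyI[of "nat (int Z + j)"]) auto
    qed
    show "filterlim (%M::nat. 2 * M) sequentially sequentially"
     by (simp add: mult_nat_left_at_top)
   qed
   show "(%M. qp Q (2 * M)) \<longlonglongrightarrow> qi Q" "(%M. qp Q (nat (j + int M))) \<longlonglongrightarrow> qi Q"
    "(%M. qp Q (nat (int M - j))) \<longlonglongrightarrow> qi Q"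
    using filterlim_compose[OF qp_lim[of Q] f(3)] filterlim_compose[OF qp_lim[of Q] f(1)] filterlim_compose[OF qp_lim[of Q] f(2)] by auto
  qed auto
  moreover have "\<forall>\<^sub>F M in sequentially. qp Q (2 * M) / (qp Q (nat (j + int M)) * qp Q (nat (int M - j))) = h M j"
  proof (rule eventually_sequentiallyI[of "nat \<bar>j\<bar>"])
   fix M assume "nat \<bar>j\<bar> \<le> M"
   hence "\<bar>j\<bar> \<le> int M" "2 * M - nat (j + int M) = nat (int M - j)" "nat (j + int M) \<le> 2 * M" by auto
   thus "qp Q (2 * M) / (qp Q (nat (j + int M)) * qp Q (nat (int M - j))) = h M j"
    by (simp add: h_def qb_def)
  qed
  ultimately show "(%M. h M j) \<longlonglongrightarrow> 1 / qi Q" by (rule Lim_transform_eventually[THEN tendsto_eq_rhs]) simp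
 next
  have "norm (h M m) \<le> B * 1 ^ nat \<bar>m\<bar>" for M m
  proof -
   have "norm (qp Q M' / (qp Q i * qp Q k)) \<le> B" for M' i k
    unfolding B_def norm_divide norm_mult
    using d q0 q1 qp_bound[of Q 1 M'] by (intro frac_le mult_mono mult_pos_pos) auto
   moreover have "B \<ge> 0" using d by (simp add: B_def)
   ultimately show ?thesis by (simp add: h_def qb_def)
  qed
  thus "\<forall>\<^sub>F M in sequentially. \<forall>m. norm (h M m) \<le> B * 1 ^ nat \<bar>m\<bar>" by simp
 qed (use assms in auto)
 also have "T (%_. 1 / qi Q) x = th x / qi Q"
  using T_cmult[of "1 / qi Q" "%_. 1" x] by (simp add: th_T)
 finally have l1: "(%M. T (h M) x) \<longlonglongrightarrow> th x / qi Q" .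
 have "T (h M) x = qp (- x) M * qp (- Q / x) M" for M
 proof -
  have "T (h M) x = (\<Sum>\<^sub>\<infinity>j\<in>{-int M..int M}. Q powi tri j * x powi j * h M j)"
   unfolding T_def by (intro infsum_cong_neutral) (auto simp: h_def)
  also have "\<dots> = (\<Sum>j=-int M..int M. Q powi tri j * x powi j * qb (2 * M) (nat (j + int M)))"
   by (auto simp: h_def intro!: sum.cong)
  finally show ?thesis using triple_finite[OF assms] by simp
 qed
 hence "(%M. T (h M) x) \<longlonglongrightarrow> qi (- x) * qi (- Q / x)"
  by (simp add: tendsto_mult qp_lim)
 from LIMSEQ_unique[OF l1 this] show ?thesis by (simp add: field_simps)
qed

lemma th_eq_0_iff: assumes "x \<noteq> 0" shows "th x = 0 \<longleftrightarrow> (\<exists>m::int. x = - (Q powi m))"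
proof -
 have "th x = 0 \<longleftrightarrow> qi (- x) = 0 \<or> qi (- Q / x) = 0"
  by (simp add: th_product[OF assms])
 also have "\<dots> \<longleftrightarrow> (\<exists>l. - x * Q ^ l = 1) \<or> (\<exists>l. - Q / x * Q ^ l = 1)"
  by (simp only: qi_eq_0_iff)
 also have "\<dots> \<longleftrightarrow> (\<exists>m::int. x = - (Q powi m))"
 proof (intro iffI; (elim disjE exE)?)
  fix l assume "- x * Q ^ l = 1"
  hence "x * Q ^ l = - 1" by (metis add.inverse_inverse mult_minus_left)
  hence "x = - 1 / Q ^ l" by (metis nonzero_eq_divide_eq Q_nz power_not_zero)
  hence "x = - (Q powi (- int l))" by (simp add: power_int_minus field_simps)
  thus "\<exists>m::int. x = - (Q powi m)" by blast
 next
  fix l assume "- Q / x * Q ^ l = 1"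
  hence "x = - (Q powi (int (Suc l)))" using assms by (simp add: field_simps del: of_nat_Suc) 
  thus "\<exists>m::int. x = - (Q powi m)" by blast
 next
  fix m :: int assume m: "x = - (Q powi m)"
  show "(\<exists>l. - x * Q ^ l = 1) \<or> (\<exists>l. - Q / x * Q ^ l = 1)"
  proof (cases "m \<le> 0")
   case True
   hence "- x * Q ^ nat (-m) = 1" using m by (simp add: power_int_def field_simps)
   thus ?thesis by blast
  next
   case False
   hence "Q powi m = Q * Q ^ nat (m - 1)" by (simp add: power_int_def flip: power_Suc) (simp add: Suc_nat_eq_nat_zadd1)
   hence "- Q / x * Q ^ nat (m - 1) = 1" using m by (simp add: field_simps)
   thus ?thesis by blast
  qed
 qed
 finally show ?thesis .
qed

lemma th_eq_0_iff': "x \<noteq> 0 ==> th x = 0 \<longleftrightarrow> - x \<in> qZ q"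
 by (auto simp: th_eq_0_iff qZ_def minus_equation_iff[of x] intro: rev_image_eqI)

lemma th_m_eq_0_iff: "x \<noteq> 0 ==> th (- x) = 0 \<longleftrightarrow> x \<in> qZ q"
 using th_eq_0_iff'[of "- x"] by simp

lemma qZ_nz: "x \<in> qZ q ==> x \<noteq> 0" by (auto simp: qZ_def)
lemma qZ_powi: "Q powi m \<in> qZ q" by (auto simp: qZ_def)
lemma qZ_1 [simp]: "1 \<in> qZ q" using qZ_powi[of 0] by simp
lemma qZ_mult: "x \<in> qZ q ==> y \<in> qZ q ==> x * y \<in> qZ q"
proof -
 assume "x \<in> qZ q" "y \<in> qZ q"
 then obtain m k where "x = Q powi m" "y = Q powi k" by (auto simp: qZ_def simp flip: of_real_power_int)
 hence "x * y = Q powi (m + k)" by (simp add: power_int_add)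
 thus ?thesis using qZ_powi by metis
qed
lemma qZ_inverse: "x \<in> qZ q ==> 1 / x \<in> qZ q"
proof -
 assume "x \<in> qZ q"
 then obtain m where "x = Q powi m" by (auto simp: qZ_def simp flip: of_real_power_int)
 hence "1 / x = Q powi (- m)" by (simp add: power_int_minus field_simps)
 thus ?thesis using qZ_powi by metis
qed
lemma qZ_mult_iff: "y \<in> qZ q ==> x * y \<in> qZ q \<longleftrightarrow> x \<in> qZ q"
 using qZ_mult[of x y] qZ_mult[of "x*y" "1/y"] qZ_inverse[of y] qZ_nz[of y] by auto
lemma q_minusN_qZ: "x \<in> q_minusN q ==> x \<in> qZ q" by (auto simp: qZ_def q_minusN_def)
lemma minus1_notin_qZ: "-1 \<notin> qZ q"
proof
 assume "-1 \<in> qZ q"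
 then obtain m where "-1 = Q powi m" by (auto simp: qZ_def)
 hence "of_real (-1) = complex_of_real (q powi m)" by simp
 hence "-1 = q powi m" by (simp only: of_real_eq_iff)
 moreover have "q powi m > 0" using q0 by simp
 ultimately show False by linarith
qed

text \<open>Every zero of theta is simple. Quasi-periodicity moves the zero -q^k to -1, where the
  product shows the single vanishing factor 1 - u.\<close>

lemma th_near: assumes "p \<noteq> 0" "th p = 0"
 shows "\<exists>L. L \<noteq> 0 \<and> ((%x. (x - p) / th x) \<longlongrightarrow> L) (at p)"
proof -
 obtain k where k: "p = - (Q powi k)" using assms th_eq_0_iff by blast
 define F where "F = (%u. - p * Q powi tri k * (- u) powi k / (qi Q * qi (u * Q) * qi (Q / u)))"
 have eq: "(x - p) / th x = F (x / p)" if "x \<noteq> p" "x \<noteq> 0" for x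
 proof -
  define u where "u = x / p"
  have u1: "u \<noteq> 1" using that assms by (simp add: u_def)
  have u: "x = Q powi k * (- u)" "u \<noteq> 0" "u \<noteq> 1" using that assms k u1 by (auto simp: u_def)
  have "th (- u) = Q powi tri k * (- u) powi k * th x" using th_shift[of "-u" k] u by simp
  moreover have "th (- u) = qi Q * ((1 - u) * qi (u * Q)) * qi (Q / u)"
   using th_product[of "- u"] u qi_rec[of u] by simp
  moreover have "Q powi tri k * (- u) powi k \<noteq> 0" using u by simp
  ultimately have "th x = (1 - u) * (qi Q * qi (u * Q) * qi (Q / u)) / (Q powi tri k * (- u) powi k)"
   by (simp add: field_simps)
  moreover have "x - p = - p * (1 - u)" using assms by (simp add: u_def field_simps)
  ultimately show ?thesis using u(3) unfolding F_def u_def[symmetric] by (simp add: mult_ac)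
 qed
 have "((%x. F (x / p)) \<longlongrightarrow> F 1) (at p)"
 proof -
  have u: "((%x. x / p) \<longlongrightarrow> 1) (at p)" using assms by (auto intro!: tendsto_eq_intros)
  show ?thesis unfolding F_def by (intro tendsto_intros u) auto
 qed
 moreover have "\<forall>\<^sub>F x in at p. F (x / p) = (x - p) / th x"
  using eventually_neq_at_within[of p] tendsto_imp_eventually_ne[OF tendsto_ident_at assms(1)]
  by eventually_elim (use eq in auto)
 ultimately have "((%x. (x - p) / th x) \<longlongrightarrow> F 1) (at p)" by (rule Lim_transform_eventually)
 moreover have "F 1 \<noteq> 0" using assms by (simp add: F_def)
 ultimately show ?thesis by blast
qed

lemma qZ_discrete: assumes "x \<noteq> 0" shows "\<forall>\<^sub>F y in at x. y \<notin> qZ q"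
proof -
 have nz: "\<forall>\<^sub>F y in at x. y \<noteq> 0" using tendsto_imp_eventually_ne[OF tendsto_ident_at assms] .
 show ?thesis
proof (cases "th (- x) = 0")
 case False
 have "isCont (%y. th (- y)) x" using assms by (intro isCont_o2[OF _ th_isCont]) auto
 hence "\<forall>\<^sub>F y in at x. th (- y) \<noteq> 0" using False by (auto simp: isCont_def intro: tendsto_imp_eventually_ne)
 thus ?thesis using nz by eventually_elim (simp add: th_m_eq_0_iff)
next
 case True
 obtain L where L: "L \<noteq> 0" "((%y. (y - - x) / th y) \<longlongrightarrow> L) (at (- x))"
  using th_near[of "- x"] assms True by auto
 have "\<forall>\<^sub>F y in at (- x). (y - - x) / th y \<noteq> 0" by (rule tendsto_imp_eventually_ne[OF L(2,1)])
 hence "\<forall>\<^sub>F y in at (- x). th y \<noteq> 0" by eventually_elim auto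
 moreover have "filterlim (%y. - y) (at (- x)) (at x)"
  unfolding filterlim_at by (auto intro!: tendsto_intros eventually_neq_at_within)
 ultimately have "\<forall>\<^sub>F y in at x. th (- y) \<noteq> 0" by (rule eventually_compose_filterlim)
 thus ?thesis using nz by eventually_elim (simp add: th_m_eq_0_iff)
qed
qed

end

section \<open>Multiplicative functions on the punctured plane\<close>

lemma filterlim_mult_at:
 fixes c :: complex assumes "c \<noteq> 0" shows "filterlim (%y. c * y) (at (c * x)) (at x)"
 unfolding filterlim_at
proof
 show "((%y. c * y) \<longlongrightarrow> c * x) (at x)" by (rule tendsto_mult_left[OF tendsto_ident_at])
 have "\<forall>\<^sub>F y in at x. y \<noteq> x" by (rule eventually_neq_at_within)
 thus "\<forall>\<^sub>F y in at x. c * y \<in> UNIV \<and> c * y \<noteq> c * x" by eventually_elim (use assms in auto)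
qed

lemma holomorphic_compose_nz:
 assumes "g holomorphic_on -{0}" "f holomorphic_on S" "\<And>z. z \<in> S ==> f z \<noteq> 0"
 shows "(%z. g (f z)) holomorphic_on S"
proof -
 have "f ` S \<subseteq> -{0}" using assms(3) by auto
 thus ?thesis using holomorphic_on_compose_gen[OF assms(2,1)] by (simp add: o_def image_subset_iff_funcset)
qed

lemma hol_isCont: "g holomorphic_on -{0} ==> x \<noteq> 0 ==> isCont g (x::complex)"
 using holomorphic_on_imp_continuous_on continuous_on_eq_continuous_at[of "-{0::complex}" g] by auto

context qbase begin

lemma ln_q_powi: "ln (q powi m) = real_of_int m * ln q"
proof -
 have "q powi m = q powr real_of_int m" using powr_real_of_int'[of q m] q0 by (metis less_imp_le less_irrefl)
 thus ?thesis using ln_powr[of q "real_of_int m"] q0 by metis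
qed

lemma q_scale: assumes "x \<noteq> 0" shows "\<exists>m::int. q < norm (x * Q powi m) \<and> norm (x * Q powi m) \<le> 1"
proof -
 define L where "L = ln (norm x) / ln q"
 have lq: "ln q < 0" using q0 q1 by simp
 define m where "m = - \<lfloor>L\<rfloor>"
 have "ln (norm x * q powi m) = ln (norm x) + m * ln q"
  using assms q0 by (simp add: ln_mult ln_q_powi)
 also have "\<dots> = (L - \<lfloor>L\<rfloor>) * ln q" using lq by (simp add: L_def m_def field_simps)
 finally have e: "ln (norm x * q powi m) = (L - \<lfloor>L\<rfloor>) * ln q" .
 have pos: "norm x * q powi m > 0" using assms q0 by simp
 have "(L - \<lfloor>L\<rfloor>) * ln q \<le> 0" using lq by (intro mult_nonneg_nonpos) linarith+
 moreover have "(L - \<lfloor>L\<rfloor>) * ln q > 1 * ln q" using lq by (intro mult_strict_right_mono_neg) linarith+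
 ultimately have "norm x * q powi m \<le> 1" "norm x * q powi m > q"
  unfolding e[symmetric] using ln_le_zero_iff[OF pos] ln_less_cancel_iff[OF q0 pos] by simp_all
 thus ?thesis using q0 by (auto simp: norm_mult norm_power_int intro!: exI[of _ m])
qed

lemma powi_shift_eq:
 fixes g :: "complex \<Rightarrow> complex"
 assumes "\<And>x. x \<noteq> 0 ==> g (Q * x) = A * g x" "A \<noteq> 0" "x \<noteq> 0"
 shows "g (x * Q powi m) = A powi m * g x"
proof -
 have nat: "g (x * Q ^ k) = A ^ k * g x" if "x \<noteq> 0" for x k
 proof (induction k)
  case (Suc k)
  have "g (x * Q ^ Suc k) = g (Q * (x * Q ^ k))" by (simp add: mult_ac)
  also have "\<dots> = A * (A ^ k * g x)" using assms(1)[of "x * Q ^ k"] that Suc by simp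
  finally show ?case by (simp only: power_Suc mult.assoc)
 qed simp
 show ?thesis
 proof (cases "m \<ge> 0")
  case True thus ?thesis using nat[OF assms(3), of "nat m"] by (simp add: power_int_def)
 next
  case False
  define k where "k = nat (-m)"
  have m: "m = - int k" using False by (simp add: k_def)
  have "(x * Q powi m) * Q ^ k = x" by (simp add: m power_int_minus)
  moreover have "g ((x * Q powi m) * Q ^ k) = A ^ k * g (x * Q powi m)"
   by (rule nat) (use assms(3) in simp)
  ultimately have "g x = A ^ k * g (x * Q powi m)" by (simp only:)
  thus ?thesis using assms(2) by (simp add: m power_int_minus field_simps)
 qed
qed

text \<open>A function on the punctured plane that is multiplied by a constant under \<open>x \<mapsto> q x\<close> has
 polynomial growth at both ends, hence is a Laurent polynomial.\<close>

lemma multiplicative_aux: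
 assumes g: "g holomorphic_on -{0}" and A: "A \<noteq> 0" and ga: "\<And>x. x \<noteq> 0 ==> g (Q * x) = A * g x"
 shows "\<exists>N::int. \<exists>\<alpha> \<beta>. q < norm (A * Q powi N) \<and> norm (A * Q powi N) \<le> 1 \<and>
     (\<forall>x. x \<noteq> 0 \<longrightarrow> g x * x powi N = \<alpha> + \<beta> * x)"
proof -
 obtain N where N: "q < norm (A * Q powi N)" "norm (A * Q powi N) \<le> 1" using q_scale[OF A] by auto
 define B where "B = A * Q powi N"
 define G where "G = (%x. g x * x powi N)"
 have Bnz: "B \<noteq> 0" using A by (simp add: B_def)
 have GB: "G (Q * x) = B * G x" if "x \<noteq> 0" for x
  using ga[OF that] by (simp add: G_def B_def power_int_mult_distrib mult_ac)
 have Gh: "G holomorphic_on -{0}" unfolding G_def by (intro holomorphic_intros g) auto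
 define K where "K = cball 0 1 - ball (0::complex) q"
 have "compact K" unfolding K_def by (intro compact_diff) auto
 moreover have "continuous_on K G"
  by (rule continuous_on_subset[OF holomorphic_on_imp_continuous_on[OF Gh]]) (use q0 in \<open>auto simp: K_def\<close>)
 ultimately have "bounded (G ` K)" by (intro compact_imp_bounded compact_continuous_image)
 then obtain M where M: "M > 0" "\<And>x. x \<in> K ==> norm (G x) \<le> M" by (auto simp: bounded_pos)
 \<comment> \<open>Moving x into the annulus \<open>K\<close> by q^m changes G by B^m. The choice of
   N puts |B| in (q, 1]: the upper bound handles small x, where m <= 0, and the lower one handles
   large x, where q^(-m) < |x| / q.\<close>
 have bd: "norm (G x) \<le> M * max 1 (norm x / q)" if x: "x \<noteq> 0" for x
 proof -
  obtain m where m: "q < norm (x * Q powi m)" "norm (x * Q powi m) \<le> 1" using q_scale[OF x] by auto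
  have "x * Q powi m \<in> K" using m by (auto simp: K_def)
  hence "norm (G (x * Q powi m)) \<le> M" by (rule M)
  hence "norm (B powi m) * norm (G x) \<le> M"
   using powi_shift_eq[of G B x m] GB Bnz x by (simp add: norm_mult)
  hence "norm (G x) \<le> M * norm B powi (- m)"
   using Bnz by (simp add: norm_power_int power_int_minus field_simps)
  also have "norm B powi (- m) \<le> max 1 (norm x / q)"
  proof (cases "m \<le> 0")
   case True
   hence "norm B powi (- m) \<le> 1" using N by (simp add: B_def power_int_def power_le_one)
   thus ?thesis by simp
  next
   case False
   have "norm B powi (- m) = inverse (norm B) ^ nat m" using False by (simp add: power_int_def)
   also have "\<dots> \<le> inverse q ^ nat m" using N q0 
    by (intro power_mono) (auto simp: B_def intro!: le_imp_inverse_le)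
   also have "\<dots> = q powi (- m)" using False by (simp add: power_int_def)
   also have "\<dots> \<le> norm x / q" using m(1) q0 by (simp add: norm_mult norm_power_int power_int_minus field_simps)
   finally show ?thesis by simp
  qed
  finally show ?thesis using M by (simp add: mult_left_mono)
 qed
 have "\<exists>h. h holomorphic_on UNIV \<and> (\<forall>x\<in>UNIV - {0}. h x = G x)"
 proof (rule removable_discrete)
  show "G holomorphic_on UNIV - {0}" using Gh by (simp add: Compl_eq_Diff_UNIV)
  show "\<forall>\<^sub>F y in at x. y \<notin> {0}" for x :: complex
  proof (cases "x = 0")
   case True thus ?thesis using eventually_neq_at_within[of 0 0 UNIV] by simp
  next
   case False thus ?thesis using tendsto_imp_eventually_ne[OF tendsto_ident_at False] by simp
  qed
  fix p :: complex assume "p \<in> {0}"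
  have "((%x. x * G x) \<longlongrightarrow> 0) (at 0)"
  proof (rule Lim_null_comparison)
   show "\<forall>\<^sub>F x in at 0. norm (x * G x) \<le> norm x * (M * max 1 (norm x / q))"
    unfolding norm_mult
   proof (rule eventually_mono[OF eventually_neq_at_within[of 0]])
    fix x :: complex assume "x \<noteq> 0"
    thus "norm x * norm (G x) \<le> norm x * (M * max 1 (norm x / q))" using bd[of x] mult_left_mono norm_ge_zero by blast
   qed
   show "((%x. norm x * (M * max 1 (norm x / q))) \<longlongrightarrow> 0) (at (0::complex))"
   proof -
    have n: "((%x::complex. norm x) \<longlongrightarrow> 0) (at 0)" by (rule tendsto_norm_zero) (rule tendsto_ident_at)
    have "((%x::complex. norm x * (M * max 1 (norm x / q))) \<longlongrightarrow> 0 * (M * max 1 (0 / q))) (at 0)"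
     by (intro tendsto_intros n) auto
    thus ?thesis by simp
   qed
  qed
  with \<open>p \<in> {0}\<close> show "((%x. (x - p) * G x) \<longlongrightarrow> 0) (at p)" by simp
 qed auto
 then obtain h where h: "h holomorphic_on UNIV" "\<And>x. x \<noteq> 0 ==> h x = G x" by auto
 have "norm (h x) \<le> (M / q) * norm x ^ 1" if "1 \<le> norm x" for x
 proof -
  have "x \<noteq> 0" using that by auto
  moreover have "max 1 (norm x / q) = norm x / q" using that q0 q1 by (simp add: field_simps)
  ultimately show ?thesis using h(2)[of x] bd[of x] by (simp only: power_one_right) (simp add: field_simps)
 qed
 hence "h x = (\<Sum>k\<le>1. (deriv ^^ k) h 0 / fact k * x ^ k)" for x
  by (rule Liouville_polynomial[OF h(1)])
 moreover have "(\<Sum>k\<le>1. (deriv ^^ k) h 0 / fact k * x ^ k) = h 0 + deriv h 0 * x" for x by simp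
 ultimately have "h x = h 0 + deriv h 0 * x" for x by (rule trans)
 hence "G x = h 0 + deriv h 0 * x" if "x \<noteq> 0" for x using h(2)[OF that] by metis
 thus ?thesis using N by (auto simp: G_def)
qed

text \<open>Here the normalising exponent satisfies q < q^N <= 1, so N = 0 and g is affine;
  invariance removes the linear term.\<close>

lemma elliptic_const:
 assumes g: "g holomorphic_on -{0}" and ga: "\<And>x. x \<noteq> 0 ==> g (Q * x) = g x"
 shows "\<exists>c. \<forall>x. x \<noteq> 0 \<longrightarrow> g x = c"
proof -
 obtain N :: int and \<alpha> \<beta> where N: "q < norm (1 * Q powi N)" "norm (1 * Q powi N) \<le> 1"
  and ab: "\<And>x. x \<noteq> 0 ==> g x * x powi N = \<alpha> + \<beta> * x"
  using multiplicative_aux[OF g, of 1] ga by auto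
 have "N = 0"
 proof (rule ccontr)
  assume "N \<noteq> 0"
  hence "N \<ge> 1 \<or> N \<le> -1" by linarith
  thus False
  proof
   assume "N \<ge> 1"
   hence "q powi N \<le> q powi 1" using q0 q1 by (intro power_int_decreasing) auto
   thus False using N q0 by (simp add: norm_power_int)
  next
   assume "N \<le> -1"
   hence "q powi N \<ge> q powi (-1)" using q0 q1 by (intro power_int_decreasing) auto
   moreover have "q powi (-1) > 1" using q0 q1 by (simp add: field_simps)
   ultimately show False using N q0 by (simp add: norm_power_int)
  qed
 qed
 hence ab: "g x = \<alpha> + \<beta> * x" if "x \<noteq> 0" for x using ab[OF that] by simp
 have "\<alpha> + \<beta> * Q = \<alpha> + \<beta> * 1" using ab[of 1] ab[of Q] ga[of 1] by simp
 hence "\<beta> * (Q - 1) = 0" by (simp add: algebra_simps)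
 hence "\<beta> = 0" using Q_pow_ne1[of 1] by simp
 thus ?thesis using ab by auto
qed

text \<open>After normalisation g is an affine function with multiplier \<open>B\<close>; its two
  coefficients could survive only for B = 1 and B = q, and both would put A into q^Z.\<close>

lemma multiplicative_zero:
 assumes g: "g holomorphic_on -{0}" and A: "A \<noteq> 0" "A \<notin> qZ q" and ga: "\<And>x. x \<noteq> 0 ==> g (Q * x) = A * g x"
  and x: "x \<noteq> 0"
 shows "g x = 0"
proof -
 obtain N :: int and \<alpha> \<beta> where N: "q < norm (A * Q powi N)" "norm (A * Q powi N) \<le> 1"
  and ab: "\<And>x. x \<noteq> 0 ==> g x * x powi N = \<alpha> + \<beta> * x"
  using multiplicative_aux[OF g A(1) ga] by blast
 define B where "B = A * Q powi N"
 have e: "\<alpha> + \<beta> * (Q * x) = B * (\<alpha> + \<beta> * x)" if "x \<noteq> 0" for x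
 proof -
  have "\<alpha> + \<beta> * (Q * x) = g (Q * x) * (Q * x) powi N" using ab[of "Q * x"] that by simp
  also have "\<dots> = A * g x * (Q powi N * x powi N)"
   unfolding ga[OF that] by (simp only: power_int_mult_distrib)
  also have "\<dots> = B * (g x * x powi N)" by (simp add: B_def mult_ac)
  finally show ?thesis using ab[OF that] by simp
 qed
 have nB: "B \<noteq> 1" "B \<noteq> Q"
 proof -
  have "B \<noteq> Q powi k" for k
  proof
   assume "B = Q powi k"
   hence "A * Q powi N * Q powi (- N) = Q powi k * Q powi (- N)" by (simp only: B_def)
   moreover have "A * Q powi N * Q powi (- N) = A" by (simp add: power_int_minus)
   moreover have "Q powi k * Q powi (- N) \<in> qZ q" by (intro qZ_mult qZ_powi)
   ultimately have "A \<in> qZ q" by metis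
   thus False using A by blast
  qed
  from this[of 0] this[of 1] show "B \<noteq> 1" "B \<noteq> Q" by (metis power_int_0_right, metis power_int_1_right)
 qed
 \<comment> \<open>The relation at x = 1 and at x = -1, added and subtracted, separates the two
   coefficients.\<close>
 have "2 * (\<alpha> * (1 - B)) = (\<alpha> + \<beta> * (Q * 1) - B * (\<alpha> + \<beta> * 1)) + (\<alpha> + \<beta> * (Q * (-1)) - B * (\<alpha> + \<beta> * (-1)))"
  by (simp add: algebra_simps)
 moreover have "2 * (\<beta> * (Q - B)) = (\<alpha> + \<beta> * (Q * 1) - B * (\<alpha> + \<beta> * 1)) - (\<alpha> + \<beta> * (Q * (-1)) - B * (\<alpha> + \<beta> * (-1)))"
  by (simp add: algebra_simps)
 moreover have "\<alpha> + \<beta> * (Q * 1) - B * (\<alpha> + \<beta> * 1) = 0" using e[of 1] by (metis right_minus_eq zero_neq_one)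
 moreover have "\<alpha> + \<beta> * (Q * -1) - B * (\<alpha> + \<beta> * -1) = 0" using e[of "-1"] by (metis right_minus_eq neg_equal_0_iff_equal zero_neq_one)
 ultimately have "2 * (\<alpha> * (1 - B)) = 0" "2 * (\<beta> * (Q - B)) = 0" by (metis add_0_left, metis diff_0_right)
 hence "\<alpha> * (1 - B) = 0" "\<beta> * (Q - B) = 0" by (metis mult_eq_0_iff zero_neq_numeral)+
 hence "\<alpha> = 0" "\<beta> = 0" using nB by (metis mult_eq_0_iff right_minus_eq)+
 thus ?thesis using ab[OF x] x by simp
qed

text \<open>Division is possible because all zeros of theta are simple, so vanishing of g to first
  order suffices.\<close>

lemma th_divide:
 assumes g: "g holomorphic_on -{0}" and \<tau>: "\<tau> \<noteq> 0" and z: "\<And>x. x \<noteq> 0 ==> th (\<tau> * x) = 0 ==> g x = 0"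
 shows "\<exists>h. h holomorphic_on -{0} \<and> (\<forall>x. x \<noteq> 0 \<longrightarrow> g x = h x * th (\<tau> * x))"
proof -
 define P where "P = {x. x \<noteq> 0 \<and> th (\<tau> * x) = 0}"
 have "\<exists>h. h holomorphic_on -{0} \<and> (\<forall>x\<in>-{0} - P. h x = g x / th (\<tau> * x))"
 proof (rule removable_discrete)
  show "(%x. g x / th (\<tau> * x)) holomorphic_on - {0} - P"
   by (intro holomorphic_intros holomorphic_on_subset[OF g]) (use \<tau> in \<open>auto simp: P_def\<close>)
  show "\<forall>\<^sub>F y in at x. y \<notin> P" if "x \<in> -{0}" for x
  proof -
   have "filterlim (%y. - \<tau> * y) (at (- \<tau> * x)) (at x)"
    using \<tau> by (intro filterlim_mult_at) auto
   hence "\<forall>\<^sub>F y in at x. - \<tau> * y \<notin> qZ q"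
    using \<tau> that by (intro eventually_compose_filterlim[OF qZ_discrete]) auto
   thus ?thesis by eventually_elim (use \<tau> in \<open>auto simp: P_def th_eq_0_iff'\<close>)
  qed
  fix p assume "p \<in> -{0}" "p \<in> P"
  hence p: "p \<noteq> 0" "th (\<tau> * p) = 0" "g p = 0" using z by (auto simp: P_def)
  obtain L where L: "((%x. (x - \<tau> * p) / th x) \<longlongrightarrow> L) (at (\<tau> * p))" using th_near[of "\<tau> * p"] p \<tau> by auto
  have f: "filterlim (%y. \<tau> * y) (at (\<tau> * p)) (at p)"
   using \<tau> by (intro filterlim_mult_at) auto
  have "((%x. (\<tau> * x - \<tau> * p) / th (\<tau> * x)) \<longlongrightarrow> L) (at p)" by (rule filterlim_compose[OF L f])
  moreover have "(g \<longlongrightarrow> g p) (at p)"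
   using hol_isCont[OF g p(1)] by (simp add: isCont_def)
  ultimately have "((%x. (\<tau> * x - \<tau> * p) / th (\<tau> * x) * g x * (1 / \<tau>)) \<longlongrightarrow> L * g p * (1 / \<tau>)) (at p)"
   by (intro tendsto_intros)
  moreover have "(\<tau> * x - \<tau> * p) / th (\<tau> * x) * g x * (1 / \<tau>) = (x - p) * (g x / th (\<tau> * x))" for x
  proof -
   have "\<tau> * x - \<tau> * p = \<tau> * (x - p)" by (simp add: algebra_simps)
   thus ?thesis using \<tau> by simp
  qed
  ultimately show "((%x. (x - p) * (g x / th (\<tau> * x))) \<longlongrightarrow> 0) (at p)" using p by simp
 qed auto
 then obtain h where h: "h holomorphic_on -{0}" "\<And>x. x \<noteq> 0 ==> x \<notin> P ==> h x = g x / th (\<tau> * x)" by auto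
 have "g x = h x * th (\<tau> * x)" if "x \<noteq> 0" for x
  using h(2)[OF that] z[OF that] that by (cases "x \<in> P") (auto simp: P_def)
 with h(1) show ?thesis by blast
qed

lemma quotient_invariant:
 \<comment> \<open>the zeros are isolated, so the transformation law extends over them by continuity\<close>
 assumes h: "h holomorphic_on -{0}" and \<tau>: "\<tau> \<noteq> 0"
  and e: "\<And>x. x \<noteq> 0 ==> th (\<tau> * x) \<noteq> 0 ==> h (Q * x) = A * h x" and x: "x \<noteq> 0"
 shows "h (Q * x) = A * h x"
proof -
 have c: "isCont h y" if "y \<noteq> 0" for y
  using h that by (rule hol_isCont)
 have "filterlim (%y. - \<tau> * y) (at (- \<tau> * x)) (at x)"
  using \<tau> by (intro filterlim_mult_at) auto
 hence "\<forall>\<^sub>F y in at x. - \<tau> * y \<notin> qZ q"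
  using \<tau> x by (intro eventually_compose_filterlim[OF qZ_discrete]) auto
 hence ev: "\<forall>\<^sub>F y in at x. h (Q * y) = A * h y"
  using tendsto_imp_eventually_ne[OF tendsto_ident_at x]
  by eventually_elim (use \<tau> in \<open>auto intro!: e simp: th_eq_0_iff'\<close>)
 have "((%y. h (Q * y)) \<longlongrightarrow> h (Q * x)) (at x)"
  by (rule isCont_tendsto_compose[OF c]) (use x in \<open>auto intro!: tendsto_intros\<close>)
 moreover have "((%y. A * h y) \<longlongrightarrow> A * h x) (at x)"
  using c[OF x] by (intro tendsto_intros) (simp add: isCont_def)
 ultimately show ?thesis using tendsto_cong[OF ev] tendsto_unique[of "at x"] by fastforce
qed

lemma theta_one:
 assumes g: "g holomorphic_on -{0}" and \<tau>: "\<tau> \<noteq> 0" and ga: "\<And>x. x \<noteq> 0 ==> g (Q * x) = g x / (\<tau> * x)"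
 shows "\<exists>C. \<forall>x. x \<noteq> 0 \<longrightarrow> g x = C * th (\<tau> * x)"
proof -
 define f where "f = (%x. g (x / \<tau>))"
 have fh: "f holomorphic_on -{0}"
  unfolding f_def using \<tau> by (intro holomorphic_compose_nz[OF g] holomorphic_intros) auto
 have fa: "f (Q * x) = f x / x" if "x \<noteq> 0" for x
  using ga[of "x / \<tau>"] that \<tau> by (simp add: f_def)
 define k where "k = (%x. f x - x * f (1 / x))"
 have fi: "(%x. f (1 / x)) holomorphic_on -{0}"
  by (intro holomorphic_compose_nz[OF fh] holomorphic_intros) auto
 have kh: "k holomorphic_on -{0}" unfolding k_def by (intro holomorphic_intros fh fi)
 have ka: "k (Q * x) = k x / x" if x: "x \<noteq> 0" for x
 proof -
  have "f (1 / x) = f (Q * (1 / (Q * x)))" by simp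
  also have "\<dots> = f (1 / (Q * x)) * (Q * x)" using fa[of "1 / (Q * x)"] x by (simp del: of_real_mult)
  finally show ?thesis using fa[OF x] x by (simp add: k_def field_simps)
 qed
 have k1: "k 1 = 0" by (simp add: k_def)
 have kz: "k x = 0" if nz: "x \<noteq> 0" "th (- 1 * x) = 0" for x
 proof -
  obtain m where "- x = - (Q powi m)" using th_eq_0_iff[of "- x"] nz by auto
  hence "x = Q powi m" by simp
  moreover have "k (Q powi m) = 0"
  proof -
   have nat: "k (Q ^ j) = 0" for j by (induction j) (use k1 ka in auto)
   have "k (1 / Q ^ j) = 0" for j
   proof (induction j)
    case (Suc j)
    have "k (1 / Q ^ j) = k (1 / Q ^ Suc j) * Q ^ Suc j" using ka[of "1 / Q ^ Suc j"] by simp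
    thus ?case using Suc by simp
   qed (use k1 in simp)
   with nat show ?thesis by (cases "m \<ge> 0") (auto simp: power_int_def power_one_over inverse_eq_divide)
  qed
  ultimately show ?thesis by simp
 qed
 obtain h where h: "h holomorphic_on -{0}" "\<And>x. x \<noteq> 0 ==> k x = h x * th (- 1 * x)"
  using th_divide[OF kh, of "-1"] kz by auto
 have "h (Q * x) = -1 * h x" if "x \<noteq> 0" for x
 proof (rule quotient_invariant[OF h(1), of "-1"])
  fix x assume x: "x \<noteq> 0" "th (- 1 * x) \<noteq> 0"
  have "h (Q * x) * th (- 1 * (Q * x)) = h x * th (- 1 * x) / x" using h(2)[of "Q * x"] h(2)[of x] ka x by simp
  also have "th (- 1 * (Q * x)) = - th (- 1 * x) / x" using th_Q'[of "-x"] x by simp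
  finally have "- (h (Q * x) * th (- 1 * x)) = h x * th (- 1 * x)" using x(1) by (simp add: field_simps)
  hence "(h (Q * x) + h x) * th (- 1 * x) = 0" by (metis distrib_right add.right_inverse)
  hence "h (Q * x) + h x = 0" using x(2) by (metis mult_eq_0_iff)
  thus "h (Q * x) = -1 * h x" by (simp add: add_eq_0_iff)
 qed (use that in auto)
 hence "h x = 0" if "x \<noteq> 0" for x
  using multiplicative_zero[OF h(1), of "-1" x] minus1_notin_qZ that by auto
 hence "k x = 0" if "x \<noteq> 0" for x using h(2) that by simp
 from this[of "-1"] have fm1: "f (-1) = 0" by (simp add: k_def)
 have fz: "f x = 0" if nz: "x \<noteq> 0" "th (1 * x) = 0" for x
 proof -
  obtain m where "x = - (Q powi m)" using th_eq_0_iff[of x] nz by auto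
  moreover have "f (- (Q powi m)) = 0"
  proof -
   have nat: "f (- (Q ^ j)) = 0" for j 
   proof (induction j)
    case (Suc j) thus ?case using fa[of "- (Q ^ j)"] by simp
   qed (use fm1 in simp)
   have "f (- (1 / Q ^ j)) = 0" for j
   proof (induction j)
    case (Suc j)
    have "f (- (1 / Q ^ j)) = - (f (- (1 / Q ^ Suc j)) * Q ^ Suc j)" using fa[of "- (1 / Q ^ Suc j)"] by simp
    thus ?case using Suc by simp
   qed (use fm1 in simp)
   with nat show ?thesis by (cases "m \<ge> 0") (auto simp: power_int_def power_one_over inverse_eq_divide)
  qed
  ultimately show ?thesis by simp
 qed
 obtain e where e: "e holomorphic_on -{0}" "\<And>x. x \<noteq> 0 ==> f x = e x * th (1 * x)"
  using th_divide[OF fh, of 1] fz by auto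
 have "e (Q * x) = 1 * e x" if "x \<noteq> 0" for x
 proof (rule quotient_invariant[OF e(1), of 1])
  fix x assume x: "x \<noteq> 0" "th (1 * x) \<noteq> 0"
  have "e (Q * x) * th (Q * x) = e x * th x / x" using e(2)[of "Q * x"] e(2)[of x] fa x by simp
  moreover have "e (Q * x) * th x = x * (e (Q * x) * th (Q * x))" using th_Q[OF x(1)] by (metis mult.left_commute)
  ultimately have "e (Q * x) * th x = e x * th x" using x(1) by (metis nonzero_mult_div_cancel_left times_divide_eq_right)
  thus "e (Q * x) = 1 * e x" using x(2) by simp
 qed (use that in auto)
 then obtain C where "\<And>x. x \<noteq> 0 ==> e x = C" using elliptic_const[OF e(1)] by auto
 hence "f x = C * th x" if "x \<noteq> 0" for x using e(2) that by simp
 hence "g x = C * th (\<tau> * x)" if "x \<noteq> 0" for x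
  using \<tau> that by (metis f_def mult_eq_0_iff nonzero_mult_div_cancel_left)
 thus ?thesis by blast
qed

end

section \<open>Partial fraction series\<close>

lemma product_summable_on:
 fixes u :: "'a \<Rightarrow> real" and v :: "'b \<Rightarrow> real"
 assumes "u summable_on A" "v summable_on B" "\<And>a. u a \<ge> 0" "\<And>b. v b \<ge> 0"
 shows "(%(a,b). u a * v b) summable_on A \<times> B"
proof -
 have "(%x. norm ((%(a,b). u a * v b) x)) summable_on A \<times> B"
  unfolding Infinite_Sum.abs_summable_on_Sigma_iff
  using assms by (auto simp: abs_mult infsum_cmult_right' infsum_nonneg intro!: summable_on_cmult_right summable_on_cmult_left)
 thus ?thesis using assms by (simp add: case_prod_unfold abs_mult)
qed

lemma infsum_swap_bounded:
 fixes f :: "'a \<Rightarrow> 'b \<Rightarrow> complex"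
 assumes "u summable_on UNIV" "v summable_on UNIV" "\<And>a. u a \<ge> 0" "\<And>b. v b \<ge> 0"
  and "\<And>a b. norm (f a b) \<le> u a * v b"
 shows "(\<Sum>\<^sub>\<infinity>a. \<Sum>\<^sub>\<infinity>b. f a b) = (\<Sum>\<^sub>\<infinity>b. \<Sum>\<^sub>\<infinity>a. f a b)"
proof (rule infsum_swap_banach)
 have "(%x. norm ((%(a,b). f a b) x)) summable_on UNIV \<times> UNIV"
  by (rule Infinite_Sum.abs_summable_on_comparison_test'[OF product_summable_on[OF assms(1-4)]]) (use assms(5) in auto)
 thus "(%(a,b). f a b) summable_on UNIV \<times> UNIV" by (rule abs_summable_summable)
qed

lemma suminf_infsum: "summable (%k. norm (f k :: complex)) ==> suminf f = infsum f UNIV"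
 using norm_summable_imp_has_sum[of f "suminf f"] summable_norm_cancel[of f] infsumI by (metis summable_sums)

lemma suminf_swap_bounded:
 fixes f :: "nat \<Rightarrow> nat \<Rightarrow> complex"
 assumes u: "summable u" and v: "summable v" and nn: "\<And>a. u a \<ge> 0" "\<And>b. v b \<ge> 0"
  and f: "\<And>a b. norm (f a b) \<le> u a * v b"
 shows "(\<Sum>a. \<Sum>b. f a b) = (\<Sum>b. \<Sum>a. f a b)"
proof -
 have s1: "summable (%b. norm (f a b))" for a
  by (rule summable_comparison_test'[of "%b. u a * v b" 0]) (use f v in \<open>auto intro: summable_mult\<close>)
 have s2: "summable (%a. norm (f a b))" for b
  by (rule summable_comparison_test'[of "%a. u a * v b" 0]) (use f u in \<open>auto intro: summable_mult2\<close>)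
 have n1: "norm (\<Sum>b. f a b) \<le> u a * suminf v" for a
 proof -
  have "norm (\<Sum>b. f a b) \<le> (\<Sum>b. norm (f a b))" by (rule summable_norm[OF s1])
  also have "\<dots> \<le> (\<Sum>b. u a * v b)" by (rule suminf_le[OF f s1]) (use v in \<open>auto intro: summable_mult\<close>)
  finally show ?thesis using suminf_mult[OF v] by simp
 qed
 have n2: "norm (\<Sum>a. f a b) \<le> suminf u * v b" for b
 proof -
  have "norm (\<Sum>a. f a b) \<le> (\<Sum>a. norm (f a b))" by (rule summable_norm[OF s2])
  also have "\<dots> \<le> (\<Sum>a. u a * v b)" by (rule suminf_le[OF f s2]) (use u in \<open>auto intro: summable_mult2\<close>)
  finally show ?thesis using suminf_mult2[OF u] by simp
 qed
 have t1: "summable (%a. norm (\<Sum>b. f a b))"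
  by (rule summable_comparison_test'[of "%a. u a * suminf v" 0]) (use n1 u in \<open>auto intro: summable_mult2\<close>)
 have t2: "summable (%b. norm (\<Sum>a. f a b))"
  by (rule summable_comparison_test'[of "%b. suminf u * v b" 0]) (use n2 v in \<open>auto intro: summable_mult\<close>)
 have "(\<Sum>\<^sub>\<infinity>a. \<Sum>\<^sub>\<infinity>b. f a b) = (\<Sum>\<^sub>\<infinity>b. \<Sum>\<^sub>\<infinity>a. f a b)"
  by (rule infsum_swap_bounded[of u v]) (use u v nn f in \<open>auto intro: summable_nonneg_imp_summable_on\<close>)
 thus ?thesis using s1 s2 t1 t2 by (simp add: suminf_infsum)
qed

text \<open>The identity theorem applied to the difference with its singularities removed; the
  convention on values at poles then fixes the remaining isolated points.\<close>

lemma nicely_meromorphic_fps_unique: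
 assumes g: "g nicely_meromorphic_on UNIV" "g has_fps_expansion F"
  and h: "h nicely_meromorphic_on UNIV" "h has_fps_expansion F"
 shows "g = h"
proof
 fix w
 have gm: "g meromorphic_on UNIV" and hm: "h meromorphic_on UNIV"
  using g h by (auto simp: nicely_meromorphic_on_def)
 define d where "d = (%z. g z - h z)"
 have dm: "d meromorphic_on UNIV" unfolding d_def by (intro meromorphic_intros gm hm)
 have "\<forall>\<^sub>F z in nhds 0. eval_fps F z = g z" "\<forall>\<^sub>F z in nhds 0. eval_fps F z = h z"
  using g h by (auto simp: has_fps_expansion_def)
 hence "\<forall>\<^sub>F z in nhds 0. d z = 0" by eventually_elim (simp add: d_def)
 hence ev0: "\<forall>\<^sub>F z in at 0. d z = 0" by (simp add: eventually_nhds_conv_at)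
 have "\<forall>\<^sub>F z in at 0. remove_sings d z = d z"
  using eventually_remove_sings_eq[OF dm] by (simp add: eventually_cosparse_open_eq)
 hence "\<forall>\<^sub>F z in at 0. remove_sings d z = 0" using ev0 by eventually_elim simp
 hence fr: "\<exists>\<^sub>F z in at 0. remove_sings d z = 0" by (intro eventually_frequently) auto
 have "remove_sings d w = 0" for w
  by (rule frequently_eq_meromorphic_imp_constant[OF fr remove_sings_nicely_meromorphic[OF dm]]) auto
 moreover have "\<forall>\<^sub>F z in at w. remove_sings d z = d z"
  using eventually_remove_sings_eq[OF dm] by (simp add: eventually_cosparse_open_eq)
 ultimately have ev: "\<forall>\<^sub>F z in at w. g z = h z" by (simp add: d_def) 
 have pole: "is_pole g w \<longleftrightarrow> is_pole h w" using ev by (intro is_pole_cong) auto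
 have lim: "(g \<longlongrightarrow> c) (at w) \<longleftrightarrow> (h \<longlongrightarrow> c) (at w)" for c using ev by (rule tendsto_cong)
 have gw: "is_pole g w \<and> g w = 0 \<or> g \<midarrow>w\<rightarrow> g w" and hw: "is_pole h w \<and> h w = 0 \<or> h \<midarrow>w\<rightarrow> h w"
  using g h by (auto simp: nicely_meromorphic_on_def)
 have np: "\<not> (is_pole f w \<and> f \<midarrow>w\<rightarrow> c)" for f :: "complex \<Rightarrow> complex" and c
  unfolding is_pole_def using not_tendsto_and_filterlim_at_infinity[of "at w" f c] by auto
 show "g w = h w" using gw hw pole lim np by (metis LIM_unique)
qed

lemma mero_sum_eq_remove_sings:
 assumes g: "g meromorphic_on UNIV" "g has_fps_expansion F"
 shows "mero_sum F = remove_sings g"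
proof -
 have "\<forall>\<^sub>F z in nhds 0. remove_sings g z = g z"
 proof -
  have "g analytic_on {0}" using g(2) by (rule has_fps_expansion_imp_analytic_0)
  thus ?thesis using analytic_at_imp_isCont remove_sings_at_analytic analytic_at[of g 0]
   by (metis (mono_tags, lifting) eventually_nhds analytic_on_open holomorphic_on_imp_analytic_at)
 qed
 moreover have "\<forall>\<^sub>F z in nhds 0. eval_fps F z = g z" using g(2) by (simp add: has_fps_expansion_def)
 ultimately have "\<forall>\<^sub>F z in nhds 0. eval_fps F z = remove_sings g z" by eventually_elim simp
 hence r: "remove_sings g has_fps_expansion F" using g(2) by (simp add: has_fps_expansion_def)
 show ?thesis unfolding mero_sum_def
  by (rule the_equality) (use r remove_sings_nicely_meromorphic[OF g(1)] nicely_meromorphic_fps_unique in blast)+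
qed

text \<open>The way in which every continued series below is evaluated: exhibit some meromorphic
  function with the right expansion that is analytic at the point.\<close>

lemma mero_sum_eq:
 assumes "g meromorphic_on UNIV" "g has_fps_expansion F" "g analytic_on {x}"
 shows "mero_sum F x = g x"
 using mero_sum_eq_remove_sings[OF assms(1,2)] remove_sings_at_analytic[OF assms(3)] by simp

context qbase begin

text \<open>Possible simple poles lie at q^(-l). The factor 1 - q^l x, rather than x - q^(-l), keeps
  the terms bounded off the poles when the weights are absolutely summable.\<close>

definition PS :: "(nat \<Rightarrow> complex) \<Rightarrow> complex \<Rightarrow> complex" where
 "PS w x = (\<Sum>l. w l / (1 - Q ^ l * x))"

text \<open>The points q^l x0 tend to 0, so only finitely many come near 1. The factor 2 leaves room
  to move x0 inside a ball of radius delta in \<open>lattice_gap_ball\<close>.\<close>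

lemma lattice_gap: "\<exists>\<delta>>0. \<forall>l. Q ^ l * x0 \<noteq> 1 \<longrightarrow> 2 * \<delta> \<le> norm (1 - Q ^ l * x0)"
proof -
 have "(%l. norm (1 - Q ^ l * x0)) \<longlonglongrightarrow> norm (1 - 0 * x0)" by (intro tendsto_intros Qpow_to_0)
 hence "\<forall>\<^sub>F l in sequentially. norm (1 - Q ^ l * x0) > 1/2" by (rule order_tendstoD) simp
 then obtain N where N: "\<And>l. l \<ge> N ==> norm (1 - Q ^ l * x0) > 1/2" by (auto simp: eventually_sequentially)
 define S where "S = insert (1/2) ((%l. norm (1 - Q ^ l * x0)) ` {l. l < N \<and> Q ^ l * x0 \<noteq> 1})"
 have S: "finite S" "S \<noteq> {}" "\<And>s. s \<in> S ==> s > 0" by (auto simp: S_def)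
 have "Min S > 0" using S by simp
 moreover have "Min S \<le> norm (1 - Q ^ l * x0)" if "Q ^ l * x0 \<noteq> 1" for l
 proof (cases "l < N")
  case True thus ?thesis using that S(1) by (intro Min_le) (auto simp: S_def)
 next
  case False
  have "Min S \<le> 1/2" using S(1) by (intro Min_le) (auto simp: S_def)
  thus ?thesis using N[of l] False by simp
 qed
 ultimately show ?thesis by (intro exI[of _ "Min S / 2"]) auto
qed

lemma lattice_gap_ball:
 assumes "\<And>l. w l = 0 \<or> Q ^ l * x0 \<noteq> 1"
 shows "\<exists>\<delta>>0. \<forall>x\<in>ball x0 \<delta>. \<forall>l. w l \<noteq> 0 \<longrightarrow> \<delta> \<le> norm (1 - Q ^ l * x)"
proof -
 obtain \<delta> where d: "\<delta> > 0" "\<And>l. Q ^ l * x0 \<noteq> 1 ==> 2 * \<delta> \<le> norm (1 - Q ^ l * x0)" using lattice_gap by blast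
 have "\<delta> \<le> norm (1 - Q ^ l * x)" if x: "x \<in> ball x0 \<delta>" and w: "w l \<noteq> 0" for x l
 proof -
  have "norm (Q ^ l * (x - x0)) \<le> 1 * norm (x - x0)"
   unfolding norm_mult using q0 qpow_le1 by (intro mult_right_mono) (auto simp: norm_power)
  also have "\<dots> < \<delta>" using x by (simp add: dist_norm norm_minus_commute)
  finally have "norm (Q ^ l * (x - x0)) < \<delta>" .
  moreover have "norm (1 - Q ^ l * x0) \<le> norm (1 - Q ^ l * x) + norm (Q ^ l * (x - x0))"
   using norm_triangle_ineq[of "1 - Q ^ l * x" "Q ^ l * (x - x0)"] by (simp add: algebra_simps)
  moreover have "2 * \<delta> \<le> norm (1 - Q ^ l * x0)" using assms[of l] w d by auto
  ultimately show ?thesis by linarith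
 qed
 thus ?thesis using d by blast
qed

lemma PS_term_bound: "(w l \<noteq> 0 ==> \<delta> \<le> norm (1 - Q ^ l * x)) ==> \<delta> > 0 ==> norm (w l / (1 - Q ^ l * x)) \<le> norm (w l) / \<delta>"
 by (cases "w l = 0") (auto simp: norm_divide intro!: divide_left_mono mult_pos_pos)

lemma PS_bound:
 assumes "summable (%l. norm (w l))" "\<delta> > 0" "\<And>l. w l \<noteq> 0 ==> \<delta> \<le> norm (1 - Q ^ l * x)"
 shows "summable (%l. norm (w l / (1 - Q ^ l * x)))" "norm (PS w x) \<le> (\<Sum>l. norm (w l)) / \<delta>"
proof -
 have s: "summable (%l. norm (w l) / \<delta>)" using assms(1) by (rule summable_divide)
 show s': "summable (%l. norm (w l / (1 - Q ^ l * x)))"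
  by (rule summable_comparison_test'[OF s, of 0]) (use PS_term_bound assms in auto)
 have "norm (PS w x) \<le> (\<Sum>l. norm (w l / (1 - Q ^ l * x)))" unfolding PS_def by (rule summable_norm[OF s'])
 also have "\<dots> \<le> (\<Sum>l. norm (w l) / \<delta>)" by (rule suminf_le[OF _ s' s]) (use PS_term_bound assms in auto)
 finally show "norm (PS w x) \<le> (\<Sum>l. norm (w l)) / \<delta>" using suminf_divide[OF assms(1), of \<delta>] by simp
qed

lemma PS_holomorphic:
 assumes s: "summable (%l. norm (w l))" and nz: "\<And>l. w l = 0 \<or> Q ^ l * x0 \<noteq> 1"
 shows "\<exists>r>0. PS w holomorphic_on ball x0 r"
proof -
 obtain \<delta> where d: "\<delta> > 0" "\<And>x l. x \<in> ball x0 \<delta> ==> w l \<noteq> 0 ==> \<delta> \<le> norm (1 - Q ^ l * x)"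
  using lattice_gap_ball[OF nz] by blast
 have ul: "uniform_limit (ball x0 \<delta>) (%n x. \<Sum>l<n. w l / (1 - Q ^ l * x)) (PS w) sequentially"
  unfolding PS_def
 proof (rule Weierstrass_m_test)
  show "norm (w l / (1 - Q ^ l * x)) \<le> norm (w l) / \<delta>" if "x \<in> ball x0 \<delta>" for l x
   by (rule PS_term_bound) (use d that in auto)
  show "summable (%l. norm (w l) / \<delta>)" using s by (rule summable_divide)
 qed
 have "PS w holomorphic_on ball x0 \<delta>"
 proof (rule holomorphic_uniform_sequence[where f = "%n x. \<Sum>l<n. w l / (1 - Q ^ l * x)"])
  show "(%x. \<Sum>l<n. w l / (1 - Q ^ l * x)) holomorphic_on ball x0 \<delta>" for n
  proof (intro holomorphic_on_sum)
   fix l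
   show "(%x. w l / (1 - Q ^ l * x)) holomorphic_on ball x0 \<delta>"
   proof (cases "w l = 0")
    case False
    thus ?thesis using d(2)[OF _ False] d(1) by (intro holomorphic_intros) fastforce
   qed simp
  qed
  fix x assume "x \<in> ball x0 \<delta>"
  then obtain e where "e > 0" "cball x e \<subseteq> ball x0 \<delta>" by (meson open_ball open_contains_cball)
  thus "\<exists>d>0. cball x d \<subseteq> ball x0 \<delta> \<and>
    uniform_limit (cball x d) (%n x. \<Sum>l<n. w l / (1 - Q ^ l * x)) (PS w) sequentially"
   using uniform_limit_on_subset[OF ul] by blast
 qed auto
 thus ?thesis using d by blast
qed

lemma PS_analytic: "summable (%l. norm (w l)) ==> (\<And>l. w l = 0 \<or> Q ^ l * x0 \<noteq> 1) ==> PS w analytic_on {x0}"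
 using PS_holomorphic[of w x0] analytic_at_ball by blast

lemma PS_analytic': "summable (%l. norm (w l)) ==> x0 \<notin> q_minusN q ==> PS w analytic_on {x0}"
 by (rule PS_analytic) (auto simp: q_minusN_iff mult.commute)

lemma Q_pow_inj: "Q ^ l * p = 1 ==> Q ^ k * p = 1 ==> l = k"
proof (induction l k rule: linorder_wlog)
 case (le l k)
 have "Q ^ k * p = Q ^ (k - l) * (Q ^ l * p)" using le(1) by (simp flip: power_add mult.assoc)
 hence "Q ^ (k - l) = 1" using le by simp
 thus ?case using Q_pow_ne1[of "k - l"] le(1) by (cases "l = k") auto
qed auto

text \<open>At most one term is singular at p, because distinct powers of q are different; replacing
  its weight by 0 leaves a function analytic at p.\<close>

lemma PS_split:
 assumes s: "summable (%l. norm (w l))" and p: "Q ^ l * p = 1"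
 shows "\<forall>\<^sub>F x in at p. PS w x = w l / (1 - Q ^ l * x) + PS (w(l := 0)) x"
proof -
 have "summable (%k. norm ((w(l := 0)) k))"
  by (rule summable_comparison_test'[OF s, of 0]) auto
 note s0 = this
 have "(w(l := 0)) k = 0 \<or> Q ^ k * p \<noteq> 1" for k using Q_pow_inj[OF p, of k] by auto
 then obtain \<delta> where d: "\<delta> > 0" "\<And>x k. x \<in> ball p \<delta> ==> (w(l := 0)) k \<noteq> 0 ==> \<delta> \<le> norm (1 - Q ^ k * x)"
  using lattice_gap_ball[of "w(l := 0)" p] by blast
 have "\<forall>\<^sub>F x in at p. x \<in> ball p \<delta>" using d(1) by (intro eventually_at_in_open') auto
 thus ?thesis
 proof eventually_elim
  case (elim x)
  have "summable (%k. (w(l := 0)) k / (1 - Q ^ k * x))"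
   using PS_bound(1)[OF s0 d(1) d(2)[OF elim]] by (rule summable_norm_cancel)
  hence "(%k. (w(l := 0)) k / (1 - Q ^ k * x)) sums PS (w(l := 0)) x" by (simp add: PS_def summable_sums)
  moreover have "(%k. if k = l then w l / (1 - Q ^ l * x) else 0) sums (w l / (1 - Q ^ l * x))" by (rule sums_single)
  ultimately have "(%k. (if k = l then w l / (1 - Q ^ l * x) else 0) + (w(l := 0)) k / (1 - Q ^ k * x)) sums
   (w l / (1 - Q ^ l * x) + PS (w(l := 0)) x)" by (intro sums_add)
  moreover have "(%k. (if k = l then w l / (1 - Q ^ l * x) else 0) + (w(l := 0)) k / (1 - Q ^ k * x)) = (%k. w k / (1 - Q ^ k * x))"
   by auto
  ultimately show ?case by (simp add: PS_def sums_iff)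
 qed
qed

lemma PS_upd_analytic:
 assumes s: "summable (%l. norm (w l))" and p: "Q ^ l * p = 1"
 shows "PS (w(l := 0)) analytic_on {p}"
proof (rule PS_analytic)
 show "summable (%k. norm ((w(l := 0)) k))"
  by (rule summable_comparison_test'[OF s, of 0]) auto
 show "(w(l := 0)) k = 0 \<or> Q ^ k * p \<noteq> 1" for k using Q_pow_inj[OF p, of k] by auto
qed

lemma PS_pole:
 assumes s: "summable (%l. norm (w l))" and p: "Q ^ l * p = 1"
 shows "((%x. (1 - Q ^ l * x) * PS w x) \<longlongrightarrow> w l) (at p)"
proof -
 have c: "isCont (PS (w(l := 0))) p" using PS_upd_analytic[OF s p] by (rule analytic_at_imp_isCont)
 have "((%x. w l + (1 - Q ^ l * x) * PS (w(l := 0)) x) \<longlongrightarrow> w l + (1 - Q ^ l * p) * PS (w(l := 0)) p) (at p)"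
  using c by (intro tendsto_intros) (simp add: isCont_def)
 hence "((%x. w l + (1 - Q ^ l * x) * PS (w(l := 0)) x) \<longlongrightarrow> w l) (at p)" using p by simp
 moreover have "\<forall>\<^sub>F x in at p. w l + (1 - Q ^ l * x) * PS (w(l := 0)) x = (1 - Q ^ l * x) * PS w x"
  using PS_split[OF s p] eventually_neq_at_within[of p]
 proof eventually_elim
  case (elim x)
  have "1 - Q ^ l * x \<noteq> 0" using elim(2) p by (metis mult_cancel_left right_minus_eq mult_zero_left zero_neq_one)
  thus ?case using elim(1) by (simp add: distrib_left)
 qed
 ultimately show ?thesis by (rule Lim_transform_eventually)
qed

lemma PS_meromorphic:
 assumes s: "summable (%l. norm (w l))"
 shows "PS w meromorphic_on UNIV"
proof (subst meromorphic_on_meromorphic_at, intro ballI)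
 fix p :: complex
 show "PS w meromorphic_on {p}"
 proof (cases "\<exists>l. Q ^ l * p = 1")
  case False
  thus ?thesis by (intro analytic_on_imp_meromorphic_on PS_analytic s) auto
 next
  case True
  then obtain l where p: "Q ^ l * p = 1" by blast
  have "(%x. w l / (1 - Q ^ l * x) + PS (w(l := 0)) x) meromorphic_on {p}"
   using PS_upd_analytic[OF s p] by (intro meromorphic_intros analytic_on_imp_meromorphic_on) auto
  moreover have "PS w meromorphic_on {p} \<longleftrightarrow> (%x. w l / (1 - Q ^ l * x) + PS (w(l := 0)) x) meromorphic_on {p}"
   using PS_split[OF s p] by (intro meromorphic_on_cong) auto
  ultimately show ?thesis by simp
 qed
qed

end

section \<open>Basic hypergeometric series\<close>

text \<open>The operator of the equation with an arbitrary shift map, so that one calculus covers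
  dilation of functions and translation of sequences in either direction.\<close>

definition opr :: "('a \<Rightarrow> 'a) \<Rightarrow> complex list \<Rightarrow> ('a \<Rightarrow> complex) \<Rightarrow> 'a \<Rightarrow> complex" where
 "opr s cs x = foldr (%c y u. y u - c * y (s u)) cs x"

lemma opr_Nil [simp]: "opr s [] x = x" by (simp add: opr_def)
lemma opr_Cons: "opr s (c # cs) x u = opr s cs x u - c * opr s cs x (s u)" by (simp add: opr_def)
lemma qdiff_op_opr: "qdiff_op q cs = opr (%z. of_real q * z) cs"
 by (simp add: qdiff_op_def opr_def fun_eq_iff)

definition pc :: "complex list \<Rightarrow> complex poly" where
 "pc cs = prod_list (map (%c. [:1, - c:]) cs)"

lemma pc_Nil [simp]: "pc [] = 1" by (simp add: pc_def)
lemma pc_Cons: "pc (c # cs) = [:1, - c:] * pc cs" by (simp add: pc_def)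
lemma coeff_pc_Cons_0: "coeff (pc (c # cs)) 0 = coeff (pc cs) 0" by (simp add: pc_Cons mult_pCons_left)
lemma coeff_pc_Cons_Suc: "coeff (pc (c # cs)) (Suc j) = coeff (pc cs) (Suc j) - c * coeff (pc cs) j"
 by (simp add: pc_Cons mult_pCons_left)
lemma coeff_pc_0 [simp]: "coeff (pc cs) 0 = 1"
 by (induction cs) (simp_all add: coeff_pc_Cons_0)
lemma coeff_pc_gt: "j > length cs ==> coeff (pc cs) j = 0"
proof (induction cs arbitrary: j)
 case (Cons c cs) thus ?case by (cases j) (auto simp: coeff_pc_Cons_Suc)
qed simp
lemma coeff_pc_length: "coeff (pc cs) (length cs) = (\<Prod>c\<leftarrow>cs. - c)"
 by (induction cs) (simp_all add: coeff_pc_Cons_Suc coeff_pc_gt)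

lemma opr_eq_sum: "opr s cs x u = (\<Sum>j\<le>length cs. coeff (pc cs) j * x ((s ^^ j) u))"
proof (induction cs arbitrary: u)
 case (Cons c cs)
 have "opr s (c # cs) x u = (\<Sum>j\<le>length cs. coeff (pc cs) j * x ((s ^^ j) u))
   - c * (\<Sum>j\<le>length cs. coeff (pc cs) j * x ((s ^^ Suc j) u))"
  by (simp add: opr_Cons Cons funpow_swap1)
 also have "(\<Sum>j\<le>length cs. coeff (pc cs) j * x ((s ^^ j) u)) = (\<Sum>j\<le>Suc (length cs). coeff (pc cs) j * x ((s ^^ j) u))"
  by (simp add: coeff_pc_gt)
 also have "\<dots> = coeff (pc (c # cs)) 0 * x ((s ^^ 0) u) + (\<Sum>j\<le>length cs. coeff (pc cs) (Suc j) * x ((s ^^ Suc j) u))"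
  by (subst sum.atMost_Suc_shift) simp
 also have "\<dots> - c * (\<Sum>j\<le>length cs. coeff (pc cs) j * x ((s ^^ Suc j) u)) =
   coeff (pc (c # cs)) 0 * x ((s ^^ 0) u) + (\<Sum>j\<le>length cs. coeff (pc (c # cs)) (Suc j) * x ((s ^^ Suc j) u))"
 proof -
  have "(\<Sum>j\<le>length cs. coeff (pc (c # cs)) (Suc j) * x ((s ^^ Suc j) u)) =
   (\<Sum>j\<le>length cs. coeff (pc cs) (Suc j) * x ((s ^^ Suc j) u)) - c * (\<Sum>j\<le>length cs. coeff (pc cs) j * x ((s ^^ Suc j) u))"
   unfolding coeff_pc_Cons_Suc left_diff_distrib sum_subtractf sum_distrib_left mult.assoc ..
  thus ?thesis by simp
 qed
 also have "\<dots> = (\<Sum>j\<le>Suc (length cs). coeff (pc (c # cs)) j * x ((s ^^ j) u))"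
  by (rule sum.atMost_Suc_shift[symmetric])
 finally show ?case unfolding length_Cons .
qed simp

lemma pc_mset: "mset cs = mset ds ==> pc cs = pc ds"
 unfolding pc_def by (metis mset_map prod_mset_prod_list)
lemma opr_mset: "mset cs = mset ds ==> opr s cs x u = opr s ds x u"
 using pc_mset[of cs ds] mset_eq_length[of cs ds] unfolding opr_eq_sum by metis

lemma opr_cong: "(\<And>j. j \<le> length cs ==> x ((s ^^ j) u) = y ((s ^^ j) u)) ==> opr s cs x u = opr s cs y u"
 by (simp add: opr_eq_sum)

text \<open>Factor by factor, 1 - c S' equals -c S' (1 - c^(-1) S) when S' is inverse to S. Thus an
  operator in the backward shift is one in the forward shift with inverted parameters.\<close>

lemma opr_inverse:
 assumes "\<And>u. s (s' u) = u" "\<forall>c\<in>set cs. c \<noteq> 0"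
 shows "opr s' cs x u = (\<Prod>c\<leftarrow>cs. - c) * opr s (map inverse cs) x ((s' ^^ length cs) u)"
 using assms(2)
proof (induction cs arbitrary: u)
 case (Cons c cs)
 have e: "s ((s' ^^ length (c # cs)) u) = (s' ^^ length cs) u" by (simp add: assms(1))
 have c: "c \<noteq> 0" using Cons by simp
 show ?case
  unfolding list.map opr_Cons e using Cons c by (simp add: opr_Cons funpow_swap1 algebra_simps)
qed simp

lemma opr_twist:
 assumes "r \<noteq> 0"
 shows "opr (%m::int. m - 1) cs (%m. r powi m * x m) m = r powi m * opr (%m. m - 1) (map (%c. c / r) cs) x m"
proof (induction cs arbitrary: m)
 case (Cons c cs)
 have "r powi (m - 1) = r powi m / r" using assms by (simp add: power_int_diff)
 thus ?case unfolding opr_Cons list.map Cons by (simp add: algebra_simps)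
qed simp

context qbase begin

lemma list_bounds:
 assumes "\<forall>B\<in>set Bs. B \<notin> q_minusN q"
 shows "\<exists>C. \<forall>k. norm ((\<Prod>x\<leftarrow>As. qp x k)) \<le> C" "\<exists>d>0. \<forall>k. d \<le> norm ((\<Prod>x\<leftarrow>Bs. qp x k))"
proof -
 show "\<exists>C. \<forall>k. norm ((\<Prod>x\<leftarrow>As. qp x k)) \<le> C"
 proof (induction As)
  case (Cons a As)
  then obtain C where C: "\<And>k. norm ((\<Prod>x\<leftarrow>As. qp x k)) \<le> C" by blast
  have "norm (\<Prod>x\<leftarrow>a # As. qp x k) \<le> exp (norm a / (1 - q)) * C" for k
   using mult_mono[OF qp_bound[of a "norm a" k] C[of k]] by (simp add: norm_mult)
  thus ?case by blast
 qed auto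
 show "\<exists>d>0. \<forall>k. d \<le> norm ((\<Prod>x\<leftarrow>Bs. qp x k))" using assms
 proof (induction Bs)
  case (Cons b Bs)
  then obtain d where d: "d > 0" "\<And>k. d \<le> norm ((\<Prod>x\<leftarrow>Bs. qp x k))" by auto
  obtain e where e: "e > 0" "\<And>k. e \<le> norm (qp b k)" using qp_lower[of b] Cons by auto
  have "e * d \<le> norm (\<Prod>x\<leftarrow>b # Bs. qp x k)" for k
   using mult_mono[OF e(2)[of k] d(2)[of k]] e d by (simp add: norm_mult)
  thus ?case using d e by (intro exI[of _ "e * d"]) auto
 qed (auto intro: exI[of _ 1])
qed

text \<open>No Gaussian factor occurs: the lists count as balanced by parameters 0, whose symbols
  are 1. This covers the series at the origin and, after rescaling the variable, the q-Borel
  transforms of the h_i.\<close>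

definition hcoef :: "complex list \<Rightarrow> complex list \<Rightarrow> nat \<Rightarrow> complex" where
 "hcoef As Bs k = (\<Prod>x\<leftarrow>As. qp x k) / (qp Q k * (\<Prod>x\<leftarrow>Bs. qp x k))"

definition ph :: "complex list \<Rightarrow> complex list \<Rightarrow> complex \<Rightarrow> complex" where
 "ph As Bs = mero_sum (Abs_fps (hcoef As Bs))"

lemma hcoef_0 [simp]: "hcoef As Bs 0 = 1"
proof -
 have "(\<Prod>x\<leftarrow>As. qp x 0) = 1" for As by (induction As) auto
 thus ?thesis by (simp add: hcoef_def)
qed

lemma prod_list_qp_Suc: "(\<Prod>x\<leftarrow>As. qp x (Suc k)) = (\<Prod>x\<leftarrow>As. qp x k) * (\<Prod>x\<leftarrow>As. 1 - x * Q ^ k)"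
 by (induction As) (simp_all add: qp_Suc)

lemma prod_list_qp_nz: "\<forall>B\<in>set Bs. B \<notin> q_minusN q ==> (\<Prod>x\<leftarrow>Bs. qp x k) \<noteq> 0"
 by (induction Bs) (auto simp: qp_nz)
lemma hcoef_Suc:
 assumes "\<forall>B\<in>set Bs. B \<notin> q_minusN q"
 shows "hcoef As Bs (Suc k) * ((1 - Q ^ Suc k) * (\<Prod>x\<leftarrow>Bs. 1 - x * Q ^ k)) = hcoef As Bs k * (\<Prod>x\<leftarrow>As. 1 - x * Q ^ k)"
proof -
 have nz: "(\<Prod>x\<leftarrow>Bs. qp x k) \<noteq> 0" "(\<Prod>x\<leftarrow>Bs. qp x (Suc k)) \<noteq> 0" "qp Q k \<noteq> 0" "qp Q (Suc k) \<noteq> 0"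
  using prod_list_qp_nz[OF assms] by auto
 have gen: "s * P * (A * B) = A * s * (B * P)" for s P A B :: complex by simp
 have "(1 - Q ^ Suc k) * (\<Prod>x\<leftarrow>Bs. 1 - x * Q ^ k) * (qp Q k * (\<Prod>x\<leftarrow>Bs. qp x k)) = qp Q (Suc k) * (\<Prod>x\<leftarrow>Bs. qp x (Suc k))"
  unfolding prod_list_qp_Suc qp_Suc[of Q] power_Suc by (rule gen)
 moreover have nzp: "qp Q k * (\<Prod>x\<leftarrow>Bs. qp x k) \<noteq> 0" using nz by simp
 ultimately have e: "(1 - Q ^ Suc k) * (\<Prod>x\<leftarrow>Bs. 1 - x * Q ^ k) = qp Q (Suc k) * (\<Prod>x\<leftarrow>Bs. qp x (Suc k)) / (qp Q k * (\<Prod>x\<leftarrow>Bs. qp x k))"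
  by (simp only: nonzero_eq_divide_eq[OF nzp])
 have "a * p / (x * y) * (x * y / (u * v)) = a / (u * v) * p" if "x \<noteq> 0" "y \<noteq> 0" for a p x y u v :: complex
  using that by simp
 thus ?thesis unfolding e hcoef_def prod_list_qp_Suc[of k As] using nz by blast
qed

lemma hcoef_bounded:
 assumes "\<forall>B\<in>set Bs. B \<notin> q_minusN q"
 shows "\<exists>C. \<forall>k. norm (hcoef As Bs k) \<le> C"
proof -
 obtain C where C: "\<And>k. norm ((\<Prod>x\<leftarrow>As. qp x k)) \<le> C" using list_bounds(1)[OF assms] by blast
 obtain d where d: "d > 0" "\<And>k. d \<le> norm ((\<Prod>x\<leftarrow>Q # Bs. qp x k))" using list_bounds(2)[of "Q # Bs"] assms by auto
 have "norm (hcoef As Bs k) \<le> C / d" for k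
  unfolding hcoef_def norm_divide using C[of k] d(2)[of k] d(1) order_trans[OF norm_ge_zero C[of k]]
  by (intro frac_le) auto
 thus ?thesis by blast
qed

lemma bounded_series_summable:
 fixes g :: "nat \<Rightarrow> complex"
 assumes "\<And>k. norm (g k) \<le> C" "norm x < 1"
 shows "summable (%k. norm (g k * x ^ k))"
proof (rule summable_comparison_test'[of "%k. C * norm x ^ k" 0])
 show "summable (%k. C * norm x ^ k)" using assms(2) by (intro summable_mult summable_geometric) auto
 show "norm (norm (g k * x ^ k)) \<le> C * norm x ^ k" for k
  using assms(1)[of k] by (simp add: norm_mult norm_power mult_right_mono)
qed

text \<open>The geometric series in k is summed first, for each j; the interchange is dominated by
  |x|^k |w_j|.\<close>

lemma series_PS:
 assumes w: "summable (%j. norm (w j))" and x: "norm x < 1" and g: "\<And>k. (%j. w j * Q ^ (j * k)) sums g k"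
 shows "(\<Sum>k. g k * x ^ k) = PS w x"
proof -
 have "(\<Sum>k. g k * x ^ k) = (\<Sum>k. \<Sum>j. w j * Q ^ (j * k) * x ^ k)"
 proof (rule suminf_cong)
  fix k
  have "(%j. w j * Q ^ (j * k) * x ^ k) sums (g k * x ^ k)" by (intro sums_mult2 g)
  thus "g k * x ^ k = (\<Sum>j. w j * Q ^ (j * k) * x ^ k)" by (simp add: sums_iff)
 qed
 also have "\<dots> = (\<Sum>j. \<Sum>k. w j * Q ^ (j * k) * x ^ k)"
 proof (rule suminf_swap_bounded[of "%k. norm x ^ k" "%j. norm (w j)"])
  show "norm (w b * Q ^ (b * a) * x ^ a) \<le> norm x ^ a * norm (w b)" for a b
   using q0 qpow_le1[of "b * a"] mult_left_mono[of "q ^ (b * a)" 1 "norm x ^ a * norm (w b)"]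
   by (simp add: norm_mult norm_power mult_ac)
 qed (use w x in \<open>auto intro: summable_geometric\<close>)
 also have "\<dots> = (\<Sum>j. w j / (1 - Q ^ j * x))"
 proof (rule suminf_cong)
  fix j
  have "norm (Q ^ j * x) \<le> 1 * norm x" unfolding norm_mult using q0 qpow_le1 by (intro mult_right_mono) (auto simp: norm_power)
  hence "norm (Q ^ j * x) < 1" using x by simp
  hence "(%k. w j * (Q ^ j * x) ^ k) sums (w j * (1 / (1 - Q ^ j * x)))" by (intro sums_mult geometric_sums)
  moreover have "w j * Q ^ (j * k) * x ^ k = w j * (Q ^ j * x) ^ k" for k
   by (simp add: power_mult power_mult_distrib)
  ultimately have "(%k. w j * Q ^ (j * k) * x ^ k) sums (w j * (1 / (1 - Q ^ j * x)))" by (simp only:)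
  thus "(\<Sum>k. w j * Q ^ (j * k) * x ^ k) = w j / (1 - Q ^ j * x)" by (simp add: sums_unique[symmetric])
 qed
 finally show ?thesis by (simp add: PS_def)
qed

lemma prod_list_qi_split: "(\<Prod>x\<leftarrow>As. qi x) = (\<Prod>x\<leftarrow>As. qp x k) * (\<Prod>x\<leftarrow>As. qi (x * Q ^ k))"
proof (induction As)
 case (Cons a As)
 have "qi a = qp a k * qi (a * Q ^ k)" by (rule qi_split)
 thus ?case using Cons by (simp add: mult_ac)
qed simp

lemma prod_list_qp_shift: "(\<Prod>x\<leftarrow>As. qp x (k0 + k)) * (\<Prod>x\<leftarrow>As. qi (x * Q ^ k0 * Q ^ k)) = (\<Prod>x\<leftarrow>As. qi x)"
 using prod_list_qi_split[of As "k0 + k"] by (simp add: power_add mult.assoc)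

lemma prod_list_holo: "(\<And>x. x \<in> set As ==> f x holomorphic_on S) ==> (%z. \<Prod>x\<leftarrow>As. f x z) holomorphic_on S"
 by (induction As) (auto intro!: holomorphic_intros)

lemma small_params: "\<exists>k0. \<forall>x\<in>set As. norm (x * Q ^ k0) < 1/2"
proof -
 have "\<forall>\<^sub>F k in sequentially. \<forall>x\<in>set As. norm (x * Q ^ k) < 1/2"
 proof (intro eventually_ball_finite ballI)
  fix x
  have "(%k. norm (x * Q ^ k)) \<longlonglongrightarrow> norm (x * 0)" by (intro tendsto_intros Qpow_to_0)
  thus "\<forall>\<^sub>F k in sequentially. norm (x * Q ^ k) < 1/2" by (rule order_tendstoD) simp
 qed auto
 thus ?thesis by (auto simp: eventually_sequentially)
qed

text \<open>The coefficients are \<open>U(q\<^sup>k)\<close> for a function \<open>U\<close> that is holomorphic near \<open>0\<close>;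
 its Taylor coefficients are the numerators of a partial fraction expansion of the series.\<close>

lemma hyp_partial_fractions:
 assumes Bs: "\<forall>B\<in>set Bs. B \<notin> q_minusN q"
 shows "\<exists>k0 w. summable (%j. norm (w j)) \<and> w 0 = (\<Prod>x\<leftarrow>As. qi x) / (qi Q * (\<Prod>x\<leftarrow>Bs. qi x)) \<and>
  (\<forall>x. norm x < 1 \<longrightarrow> (\<Sum>k. hcoef As Bs k * x ^ k) = (\<Sum>k<k0. hcoef As Bs k * x ^ k) + x ^ k0 * PS w x)"
proof -
 \<comment> \<open>Dropping k0 coefficients replaces each parameter x by x q^k0. With these below
   1/2, the zeros of the denominator of \<open>U\<close> stay outside the disc of radius 2.\<close>
 obtain k0 where k0: "\<And>x. x \<in> set As ==> norm (x * Q ^ k0) < 1/2" using small_params[of As] by blast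
 define G where "G = (\<Prod>x\<leftarrow>As. qi x) / (qi Q * (\<Prod>x\<leftarrow>Bs. qi x))"
 define U where "U = (%s. G * ((\<Prod>x\<leftarrow>Q # Bs. qi (x * Q ^ k0 * s)) / (\<Prod>x\<leftarrow>As. qi (x * Q ^ k0 * s))))"
 have Anz: "(\<Prod>x\<leftarrow>As. qi (x * Q ^ k0 * s)) \<noteq> 0" if "norm s < 2" for s
 proof -
  have "qi (x * Q ^ k0 * s) \<noteq> 0" if "x \<in> set As" for x
  proof (rule qi_nz, rule small_notin_q_minusN)
   have "norm (x * Q ^ k0) * norm s \<le> 1/2 * norm s" using k0[OF that] by (intro mult_right_mono) auto
   thus "norm (x * Q ^ k0 * s) < 1" using \<open>norm s < 2\<close> by (simp add: norm_mult)
  qed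
  thus ?thesis by (auto simp: prod_list_zero_iff)
 qed
 have Uh: "U holomorphic_on ball 0 2"
  unfolding U_def by (intro holomorphic_intros prod_list_holo) (use Anz in auto)
 define w where "w = (%n. (deriv ^^ n) U 0 / fact n)"
 have ws: "(%n. w n * s ^ n) sums U s" if "norm s < 2" for s
  using holomorphic_power_series[OF Uh, of s] that by (simp add: w_def)
 have "summable (%n. w n * (3/2) ^ n)" using ws[of "3/2"] by (simp add: sums_iff)
 hence "summable (%n. norm (w n * 1 ^ n))" by (rule powser_insidea) simp
 hence wsum: "summable (%n. norm (w n))" by simp
 have U0: "U 0 = G"
 proof -
  have "(\<Prod>x\<leftarrow>L. qi (x * Q ^ k0 * 0)) = 1" for L by (induction L) auto
  thus ?thesis by (simp add: U_def)
 qed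
 have w0: "w 0 = G" using U0 by (simp add: w_def)
 have nzB: "(\<Prod>x\<leftarrow>Q # Bs. qp x k) \<noteq> 0" for k
  using prod_list_qp_nz[of "Q # Bs" k] Bs by simp
 have nzB': "(\<Prod>x\<leftarrow>Q # Bs. qi (x * Q ^ k0 * Q ^ k)) \<noteq> 0" for k
 proof -
  have "qi (x * Q ^ k0 * Q ^ k) \<noteq> 0" if "x \<in> set (Q # Bs)" for x
   using that Bs by (intro qi_nz q_minusN_mult) auto
  thus ?thesis by (auto simp: prod_list_zero_iff)
 qed
 have hU: "hcoef As Bs (k0 + k) = U (Q ^ k)" for k
 proof -
  have "norm (Q ^ k) < 2" using q0 qpow_le1[of k] by (simp add: norm_power)
  hence a: "(\<Prod>x\<leftarrow>As. qi (x * Q ^ k0 * Q ^ k)) \<noteq> 0" by (rule Anz)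
  have gen: "p * a / (r * b) * (b / a) = p / r" if "a \<noteq> 0" "b \<noteq> 0" for p a r b :: complex
   using that by simp
  have G: "G = (\<Prod>x\<leftarrow>As. qi x) / (\<Prod>x\<leftarrow>Q # Bs. qi x)" by (simp add: G_def)
  have "hcoef As Bs (k0 + k) = (\<Prod>x\<leftarrow>As. qp x (k0 + k)) / (\<Prod>x\<leftarrow>Q # Bs. qp x (k0 + k))" by (simp add: hcoef_def)
  moreover have "U (Q ^ k) = (\<Prod>x\<leftarrow>As. qp x (k0 + k)) / (\<Prod>x\<leftarrow>Q # Bs. qp x (k0 + k))"
   unfolding U_def G prod_list_qp_shift[of k0 k As, symmetric] prod_list_qp_shift[of k0 k "Q # Bs", symmetric]
   by (rule gen[OF a nzB'])
  ultimately show ?thesis by simp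
 qed
 obtain C where C: "\<And>k. norm (hcoef As Bs k) \<le> C" using hcoef_bounded[OF Bs] by blast
 have "(\<Sum>k. hcoef As Bs k * x ^ k) = (\<Sum>k<k0. hcoef As Bs k * x ^ k) + x ^ k0 * PS w x" if x: "norm x < 1" for x
 proof -
  have sm: "summable (%k. hcoef As Bs k * x ^ k)"
   using bounded_series_summable[OF C x] by (rule summable_norm_cancel)
  have sm2: "summable (%k. hcoef As Bs (k0 + k) * x ^ k)"
   by (rule summable_norm_cancel, rule bounded_series_summable[where C = C]) (use C x in auto)
  have "(\<Sum>k. hcoef As Bs k * x ^ k) = (\<Sum>k. hcoef As Bs (k + k0) * x ^ (k + k0)) + (\<Sum>k<k0. hcoef As Bs k * x ^ k)"
   by (rule suminf_split_initial_segment[OF sm])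
  also have "(\<Sum>k. hcoef As Bs (k + k0) * x ^ (k + k0)) = (\<Sum>k. x ^ k0 * (hcoef As Bs (k0 + k) * x ^ k))"
   by (simp add: power_add mult_ac add.commute)
  also have "\<dots> = x ^ k0 * (\<Sum>k. hcoef As Bs (k0 + k) * x ^ k)" by (rule suminf_mult[OF sm2])
  also have "(\<Sum>k. hcoef As Bs (k0 + k) * x ^ k) = PS w x"
  proof (rule series_PS[OF wsum x])
   fix k
   have "norm (Q ^ k) < 2" using q0 qpow_le1[of k] by (simp add: norm_power)
   thus "(%j. w j * Q ^ (j * k)) sums hcoef As Bs (k0 + k)"
    using ws[of "Q ^ k"] by (simp add: hU power_mult[symmetric] mult.commute)
  qed
  finally show ?thesis by simp
 qed
 thus ?thesis using wsum w0 G_def by blast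
qed

lemma series_has_fps:
 fixes \<rho> :: complex
 assumes C: "\<And>k. norm (g k) \<le> C" and f: "\<And>x. norm x < 1 ==> (\<Sum>k. g k * x ^ k) = f x"
 shows "(%x. f (\<rho> * x)) has_fps_expansion Abs_fps (%k. g k * \<rho> ^ k)"
proof (rule has_fps_expansionI)
 have "isCont (%x. norm (\<rho> * x)) 0" by (intro continuous_intros)
 hence "\<forall>\<^sub>F x in nhds 0. norm (\<rho> * x) < 1" unfolding continuous_at
  by (intro order_tendstoD(2)) (auto simp: tendsto_nhds_iff)
 thus "\<forall>\<^sub>F u in nhds 0. (%n. fps_nth (Abs_fps (%k. g k * \<rho> ^ k)) n * u ^ n) sums f (\<rho> * u)"
 proof eventually_elim
  case (elim u)
  have "summable (%k. g k * (\<rho> * u) ^ k)"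
   using bounded_series_summable[OF C elim] by (rule summable_norm_cancel)
  thus ?case using f[OF elim] by (simp add: sums_iff power_mult_distrib mult_ac)
 qed
qed

text \<open>The global form of the continued series: the polynomial holds the first k0 terms, the
  partial fractions the rest.\<close>

definition pfun :: "nat \<Rightarrow> (nat \<Rightarrow> complex) \<Rightarrow> (nat \<Rightarrow> complex) \<Rightarrow> complex \<Rightarrow> complex" where
 "pfun k0 g w x = (\<Sum>k<k0. g k * x ^ k) + x ^ k0 * PS w x"

lemma pfun_analytic: "summable (%l. norm (w l)) ==> x \<notin> q_minusN q ==> pfun k0 g w analytic_on {x}"
 unfolding pfun_def by (intro analytic_intros) (auto intro!: PS_analytic')

lemma pfun_meromorphic: "summable (%l. norm (w l)) ==> pfun k0 g w meromorphic_on UNIV"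
 unfolding pfun_def by (intro meromorphic_intros PS_meromorphic) auto

lemma mero_sum_pfun:
 assumes C: "\<And>k. norm (g k) \<le> C" and w: "summable (%l. norm (w l))"
  and f: "\<And>x. norm x < 1 ==> (\<Sum>k. g k * x ^ k) = pfun k0 g w x" and x: "\<rho> * x \<notin> q_minusN q" and \<rho>: "\<rho> \<noteq> 0"
 shows "mero_sum (Abs_fps (%k. g k * \<rho> ^ k)) x = pfun k0 g w (\<rho> * x)"
proof (rule mero_sum_eq)
 show "(%x. pfun k0 g w (\<rho> * x)) has_fps_expansion Abs_fps (%k. g k * \<rho> ^ k)"
  by (rule series_has_fps[OF C f])
 show "(%x. pfun k0 g w (\<rho> * x)) meromorphic_on UNIV"
 proof (rule meromorphic_on_compose[of "pfun k0 g w" UNIV "%x. \<rho> * x"])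
  show "pfun k0 g w meromorphic_on UNIV" by (rule pfun_meromorphic[OF w])
 qed (auto intro!: analytic_intros)
 have "(pfun k0 g w \<circ> (%x. \<rho> * x)) analytic_on {x}"
  by (rule analytic_on_compose) (use pfun_analytic[OF w x] in \<open>auto intro!: analytic_intros\<close>)
 thus "(%x. pfun k0 g w (\<rho> * x)) analytic_on {x}" by (simp add: o_def)
qed

lemma ph_pfun:
 assumes Bs: "\<forall>B\<in>set Bs. B \<notin> q_minusN q"
 shows "\<exists>k0 w. summable (%j. norm (w j)) \<and> w 0 = (\<Prod>x\<leftarrow>As. qi x) / (qi Q * (\<Prod>x\<leftarrow>Bs. qi x)) \<and>
  (\<forall>x. norm x < 1 \<longrightarrow> (\<Sum>k. hcoef As Bs k * x ^ k) = pfun k0 (hcoef As Bs) w x) \<and>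
  (\<forall>\<rho> x. \<rho> \<noteq> 0 \<longrightarrow> \<rho> * x \<notin> q_minusN q \<longrightarrow> mero_sum (Abs_fps (%k. hcoef As Bs k * \<rho> ^ k)) x = pfun k0 (hcoef As Bs) w (\<rho> * x)) \<and>
  (\<forall>x. x \<notin> q_minusN q \<longrightarrow> ph As Bs x = pfun k0 (hcoef As Bs) w x)"
proof -
 obtain C where C: "\<And>k. norm (hcoef As Bs k) \<le> C" using hcoef_bounded[OF Bs] by blast
 obtain k0 w where w: "summable (%j. norm (w j))" "w 0 = (\<Prod>x\<leftarrow>As. qi x) / (qi Q * (\<Prod>x\<leftarrow>Bs. qi x))"
  "\<And>x. norm x < 1 ==> (\<Sum>k. hcoef As Bs k * x ^ k) = pfun k0 (hcoef As Bs) w x"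
  using hyp_partial_fractions[OF Bs, of As] unfolding pfun_def by blast
 have m: "mero_sum (Abs_fps (%k. hcoef As Bs k * \<rho> ^ k)) x = pfun k0 (hcoef As Bs) w (\<rho> * x)"
  if "\<rho> * x \<notin> q_minusN q" "\<rho> \<noteq> 0" for \<rho> x
  by (rule mero_sum_pfun[OF C w(1) w(3) that])
 have "ph As Bs x = pfun k0 (hcoef As Bs) w x" if "x \<notin> q_minusN q" for x
  using m[of 1 x] that by (simp add: ph_def)
 with w m show ?thesis by blast
qed

lemma mero_sum_scaled:
 assumes Bs: "\<forall>B\<in>set Bs. B \<notin> q_minusN q" and "\<rho> \<noteq> 0" "\<rho> * x \<notin> q_minusN q"
 shows "mero_sum (Abs_fps (%k. hcoef As Bs k * \<rho> ^ k)) x = ph As Bs (\<rho> * x)"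
 using ph_pfun[OF Bs, of As] assms by metis

lemma ph_series:
 assumes Bs: "\<forall>B\<in>set Bs. B \<notin> q_minusN q" and "norm x < 1"
 shows "ph As Bs x = (\<Sum>k. hcoef As Bs k * x ^ k)"
 using ph_pfun[OF Bs, of As] assms small_notin_q_minusN by metis

lemma open_compl_q_minusN: "open (- q_minusN q)"
proof (subst open_contains_ball, intro ballI)
 fix x assume "x \<in> - q_minusN q"
 hence "\<exists>\<delta>>0. \<forall>y\<in>ball x \<delta>. \<forall>l. (1::complex) \<noteq> 0 \<longrightarrow> \<delta> \<le> norm (1 - Q ^ l * y)"
  by (intro lattice_gap_ball[of "%_. 1"]) (auto simp: q_minusN_iff mult.commute)
 then obtain \<delta> where d: "\<delta> > 0" "\<And>y l. y \<in> ball x \<delta> ==> \<delta> \<le> norm (1 - Q ^ l * y)"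
  by (metis zero_neq_one)
 have "y \<in> - q_minusN q" if "y \<in> ball x \<delta>" for y
 proof
  assume "y \<in> q_minusN q"
  then obtain l where "Q ^ l * y = 1" by (auto simp: q_minusN_iff mult.commute)
  thus False using d(2)[OF that, of l] d(1) by simp
 qed
 thus "\<exists>e>0. ball x e \<subseteq> - q_minusN q" using d(1) by blast
qed

text \<open>The complement of a countable set in the plane is path connected; this allows the
  identity theorem in \<open>ph_equation\<close>.\<close>

lemma connected_compl_q_minusN: "connected (- q_minusN q)"
proof -
 have "countable (q_minusN q)" by (simp add: q_minusN_def)
 thus ?thesis by (intro path_connected_imp_connected path_connected_complement_countable) auto
qed

lemma ph_analytic:
 assumes Bs: "\<forall>B\<in>set Bs. B \<notin> q_minusN q" and x: "x \<notin> q_minusN q"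
 shows "ph As Bs analytic_on {x}"
proof -
 obtain k0 w where w: "summable (%j. norm (w j))" "\<And>x. x \<notin> q_minusN q ==> ph As Bs x = pfun k0 (hcoef As Bs) w x"
  using ph_pfun[OF Bs, of As] by blast
 have "\<forall>\<^sub>F y in nhds x. y \<in> - q_minusN q" using open_compl_q_minusN x by (intro eventually_nhds_in_open) auto
 hence "\<forall>\<^sub>F y in nhds x. ph As Bs y = pfun k0 (hcoef As Bs) w y" by eventually_elim (use w in auto)
 hence "ph As Bs analytic_on {x} \<longleftrightarrow> pfun k0 (hcoef As Bs) w analytic_on {x}" by (intro analytic_at_cong) auto
 thus ?thesis using pfun_analytic[OF w(1) x] by simp
qed

lemma ph_holomorphic: "\<forall>B\<in>set Bs. B \<notin> q_minusN q ==> ph As Bs holomorphic_on - q_minusN q"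
 by (meson ComplD analytic_imp_holomorphic analytic_on_analytic_at ph_analytic)

lemma funpow_Q: "((%z. Q * z) ^^ j) x = Q ^ j * x"
 by (induction j) auto

lemma opr_holomorphic:
 assumes "f holomorphic_on - q_minusN q"
 shows "opr (%z. Q * z) cs f holomorphic_on - q_minusN q"
proof -
 have "(%u. f (Q ^ j * u)) holomorphic_on - q_minusN q" for j
 proof -
  have "(f \<circ> (%u. Q ^ j * u)) holomorphic_on - q_minusN q"
   by (rule holomorphic_on_compose_gen[OF _ assms]) 
    (use q_minusN_mult in \<open>auto intro!: holomorphic_intros simp: mult.commute\<close>)
  thus ?thesis by (simp add: o_def)
 qed
 thus ?thesis unfolding opr_eq_sum[abs_def] funpow_Q by (intro holomorphic_intros) auto
qed

lemma opr_series:
 assumes "\<And>k. norm (g k) \<le> C" "norm x < 1"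
 shows "(%k. g k * (\<Prod>c\<leftarrow>cs. 1 - c * Q ^ k) * x ^ k) sums opr (%z. Q * z) cs (%x. \<Sum>k. g k * x ^ k) x"
 using assms(2)
proof (induction cs arbitrary: x)
 case Nil
 thus ?case using bounded_series_summable[OF assms(1) Nil] by (simp add: summable_norm_cancel summable_sums)
next
 case (Cons c cs)
 have "norm (Q * x) \<le> 1 * norm x" unfolding norm_mult using q0 q1 by (intro mult_right_mono) auto
 hence "norm (Q * x) < 1" using Cons by simp
 from sums_diff[OF Cons.IH[OF Cons.prems] sums_mult[OF Cons.IH[OF this], of c]]
 show ?case by (simp add: opr_Cons algebra_simps power_mult_distrib)
qed

text \<open>Inside the unit disc this is the two-term recursion of the coefficients; analytic
  continuation carries it to the complement of the poles.\<close>

theorem ph_equation: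
 assumes Bs: "\<forall>B\<in>set Bs. B \<notin> q_minusN q" and x: "x \<notin> q_minusN q"
 shows "x * opr (%z. Q * z) As (ph As Bs) x = opr (%z. Q * z) (1 # map (%b. b / Q) Bs) (ph As Bs) x"
proof -
 let ?L = "%x. x * opr (%z. Q * z) As (ph As Bs) x"
 let ?R = "%x. opr (%z. Q * z) (1 # map (%b. b / Q) Bs) (ph As Bs) x"
 let ?s = "%x. \<Sum>k. hcoef As Bs k * x ^ k"
 have eq: "?L x = ?R x" if x: "x \<in> ball 0 1" for x
 proof -
  have nx: "norm x < 1" using x by simp
  obtain C where C: "\<And>k. norm (hcoef As Bs k) \<le> C" using hcoef_bounded[OF Bs] by blast
  have o: "opr (%z. Q * z) cs (ph As Bs) x = opr (%z. Q * z) cs ?s x" for cs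
  proof (rule opr_cong)
   fix j
   have "norm (Q ^ j * x) \<le> 1 * norm x" unfolding norm_mult using q0 qpow_le1 by (intro mult_right_mono) (auto simp: norm_power)
   thus "ph As Bs (((%z. Q * z) ^^ j) x) = ?s (((%z. Q * z) ^^ j) x)"
    unfolding funpow_Q by (intro ph_series Bs) (use nx in simp)
  qed
  let ?r = "%k. hcoef As Bs k * (\<Prod>c\<leftarrow>1 # map (%b. b / Q) Bs. 1 - c * Q ^ k) * x ^ k"
  have s1: "?r sums ?R x" unfolding o by (rule opr_series[OF C nx])
  \<comment> \<open>The parameter 1 of the operator kills the term k = 0, so the index shift yields
    exactly the factor x of the other side.\<close>
  have "(%k. ?r (Suc k)) sums (?R x - ?r 0)" using s1 by (subst sums_Suc_iff) simp
  hence s2: "(%k. ?r (Suc k)) sums ?R x" by simp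
  have "?r (Suc k) = x * (hcoef As Bs k * (\<Prod>c\<leftarrow>As. 1 - c * Q ^ k) * x ^ k)" for k
  proof -
   have "(\<Prod>c\<leftarrow>1 # map (%b. b / Q) Bs. 1 - c * Q ^ Suc k) = (1 - Q ^ Suc k) * (\<Prod>x\<leftarrow>Bs. 1 - x * Q ^ k)"
    by (simp add: o_def)
   hence "?r (Suc k) = hcoef As Bs (Suc k) * ((1 - Q ^ Suc k) * (\<Prod>x\<leftarrow>Bs. 1 - x * Q ^ k)) * x ^ Suc k"
    by (simp only:)
   also have "\<dots> = hcoef As Bs k * (\<Prod>x\<leftarrow>As. 1 - x * Q ^ k) * x ^ Suc k" by (simp only: hcoef_Suc[OF Bs])
   also have "\<dots> = x * (hcoef As Bs k * (\<Prod>c\<leftarrow>As. 1 - c * Q ^ k) * x ^ k)" by simp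
   finally show ?thesis .
  qed
  moreover have "(%k. x * (hcoef As Bs k * (\<Prod>c\<leftarrow>As. 1 - c * Q ^ k) * x ^ k)) sums ?L x"
   unfolding o by (intro sums_mult opr_series[OF C nx])
  ultimately have "(%k. ?r (Suc k)) sums ?L x" by (simp only:)
  thus ?thesis using s2 by (rule sums_unique2)
 qed
 show ?thesis
 proof (rule analytic_continuation_open[of "ball 0 1" "- q_minusN q" ?L ?R])
  show "ball 0 1 \<subseteq> - q_minusN q" using small_notin_q_minusN by auto
  show "?L holomorphic_on - q_minusN q"
   by (intro holomorphic_intros opr_holomorphic ph_holomorphic Bs)
  show "?R holomorphic_on - q_minusN q"
   by (intro opr_holomorphic ph_holomorphic Bs)
 qed (use open_compl_q_minusN connected_compl_q_minusN x eq in auto)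
qed

end

context qbase begin

lemma tempered_powi: "c \<noteq> 0 ==> tempered (%m. c powi m)"
proof -
 assume c: "c \<noteq> 0"
 obtain L where L: "L \<ge> 1" "norm c \<le> L" "1 / L \<le> norm c" using powi_bounds_exist[OF c] by auto
 have "norm (c powi m) \<le> 1 * L ^ nat \<bar>m\<bar>" for m using norm_powi_le[OF c L(2,3,1)] by simp
 thus ?thesis unfolding tempered_def using L(1) by blast
qed

lemma tempered_bounded: "(\<And>m. norm (x m) \<le> C) ==> tempered x"
 unfolding tempered_def by (intro exI[of _ C] exI[of _ 1]) auto

lemma tempered_mult: assumes "tempered x" "tempered y" shows "tempered (%m. x m * y m)"
proof -
 obtain C K where K: "K \<ge> 1" "\<And>m. norm (x m) \<le> C * K ^ nat \<bar>m\<bar>" using assms by (auto simp: tempered_def)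
 obtain D M where M: "M \<ge> 1" "\<And>m. norm (y m) \<le> D * M ^ nat \<bar>m\<bar>" using assms by (auto simp: tempered_def)
 have "norm (x m * y m) \<le> (C * D) * (K * M) ^ nat \<bar>m\<bar>" for m
 proof -
  have "norm (x m) * norm (y m) \<le> (C * K ^ nat \<bar>m\<bar>) * (D * M ^ nat \<bar>m\<bar>)"
   using K(2)[of m] M(2)[of m] order_trans[OF norm_ge_zero K(2)[of m]] by (intro mult_mono) auto
  thus ?thesis by (simp add: norm_mult power_mult_distrib mult_ac)
 qed
 moreover have "K * M \<ge> 1" using K M by (simp add: mult_ge1_I)
 ultimately show ?thesis unfolding tempered_def by blast
qed

lemma tempered_cmult: "tempered x ==> tempered (%m. c * x m)"
 by (intro tempered_mult tempered_const)

lemma tempered_sum: "finite I ==> (\<And>i. i \<in> I ==> tempered (x i)) ==> tempered (%m. \<Sum>i\<in>I. x i m)"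
proof (induction I rule: finite_induct)
 case (insert a I)
 hence "tempered (%m. x a m + (\<Sum>i\<in>I. x i m))" by (intro tempered_add) auto
 thus ?case using insert by simp
qed (use tempered_const[of 0] in simp)

text \<open>Both ends of the orbit must be controlled: q^m t tends to 0 on one side, and on the
  other the inverse orbit of 1/t does.\<close>

lemma lattice_gap_int:
 assumes t: "t \<noteq> 0" "t \<notin> qZ q" shows "\<exists>\<delta>>0. \<forall>m::int. \<delta> \<le> norm (1 - t * Q powi m)"
proof -
 have nz: "Q ^ l * t \<noteq> 1" "Q ^ l * (1 / t) \<noteq> 1" for l
 proof -
  show "Q ^ l * t \<noteq> 1" using t q_minusN_qZ by (auto simp: q_minusN_iff mult.commute)
  show "Q ^ l * (1 / t) \<noteq> 1"
  proof
   assume "Q ^ l * (1 / t) = 1"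
   hence "t = Q powi int l" using t by (simp add: field_simps)
   thus False using t qZ_powi by metis
  qed
 qed
 obtain d where d: "d > 0" "\<And>l. 2 * d \<le> norm (1 - Q ^ l * t)" using lattice_gap[of t] nz by blast
 obtain e where e: "e > 0" "\<And>l. 2 * e \<le> norm (1 - Q ^ l * (1 / t))" using lattice_gap[of "1/t"] nz by blast
 have "min (2 * d) (norm t * (2 * e)) \<le> norm (1 - t * Q powi m)" for m
 proof (cases "m \<ge> 0")
  case True
  thus ?thesis using d(2)[of "nat m"] by (simp add: power_int_def mult.commute)
 next
  case False
  define l where "l = nat (- m)"
  have m: "m = - int l" using False by (simp add: l_def)
  have "1 - t * Q powi m = - (t / Q ^ l) * (1 - Q ^ l * (1 / t))"
   using t by (simp add: m power_int_minus field_simps)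
  hence "norm (1 - t * Q powi m) = norm t * inverse (q ^ l) * norm (1 - Q ^ l * (1 / t))"
   using q0 by (simp add: norm_mult norm_divide norm_power norm_inverse divide_inverse)
  moreover have "norm t * 1 * (2 * e) \<le> norm t * inverse (q ^ l) * norm (1 - Q ^ l * (1 / t))"
  proof (intro mult_mono)
   show "1 \<le> inverse (q ^ l)" using q0 qpow_le1[of l] by (simp add: one_le_inverse)
  qed (use e q0 in auto)
  ultimately show ?thesis by simp
 qed
 moreover have "min (2 * d) (norm t * (2 * e)) > 0" using d e t by simp
 ultimately show ?thesis by blast
qed

lemma tempered_frac: "t \<noteq> 0 ==> t \<notin> qZ q ==> tempered (%m. 1 / (1 - t * Q powi (m + k)))"
proof -
 assume t: "t \<noteq> 0" "t \<notin> qZ q"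
 obtain \<delta> where d: "\<delta> > 0" "\<And>m. \<delta> \<le> norm (1 - t * Q powi m)" using lattice_gap_int[OF t] by blast
 have "norm (1 / (1 - t * Q powi (m + k))) \<le> 1 / \<delta>" for m
  using d(2)[of "m+k"] d(1) by (auto simp: norm_divide intro!: divide_left_mono mult_pos_pos)
 thus ?thesis by (rule tempered_bounded)
qed

section \<open>The basic Appell-Lerch sum\<close>

text \<open>The special value at which the Appell-Lerch sum degenerates to a theta quotient, since
  there its inhomogeneous term vanishes.\<close>

definition lerch1 :: "complex \<Rightarrow> complex" where
 "lerch1 t = T (%m. 1 / (1 - t * Q powi m)) (-1)"

text \<open>Moving q from t into the summation index produces an additional term theta(-1/q), and
  this is 0.\<close>

lemma lerch1_shift: assumes t: "t \<noteq> 0" "t \<notin> qZ q" shows "lerch1 (Q * t) = - Q * t * lerch1 t"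
proof -
 let ?x = "%m. 1 / (1 - t * Q powi m)"
 have nz: "1 - t * Q powi m \<noteq> 0" for m
  using lattice_gap_int[OF t] by (metis norm_zero not_le)
 have "lerch1 (Q * t) = T (%m. ?x (m - (-1))) (-1)"
  unfolding lerch1_def by (simp add: power_int_add mult_ac)
 also have "\<dots> = - Q * T ?x (- 1 / Q)"
 proof -
  have "tri (-1) = 1" using tri_minus[of 1] by simp
  thus ?thesis by (subst T_shift) (simp_all add: power_int_minus divide_inverse)
 qed
 also have "- 1 / Q = (1 / Q) * (-1)" by simp
 also have "T ?x ((1 / Q) * (-1)) = T (%m. (1 / Q) powi m * ?x m) (-1)" by (rule T_scale[symmetric])
 also have "(%m. (1 / Q) powi m * ?x m) = (%m. (1 / Q) powi m + t * ?x m)"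
 proof
  fix m
  have "(1 / Q) powi m * Q powi m = 1" by (simp flip: power_int_mult_distrib)
  hence "(1 / Q) powi m * 1 = (1 / Q) powi m * (1 - t * Q powi m) + t" by (simp add: algebra_simps)
  hence "(1 / Q) powi m * 1 / (1 - t * Q powi m) = ((1 / Q) powi m * (1 - t * Q powi m) + t) / (1 - t * Q powi m)"
   by (simp only:)
  thus "(1 / Q) powi m * ?x m = (1 / Q) powi m + t * ?x m" using nz[of m] by (simp add: add_divide_distrib)
 qed
 also have "T \<dots> (-1) = T (%m. (1 / Q) powi m) (-1) + T (%m. t * ?x m) (-1)"
  by (intro T_add tempered_powi tempered_cmult) (use tempered_frac[OF t, of 0] in auto)
 also have "T (%m. (1 / Q) powi m) (-1) = th (- 1 / Q)"
  using T_scale[of "1 / Q" "%_. 1" "-1"] by (simp add: th_T)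
 also have "th (- 1 / Q) = 0" by (subst th_eq_0_iff) (auto intro!: exI[of _ "-1"] simp: power_int_minus divide_inverse)
 finally show ?thesis unfolding T_cmult lerch1_def by simp
qed

lemma gauss_summable_tail: "summable (%l. norm (Q powi tri (int l) * (-1) ^ l))"
 "summable (%l. norm (if l = 0 then 0 else Q powi tri (- int l) * (-1) ^ l * Q ^ l))"
proof -
 have s: "summable (%k. q ^ (k * (k - 1) div 2) * 1 ^ k)" by (rule gauss_summable_nat) simp
 show "summable (%l. norm (Q powi tri (int l) * (-1) ^ l))"
  using s q0 by (simp add: norm_mult norm_power tri_nat)
 show "summable (%l. norm (if l = 0 then 0 else Q powi tri (- int l) * (-1) ^ l * Q ^ l))"
 proof (rule summable_comparison_test'[OF s, of 0])
  fix l
  have "q powi tri (- int l) * q ^ l = q ^ (l * (l - 1) div 2) * (q ^ l * q ^ l)"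
   using q0 by (simp add: tri_minus power_int_add tri_nat)
  also have "\<dots> \<le> q ^ (l * (l - 1) div 2) * (1 * 1)"
   using q0 qpow_le1[of l] by (intro mult_left_mono mult_mono) auto
  finally show "norm (norm (if l = 0 then 0 else Q powi tri (- int l) * (-1) ^ l * Q ^ l)) \<le> q ^ (l * (l - 1) div 2) * 1 ^ l"
   using q0 by (simp add: norm_mult norm_power norm_power_int)
 qed
qed

text \<open>The halves m >= 0 and m < 0 have their poles on opposite parts of the lattice. The
  negative half is rewritten in 1/t; its weight at l = 0 is set to 0 because m = 0 belongs to the
  first half.\<close>

lemma lerch1_PS:
 assumes t: "t \<noteq> 0" "t \<notin> qZ q"
 shows "lerch1 t = PS (%l. Q powi tri (int l) * (-1) ^ l) t
  - 1 / t * PS (%l. if l = 0 then 0 else Q powi tri (- int l) * (-1) ^ l * Q ^ l) (1 / t)"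
proof -
 let ?F = "%m::int. Q powi tri m * (-1) powi m * (1 / (1 - t * Q powi m))"
 have sm: "(%m. norm (?F m)) summable_on UNIV"
  by (rule T_abs_summable) (use tempered_frac[OF t, of 0] in auto)
 have sub: "(%m. norm (?F m)) summable_on A" for A
  by (rule summable_on_subset_banach[OF sm]) auto
 have U: "(UNIV::int set) = range int \<union> range (%l. - int (Suc l))"
 proof -
  have "m \<in> range int \<union> range (%l. - int (Suc l))" for m
   by (cases "m \<ge> 0") (auto intro: image_eqI[of _ _ "nat m"] image_eqI[of _ _ "nat (-m-1)"])
  thus ?thesis by auto
 qed
 have D: "range int \<inter> range (%l. - int (Suc l)) = {}" by auto
 have "lerch1 t = infsum ?F (range int \<union> range (%l. - int (Suc l)))"
  unfolding lerch1_def T_def U[symmetric] ..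
 also have "\<dots> = infsum ?F (range int) + infsum ?F (range (%l. - int (Suc l)))"
  by (rule infsum_Un_disjoint[OF abs_summable_summable[OF sub] abs_summable_summable[OF sub] D])
 also have "infsum ?F (range int) = (\<Sum>\<^sub>\<infinity>l. ?F (int l))" by (subst infsum_reindex) (auto simp: o_def)
 also have "\<dots> = (\<Sum>l. ?F (int l))"
 proof -
  have "(%l. norm (?F (int l))) summable_on UNIV"
   using sub[of "range int"] by (subst (asm) summable_on_reindex) (auto simp: o_def)
  thus ?thesis by (rule suminf_infsum[OF summable_on_imp_summable, symmetric])
 qed
 also have "\<dots> = PS (%l. Q powi tri (int l) * (-1) ^ l) t"
  unfolding PS_def by (simp add: mult.commute)
 also have "infsum ?F (range (%l. - int (Suc l))) = (\<Sum>\<^sub>\<infinity>l. ?F (- int (Suc l)))"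
  by (subst infsum_reindex) (auto simp: o_def inj_on_def)
 also have "\<dots> = (\<Sum>l. ?F (- int (Suc l)))"
 proof -
  have "(%l. norm (?F (- int (Suc l)))) summable_on UNIV"
   using sub[of "range (%l. - int (Suc l))"] by (subst (asm) summable_on_reindex) (auto simp: o_def inj_on_def)
  thus ?thesis by (rule suminf_infsum[OF summable_on_imp_summable, symmetric])
 qed
 also have "\<dots> = (\<Sum>l. - (1 / t) * ((Q powi tri (- int (Suc l)) * (-1) ^ Suc l * Q ^ Suc l) / (1 - Q ^ Suc l * (1 / t))))"
 proof (rule suminf_cong)
  fix l
  have nz: "t \<noteq> Q ^ Suc l"
  proof
   assume "t = Q ^ Suc l"
   hence "t = Q powi int (Suc l)" by (simp only: power_int_of_nat)
   thus False using t qZ_powi by metis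
  qed
  have e: "1 / (1 - t * Q powi (- int (Suc l))) = - (1 / t) * (Q ^ Suc l / (1 - Q ^ Suc l * (1 / t)))"
   unfolding power_int_minus power_int_of_nat using t nz by (simp add: divide_simps del: power_Suc) (simp add: algebra_simps)
  have s: "(-1::complex) powi (- int (Suc l)) = (-1) ^ Suc l"
   by (cases "even l") (auto simp: power_int_minus power_int_of_nat simp del: of_nat_Suc)
  show "?F (- int (Suc l)) = - (1 / t) * ((Q powi tri (- int (Suc l)) * (-1) ^ Suc l * Q ^ Suc l) / (1 - Q ^ Suc l * (1 / t)))"
   unfolding e s by (simp only: times_divide_eq_right mult_ac)
 qed
 also have "\<dots> = - (1 / t) * PS (%l. if l = 0 then 0 else Q powi tri (- int l) * (-1) ^ l * Q ^ l) (1 / t)"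
 proof -
  let ?w = "%l. if l = 0 then 0 else Q powi tri (- int l) * (-1) ^ l * Q ^ l"
  let ?A = "%l. (Q powi tri (- int (Suc l)) * (-1) ^ Suc l * Q ^ Suc l) / (1 - Q ^ Suc l * (1 / t))"
  have nm: "1 / t \<notin> q_minusN q" using q_minusN_qZ[of "1/t"] qZ_inverse[of "1/t"] t by auto
  hence g: "\<exists>\<delta>>0. \<forall>x\<in>ball (1 / t) \<delta>. \<forall>l. ?w l \<noteq> 0 \<longrightarrow> \<delta> \<le> norm (1 - Q ^ l * x)"
   by (intro lattice_gap_ball) (auto simp: q_minusN_iff mult.commute)
  then obtain \<delta> where d: "\<delta> > 0" "\<And>l. ?w l \<noteq> 0 ==> \<delta> \<le> norm (1 - Q ^ l * (1 / t))"
   by (meson centre_in_ball)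
  have s: "summable (%l. ?w l / (1 - Q ^ l * (1 / t)))"
   using PS_bound(1)[OF gauss_summable_tail(2) d] by (rule summable_norm_cancel)
  have "PS ?w (1 / t) = (\<Sum>l. ?w (Suc l) / (1 - Q ^ Suc l * (1 / t)))"
   unfolding PS_def using suminf_split_head[OF s] by simp
  moreover have "summable (%l. ?w (Suc l) / (1 - Q ^ Suc l * (1 / t)))" using s by (subst summable_Suc_iff)
  ultimately have s': "summable ?A" and "PS ?w (1 / t) = suminf ?A" by simp_all
  thus ?thesis by (simp only: suminf_mult[OF s'])
 qed
 finally show ?thesis by simp
qed

lemma lerch1_limit_one: "((%t. (1 - t) * lerch1 t) \<longlongrightarrow> 1) (at 1)"
proof -
 let ?w = "%l. Q powi tri (int l) * (-1) ^ l"
 let ?v = "%l. if l = 0 then 0 else Q powi tri (- int l) * (-1) ^ l * Q ^ l"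
 have a: "((%x. (1 - Q ^ 0 * x) * PS ?w x) \<longlongrightarrow> ?w 0) (at 1)"
  by (rule PS_pole[OF gauss_summable_tail(1)]) simp
 have "PS ?v analytic_on {1}"
 proof (rule PS_analytic[OF gauss_summable_tail(2)])
  show "?v l = 0 \<or> Q ^ l * 1 \<noteq> 1" for l using Q_pow_ne1[of l] by (cases "l = 0") auto
 qed
 hence "isCont (PS ?v) 1" by (rule analytic_at_imp_isCont)
 hence pv: "((%x. PS ?v (1 / x)) \<longlongrightarrow> PS ?v 1) (at 1)"
  by (rule isCont_tendsto_compose) (auto intro!: tendsto_eq_intros)
 have "((%x. (1 - Q ^ 0 * x) * PS ?w x - (1 - x) * (1 / x * PS ?v (1 / x))) \<longlongrightarrow> ?w 0 - (1 - 1) * (1 / 1 * PS ?v 1)) (at 1)"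
  by (intro tendsto_diff[OF a] tendsto_mult[OF _ tendsto_mult[OF _ pv]] tendsto_intros) auto
 hence "((%x. (1 - Q ^ 0 * x) * PS ?w x - (1 - x) * (1 / x * PS ?v (1 / x))) \<longlongrightarrow> 1) (at 1)" by simp
 moreover have "\<forall>\<^sub>F x in at 1. (1 - Q ^ 0 * x) * PS ?w x - (1 - x) * (1 / x * PS ?v (1 / x)) = (1 - x) * lerch1 x"
  using qZ_discrete[of 1, simplified] tendsto_imp_eventually_ne[OF tendsto_ident_at[of "1::complex"], of 0, simplified]
  by eventually_elim (simp add: lerch1_PS right_diff_distrib)
 ultimately show ?thesis by (rule Lim_transform_eventually)
qed

lemma lerch1_pole:
 assumes p: "p \<in> qZ q" shows "\<exists>L. ((%t. (t - p) * lerch1 t) \<longlongrightarrow> L) (at p)"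
proof -
 let ?w = "%l. Q powi tri (int l) * (-1) ^ l"
 let ?v = "%l. if l = 0 then 0 else Q powi tri (- int l) * (-1) ^ l * Q ^ l"
 have pnz: "p \<noteq> 0" using p qZ_nz by auto
 obtain m :: int where m: "p = Q powi m" using p by (auto simp: qZ_def)
 have ip: "((%x. 1 / x) \<longlongrightarrow> 1 / p) (at p)" using pnz by (auto intro!: tendsto_eq_intros)
 have A: "\<exists>L. ((%x. (x - p) * PS ?w x) \<longlongrightarrow> L) (at p)"
 proof (cases "\<exists>l. Q ^ l * p = 1")
  case True
  then obtain l where l: "Q ^ l * p = 1" by blast
  have "((%x. - p * ((1 - Q ^ l * x) * PS ?w x)) \<longlongrightarrow> - p * ?w l) (at p)"
   by (intro tendsto_intros PS_pole[OF gauss_summable_tail(1) l])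
  moreover have "- p * ((1 - Q ^ l * x) * PS ?w x) = (x - p) * PS ?w x" for x
  proof -
   have "- p * (1 - Q ^ l * x) = x * (Q ^ l * p) - p" by (simp add: algebra_simps)
   thus ?thesis using l by (simp flip: mult.assoc)
  qed
  ultimately show ?thesis by (simp only:) blast
 next
  case False
  hence "PS ?w analytic_on {p}" by (intro PS_analytic gauss_summable_tail(1)) auto
  hence "(PS ?w \<longlongrightarrow> PS ?w p) (at p)" using analytic_at_imp_isCont isContD by blast
  hence "((%x. (x - p) * PS ?w x) \<longlongrightarrow> (p - p) * PS ?w p) (at p)" by (intro tendsto_intros)
  thus ?thesis by blast
 qed
 have B: "\<exists>L. ((%x. (x - p) * (1 / x * PS ?v (1 / x))) \<longlongrightarrow> L) (at p)"
 proof (cases "\<exists>l. Q ^ l * (1 / p) = 1")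
  case True
  then obtain l where l: "Q ^ l * (1 / p) = 1" by blast
  have f: "filterlim (%x. 1 / x) (at (1 / p)) (at p)"
   unfolding filterlim_at using ip pnz eventually_neq_at_within[of p p UNIV] by (auto elim!: eventually_mono)
  have "((%x. (1 - Q ^ l * (1 / x)) * PS ?v (1 / x)) \<longlongrightarrow> ?v l) (at p)"
   by (rule filterlim_compose[OF PS_pole[OF gauss_summable_tail(2) l] f])
  moreover have "\<forall>\<^sub>F x in at p. (1 - Q ^ l * (1 / x)) * PS ?v (1 / x) = (x - p) * (1 / x * PS ?v (1 / x))"
   using tendsto_imp_eventually_ne[OF tendsto_ident_at pnz]
  proof eventually_elim
   case (elim x)
   have "Q ^ l = p" using l pnz by (simp add: field_simps)
   hence "1 - Q ^ l * (1 / x) = (x - p) * (1 / x)" using elim by (simp add: field_simps)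
   thus ?case by simp
  qed
  ultimately show ?thesis by (intro exI) (rule Lim_transform_eventually)
 next
  case False
  hence "PS ?v analytic_on {1 / p}" by (intro PS_analytic gauss_summable_tail(2)) auto
  hence "isCont (PS ?v) (1 / p)" by (rule analytic_at_imp_isCont)
  hence "((%x. PS ?v (1 / x)) \<longlongrightarrow> PS ?v (1 / p)) (at p)" by (rule isCont_tendsto_compose[OF _ ip])
  hence "((%x. (x - p) * (1 / x * PS ?v (1 / x))) \<longlongrightarrow> (p - p) * (1 / p * PS ?v (1 / p))) (at p)"
   using ip by (intro tendsto_intros) (use pnz in auto)
  thus ?thesis by blast
 qed
 from A B obtain L M where "((%x. (x - p) * PS ?w x) \<longlongrightarrow> L) (at p)" "((%x. (x - p) * (1 / x * PS ?v (1 / x))) \<longlongrightarrow> M) (at p)" by blast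
 hence "((%x. (x - p) * PS ?w x - (x - p) * (1 / x * PS ?v (1 / x))) \<longlongrightarrow> L - M) (at p)" by (intro tendsto_intros)
 moreover have "\<forall>\<^sub>F x in at p. (x - p) * PS ?w x - (x - p) * (1 / x * PS ?v (1 / x)) = (x - p) * lerch1 x"
  using qZ_discrete[OF pnz] tendsto_imp_eventually_ne[OF tendsto_ident_at pnz]
  by eventually_elim (simp add: lerch1_PS right_diff_distrib)
 ultimately show ?thesis by (intro exI) (rule Lim_transform_eventually)
qed

text \<open>The quotient \<open>F\<close> of both sides, apart from the constant, is q-invariant;
  the zeros of theta cancel the poles of the sum, so it extends holomorphically and is constant. The
  limit t -> 1, where only the term m = 0 is singular, gives the cube.\<close>

theorem lerch1_eq: assumes t: "t \<noteq> 0" "t \<notin> qZ q" shows "lerch1 t = qi Q ^ 3 * t / th (- t)"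
proof -
 let ?w = "%l. Q powi tri (int l) * (-1) ^ l"
 let ?v = "%l. if l = 0 then 0 else Q powi tri (- int l) * (-1) ^ l * Q ^ l"
 define F where "F = (%t. lerch1 t * th (- t) / t)"
 have "\<exists>G. G holomorphic_on -{0} \<and> (\<forall>x\<in>-{0} - qZ q. G x = F x)"
 proof (rule removable_discrete)
  show "F holomorphic_on -{0} - qZ q"
  proof -
   have "PS ?w holomorphic_on - {0} - qZ q"
    using PS_analytic'[OF gauss_summable_tail(1)] q_minusN_qZ
    by (intro analytic_imp_holomorphic) (subst analytic_on_analytic_at, auto)
   moreover have "(%t. PS ?v (1 / t)) holomorphic_on - {0} - qZ q"
   proof -
    have "PS ?v holomorphic_on - {0} - qZ q"
     using PS_analytic'[OF gauss_summable_tail(2)] q_minusN_qZ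
     by (intro analytic_imp_holomorphic) (subst analytic_on_analytic_at, auto)
    moreover have "(%t. 1 / t) ` (- {0} - qZ q) \<subseteq> - {0} - qZ q"
     using qZ_inverse by force
    ultimately have "(PS ?v \<circ> (%t. 1 / t)) holomorphic_on - {0} - qZ q"
     by (intro holomorphic_on_compose_gen[where t = "- {0} - qZ q"] holomorphic_intros) auto
    thus ?thesis by (simp add: o_def)
   qed
   ultimately have "(%t. (PS ?w t - 1 / t * PS ?v (1 / t)) * th (- t) / t) holomorphic_on - {0} - qZ q"
    by (intro holomorphic_intros) auto
   moreover have "F holomorphic_on - {0} - qZ q \<longleftrightarrow> (%t. (PS ?w t - 1 / t * PS ?v (1 / t)) * th (- t) / t) holomorphic_on - {0} - qZ q"
    by (intro holomorphic_cong) (auto simp: F_def lerch1_PS)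
   ultimately show ?thesis by simp
  qed
  show "\<forall>\<^sub>F y in at x. y \<notin> qZ q" if "x \<in> - {0}" for x using qZ_discrete that by auto
  fix p assume "p \<in> -{0}" and p: "p \<in> qZ q"
  hence pnz: "p \<noteq> 0" by simp
  obtain L where L: "((%t. (t - p) * lerch1 t) \<longlongrightarrow> L) (at p)" using lerch1_pole[OF p] by blast
  have "((%t. (t - p) * lerch1 t * (th (- t) / t)) \<longlongrightarrow> L * (th (- p) / p)) (at p)"
   using pnz by (intro tendsto_intros L) auto
  thus "((%x. (x - p) * F x) \<longlongrightarrow> 0) (at p)"
   using th_m_eq_0_iff[OF pnz] p by (simp add: F_def mult.assoc)
 qed auto
 then obtain G where G: "G holomorphic_on -{0}" "\<And>x. x \<noteq> 0 ==> x \<notin> qZ q ==> G x = F x" by auto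
 have "G (Q * x) = 1 * G x" if "x \<noteq> 0" for x
 proof (rule quotient_invariant[OF G(1), of "-1"])
  fix x assume x: "x \<noteq> 0" "th (- 1 * x) \<noteq> 0"
  have x1: "x \<notin> qZ q" using x th_m_eq_0_iff[of x] by auto
  have x2: "Q * x \<notin> qZ q" using x1 qZ_mult_iff[OF qZ_powi[of 1], of x] by (simp add: mult.commute)
  have tt: "th (- (Q * x)) = th (- x) / (- x)" using th_Q'[of "-x"] x by simp
  have "F (Q * x) = F x" unfolding F_def lerch1_shift[OF x(1) x1] tt using x(1) by (simp add: field_simps)
  thus "G (Q * x) = 1 * G x" using G(2)[of x] G(2)[of "Q*x"] x x1 x2 by simp
 qed (use that in auto)
 then obtain c where c: "\<And>x. x \<noteq> 0 ==> G x = c" using elliptic_const[OF G(1)] by auto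
 have "((%t. ((1 - t) * lerch1 t) * (qi Q * qi (t * Q) * qi (Q / t) / t)) \<longlongrightarrow> 1 * (qi Q * qi (1 * Q) * qi (Q / 1) / 1)) (at 1)"
  by (intro tendsto_intros lerch1_limit_one) auto
 moreover have "\<forall>\<^sub>F t in at 1. ((1 - t) * lerch1 t) * (qi Q * qi (t * Q) * qi (Q / t) / t) = c"
  using qZ_discrete[of 1, simplified] tendsto_imp_eventually_ne[OF tendsto_ident_at[of "1::complex"], of 0, simplified]
 proof eventually_elim
  case (elim t)
  have "th (- t) = qi Q * ((1 - t) * qi (t * Q)) * qi (Q / t)"
   using th_product[of "- t"] elim qi_rec[of t] by simp
  hence "((1 - t) * lerch1 t) * (qi Q * qi (t * Q) * qi (Q / t) / t) = F t" by (simp add: F_def)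
  thus ?case using G(2)[of t] c[of t] elim by simp
 qed
 ultimately have "((%_. c) \<longlongrightarrow> 1 * (qi Q * qi (1 * Q) * qi (Q / 1) / 1)) (at (1::complex))"
  by (rule Lim_transform_eventually)
 hence "c = qi Q ^ 3" using tendsto_unique[OF _ tendsto_const] by (force simp: power3_eq_cube)
 hence "lerch1 t * th (- t) / t = qi Q ^ 3" using G(2)[of t] c[of t] t by (simp add: F_def)
 thus ?thesis using t th_m_eq_0_iff[of t] by (simp add: field_simps)
qed

definition lerch :: "complex \<Rightarrow> complex \<Rightarrow> complex" where
 "lerch t y = T (%m. t powi m * (1 / (1 - t * Q powi m))) y"

text \<open>The factor of proportionality in \<open>lerch_stokes\<close>; it does not depend on
  y.\<close>

definition stokes :: "complex \<Rightarrow> complex \<Rightarrow> complex" where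
 "stokes t t' = - (qi Q ^ 3) * t' * th (- t / t') / (th (- t') * th (- t))"

lemma tempered_lerch: "t \<noteq> 0 ==> t \<notin> qZ q ==> tempered (%m. t powi m * (1 / (1 - t * Q powi m)))"
 using tempered_frac[of t 0] by (intro tempered_mult tempered_powi) auto

lemma lerch_shift: assumes t: "t \<noteq> 0" "t \<notin> qZ q" and y: "y \<noteq> 0"
 shows "t * lerch t (Q * y) = lerch t y - th (t * y)"
proof -
 let ?x = "%m. t powi m * (1 / (1 - t * Q powi m))"
 have nz: "1 - t * Q powi m \<noteq> 0" for m
  using lattice_gap_int[OF t] by (metis norm_zero not_le)
 have tx: "tempered ?x" by (rule tempered_lerch[OF t])
 have tqx: "tempered (%m. t * (Q powi m * ?x m))" by (intro tempered_cmult tempered_mult[OF tempered_powi tx]) auto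
 have "th (t * y) = T (%m. t powi m * 1) y" by (simp only: T_scale th_T)
 also have "(%m. t powi m * 1) = (%m. ?x m - t * (Q powi m * ?x m))"
 proof
  fix m
  define r where "r = 1 / (1 - t * Q powi m)"
  have r: "(1 - t * Q powi m) * r = 1" using nz[of m] by (simp add: r_def)
  have "t powi m * 1 = t powi m * ((1 - t * Q powi m) * r)" by (simp only: r)
  also have "\<dots> = t powi m * r - t * (Q powi m * (t powi m * r))" by (simp add: algebra_simps)
  finally show "t powi m * 1 = ?x m - t * (Q powi m * ?x m)" by (simp only: r_def)
 qed
 also have "T \<dots> y = T ?x y - T (%m. t * (Q powi m * ?x m)) y" by (rule T_diff[OF tx tqx y])
 also have "T (%m. t * (Q powi m * ?x m)) y = t * T ?x (Q * y)" by (simp only: T_cmult T_scale)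
 finally show ?thesis by (simp add: lerch_def)
qed

text \<open>In the antisymmetric combination the inhomogeneous terms of the two shift equations
  cancel. What remains obeys a homogeneous first-order law, so \<open>theta_one\<close> makes it a
  multiple of one theta function.\<close>

theorem lerch_stokes:
 assumes t: "t \<noteq> 0" "t \<notin> qZ q" and t': "t' \<noteq> 0" "t' \<notin> qZ q" and y: "y \<noteq> 0"
 shows "lerch t y * th (t' * y) - lerch t' y * th (t * y) = stokes t t' * th (t * t' * y)"
proof -
 define N where "N = (%y. lerch t y * th (t' * y) - lerch t' y * th (t * y))"
 have Nh: "N holomorphic_on -{0}"
  unfolding N_def lerch_def
  by (intro holomorphic_intros T_holomorphic tempered_lerch t t') (use t t' in auto)
 have Na: "N (Q * y) = N y / (t * t' * y)" if y: "y \<noteq> 0" for y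
 proof -
  have a: "lerch t (Q * y) = (lerch t y - th (t * y)) / t" "lerch t' (Q * y) = (lerch t' y - th (t' * y)) / t'"
   using lerch_shift[OF t y] lerch_shift[OF t' y] t t' by (simp_all add: field_simps)
  have b: "th (t * (Q * y)) = th (t * y) / (t * y)" "th (t' * (Q * y)) = th (t' * y) / (t' * y)"
   using th_Q'[of "t*y"] th_Q'[of "t'*y"] t t' y by (simp_all add: mult_ac)
  show ?thesis unfolding N_def a b using t t' y by (simp add: field_simps)
 qed
 obtain X where X: "\<And>y. y \<noteq> 0 ==> N y = X * th (t * t' * y)"
  using theta_one[OF Nh, of "t * t'"] Na t t' by auto
 \<comment> \<open>The constant is read off at y = -1/t', where one theta factor vanishes and the
   other Appell-Lerch sum becomes \<open>lerch1 t'\<close>.\<close>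
 have "th (-1) = 0" by (subst th_eq_0_iff) (auto intro!: exI[of _ 0])
 hence "N (- 1 / t') = - lerch t' (- 1 / t') * th (- t / t')" using t' by (simp add: N_def)
 moreover have "lerch t' (- 1 / t') = lerch1 t'"
 proof -
  have "t' * (- 1 / t') = -1" using t' by simp
  thus ?thesis by (simp only: lerch_def T_scale lerch1_def)
 qed
 moreover have "N (- 1 / t') = X * th (- t)" using X[of "- 1 / t'"] t' by simp
 ultimately have "X * th (- t) = - (qi Q ^ 3 * t' / th (- t')) * th (- t / t')" using lerch1_eq[OF t'] by simp
 moreover have "th (- t) \<noteq> 0" using t th_m_eq_0_iff by auto
 ultimately have "X = - (qi Q ^ 3 * t' / th (- t')) * th (- t / t') / th (- t)" by (metis nonzero_eq_divide_eq)
 hence "X = stokes t t'" by (simp add: stokes_def mult_ac)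
 thus ?thesis using X[OF y] by (simp add: N_def)
qed

end

lemma powi_nf: "(x powi m) ^ k = x powi (m * int k)" "(x ^ k) powi m = x powi (m * int k)" for x :: complex
proof -
 show "(x powi m) ^ k = x powi (m * int k)" by (simp only: power_int_mult power_int_of_nat)
 have "(x ^ k) powi m = x powi (int k * m)" by (simp only: power_int_mult power_int_of_nat)
 thus "(x ^ k) powi m = x powi (m * int k)" by (simp only: mult.commute)
qed

section \<open>The jump of a sampled sum between two spirals\<close>

context qbase begin

text \<open>The numerator of a q-Laplace sum over the spiral t q^Z: quasi-periodicity of theta turns
  its reciprocals into the Gaussian weights of \<open>T\<close>.\<close>

definition psum :: "(complex \<Rightarrow> complex) \<Rightarrow> complex \<Rightarrow> complex \<Rightarrow> complex" where
 "psum b t y = T (%m. t powi m * b (t * Q powi m)) y"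

text \<open>The residues of \<open>pfun\<close> at q^m in the form of the limits of (1 - t) pfun(t
  q^m) for t -> 1; there is no pole for m > 0.\<close>

definition resseq :: "nat \<Rightarrow> (nat \<Rightarrow> complex) \<Rightarrow> int \<Rightarrow> complex" where
 "resseq k0 w m = (if m \<le> 0 then w (nat (- m)) * Q powi (m * int k0) else 0)"

lemma orbit_notin:
 assumes "t \<notin> qZ q" shows "t * Q powi m \<notin> q_minusN q"
 using assms q_minusN_qZ qZ_mult_iff[OF qZ_powi] by blast

text \<open>The contribution of a single partial fraction. Up to an elementary factor it is the jump
  of the basic Appell-Lerch sum at q^(-l) y, and the dependence on l separates from the dependence
  on the spirals.\<close>

lemma lerch_l_stokes:
 fixes k0 :: nat
 assumes t: "t \<noteq> 0" "t \<notin> qZ q" and t': "t' \<noteq> 0" "t' \<notin> qZ q" and y: "y \<noteq> 0"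
 defines "J \<equiv> %l t. T (%m. t powi m * ((t * Q powi m) ^ k0 * (1 / (1 - t * Q powi (m + int l))))) y"
 shows "J l t * th (t' * y) - J l t' * th (t * y)
  = Q powi (- int l * int k0) * Q powi tri (- int l) * y powi (- int l) * (stokes t t' * th (t * t' * y))"
proof -
 define K where "K = (%t. T (%m. t powi m * (1 / (1 - t * Q powi (m + int l)))) y)"
 \<comment> \<open>Writing x^k0 / (1 - x) as 1 / (1 - x) minus a finite geometric sum leaves a
   multiple of theta(t y) with a factor independent of t; it cancels in the antisymmetric
   combination.\<close>
 define S where "S = (\<Sum>k<k0. Q powi (int l * int k) * (1 / (Q powi tri (int k) * y powi int k)))"
 have Jeq: "J l t = Q powi (- int l * int k0) * (K t - S * th (t * y))" if t: "t \<noteq> 0" "t \<notin> qZ q" for t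
 proof -
  have nz: "1 - t * Q powi m \<noteq> 0" for m
   using lattice_gap_int[OF t] by (metis norm_zero not_le)
  let ?x = "%m. t powi m * (1 / (1 - t * Q powi (m + int l)))"
  let ?z = "%k m. Q powi (int l * int k) * t ^ k * ((t * Q ^ k) powi m)"
  have tx: "tempered ?x" by (intro tempered_mult tempered_powi tempered_frac t)
  have tz: "tempered (?z k)" for k using t by (intro tempered_cmult tempered_powi) auto
  have "t powi m * ((t * Q powi m) ^ k0 * (1 / (1 - t * Q powi (m + int l)))) =
   Q powi (- int l * int k0) * (?x m - (\<Sum>k<k0. ?z k m))" for m
  proof -
   define x where "x = t * Q powi (m + int l)"
   have x1: "1 - x \<noteq> 0" using nz by (simp add: x_def)
   have g: "(\<Sum>k<k0. x ^ k) = (1 - x ^ k0) * (1 / (1 - x))"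
    using x1 by (simp add: sum_gp_strict)
   have xe: "t * Q powi m = Q powi (- int l) * x"
    by (simp add: x_def power_int_add power_int_minus)
   have z: "?z k m = t powi m * x ^ k" for k
    unfolding x_def power_mult_distrib
    by (simp add: power_int_mult_distrib power_int_add powi_nf power_mult_distrib mult_ac)
     (simp add: mult.commute flip: power_mult of_nat_mult)
   have "(\<Sum>k<k0. ?z k m) = t powi m * ((1 - x ^ k0) * (1 / (1 - x)))"
    unfolding z sum_distrib_left[symmetric] g ..
   moreover have "(t * Q powi m) ^ k0 = Q powi (- int l * int k0) * x ^ k0"
    unfolding xe power_mult_distrib by (simp add: powi_nf)
   moreover have "t powi m * (Q powi (- int l * int k0) * x ^ k0 * r) =
     Q powi (- int l * int k0) * (t powi m * r - t powi m * ((1 - x ^ k0) * r))" for r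
    by (simp add: algebra_simps)
   ultimately show ?thesis unfolding x_def[symmetric] by (simp only:)
  qed
  hence "J l t = T (%m. Q powi (- int l * int k0) * (?x m - (\<Sum>k<k0. ?z k m))) y"
   by (simp only: J_def)
  also have "\<dots> = Q powi (- int l * int k0) * (T ?x y - T (%m. \<Sum>k<k0. ?z k m) y)"
   using tx tz y by (simp only: T_cmult) (subst T_diff, auto intro!: tempered_sum)
  also have "T (%m. \<Sum>k<k0. ?z k m) y = (\<Sum>k<k0. T (?z k) y)" by (rule T_sum[OF _ tz y]) auto
  also have "\<dots> = S * th (t * y)"
   unfolding S_def sum_distrib_right
  proof (rule sum.cong)
   fix k
   have "T (?z k) y = Q powi (int l * int k) * t ^ k * T (%m. (t * Q ^ k) powi m * 1) y" by (simp add: T_cmult)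
   also have "\<dots> = Q powi (int l * int k) * t ^ k * th (t * Q ^ k * y)" by (simp only: T_scale th_T)
   also have "\<dots> = Q powi (int l * int k) * (1 / (Q powi tri (int k) * y powi int k) * th (t * y))"
   proof -
    have "t ^ k * th (t * Q ^ k * y) = 1 / (Q powi tri (int k) * y powi int k) * th (t * y)"
     using th_shift[of "t * y" "int k"] t y by (simp add: power_mult_distrib mult_ac)
    thus ?thesis by (simp only: mult.assoc)
   qed
   finally show "T (?z k) y = Q powi (int l * int k) * (1 / (Q powi tri (int k) * y powi int k)) * th (t * y)"
    by (simp add: mult_ac)
  qed auto
  finally show ?thesis by (simp add: K_def)
 qed
 \<comment> \<open>Translating the summation index by l turns the pole at q^(-l) into the one at 1,
   at the price of dilating y.\<close>
 have Keq: "K t = (t * y) powi (- int l) * Q powi tri (- int l) * lerch t (Q powi (- int l) * y)" if t: "t \<noteq> 0" for t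
 proof -
  let ?x = "%m. t powi m * (1 / (1 - t * Q powi m))"
  have "K t = T (%m. t powi (- int l) * ?x (m - (- int l))) y"
  proof -
   have "t powi m * (1 / (1 - t * Q powi (m + int l))) = t powi (- int l) * ?x (m - (- int l))" for m
   proof -
    have "t powi m = t powi (- int l) * t powi (m + int l)" using t by (simp flip: power_int_add)
    thus ?thesis by (simp only: mult.assoc diff_minus_eq_add)
   qed
   thus ?thesis by (simp only: K_def)
  qed
  thus ?thesis unfolding T_cmult T_shift[OF y, of ?x "- int l"] lerch_def
   by (simp only: power_int_mult_distrib mult_ac)
 qed
 have thl: "th (s * y) = Q powi tri (- int l) * (s * y) powi (- int l) * th (s * (Q powi (- int l) * y))" if "s \<noteq> 0" for s
  using th_shift[of "s * y" "- int l"] that y by (simp add: mult_ac)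
 define Y where "Y = Q powi (- int l) * y"
 have Y: "Y \<noteq> 0" using y by (simp add: Y_def)
 have "J l t * th (t' * y) - J l t' * th (t * y) = Q powi (- int l * int k0) * (K t * th (t' * y) - K t' * th (t * y))"
  unfolding Jeq[OF t] Jeq[OF t'] by (simp add: algebra_simps)
 also have "K t * th (t' * y) - K t' * th (t * y) =
   (t * y) powi (- int l) * (t' * y) powi (- int l) * Q powi tri (- int l) * Q powi tri (- int l) *
   (lerch t Y * th (t' * Y) - lerch t' Y * th (t * Y))"
  unfolding Keq[OF t(1)] Keq[OF t'(1)] thl[OF t(1)] thl[OF t'(1)] Y_def[symmetric] by (simp add: algebra_simps)
 also have "lerch t Y * th (t' * Y) - lerch t' Y * th (t * Y) = stokes t t' * th (t * t' * Y)"
  by (rule lerch_stokes[OF t t' Y])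
 also have "(t * y) powi (- int l) * (t' * y) powi (- int l) * Q powi tri (- int l) * Q powi tri (- int l) * (stokes t t' * th (t * t' * Y))
  = Q powi tri (- int l) * y powi (- int l) * (stokes t t' * th (t * t' * y))"
  using thl[of "t * t'"] t t' by (simp add: Y_def power_int_mult_distrib mult_ac)
 finally show ?thesis by (simp add: mult_ac)
qed

text \<open>Summed over the partial fractions, the factors in l of \<open>lerch_l_stokes\<close>
  form exactly the series \<open>T\<close> of the residues. The polynomial part of
  \<open>pfun\<close> contributes only multiples of theta(t y) and drops out.\<close>

theorem stokes_pfun:
 assumes w: "summable (%l. norm (w l))" and t: "t \<noteq> 0" "t \<notin> qZ q" and t': "t' \<noteq> 0" "t' \<notin> qZ q" and y: "y \<noteq> 0"
 shows "psum (pfun k0 g w) t y * th (t' * y) - psum (pfun k0 g w) t' y * th (t * y)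
  = stokes t t' * th (t * t' * y) * T (resseq k0 w) y"
proof -
 define J where "J = (%l t. T (%m. t powi m * ((t * Q powi m) ^ k0 * (1 / (1 - t * Q powi (m + int l))))) y)"
 define S where "S = (\<Sum>k<k0. g k * (1 / (Q powi tri (int k) * y powi int k)))"
 have main: "psum (pfun k0 g w) t y = S * th (t * y) + (\<Sum>\<^sub>\<infinity>l. w l * J l t) \<and> (%l. w l * J l t) summable_on UNIV"
  if t: "t \<noteq> 0" "t \<notin> qZ q" for t
 proof -
  obtain \<delta> where d: "\<delta> > 0" "\<And>m. \<delta> \<le> norm (1 - t * Q powi m)" using lattice_gap_int[OF t] by blast
  have wl: "(%l. norm (w l)) summable_on UNIV" using w by (intro summable_nonneg_imp_summable_on) auto
  let ?x = "%m. t powi m * (t * Q powi m) ^ k0"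
  have tx: "tempered ?x"
  proof -
   have "(t * Q powi m) ^ k0 = t ^ k0 * (Q ^ k0) powi m" for m
    by (simp add: power_mult_distrib powi_nf mult.commute)
   thus ?thesis using t by (auto intro!: tempered_mult tempered_powi)
  qed
  let ?u = "%m. norm (Q powi tri m * y powi m * ?x m)"
  have u: "?u summable_on UNIV" by (rule T_abs_summable[OF tx y])
  let ?f = "%m l. Q powi tri m * y powi m * (w l * (?x m * (1 / (1 - t * Q powi (m + int l)))))"
  have fb: "norm (?f m l) \<le> ?u m * (norm (w l) / \<delta>)" for m l
  proof -
   have "norm (?f m l) = ?u m * (norm (w l) / norm (1 - t * Q powi (m + int l)))"
    by (simp add: norm_mult norm_divide mult_ac)
   also have "norm (w l) / norm (1 - t * Q powi (m + int l)) \<le> norm (w l) / \<delta>"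
    using d(1) d(2)[of "m + int l"] by (intro divide_left_mono mult_pos_pos) auto
   finally show ?thesis by (simp add: mult_left_mono)
  qed
  have wd: "(%l. norm (w l) / \<delta>) summable_on UNIV"
   using summable_on_cmult_left[OF wl, of "1 / \<delta>"] by simp
  have sw: "(\<Sum>\<^sub>\<infinity>m. \<Sum>\<^sub>\<infinity>l. ?f m l) = (\<Sum>\<^sub>\<infinity>l. \<Sum>\<^sub>\<infinity>m. ?f m l)"
   by (rule infsum_swap_bounded[OF u wd _ _ fb]) (use d in auto)
  have Jl: "(\<Sum>\<^sub>\<infinity>m. ?f m l) = w l * J l t" for l
   unfolding J_def T_cmult[symmetric] by (simp add: T_def mult_ac)
  have Jb: "norm (w l * J l t) \<le> norm (w l) * (infsum ?u UNIV / \<delta>)" for l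
  proof -
   have s1: "(%m. ?u m * (norm (w l) / \<delta>)) summable_on UNIV" by (rule summable_on_cmult_left[OF u])
   have s2: "(%m. norm (?f m l)) summable_on UNIV"
    by (rule Infinite_Sum.abs_summable_on_comparison_test'[OF s1]) (use fb in auto)
   have "norm (w l * J l t) \<le> infsum (%m. ?u m * (norm (w l) / \<delta>)) UNIV"
    unfolding Jl[symmetric]
    by (rule norm_infsum_le[OF has_sum_infsum[OF abs_summable_summable[OF s2]] has_sum_infsum[OF s1]]) (use fb in auto)
   also have "\<dots> = infsum ?u UNIV * (norm (w l) / \<delta>)" by (rule infsum_cmult_left')
   finally show ?thesis by (simp add: mult_ac)
  qed
  have Js: "(%l. w l * J l t) summable_on UNIV"
   by (rule abs_summable_summable, rule Infinite_Sum.abs_summable_on_comparison_test'[OF summable_on_cmult_left[OF wl, of "infsum ?u UNIV / \<delta>"]]) (use Jb in auto)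
  have PSs: "(\<Sum>\<^sub>\<infinity>l. ?f m l) = Q powi tri m * y powi m * (?x m * PS w (t * Q powi m))" for m
  proof -
   have sl: "summable (%l. norm (w l / (1 - Q ^ l * (t * Q powi m))))"
   proof (rule PS_bound(1)[OF w d(1)])
    fix l show "\<delta> \<le> norm (1 - Q ^ l * (t * Q powi m))"
     using d(2)[of "m + int l"] by (simp add: power_int_add mult_ac)
   qed
   have "PS w (t * Q powi m) = (\<Sum>\<^sub>\<infinity>l. w l / (1 - Q ^ l * (t * Q powi m)))"
    unfolding PS_def by (rule suminf_infsum[OF sl])
   also have "\<dots> = (\<Sum>\<^sub>\<infinity>l. w l * (1 / (1 - t * Q powi (m + int l))))"
    by (intro infsum_cong) (simp add: power_int_add mult_ac)
   finally have e: "PS w (t * Q powi m) = (\<Sum>\<^sub>\<infinity>l. w l * (1 / (1 - t * Q powi (m + int l))))" .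
   have "(\<Sum>\<^sub>\<infinity>l. ?f m l) = (\<Sum>\<^sub>\<infinity>l. Q powi tri m * y powi m * ?x m * (w l * (1 / (1 - t * Q powi (m + int l)))))"
    by (intro infsum_cong) (simp add: mult_ac)
   also have "\<dots> = Q powi tri m * y powi m * ?x m * (\<Sum>\<^sub>\<infinity>l. w l * (1 / (1 - t * Q powi (m + int l))))"
    by (rule infsum_cmult_right')
   finally show ?thesis unfolding e by (simp add: mult.assoc)
  qed
  have "T (%m. ?x m * PS w (t * Q powi m)) y = (\<Sum>\<^sub>\<infinity>l. w l * J l t)"
   unfolding T_def using sw PSs Jl by simp
  moreover have tP: "tempered (%m. ?x m * PS w (t * Q powi m))"
  proof (rule tempered_mult[OF tx])
   have "norm (PS w (t * Q powi m)) \<le> (\<Sum>l. norm (w l)) / \<delta>" for m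
   proof (rule PS_bound(2)[OF w d(1)])
    fix l show "\<delta> \<le> norm (1 - Q ^ l * (t * Q powi m))"
     using d(2)[of "m + int l"] by (simp add: power_int_add mult_ac)
   qed
   thus "tempered (%m. PS w (t * Q powi m))" by (rule tempered_bounded)
  qed
  moreover have "psum (pfun k0 g w) t y = (\<Sum>k<k0. g k * t ^ k * th (t * Q ^ k * y)) + T (%m. ?x m * PS w (t * Q powi m)) y"
  proof -
   let ?z = "%k m. g k * t ^ k * ((t * Q ^ k) powi m)"
   have tz: "tempered (?z k)" for k using t by (intro tempered_cmult tempered_powi) auto
   have z: "t powi m * pfun k0 g w (t * Q powi m) = (\<Sum>k<k0. ?z k m) + ?x m * PS w (t * Q powi m)" for m
    unfolding pfun_def distrib_left sum_distrib_left
    by (simp add: power_mult_distrib power_int_mult_distrib powi_nf mult_ac)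
   have "psum (pfun k0 g w) t y = T (%m. \<Sum>k<k0. ?z k m) y + T (%m. ?x m * PS w (t * Q powi m)) y"
    unfolding psum_def z by (intro T_add tempered_sum tz tP y) auto
   also have "T (%m. \<Sum>k<k0. ?z k m) y = (\<Sum>k<k0. T (?z k) y)" by (rule T_sum[OF _ tz y]) auto
   also have "\<dots> = (\<Sum>k<k0. g k * t ^ k * th (t * Q ^ k * y))"
   proof (rule sum.cong[OF refl])
    fix k
    have "T (?z k) y = g k * t ^ k * T (%m. (t * Q ^ k) powi m * 1) y" by (simp add: T_cmult)
    also have "T (%m. (t * Q ^ k) powi m * 1) y = th (t * Q ^ k * y)" by (simp only: T_scale th_T)
    finally show "T (?z k) y = g k * t ^ k * th (t * Q ^ k * y)" .
   qed
   finally show ?thesis .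
  qed
  moreover have "(\<Sum>k<k0. g k * t ^ k * th (t * Q ^ k * y)) = S * th (t * y)"
   unfolding S_def sum_distrib_right
  proof (rule sum.cong)
   fix k
   have "t ^ k * th (t * Q ^ k * y) = 1 / (Q powi tri (int k) * y powi int k) * th (t * y)"
    using th_shift[of "t * y" "int k"] t y by (simp add: power_mult_distrib mult_ac)
   thus "g k * t ^ k * th (t * Q ^ k * y) = g k * (1 / (Q powi tri (int k) * y powi int k)) * th (t * y)"
    by (simp add: mult.assoc)
  qed auto
  ultimately show ?thesis using Js by simp
 qed
 let ?c = "stokes t t' * th (t * t' * y)"
 let ?r = "%l. w l * Q powi (- int l * int k0) * Q powi tri (- int l) * y powi (- int l)"
 have "psum (pfun k0 g w) t y * th (t' * y) - psum (pfun k0 g w) t' y * th (t * y)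
  = (\<Sum>\<^sub>\<infinity>l. w l * J l t) * th (t' * y) - (\<Sum>\<^sub>\<infinity>l. w l * J l t') * th (t * y)"
  using main[OF t] main[OF t'] by (simp add: algebra_simps)
 also have "\<dots> = (\<Sum>\<^sub>\<infinity>l. w l * J l t * th (t' * y)) + (\<Sum>\<^sub>\<infinity>l. w l * J l t' * (- th (t * y)))"
  by (simp only: infsum_cmult_left') simp
 also have "\<dots> = (\<Sum>\<^sub>\<infinity>l. w l * J l t * th (t' * y) + w l * J l t' * (- th (t * y)))"
  by (intro infsum_add[symmetric] summable_on_cmult_left) (use main[OF t] main[OF t'] in auto)
 also have "\<dots> = (\<Sum>\<^sub>\<infinity>l. ?r l * ?c)"
 proof (rule infsum_cong)
  fix l
  have "w l * J l t * th (t' * y) + w l * J l t' * (- th (t * y)) = w l * (J l t * th (t' * y) - J l t' * th (t * y))"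
   by (simp add: algebra_simps)
  also have "\<dots> = w l * (Q powi (- int l * int k0) * Q powi tri (- int l) * y powi (- int l) * ?c)"
   unfolding J_def by (subst lerch_l_stokes[OF t t' y]) simp
  finally show "w l * J l t * th (t' * y) + w l * J l t' * (- th (t * y)) = ?r l * ?c" by (simp add: mult_ac)
 qed
 also have "\<dots> = (\<Sum>\<^sub>\<infinity>l. ?r l) * ?c" by (rule infsum_cmult_left')
 also have "(\<Sum>\<^sub>\<infinity>l. ?r l) = T (resseq k0 w) y"
 proof -
  have "T (resseq k0 w) y = (\<Sum>\<^sub>\<infinity>m\<in>range (%l. - int l). Q powi tri m * y powi m * resseq k0 w m)"
   unfolding T_def
  proof (rule infsum_cong_neutral)
   fix m :: int assume "m \<in> UNIV - range (%l. - int l)"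
   hence "\<not> m \<le> 0" by (auto intro: image_eqI[of _ _ "nat (-m)"] simp: image_iff) (metis nat_0_le neg_0_le_iff_le minus_minus)
   thus "Q powi tri m * y powi m * resseq k0 w m = 0" by (simp add: resseq_def)
  qed auto
  also have "\<dots> = (\<Sum>\<^sub>\<infinity>l. ?r l)"
   by (subst infsum_reindex) (auto simp: o_def inj_on_def resseq_def mult_ac)
  finally show ?thesis by simp
 qed
 finally show ?thesis by (simp add: mult_ac)
qed

text \<open>Multiplication by 1 - t selects the term whose pole is at q^m; the factor q^(m k0) is
  the value there of the power in front of the partial fractions.\<close>

lemma resseq_limit:
 assumes w: "summable (%l. norm (w l))"
 shows "((%t. (1 - t) * pfun k0 g w (t * Q powi m)) \<longlongrightarrow> resseq k0 w m) (at 1)"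
proof -
 have f: "filterlim (%t. Q powi m * t) (at (Q powi m * 1)) (at 1)" by (rule filterlim_mult_at) simp
 have ft: "((%t. Q powi m * t) \<longlongrightarrow> Q powi m * 1) (at 1)" by (intro tendsto_intros)
 have P: "((%t. (1 - t) * PS w (Q powi m * t)) \<longlongrightarrow> (if m \<le> 0 then w (nat (-m)) else 0)) (at 1)"
 proof (cases "m \<le> 0")
  case True
  define l where "l = nat (- m)"
  have m: "m = - int l" using True by (simp add: l_def)
  have lp: "Q ^ l * (Q powi m * 1) = 1" by (simp add: m power_int_minus)
  have "((%t. (1 - Q ^ l * (Q powi m * t)) * PS w (Q powi m * t)) \<longlongrightarrow> w l) (at 1)"
   by (rule filterlim_compose[OF PS_pole[OF w lp] f])
  moreover have "Q ^ l * (Q powi m * t) = t" for t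
  proof -
   have "Q ^ l * (Q powi m * t) = Q ^ l * (Q powi m * 1) * t" by simp
   thus ?thesis by (simp only: lp mult_1_left)
  qed
  ultimately have "((%t. (1 - t) * PS w (Q powi m * t)) \<longlongrightarrow> w l) (at 1)" by (simp only:)
  thus ?thesis using True by (simp add: l_def)
 next
  case False
  have "Q powi m \<notin> q_minusN q"
  proof (rule small_notin_q_minusN)
   have "q ^ nat m < 1" using False q0 q1 by (simp add: power_less_one_iff)
   thus "norm (Q powi m) < 1" using False q0 by (simp add: power_int_def norm_power)
  qed
  hence "isCont (PS w) (Q powi m * 1)" using PS_analytic'[OF w] analytic_at_imp_isCont by auto
  hence "((%t. PS w (Q powi m * t)) \<longlongrightarrow> PS w (Q powi m * 1)) (at 1)" by (rule isCont_tendsto_compose[OF _ ft])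
  hence "((%t. (1 - t) * PS w (Q powi m * t)) \<longlongrightarrow> (1 - 1) * PS w (Q powi m * 1)) (at 1)" by (intro tendsto_intros)
  thus ?thesis using False by simp
 qed
 have "((%t. (1 - t) * (\<Sum>k<k0. g k * (Q powi m * t) ^ k) + (Q powi m * t) ^ k0 * ((1 - t) * PS w (Q powi m * t)))
  \<longlongrightarrow> (1 - 1) * (\<Sum>k<k0. g k * (Q powi m * 1) ^ k) + (Q powi m * 1) ^ k0 * (if m \<le> 0 then w (nat (-m)) else 0)) (at 1)"
  by (intro tendsto_intros P)
 moreover have "(1 - t) * (\<Sum>k<k0. g k * (Q powi m * t) ^ k) + (Q powi m * t) ^ k0 * ((1 - t) * PS w (Q powi m * t)) = (1 - t) * pfun k0 g w (t * Q powi m)" for t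
  by (simp add: pfun_def algebra_simps)
 moreover have "(1 - 1) * (\<Sum>k<k0. g k * (Q powi m * 1) ^ k) + (Q powi m * 1) ^ k0 * (if m \<le> 0 then w (nat (-m)) else 0) = resseq k0 w m"
  by (simp add: resseq_def powi_nf mult.commute)
 ultimately show ?thesis by simp
qed

lemma pfun_orbit_tempered:
 assumes w: "summable (%l. norm (w l))" and t: "t \<noteq> 0" "t \<notin> qZ q"
 shows "tempered (%m. pfun k0 g w (t * Q powi m))"
proof -
 obtain \<delta> where d: "\<delta> > 0" "\<And>m. \<delta> \<le> norm (1 - t * Q powi m)" using lattice_gap_int[OF t] by blast
 have e: "(t * Q powi m) ^ k = t ^ k * (Q ^ k) powi m" for m k
  by (simp add: power_mult_distrib powi_nf mult.commute)
 have "norm (PS w (t * Q powi m)) \<le> (\<Sum>l. norm (w l)) / \<delta>" for m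
 proof (rule PS_bound(2)[OF w d(1)])
  fix l show "\<delta> \<le> norm (1 - Q ^ l * (t * Q powi m))"
   using d(2)[of "m + int l"] by (simp add: power_int_add mult_ac)
 qed
 hence "tempered (%m. PS w (t * Q powi m))" by (rule tempered_bounded)
 thus ?thesis unfolding pfun_def e
  by (intro tempered_add tempered_sum tempered_mult tempered_powi tempered_const) auto
qed

end

section \<open>The recursion along a spiral\<close>

lemma funpow_shift: "((%m::int. m - 1) ^^ j) m = m - int j"
 by (induction j) auto

lemma opr_compose: "(\<And>u. h (s u) = s' (h u)) ==> opr s cs (%u. f (h u)) u = opr s' cs f (h u)"
 by (induction cs arbitrary: u) (simp_all add: opr_Cons)

context qbase begin

abbreviation shf :: "int \<Rightarrow> int" where "shf \<equiv> %m. m - 1"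

lemma tempered_shift: assumes "tempered x" shows "tempered (%m. x (m - 1))"
proof -
 obtain C K where K: "K \<ge> 1" "\<And>m. norm (x m) \<le> C * K ^ nat \<bar>m\<bar>" using assms by (auto simp: tempered_def)
 have C: "C \<ge> 0" using order_trans[OF norm_ge_zero K(2)[of 0]] by simp
 have "norm (x (m - 1)) \<le> (C * K) * K ^ nat \<bar>m\<bar>" for m
 proof -
  have "K ^ nat \<bar>m - 1\<bar> \<le> K ^ Suc (nat \<bar>m\<bar>)" using K(1) by (intro power_increasing) auto
  hence "C * K ^ nat \<bar>m - 1\<bar> \<le> C * K ^ Suc (nat \<bar>m\<bar>)" using C by (rule mult_left_mono)
  thus ?thesis using K(2)[of "m - 1"] by (simp add: mult_ac)
 qed
 thus ?thesis unfolding tempered_def using K(1) by blast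
qed

lemma tempered_diff: "tempered x ==> tempered y ==> tempered (%m. x m - y m)"
 using tempered_add[of x "%m. -1 * y m"] tempered_cmult[of y "-1"] by simp

lemma opr_tempered: "tempered x ==> tempered (%m. opr shf cs x m)"
proof (induction cs)
 case (Cons c cs)
 hence "tempered (%m. opr shf cs x m)" by simp
 thus ?case unfolding opr_Cons by (intro tempered_diff tempered_cmult) (auto intro: tempered_shift)
qed simp

text \<open>The factor l0 z from \<open>E\<close> equals the factor that \<open>T_shift1\<close>
  produces, so z -> q z on E(z) T x (l0 z) is precisely the translation of x by one step.\<close>

lemma opr_T:
 assumes E: "\<And>z. z \<noteq> 0 ==> E (Q * z) = l0 * z * E z" and l0: "l0 \<noteq> 0" and x: "tempered x" and z: "z \<noteq> 0"
 shows "opr (%z. Q * z) cs (%z. E z * T x (l0 * z)) z = E z * T (%m. opr shf cs x m) (l0 * z)"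
 using z
proof (induction cs arbitrary: z)
 case (Cons c cs)
 have t: "tempered (%m. opr shf cs x m)" by (rule opr_tempered[OF x])
 have z: "l0 * z \<noteq> 0" "Q * z \<noteq> 0" using Cons.prems l0 by auto
 have "T (%m. opr shf (c # cs) x m) (l0 * z) = T (%m. opr shf cs x m) (l0 * z) - T (%m. c * opr shf cs x (m - 1)) (l0 * z)"
  unfolding opr_Cons by (intro T_diff t tempered_cmult z) (rule tempered_shift[OF t])
 also have "T (%m. c * opr shf cs x (m - 1)) (l0 * z) = c * (l0 * z * T (%m. opr shf cs x m) (Q * (l0 * z)))"
  unfolding T_cmult by (subst T_shift1[OF z(1), of "%m. opr shf cs x m"]) simp
 finally have e: "T (%m. opr shf (c # cs) x m) (l0 * z) =
  T (%m. opr shf cs x m) (l0 * z) - c * (l0 * z * T (%m. opr shf cs x m) (Q * (l0 * z)))" .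
 have "opr (%z. Q * z) (c # cs) (%z. E z * T x (l0 * z)) z =
  E z * T (%m. opr shf cs x m) (l0 * z) - c * (l0 * z * E z * T (%m. opr shf cs x m) (l0 * (Q * z)))"
  by (simp only: opr_Cons Cons.IH[OF Cons.prems] Cons.IH[OF z(2)] E[OF Cons.prems])
 also have "l0 * (Q * z) = Q * (l0 * z)" by simp
 finally show ?case unfolding e by (simp add: algebra_simps)
qed simp

end

locale qconf = qbase +
 fixes n :: nat and a b :: "nat \<Rightarrow> complex"
 assumes n1: "n \<ge> 1"
  and a_nz: "\<And>i. i \<in> {1..<n} ==> a i \<noteq> 0"
  and a_gen: "\<And>i j. i \<in> {1..<n} ==> j \<in> {1..<n} ==> i \<noteq> j ==> a i / a j \<notin> qZ q"
  and b_gen: "\<And>l. l \<in> {1..<n} ==> b l \<notin> {0} \<union> q_minusN q"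
begin

definition as where "as = map a [1..<n]"
definition bs where "bs = map b [1..<n]"
definition bs1 where "bs1 = 1 # map (%b. b / Q) bs"
definition PA where "PA = (\<Prod>l\<in>{1..<n}. a l)"
definition PB where "PB = (\<Prod>l\<in>{1..<n}. b l)"
definition c where "c = PA / PB"

lemma b_nz: "l \<in> {1..<n} ==> b l \<noteq> 0" using b_gen by auto
lemma PA_nz: "PA \<noteq> 0" by (simp add: PA_def a_nz)
lemma PB_nz: "PB \<noteq> 0" by (simp add: PB_def b_nz)
lemma c_nz: "c \<noteq> 0" by (simp add: c_def PA_nz PB_nz)
lemma length_as [simp]: "length as = n - 1" by (simp add: as_def)
lemma length_bs1 [simp]: "length bs1 = n" using n1 by (simp add: bs1_def bs_def)

lemma prod_list_range: "(\<Prod>l\<leftarrow>[1..<n]. f l) = (\<Prod>l\<in>{1..<n}. (f l :: complex))"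
 using prod.distinct_set_conv_list[of "[1..<n]" f] by simp

lemma power_n: "x ^ n = x * (x::complex) ^ (n - 1)"
 using n1 by (cases n) auto
lemma Q_powi_1n: "Q powi (1 - int n) = 1 / Q ^ (n - 1)"
 using n1 by (cases n) (auto simp: power_int_minus inverse_eq_divide)

lemma prod_neg_as: "(\<Prod>c\<leftarrow>as. - c) = (-1) ^ (n - 1) * PA"
proof -
 have "(\<Prod>c\<leftarrow>as. - c) = (\<Prod>l\<leftarrow>[1..<n]. - 1 * a l)" by (simp add: as_def o_def)
 also have "\<dots> = (\<Prod>l\<in>{1..<n}. - 1 * a l)" by (rule prod_list_range)
 also have "\<dots> = (-1) ^ (n - 1) * PA" unfolding prod.distrib by (simp add: PA_def)
 finally show ?thesis .
qed

lemma prod_neg_bs1: "(\<Prod>c\<leftarrow>bs1. - c) = (-1) ^ n * PB / Q ^ (n - 1)"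
proof -
 have "(\<Prod>c\<leftarrow>bs1. - c) = - (\<Prod>l\<leftarrow>[1..<n]. (- 1 / Q) * b l)" by (simp add: bs1_def bs_def o_def)
 also have "(\<Prod>l\<leftarrow>[1..<n]. (- 1 / Q) * b l) = (\<Prod>l\<in>{1..<n}. (- 1 / Q) * b l)" by (rule prod_list_range)
 also have "\<dots> = (- 1 / Q) ^ (n - 1) * PB" unfolding prod.distrib by (simp add: PB_def)
 finally have "(\<Prod>c\<leftarrow>bs1. - c) = - ((- 1 / Q) ^ (n - 1) * PB)" .
 moreover have "(- 1 / Q) ^ (n - 1) = (- 1) ^ (n - 1) / Q ^ (n - 1)" by (rule power_divide)
 ultimately show ?thesis by (simp add: power_n[of "-1"])
qed

definition Rec :: "complex \<Rightarrow> (int \<Rightarrow> complex) \<Rightarrow> bool" where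
 "Rec l0 x \<longleftrightarrow> (\<forall>m. 1 / l0 * Q powi (1 - m) * opr shf as x (m - 1) = opr shf bs1 x m)"

text \<open>Multiplication by z is also an operation on sequences: translate by one step and weight
  with q^(1-m), which undoes the dilation caused by the translation. This accounts for the left side
  of \<open>Rec\<close>.\<close>

theorem Rec_solution:
 assumes R: "Rec l0 x" and x: "tempered x" and l0: "l0 \<noteq> 0"
  and E: "\<And>z. z \<noteq> 0 ==> E (Q * z) = l0 * z * E z"
  and y: "\<And>z. z \<noteq> 0 ==> y z = E z * T x (l0 * z)" and z: "z \<noteq> 0"
 shows "z * opr (%z. Q * z) as y z = opr (%z. Q * z) bs1 y z"
proof -
 have yo: "opr (%z. Q * z) cs y z = E z * T (%m. opr shf cs x m) (l0 * z)" for cs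
 proof -
  have "opr (%z. Q * z) cs y z = opr (%z. Q * z) cs (%z. E z * T x (l0 * z)) z"
   by (rule opr_cong) (use z y in \<open>simp add: funpow_Q\<close>)
  thus ?thesis using opr_T[OF E l0 x z] by simp
 qed
 let ?X = "%m. opr shf as x m"
 define w where "w = l0 * z"
 have w: "w \<noteq> 0" using l0 z by (simp add: w_def)
 have "T (%m. opr shf bs1 x m) w = T (%m. 1 / l0 * (Q powi (- (m - 1)) * ?X (m - 1))) w"
  using R by (simp add: Rec_def algebra_simps)
 also have "\<dots> = 1 / l0 * (w * T (%m. Q powi (- m) * ?X m) (Q * w))"
  unfolding T_cmult by (subst T_shift1[OF w, of "%m. Q powi (- m) * ?X m"]) simp
 also have "T (%m. Q powi (- m) * ?X m) (Q * w) = T (%m. (1 / Q) powi m * ?X m) (Q * w)"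
  by (simp add: power_int_minus power_int_divide_distrib inverse_eq_divide)
 also have "\<dots> = T ?X w" by (simp only: T_scale) simp
 finally have "T (%m. opr shf bs1 x m) w = z * T ?X w" using l0 by (simp add: w_def)
 thus ?thesis unfolding yo w_def by simp
qed

definition Asi where "Asi i = a i # map (%l. a i * Q / b l) [1..<n]"
definition Bsi where "Bsi i = map (%l. a i * Q / a l) (filter (%l. l \<noteq> i) [1..<n])"
text \<open>The q-Borel transform of h_i in a normalised variable: the transform at xi equals
  \<open>bi i\<close> at -xi / (a_i c), by \<open>qborel_h_hat\<close>.\<close>

definition bi where "bi i = ph (Asi i) (Bsi i)"

lemma Bsi_ok: assumes "i \<in> {1..<n}" shows "\<forall>B\<in>set (Bsi i). B \<notin> q_minusN q"
proof
 fix B assume "B \<in> set (Bsi i)"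
 then obtain l where l: "l \<in> {1..<n}" "l \<noteq> i" "B = a i / a l * Q" by (auto simp: Bsi_def)
 have "a i / a l * Q \<notin> qZ q" using a_gen[OF assms l(1)] l(2) qZ_mult_iff[OF qZ_powi[of 1], of "a i / a l"] by simp
 thus "B \<notin> q_minusN q" using l q_minusN_qZ by auto
qed

text \<open>The hypergeometric equation of \<open>bi i\<close> read along a spiral. The weight a_i^m
  divides the parameters by a_i, and inverting the shift inverts them; the operators with parameters
  a_l and b_l/q thereby become those of the two sides of the equation of \<open>bi i\<close>, in
  exchanged roles.\<close>

lemma bi_orbit_Rec:
 assumes i: "i \<in> {1..<n}" and t: "t \<noteq> 0" "t \<notin> qZ q"
 shows "Rec (- c * t) (%m. a i powi m * bi i (t * Q powi m))"
 unfolding Rec_def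
proof
 fix m
 let ?\<beta> = "%m. bi i (t * Q powi m)"
 let ?r = "a i"
 have r: "?r \<noteq> 0" using a_nz i by auto
 define x0 where "x0 = t * Q powi (m - int n)"
 have x0: "x0 \<notin> q_minusN q" unfolding x0_def by (rule orbit_notin[OF t(2)])
 \<comment> \<open>An operator of order k in the backward shift, evaluated at m' + k, involves the
   points from m' upwards; it becomes a forward q-difference operator at t q^m'.\<close>
 have inv: "opr shf (map (%c. c / ?r) cs) ?\<beta> (m' + int (length cs)) =
   (\<Prod>c\<leftarrow>cs. - (c / ?r)) * opr (%z. Q * z) (map (%c. ?r / c) cs) (bi i) (t * Q powi m')"
  if "\<forall>c\<in>set cs. c \<noteq> 0" for cs m'
 proof -
  have "opr shf (map (%c. c / ?r) cs) ?\<beta> (m' + int (length cs)) =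
   (\<Prod>c\<leftarrow>map (%c. c / ?r) cs. - c) * opr (%m. m + 1) (map inverse (map (%c. c / ?r) cs)) ?\<beta> ((shf ^^ length (map (%c. c / ?r) cs)) (m' + int (length cs)))"
   by (rule opr_inverse) (use that r in auto)
  also have "(shf ^^ length (map (%c. c / ?r) cs)) (m' + int (length cs)) = m'"
   by (simp add: funpow_shift)
  also have "opr (%m. m + 1) (map inverse (map (%c. c / ?r) cs)) ?\<beta> m' = opr (%z. Q * z) (map inverse (map (%c. c / ?r) cs)) (bi i) (t * Q powi m')"
   by (rule opr_compose) (simp add: power_int_add)
  finally show ?thesis by (simp add: o_def inverse_eq_divide)
 qed
 have as0: "\<forall>c\<in>set as. c \<noteq> 0" using a_nz by (auto simp: as_def)
 have bs0: "\<forall>c\<in>set bs1. c \<noteq> 0" using b_nz by (auto simp: bs1_def bs_def)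
 have e1: "opr shf as (%m. ?r powi m * ?\<beta> m) (m - 1) = ?r powi (m - 1) * ((\<Prod>c\<leftarrow>as. - (c / ?r)) * opr (%z. Q * z) (map (%c. ?r / c) as) (bi i) x0)"
  using inv[OF as0, of "m - int n"] n1 by (subst opr_twist[OF r]) (simp add: x0_def of_nat_diff)
 have e2: "opr shf bs1 (%m. ?r powi m * ?\<beta> m) m = ?r powi m * ((\<Prod>c\<leftarrow>bs1. - (c / ?r)) * opr (%z. Q * z) (map (%c. ?r / c) bs1) (bi i) x0)"
  using inv[OF bs0, of "m - int n"] by (subst opr_twist[OF r]) (simp add: x0_def)
 \<comment> \<open>The parameter a_i / a_i = 1 supplies the factor 1 - sigma; the others are those
   of \<open>Bsi i\<close> divided by q.\<close>
 have l1: "opr (%z. Q * z) (map (%c. ?r / c) as) (bi i) x0 = opr (%z. Q * z) (1 # map (%b. b / Q) (Bsi i)) (bi i) x0"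
 proof (rule opr_mset)
  have "mset [1..<n] = add_mset i (mset (filter (%l. l \<noteq> i) [1..<n]))"
  proof -
   have "mset [1..<n] = mset (i # filter (%l. l \<noteq> i) [1..<n])"
    by (rule set_eq_iff_mset_eq_distinct[THEN iffD1]) (use i in auto)
   thus ?thesis by simp
  qed
  hence "image_mset (%l. ?r / a l) (mset [1..<n]) = image_mset (%l. ?r / a l) (add_mset i (mset (filter (%l. l \<noteq> i) [1..<n])))" by simp
  thus "mset (map (%c. ?r / c) as) = mset (1 # map (%b. b / Q) (Bsi i))"
   using r by (simp add: as_def Bsi_def o_def multiset.map_comp)
 qed
 have l2: "map (%c. ?r / c) bs1 = Asi i" by (simp add: bs1_def bs_def Asi_def)
 have eq: "opr (%z. Q * z) (1 # map (%b. b / Q) (Bsi i)) (bi i) x0 = x0 * opr (%z. Q * z) (Asi i) (bi i) x0"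
  unfolding bi_def by (rule ph_equation[OF Bsi_ok[OF i] x0, symmetric])
 have p: "(\<Prod>c\<leftarrow>cs. - (c / ?r)) = (\<Prod>c\<leftarrow>cs. - c) / ?r ^ length cs" for cs
  using r by (induction cs) (auto simp: field_simps)
 have gen: "A * (R1 * (P1 * (x * Z))) = R * (P2 * Z)" if "A * (R1 * (P1 * x)) = R * P2" for A R1 P1 x Z R P2 :: complex
 proof -
  have "A * (R1 * (P1 * (x * Z))) = (A * (R1 * (P1 * x))) * Z" by simp
  thus ?thesis using that by simp
 qed
 have "1 / (- c * t) * Q powi (1 - m) * (?r powi (m - 1) * ((\<Prod>c\<leftarrow>as. - (c / ?r)) * x0)) =
  ?r powi m * (\<Prod>c\<leftarrow>bs1. - (c / ?r))"
 proof -
  have "Q powi (1 - m) * Q powi (m - int n) = Q powi (1 - int n)"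
   by (simp flip: power_int_add)
  hence q1: "Q powi (1 - m) * Q powi (m - int n) = 1 / Q ^ (n - 1)" by (simp only: Q_powi_1n)
  have r1: "?r powi (m - 1) = ?r powi m / ?r" using r by (simp add: power_int_diff)
  have "1 / (- c * t) * Q powi (1 - m) * (?r powi (m - 1) * ((\<Prod>c\<leftarrow>as. - (c / ?r)) * x0)) =
   1 / (- c) * (?r powi m / ?r * ((-1) ^ (n - 1) * PA / ?r ^ (n - 1))) * (Q powi (1 - m) * Q powi (m - int n))"
   using t by (simp add: x0_def r1 p prod_neg_as)
  also have "\<dots> = ?r powi m * ((-1) ^ n * PB / Q ^ (n - 1) / ?r ^ n)"
   unfolding q1 power_n[of "-1"] power_n[of ?r] using PA_nz PB_nz r by (simp add: c_def field_simps)
  finally show ?thesis by (simp add: p prod_neg_bs1)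
 qed
 thus "1 / (- c * t) * Q powi (1 - m) * opr shf as (%m. ?r powi m * ?\<beta> m) (m - 1) = opr shf bs1 (%m. ?r powi m * ?\<beta> m) m"
  unfolding e1 e2 l1 l2 eq by (rule gen)
qed

text \<open>The coefficients after solving for the term of lowest index; the normalisation makes
  \<open>kap 0 = -1\<close> and \<open>kap' 0 = 1\<close>, so that q^M - 1/t stands in
  front.\<close>

definition kap where "kap j = - coeff (pc bs1) (n - j) / coeff (pc bs1) n"
definition kap' where "kap' j = - (Q powi (1 - int n) / c) * (if j \<le> n - 1 then coeff (pc as) (n - 1 - j) else 0) / coeff (pc bs1) n"

definition RecS :: "complex \<Rightarrow> (int \<Rightarrow> complex) \<Rightarrow> bool" where
 "RecS t x \<longleftrightarrow> (\<forall>M. (Q powi M - 1 / t) * x M = (\<Sum>j=1..n. (kap j * Q powi M + kap' j / t) * x (M + int j)))"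

lemma pb_n: "coeff (pc bs1) n = (-1) ^ n * PB / Q ^ (n - 1)"
 using coeff_pc_length[of bs1] by (simp add: prod_neg_bs1)
lemma pa_n: "coeff (pc as) (n - 1) = (-1) ^ (n - 1) * PA"
 using coeff_pc_length[of as] by (simp add: prod_neg_as)
lemma pb_nz: "coeff (pc bs1) n \<noteq> 0" by (simp add: pb_n PB_nz)
lemma kap_0: "kap 0 = -1" using pb_nz by (simp add: kap_def)
lemma kap'_0: "kap' 0 = 1"
proof -
 show ?thesis unfolding kap'_def pb_n Q_powi_1n power_n[of "-1"] using pa_n PA_nz PB_nz
  by (simp add: c_def field_simps)
qed

lemma Rec_iff_RecS: assumes t: "t \<noteq> 0" shows "Rec (- c * t) x \<longleftrightarrow> RecS t x"
proof -
 let ?pa = "%j. if j \<le> n - 1 then coeff (pc as) (n - 1 - j) else 0"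
 define P where "P = coeff (pc bs1) n"
 have P: "P \<noteq> 0" using pb_nz by (simp add: P_def)
 have key: "1 / (- c * t) * Q powi (1 - (M + int n)) * opr shf as x (M + int n - 1) = opr shf bs1 x (M + int n)
  \<longleftrightarrow> (Q powi M - 1 / t) * x M = (\<Sum>j=1..n. (kap j * Q powi M + kap' j / t) * x (M + int j))" for M
 proof -
  have A: "opr shf as x (M + int n - 1) = (\<Sum>j\<le>n. ?pa j * x (M + int j))"
  proof -
   have "opr shf as x (M + int n - 1) = (\<Sum>j\<le>n-1. coeff (pc as) j * x (M + int n - 1 - int j))"
    by (simp add: opr_eq_sum funpow_shift)
   also have "\<dots> = (\<Sum>j\<le>n-1. coeff (pc as) (n - 1 - j) * x (M + int j))"
    by (rule sum.reindex_bij_witness[of _ "%j. n - 1 - j" "%j. n - 1 - j"]) (use n1 in \<open>auto simp: of_nat_diff algebra_simps\<close>)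
   also have "\<dots> = (\<Sum>j\<le>n. ?pa j * x (M + int j))"
    by (rule sum.mono_neutral_cong_left) auto
   finally show ?thesis .
  qed
  have B: "opr shf bs1 x (M + int n) = (\<Sum>j\<le>n. coeff (pc bs1) (n - j) * x (M + int j))"
  proof -
   have "opr shf bs1 x (M + int n) = (\<Sum>j\<le>n. coeff (pc bs1) j * x (M + int n - int j))"
    by (simp add: opr_eq_sum funpow_shift)
   also have "\<dots> = (\<Sum>j\<le>n. coeff (pc bs1) (n - j) * x (M + int j))"
    by (rule sum.reindex_bij_witness[of _ "%j. n - j" "%j. n - j"]) (auto simp: of_nat_diff algebra_simps)
   finally show ?thesis .
  qed
  have q: "Q powi (1 - (M + int n)) = Q powi (1 - int n) / Q powi M"
   by (simp flip: power_int_diff add: algebra_simps)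
  have A': "1 / (- c * t) * Q powi (1 - (M + int n)) * opr shf as x (M + int n - 1) = P / Q powi M * (\<Sum>j\<le>n. kap' j / t * x (M + int j))"
   unfolding A q sum_distrib_left
   by (rule sum.cong) (use P t c_nz in \<open>auto simp: kap'_def P_def[symmetric]\<close>)
  have B': "opr shf bs1 x (M + int n) = P / Q powi M * (\<Sum>j\<le>n. - kap j * Q powi M * x (M + int j))"
   unfolding B sum_distrib_left
   by (rule sum.cong) (use P in \<open>auto simp: kap_def P_def[symmetric]\<close>)
  have nzc: "P / Q powi M \<noteq> 0" using P by simp
  have "1 / (- c * t) * Q powi (1 - (M + int n)) * opr shf as x (M + int n - 1) = opr shf bs1 x (M + int n)
   \<longleftrightarrow> (\<Sum>j\<le>n. kap' j / t * x (M + int j)) = (\<Sum>j\<le>n. - kap j * Q powi M * x (M + int j))"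
   unfolding A' B' by (simp only: mult_cancel_left nzc simp_thms)
  also have "\<dots> \<longleftrightarrow> (\<Sum>j\<le>n. (kap j * Q powi M + kap' j / t) * x (M + int j)) = 0"
  proof -
   have "(\<Sum>j\<le>n. (kap j * Q powi M + kap' j / t) * x (M + int j)) =
    (\<Sum>j\<le>n. kap' j / t * x (M + int j)) - (\<Sum>j\<le>n. - kap j * Q powi M * x (M + int j))"
    unfolding sum_subtractf[symmetric] by (rule sum.cong[OF refl]) (simp add: distrib_right)
   thus ?thesis by (simp only: right_minus_eq)
  qed
  also have "(\<Sum>j\<le>n. (kap j * Q powi M + kap' j / t) * x (M + int j)) =
   - (Q powi M - 1 / t) * x M + (\<Sum>j=1..n. (kap j * Q powi M + kap' j / t) * x (M + int j))"
  proof -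
   have "{..n} = insert 0 {1..n}" by auto
   thus ?thesis by (simp add: kap_0 kap'_0)
  qed
  also have "- (Q powi M - 1 / t) * x M + (\<Sum>j=1..n. (kap j * Q powi M + kap' j / t) * x (M + int j)) = 0
   \<longleftrightarrow> (Q powi M - 1 / t) * x M = (\<Sum>j=1..n. (kap j * Q powi M + kap' j / t) * x (M + int j))"
  proof -
   have "- u + s = 0 \<longleftrightarrow> u = s" for u s :: complex by (simp add: add_eq_0_iff) auto
   thus ?thesis by (simp only: minus_mult_left[symmetric])
  qed
  finally show ?thesis .
 qed
 show ?thesis
 proof
  assume "Rec (- c * t) x"
  thus "RecS t x" unfolding RecS_def Rec_def using key by auto
 next
  assume R: "RecS t x"
  show "Rec (- c * t) x" unfolding Rec_def
  proof
   fix m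
   show "1 / (- c * t) * Q powi (1 - m) * opr shf as x (m - 1) = opr shf bs1 x m"
    using key[of "m - int n"] R by (simp add: RecS_def)
  qed
 qed
qed

end

declare sum.cong [fundef_cong]

text \<open>The recursion \<open>RecS 1\<close> at M = -k, started with 1 at index 0 and 0 at
  positive indices. The coefficient functions are arguments because scaling the a_l later changes
  \<open>kap'\<close>.\<close>

fun sqn :: "real \<Rightarrow> nat \<Rightarrow> (nat \<Rightarrow> complex) \<Rightarrow> (nat \<Rightarrow> complex) \<Rightarrow> nat \<Rightarrow> complex" where
 "sqn q n k1 k2 k = (if k = 0 then 1 else
  (\<Sum>i<k. (if k - i \<le> n then k1 (k - i) * of_real q powi (- int k) + k2 (k - i) else 0) * sqn q n k1 k2 i)
   / (of_real q powi (- int k) - 1))"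

declare sqn.simps [simp del]

context qconf begin

definition sseq :: "int \<Rightarrow> complex" where
 "sseq m = (if m \<le> 0 then sqn q n kap kap' (nat (- m)) else 0)"

lemma sqn_0 [simp]: "sqn q n k1 k2 0 = 1" by (simp add: sqn.simps)
lemma sseq_0 [simp]: "sseq 0 = 1" by (simp add: sseq_def)
lemma sseq_pos: "m > 0 ==> sseq m = 0" by (simp add: sseq_def)

lemma Qpowi_ne1: "k > 0 ==> Q powi (- int k) \<noteq> 1"
 using Q_pow_ne1[of k] by (simp add: power_int_minus)

lemma tail_sum:
 fixes x :: "int \<Rightarrow> complex"
 assumes "\<And>m. m > 0 ==> x m = 0" "k > 0"
 shows "(\<Sum>j=1..n. f j * x (- int k + int j)) = (\<Sum>i<k. (if k - i \<le> n then f (k - i) else 0) * x (- int i))"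
proof -
 have "(\<Sum>j=1..n. f j * x (- int k + int j)) = (\<Sum>j\<in>{1..n} \<inter> {1..k}. f j * x (- int k + int j))"
  by (rule sum.mono_neutral_right) (use assms in auto)
 also have "\<dots> = (\<Sum>j\<in>{1..k}. (if j \<le> n then f j else 0) * x (- int k + int j))"
  by (rule sum.mono_neutral_cong_left) auto
 also have "\<dots> = (\<Sum>i<k. (if k - i \<le> n then f (k - i) else 0) * x (- int i))"
  by (rule sum.reindex_bij_witness[of _ "%i. k - i" "%j. k - j"]) (auto simp: of_nat_diff)
 finally show ?thesis .
qed

lemma sseq_RecS: "RecS 1 sseq"
 unfolding RecS_def
proof
 fix M :: int
 consider "M > 0" | "M = 0" | "M < 0" by linarith
 thus "(Q powi M - 1 / 1) * sseq M = (\<Sum>j=1..n. (kap j * Q powi M + kap' j / 1) * sseq (M + int j))"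
 proof cases
  case 3
  define k where "k = nat (- M)"
  have M: "M = - int k" "k > 0" using 3 by (auto simp: k_def)
  have "(\<Sum>j=1..n. (kap j * Q powi M + kap' j / 1) * sseq (M + int j)) =
   (\<Sum>i<k. (if k - i \<le> n then (kap (k - i) * Q powi M + kap' (k - i) / 1) else 0) * sseq (- int i))"
   unfolding M(1) by (rule tail_sum[OF sseq_pos M(2)])
  also have "\<dots> = (\<Sum>i<k. (if k - i \<le> n then kap (k - i) * Q powi (- int k) + kap' (k - i) else 0) * sqn q n kap kap' i)"
   by (simp add: M(1) sseq_def cong: if_cong)
  also have "\<dots> = (Q powi (- int k) - 1) * sqn q n kap kap' k"
   using Qpowi_ne1[OF M(2)] M(2) by (simp add: sqn.simps[of q n kap kap' k])
  finally show ?thesis by (simp add: M(1) sseq_def)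
 qed (auto simp: sseq_pos)
qed

text \<open>At t = 1 the leading coefficient vanishes only at M = 0, so only the value at 0 is free
  once the positive indices carry 0.\<close>

lemma RecS_unique:
 assumes x: "RecS 1 x" "\<And>m. m > 0 ==> x m = 0"
 shows "x m = x 0 * sseq m"
proof -
 have "x (- int k) = x 0 * sseq (- int k)" for k
 proof (induction k rule: less_induct)
  case (less k)
  show ?case
  proof (cases "k = 0")
   case False
   hence k: "k > 0" by simp
   let ?f = "%j. kap j * Q powi (- int k) + kap' j / 1"
   have "(Q powi (- int k) - 1 / 1) * x (- int k) = (\<Sum>j=1..n. ?f j * x (- int k + int j))"
    using x(1) by (simp only: RecS_def)
   also have "\<dots> = (\<Sum>i<k. (if k - i \<le> n then ?f (k - i) else 0) * x (- int i))"
    by (rule tail_sum[OF x(2) k])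
   also have "\<dots> = x 0 * (\<Sum>i<k. (if k - i \<le> n then ?f (k - i) else 0) * sseq (- int i))"
    unfolding sum_distrib_left by (rule sum.cong) (auto simp: less)
   also have "(\<Sum>i<k. (if k - i \<le> n then ?f (k - i) else 0) * sseq (- int i)) = (\<Sum>j=1..n. ?f j * sseq (- int k + int j))"
    by (rule tail_sum[OF sseq_pos k, symmetric])
   also have "\<dots> = (Q powi (- int k) - 1 / 1) * sseq (- int k)"
    using sseq_RecS by (simp only: RecS_def)
   finally have "(Q powi (- int k) - 1) * x (- int k) = (Q powi (- int k) - 1) * (x 0 * sseq (- int k))" by simp
   thus ?thesis using Qpowi_ne1[OF k] by (metis mult_cancel_left right_minus_eq)
  qed simp
 qed
 from this[of "nat (- m)"] show ?thesis using x(2)[of m] sseq_pos[of m] by (cases "m \<le> 0") auto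
qed

text \<open>With P = q^(-k) the numerator grows at most like P A^(k-1), and the denominator P - 1 is
  at least P (1 - q). The quotient gains one factor \<open>A\<close> per step.\<close>

lemma sqn_bound:
 assumes A: "(\<Sum>j=1..n. norm (k1 j) + norm (k2 j)) / (1 - q) \<le> A" "1 \<le> A"
 shows "norm (sqn q n k1 k2 k) \<le> A ^ k"
proof (induction k rule: less_induct)
 case (less k)
 show ?case
 proof (cases "k = 0")
  case False
  hence k: "k > 0" by simp
  define P where "P = q powi (- int k)"
  have P1: "P \<ge> 1" unfolding P_def power_int_minus using q0 qpow_le1[of k] by (simp add: one_le_inverse)
  have qk: "q ^ k \<le> q" using q0 q1 k by (simp add: power_le_one_iff power_decreasing[of 1 k q, simplified])
  have "P * (1 - q) \<le> P * (1 - q ^ k)" using qk P1 by (intro mult_left_mono) auto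
  also have "P * (1 - q ^ k) = P - 1" using q0 by (simp add: P_def power_int_minus field_simps)
  finally have den: "P * (1 - q) \<le> P - 1" .
  have nden: "norm (Q powi (- int k) - 1) = P - 1"
  proof -
   have "Q powi (- int k) - 1 = of_real (P - 1)" by (simp add: P_def)
   thus ?thesis using P1 by (simp only: norm_of_real)
  qed
  let ?g = "%i. (if k - i \<le> n then k1 (k - i) * Q powi (- int k) + k2 (k - i) else 0)"
  have "norm (\<Sum>i<k. ?g i * sqn q n k1 k2 i) \<le> (\<Sum>i<k. (if k - i \<le> n then norm (k1 (k - i)) + norm (k2 (k - i)) else 0) * (P * A ^ (k - 1)))"
  proof (intro sum_norm_le)
   fix i assume "i \<in> {..<k}"
   hence i: "i < k" by simp
   have s: "norm (sqn q n k1 k2 i) \<le> A ^ (k - 1)"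
    using less[OF i] power_increasing[of i "k - 1" A] A i by linarith
   have "norm (k1 (k - i) * Q powi (- int k) + k2 (k - i)) \<le> norm (k1 (k - i)) * P + norm (k2 (k - i)) * 1"
    using norm_triangle_ineq[of "k1 (k - i) * Q powi (- int k)" "k2 (k - i)"] q0 by (simp add: norm_mult norm_power_int P_def)
   also have "\<dots> \<le> norm (k1 (k - i)) * P + norm (k2 (k - i)) * P" using P1 by (intro add_left_mono mult_left_mono) auto
   finally have g: "norm (?g i) \<le> (if k - i \<le> n then norm (k1 (k - i)) + norm (k2 (k - i)) else 0) * P" by (simp add: distrib_right)
   have "norm (?g i * sqn q n k1 k2 i) \<le> ((if k - i \<le> n then norm (k1 (k - i)) + norm (k2 (k - i)) else 0) * P) * A ^ (k - 1)"
    unfolding norm_mult using P1 by (intro mult_mono g s) auto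
   thus "norm (?g i * sqn q n k1 k2 i) \<le> (if k - i \<le> n then norm (k1 (k - i)) + norm (k2 (k - i)) else 0) * (P * A ^ (k - 1))"
    by (simp add: mult.assoc)
  qed
  also have "\<dots> = (\<Sum>i<k. (if k - i \<le> n then norm (k1 (k - i)) + norm (k2 (k - i)) else 0)) * (P * A ^ (k - 1))"
   by (simp only: sum_distrib_right)
  also have "(\<Sum>i<k. (if k - i \<le> n then norm (k1 (k - i)) + norm (k2 (k - i)) else 0)) = (\<Sum>j\<in>{1..k} \<inter> {..n}. norm (k1 j) + norm (k2 j))"
  proof -
   have "(\<Sum>i<k. (if k - i \<le> n then norm (k1 (k - i)) + norm (k2 (k - i)) else 0)) = (\<Sum>j\<in>{1..k}. if j \<le> n then norm (k1 j) + norm (k2 j) else 0)"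
    by (rule sum.reindex_bij_witness[of _ "%j. k - j" "%i. k - i"]) auto
   also have "\<dots> = (\<Sum>j\<in>{1..k} \<inter> {..n}. norm (k1 j) + norm (k2 j))"
    by (rule sum.mono_neutral_cong_right) auto
   finally show ?thesis .
  qed
  also have "\<dots> * (P * A ^ (k - 1)) \<le> (\<Sum>j=1..n. norm (k1 j) + norm (k2 j)) * (P * A ^ (k - 1))"
   using P1 A by (intro mult_right_mono sum_mono2) auto
  also have "\<dots> \<le> (A * (1 - q)) * (P * A ^ (k - 1))"
   using A P1 q1 by (intro mult_right_mono) (auto simp: field_simps)
  also have "\<dots> = A * A ^ (k - 1) * (P * (1 - q))" by simp
  also have "A * A ^ (k - 1) = A ^ k" using k by (cases k) auto
  finally have "norm (\<Sum>i<k. ?g i * sqn q n k1 k2 i) \<le> A ^ k * (P * (1 - q))" .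
  also have "\<dots> \<le> A ^ k * (P - 1)" using den A by (intro mult_left_mono) auto
  finally have num: "norm (\<Sum>i<k. ?g i * sqn q n k1 k2 i) \<le> A ^ k * (P - 1)" .
  have "P - 1 > 0" using den P1 q1 by (smt (verit) mult_pos_pos)
  thus ?thesis using num False by (subst sqn.simps) (simp add: norm_divide nden field_simps)
 qed simp
qed

lemma sseq_bound:
 assumes A: "(\<Sum>j=1..n. norm (kap j) + norm (kap' j)) / (1 - q) \<le> A" "1 \<le> A"
 shows "norm (sseq m) \<le> 1 * A ^ nat \<bar>m\<bar>"
 using sqn_bound[OF A, of "nat (- m)"] A by (auto simp: sseq_def)

lemma sseq_tempered: "tempered sseq"
 unfolding tempered_def
 by (rule exI[of _ 1], rule exI[of _ "max 1 ((\<Sum>j=1..n. norm (kap j) + norm (kap' j)) / (1 - q))"])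
  (use sseq_bound[of "max 1 ((\<Sum>j=1..n. norm (kap j) + norm (kap' j)) / (1 - q))"] in auto)

text \<open>The weight \<open>w 0\<close> of the first partial fraction of \<open>bi i\<close>,
  hence its residue at 1 in the sense of \<open>resseq\<close>.\<close>

definition Gam where "Gam i = (\<Prod>x\<leftarrow>Asi i. qi x) / (qi Q * (\<Prod>x\<leftarrow>Bsi i. qi x))"

lemma bi_data:
 assumes i: "i \<in> {1..<n}"
 obtains k0 w where "summable (%j. norm (w j))" "w 0 = Gam i"
  "\<And>t m. t \<notin> qZ q ==> bi i (t * Q powi m) = pfun k0 (hcoef (Asi i) (Bsi i)) w (t * Q powi m)"
 using ph_pfun[OF Bsi_ok[OF i], of "Asi i"] orbit_notin unfolding bi_def Gam_def by metis

lemma bi_tempered: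
 assumes i: "i \<in> {1..<n}" and t: "t \<noteq> 0" "t \<notin> qZ q"
 shows "tempered (%m. bi i (t * Q powi m))"
proof -
 obtain k0 w where w: "summable (%j. norm (w j))" 
  "\<And>t m. t \<notin> qZ q ==> bi i (t * Q powi m) = pfun k0 (hcoef (Asi i) (Bsi i)) w (t * Q powi m)"
  using bi_data[OF i] by metis
 show ?thesis using pfun_orbit_tempered[OF w(1) t] by (simp add: w(2)[OF t(2)])
qed

lemma bi_RecS:
 assumes i: "i \<in> {1..<n}" and t: "t \<noteq> 0" "t \<notin> qZ q"
 shows "RecS t (%m. a i powi m * bi i (t * Q powi m))"
 using bi_orbit_Rec[OF assms] Rec_iff_RecS[OF t(1)] by simp

text \<open>Besides \<open>stokes_pfun\<close>, the residue sequence has to be identified.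
  Multiplying \<open>RecS t\<close> by 1 - t and letting t -> 1 shows that the residues, weighted by
  a_i^m, satisfy \<open>RecS 1\<close>. They vanish for m > 0, so they form a multiple of
  \<open>sseq\<close>.\<close>

theorem bi_stokes:
 assumes i: "i \<in> {1..<n}" and t: "t \<noteq> 0" "t \<notin> qZ q" and t': "t' \<noteq> 0" "t' \<notin> qZ q" and y: "y \<noteq> 0"
 shows "psum (bi i) t y * th (t' * y) - psum (bi i) t' y * th (t * y) = stokes t t' * th (t * t' * y) * (Gam i * T sseq (y / a i))"
proof -
 obtain k0 w where w: "summable (%j. norm (w j))" "w 0 = Gam i"
  "\<And>t m. t \<notin> qZ q ==> bi i (t * Q powi m) = pfun k0 (hcoef (Asi i) (Bsi i)) w (t * Q powi m)"
  using bi_data[OF i] by metis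
 let ?p = "pfun k0 (hcoef (Asi i) (Bsi i)) w"
 let ?r = "resseq k0 w"
 have ai: "a i \<noteq> 0" using a_nz i by auto
 have ps: "psum (bi i) t y = psum ?p t y" if "t \<notin> qZ q" for t y
  unfolding psum_def by (simp add: w(3)[OF that])
 have lim: "((%t. (1 - t) * (a i powi m * bi i (t * Q powi m))) \<longlongrightarrow> a i powi m * ?r m) (at 1)" for m
 proof -
  have "((%t. a i powi m * ((1 - t) * ?p (t * Q powi m))) \<longlongrightarrow> a i powi m * ?r m) (at 1)"
   by (intro tendsto_intros resseq_limit w(1))
  moreover have "\<forall>\<^sub>F t in at 1. a i powi m * ((1 - t) * ?p (t * Q powi m)) = (1 - t) * (a i powi m * bi i (t * Q powi m))"
   using qZ_discrete[of 1, simplified] by eventually_elim (simp add: w(3))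
  ultimately show ?thesis by (rule Lim_transform_eventually)
 qed
 have "RecS 1 (%m. a i powi m * ?r m)"
  unfolding RecS_def
 proof
  fix M
  let ?x = "%t m. a i powi m * bi i (t * Q powi m)"
  have l1: "((%t. (Q powi M - 1 / t) * ((1 - t) * ?x t M)) \<longlongrightarrow> (Q powi M - 1 / 1) * (a i powi M * ?r M)) (at 1)"
   by (intro tendsto_intros lim) auto
  have l2: "((%t. \<Sum>j=1..n. (kap j * Q powi M + kap' j / t) * ((1 - t) * ?x t (M + int j))) \<longlongrightarrow>
   (\<Sum>j=1..n. (kap j * Q powi M + kap' j / 1) * (a i powi (M + int j) * ?r (M + int j)))) (at 1)"
   by (intro tendsto_intros lim) auto
  have "\<forall>\<^sub>F t in at 1. (Q powi M - 1 / t) * ((1 - t) * ?x t M) = (\<Sum>j=1..n. (kap j * Q powi M + kap' j / t) * ((1 - t) * ?x t (M + int j)))"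
   using qZ_discrete[of 1, simplified] tendsto_imp_eventually_ne[OF tendsto_ident_at[of "1::complex"], of 0, simplified]
  proof eventually_elim
   case (elim t)
   have "(Q powi M - 1 / t) * ?x t M = (\<Sum>j=1..n. (kap j * Q powi M + kap' j / t) * ?x t (M + int j))"
    using bi_RecS[OF i elim(2,1)] by (simp only: RecS_def)
   hence "(1 - t) * ((Q powi M - 1 / t) * ?x t M) = (\<Sum>j=1..n. (1 - t) * ((kap j * Q powi M + kap' j / t) * ?x t (M + int j)))"
    by (simp only: sum_distrib_left)
   thus ?case by (simp only: mult.left_commute)
  qed
  from tendsto_cong[OF this] l1 have "((%t. \<Sum>j=1..n. (kap j * Q powi M + kap' j / t) * ((1 - t) * ?x t (M + int j))) \<longlongrightarrow> (Q powi M - 1 / 1) * (a i powi M * ?r M)) (at 1)" by simp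
  with l2 show "(Q powi M - 1 / 1) * (a i powi M * ?r M) = (\<Sum>j=1..n. (kap j * Q powi M + kap' j / 1) * (a i powi (M + int j) * ?r (M + int j)))"
   using tendsto_unique[OF at_neq_bot] by blast
 qed
 hence "a i powi m * ?r m = a i powi 0 * ?r 0 * sseq m" for m
  by (rule RecS_unique) (simp add: resseq_def)
 hence rm: "?r m = (1 / a i) powi m * (Gam i * sseq m)" for m
  using ai by (simp add: resseq_def w(2) power_int_divide_distrib field_simps)
 have "T ?r y = T (%m. (1 / a i) powi m * (Gam i * sseq m)) y" using rm by (intro arg_cong2[where f = T] ext) auto
 also have "\<dots> = Gam i * T sseq (1 / a i * y)" by (simp only: T_scale T_cmult)
 finally have Tr: "T ?r y = Gam i * T sseq (y / a i)" by simp
 show ?thesis unfolding ps[OF t(2)] ps[OF t'(2)]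
  using stokes_pfun[OF w(1) t t' y] by (simp only: Tr)
qed

end

section \<open>Euler's expansion, partial fractions of its reciprocal, and growth on circles\<close>

context qbase begin

lemma Q_powi_cancel: "Q powi (- int s) * Q ^ s = 1"
proof -
 have "Q powi (- int s) * Q powi (int s) = Q powi (- int s + int s)" by (rule power_int_add[symmetric]) simp
 thus ?thesis by simp
qed

lemma lattice_gap': "y \<notin> q_minusN q ==> \<exists>\<delta>>0. \<forall>l. \<delta> \<le> norm (1 - Q ^ l * y)"
proof -
 assume y: "y \<notin> q_minusN q"
 obtain \<delta> where "\<delta> > 0" "\<And>l. Q ^ l * y \<noteq> 1 ==> 2 * \<delta> \<le> norm (1 - Q ^ l * y)" using lattice_gap[of y] by blast
 moreover have "Q ^ l * y \<noteq> 1" for l using y by (auto simp: q_minusN_iff mult.commute)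
 ultimately show ?thesis by (intro exI[of _ "2 * \<delta>"]) auto
qed

text \<open>Euler's coefficients of the power series of (z; q)_infinity.\<close>

definition ec :: "nat \<Rightarrow> complex" where "ec k = (-1) ^ k * Q ^ (k * (k - 1) div 2) / qp Q k"

lemma ec_0 [simp]: "ec 0 = 1" by (simp add: ec_def)
lemma ec_Suc: "ec (Suc k) * (1 - Q ^ Suc k) = - (Q ^ k) * ec k"
proof -
 have "1 - Q * Q ^ k \<noteq> 0" using Q_pow_ne1[of "Suc k"] by simp
 moreover have "qp Q k \<noteq> 0" by simp
 ultimately show ?thesis unfolding ec_def nat_tri_Suc qp_Suc by (simp add: power_add field_simps)
qed

lemma ec_summable: "summable (%k. norm (ec k * r ^ k))"
proof -
 obtain d where d: "d > 0" "\<And>k. d \<le> norm (qp Q k)" using qp_lower[of Q] by auto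
 have s: "summable (%k. q ^ (k * (k - 1) div 2) * norm r ^ k / d)"
  by (intro summable_divide gauss_summable_nat) auto
 show ?thesis
 proof (rule summable_comparison_test'[OF s, of 0])
  fix k
  have "norm (ec k * r ^ k) = q ^ (k * (k - 1) div 2) * norm r ^ k / norm (qp Q k)"
   using q0 by (simp add: ec_def norm_mult norm_divide norm_power)
  also have "\<dots> \<le> q ^ (k * (k - 1) div 2) * norm r ^ k / d"
   using d(1) d(2)[of k] q0 by (intro divide_left_mono mult_nonneg_nonneg mult_pos_pos) auto
  finally show "norm (norm (ec k * r ^ k)) \<le> q ^ (k * (k - 1) div 2) * norm r ^ k / d" by simp
 qed
qed

theorem qi_series: "(%k. ec k * z ^ k) sums qi z"
proof -
 define f where "f = (%z. \<Sum>k. ec k * z ^ k)"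
 have s: "summable (%k. ec k * z ^ k)" for z using ec_summable by (rule summable_norm_cancel)
 have f: "(%k. ec k * z ^ k) sums f z" for z using s by (simp add: f_def summable_sums)
 have fq: "f z = (1 - z) * f (Q * z)" for z
 proof -
  have a: "(%k. ec k * z ^ k - ec k * (Q * z) ^ k) sums (f z - f (Q * z))" by (intro sums_diff f)
  have "(%k. ec (Suc k) * z ^ Suc k - ec (Suc k) * (Q * z) ^ Suc k) sums (f z - f (Q * z))"
   using a by (subst sums_Suc_iff) simp
  moreover have "ec (Suc k) * z ^ Suc k - ec (Suc k) * (Q * z) ^ Suc k = - z * (ec k * (Q * z) ^ k)" for k
  proof -
   have "ec (Suc k) * z ^ Suc k - ec (Suc k) * (Q * z) ^ Suc k = (ec (Suc k) * (1 - Q ^ Suc k)) * z ^ Suc k"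
    by (simp add: power_mult_distrib algebra_simps)
   thus ?thesis unfolding ec_Suc by (simp add: power_mult_distrib)
  qed
  ultimately have "(%k. - z * (ec k * (Q * z) ^ k)) sums (f z - f (Q * z))" by simp
  moreover have "(%k. - z * (ec k * (Q * z) ^ k)) sums (- z * f (Q * z))" by (intro sums_mult f)
  ultimately have "f z - f (Q * z) = - z * f (Q * z)" by (rule sums_unique2)
  thus ?thesis by (simp add: algebra_simps)
 qed
 have fk: "f z = qp z k * f (z * Q ^ k)" for k
 proof (induction k)
  case (Suc k)
  have "f (z * Q ^ k) = (1 - z * Q ^ k) * f (z * Q ^ Suc k)" using fq[of "z * Q ^ k"] by (simp add: mult_ac)
  thus ?case using Suc by (simp add: qp_Suc)
 qed simp
 have c: "isCont f 0" unfolding f_def by (rule isCont_powser[of _ 1]) (use s[of 1] in auto)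
 have "(%k. f (z * Q ^ k)) \<longlonglongrightarrow> f 0"
  by (rule isCont_tendsto_compose[OF c]) (intro tendsto_mult_right_zero Qpow_to_0)
 hence "(%k. qp z k * f (z * Q ^ k)) \<longlonglongrightarrow> qi z * f 0" by (intro tendsto_intros qp_lim)
 hence "(%k. f z) \<longlonglongrightarrow> qi z * f 0" using fk by simp
 hence "f z = qi z * f 0" by (simp add: LIMSEQ_const_iff)
 moreover have "f 0 = 1" using f[of 0] by (simp add: powser_zero f_def)
 ultimately show ?thesis using f[of z] by simp
qed

lemma qi_powi_zero: "m \<le> 0 ==> qi (Q powi m) = 0"
 unfolding qi_eq_0_iff using Q_powi_cancel[of "nat (- m)"] by (intro exI[of _ "nat (-m)"]) simp

text \<open>The partial fraction expansion of (q; q)_infinity / (y; q)_infinity. Two linear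
  relations with the auxiliary series \<open>?h\<close>, one from cancelling denominators and one
  from the recursion of \<open>ec\<close>, eliminate \<open>?h\<close> and leave the first-order
  equation treated by \<open>qfun_eq\<close>.\<close>

lemma PS_ec_base: assumes y: "y \<notin> q_minusN q" shows "qi y * PS (%k. ec k * Q ^ k) y = qi Q"
proof -
 let ?g = "PS (%k. ec k * Q ^ k)" let ?h = "PS (%k. ec k * (Q ^ 2) ^ k)"
 have sm: "summable (%k. ec k * r ^ k / (1 - Q ^ k * y))" if y: "y \<notin> q_minusN q" for r y
 proof -
  obtain \<delta> where d: "\<delta> > 0" "\<And>l. \<delta> \<le> norm (1 - Q ^ l * y)" using lattice_gap'[OF y] by blast
  show ?thesis by (rule summable_norm_cancel, rule PS_bound(1)[OF ec_summable d(1)]) (use d in auto)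
 qed
 have rel: "?g y - y * ?h y = qi Q" if y: "y \<notin> q_minusN q" for y
 proof -
  have "(%k. ec k * Q ^ k / (1 - Q ^ k * y) - y * (ec k * (Q ^ 2) ^ k / (1 - Q ^ k * y))) sums (?g y - y * ?h y)"
   unfolding PS_def by (intro sums_diff sums_mult summable_sums sm y)
  moreover have "ec k * Q ^ k / (1 - Q ^ k * y) - y * (ec k * (Q ^ 2) ^ k / (1 - Q ^ k * y)) = ec k * Q ^ k" for k
  proof -
   have nz: "1 - Q ^ k * y \<noteq> 0" using y by (auto simp: q_minusN_iff mult.commute)
   have e: "(Q ^ 2) ^ k = Q ^ k * Q ^ k" by (simp add: power2_eq_square power_mult_distrib)
   have "ec k * Q ^ k / (1 - Q ^ k * y) - y * (ec k * (Q ^ 2) ^ k / (1 - Q ^ k * y)) = ec k * Q ^ k * (1 - Q ^ k * y) / (1 - Q ^ k * y)"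
    unfolding e by (simp only: times_divide_eq_right diff_divide_distrib[symmetric]) (simp add: algebra_simps)
   thus ?thesis using nz by simp
  qed
  ultimately have "(%k. ec k * Q ^ k) sums (?g y - y * ?h y)" by simp
  thus ?thesis using qi_series[of Q] by (rule sums_unique2)
 qed
 have rel2: "?g y - ?h y = - Q * ?h (Q * y)" if y: "y \<notin> q_minusN q" for y
 proof -
  have y2: "Q * y \<notin> q_minusN q" using q_minusN_mult[OF y, of 1] by (simp add: mult.commute)
  let ?f = "%k. ec k * Q ^ k / (1 - Q ^ k * y) - ec k * (Q ^ 2) ^ k / (1 - Q ^ k * y)"
  have "?f sums (?g y - ?h y)"
   unfolding PS_def by (intro sums_diff summable_sums sm y)
  hence "(%k. ?f (Suc k)) sums (?g y - ?h y)" by (subst sums_Suc_iff) simp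
  moreover have "?f (Suc k) = - Q * (ec k * (Q ^ 2) ^ k / (1 - Q ^ k * (Q * y)))" for k
  proof -
   have "(Q ^ 2) ^ k = Q ^ k * Q ^ k" for k by (simp add: power2_eq_square power_mult_distrib)
   hence "?f (Suc k) = (ec (Suc k) * (1 - Q ^ Suc k)) * Q ^ Suc k / (1 - Q ^ Suc k * y)"
    by (simp only: diff_divide_distrib[symmetric]) (simp add: algebra_simps)
   also have "\<dots> = - Q * (ec k * (Q ^ k * Q ^ k) / (1 - Q ^ k * (Q * y)))"
    unfolding ec_Suc by (simp add: mult_ac)
   finally show ?thesis by (simp add: power2_eq_square power_mult_distrib)
  qed
  ultimately have "(%k. - Q * (ec k * (Q ^ 2) ^ k / (1 - Q ^ k * (Q * y)))) sums (?g y - ?h y)" by (simp only:)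
  moreover have "(%k. - Q * (ec k * (Q ^ 2) ^ k / (1 - Q ^ k * (Q * y)))) sums (- Q * ?h (Q * y))"
   unfolding PS_def by (intro sums_mult summable_sums sm y2)
  ultimately show ?thesis by (rule sums_unique2)
 qed
 have step: "?g (Q * y) = (1 - y) * ?g y" if y: "y \<notin> q_minusN q" for y
 proof -
  have y2: "Q * y \<notin> q_minusN q" using q_minusN_mult[OF y, of 1] by (simp add: mult.commute)
  have "y * (?g y - ?h y) = - (Q * y * ?h (Q * y))" using rel2[OF y] by simp
  hence "y * ?g y - y * ?h y = - (?g (Q * y) - qi Q)" using rel[OF y2] by (simp add: algebra_simps)
  thus ?thesis using rel[OF y] by (simp add: algebra_simps)
 qed
 have "isCont ?g 0" by (intro analytic_at_imp_isCont PS_analytic' ec_summable) simp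
 hence "?g 0 = qi y * ?g y"
 proof (rule qfun_eq)
  fix k
  have "?g (Q * (y * Q ^ k)) = (1 - y * Q ^ k) * ?g (y * Q ^ k)" by (rule step[OF q_minusN_mult[OF y]])
  thus "?g (y * Q ^ Suc k) = (1 - y * Q ^ k) * ?g (y * Q ^ k)" by (simp add: mult_ac)
 qed
 moreover have "?g 0 = qi Q" using rel[of 0] by simp
 ultimately show ?thesis by simp
qed

text \<open>Each additional factor y multiplies the weight at the pole q^(-k) by q^(-k). No
  polynomial part appears in the step, since it would be \<open>qi\<close> at a power q^(-s), which
  is 0.\<close>

lemma PS_ec: assumes y: "y \<notin> q_minusN q" shows "PS (%k. ec k * (Q powi (1 - int s)) ^ k) y = y ^ s * qi Q / qi y"
proof (induction s)
 case 0
 have "qi y \<noteq> 0" using y by (rule qi_nz)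
 thus ?case using PS_ec_base[OF y] by (simp add: field_simps)
next
 case (Suc s)
 have sm: "summable (%k. ec k * r ^ k / (1 - Q ^ k * y))" for r
 proof -
  obtain \<delta> where d: "\<delta> > 0" "\<And>l. \<delta> \<le> norm (1 - Q ^ l * y)" using lattice_gap'[OF y] by blast
  show ?thesis by (rule summable_norm_cancel, rule PS_bound(1)[OF ec_summable d(1)]) (use d in auto)
 qed
 let ?A = "Q powi (1 - int (Suc s))" let ?B = "Q powi (1 - int s)"
 have AB: "?B = ?A * Q"
 proof -
  have "Q powi (- int s + 1) = Q powi (- int s) * Q powi 1" by (rule power_int_add) simp
  thus ?thesis by simp
 qed
 have "(%k. ec k * ?A ^ k / (1 - Q ^ k * y) - y * (ec k * ?B ^ k / (1 - Q ^ k * y))) sums (PS (%k. ec k * ?A ^ k) y - y * PS (%k. ec k * ?B ^ k) y)"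
  unfolding PS_def by (intro sums_diff sums_mult summable_sums sm)
 moreover have "ec k * ?A ^ k / (1 - Q ^ k * y) - y * (ec k * ?B ^ k / (1 - Q ^ k * y)) = ec k * ?A ^ k" for k
 proof -
  have nz: "1 - Q ^ k * y \<noteq> 0" using y by (auto simp: q_minusN_iff mult.commute)
  have "ec k * ?A ^ k / (1 - Q ^ k * y) - y * (ec k * ?B ^ k / (1 - Q ^ k * y)) = ec k * ?A ^ k * (1 - Q ^ k * y) / (1 - Q ^ k * y)"
   unfolding AB power_mult_distrib by (simp only: times_divide_eq_right diff_divide_distrib[symmetric]) (simp add: algebra_simps)
  thus ?thesis using nz by simp
 qed
 ultimately have "(%k. ec k * ?A ^ k) sums (PS (%k. ec k * ?A ^ k) y - y * PS (%k. ec k * ?B ^ k) y)" by (simp only:)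
 hence "qi ?A = PS (%k. ec k * ?A ^ k) y - y * PS (%k. ec k * ?B ^ k) y" using qi_series sums_unique2 by blast
 moreover have "qi ?A = 0" by (rule qi_powi_zero) simp
 ultimately show ?case using Suc by simp
qed

lemma qp_backward: "x \<noteq> 0 ==> qp (x / Q ^ l) l = (- x) ^ l * qp (Q / x) l / Q powi tri (- int l)"
 using qp_reverse[of "- x" l] by (simp add: field_simps)

text \<open>Cauchy's estimates need the bound only on some circles of radius tending to infinity;
  this permits circles that avoid poles.\<close>

lemma entire_polynomial_growth:
 assumes h: "h holomorphic_on UNIV" and R: "filterlim R at_top sequentially"
  and bd: "\<And>k x. norm x = R k ==> norm (h x) \<le> C * (1 + R k) ^ p"
 shows "\<exists>\<alpha>. \<forall>x. h x = (\<Sum>j\<le>p. \<alpha> j * x ^ j)"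
proof -
 have dz: "(deriv ^^ j) h 0 = 0" if j: "j > p" for j
 proof -
  have ev: "\<forall>\<^sub>F k in sequentially. R k \<ge> 1" using R by (simp add: filterlim_at_top)
  have "\<forall>\<^sub>F k in sequentially. norm ((deriv ^^ j) h 0) \<le> fact j * \<bar>C\<bar> * 2 ^ p / R k"
   using ev
  proof eventually_elim
   case (elim k)
   have R0: "R k > 0" using elim by simp
   have "norm ((deriv ^^ j) h 0) \<le> fact j * (\<bar>C\<bar> * (2 * R k) ^ p) / R k ^ j"
   proof (rule Cauchy_inequality)
    show "h holomorphic_on ball 0 (R k)" using h by (rule holomorphic_on_subset) auto
    show "continuous_on (cball 0 (R k)) h" using h by (meson continuous_on_subset holomorphic_on_imp_continuous_on subset_UNIV)
    fix x :: complex assume "norm (0 - x) = R k"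
    hence "norm (h x) \<le> C * (1 + R k) ^ p" using bd[of x k] by simp
    also have "\<dots> \<le> \<bar>C\<bar> * (2 * R k) ^ p" using elim by (intro mult_mono power_mono) auto
    finally show "norm (h x) \<le> \<bar>C\<bar> * (2 * R k) ^ p" .
   qed (use R0 in auto)
   also have "\<dots> = fact j * \<bar>C\<bar> * 2 ^ p * (R k ^ p / R k ^ j)" by (simp add: power_mult_distrib)
   also have "R k ^ p / R k ^ j \<le> 1 / R k"
   proof -
    have "R k ^ Suc p \<le> R k ^ j" using elim j by (intro power_increasing) auto
    thus ?thesis using R0 by (simp add: field_simps)
   qed
   finally show ?case by (simp add: mult_left_mono)
  qed
  moreover have "(%k. fact j * \<bar>C\<bar> * 2 ^ p / R k) \<longlonglongrightarrow> 0"
   by (rule tendsto_divide_0[OF tendsto_const]) (use R in \<open>simp add: filterlim_at_top_imp_at_infinity\<close>)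
  ultimately have "norm ((deriv ^^ j) h 0) \<le> 0"
   by (intro tendsto_lowerbound[of _ 0 sequentially]) auto
  thus ?thesis by simp
 qed
 have "h x = (\<Sum>j\<le>p. (deriv ^^ j) h 0 / fact j * x ^ j)" for x
 proof -
  have "(%j. (deriv ^^ j) h 0 / fact j * (x - 0) ^ j) sums h x"
   by (rule holomorphic_power_series[of h 0 "norm x + 1"]) (use h in \<open>auto intro: holomorphic_on_subset\<close>)
  moreover have "(%j. (deriv ^^ j) h 0 / fact j * (x - 0) ^ j) sums (\<Sum>j\<le>p. (deriv ^^ j) h 0 / fact j * (x - 0) ^ j)"
   by (rule sums_finite) (use dz in auto)
  ultimately show ?thesis using sums_unique2 by fastforce
 qed
 thus ?thesis by (intro exI[of _ "%j. (deriv ^^ j) h 0 / fact j"]) auto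
qed

text \<open>On the circles of radius rho q^(-k) each of the k factors is bounded by a common K. The
  denominator is estimated by its modulus alone, so the gap needed is that of the real number rho
  |a| from q^Z. Note that K^k is polynomial in the radius.\<close>

lemma qp_ratio_bound:
 assumes a: "a \<noteq> 0" and \<rho>: "\<rho> > 0" and gen: "\<And>m. \<rho> * norm a \<noteq> q powi m"
 shows "\<exists>K\<ge>1. \<forall>k x. norm x = \<rho> / q ^ k \<longrightarrow> norm (qp (b * x) k / qp (a * x) k) \<le> K ^ k"
proof -
 define u0 where "u0 = complex_of_real (\<rho> * norm a)"
 have u0: "u0 \<noteq> 0" "u0 \<notin> qZ q"
 proof -
  show "u0 \<noteq> 0" using a \<rho> by (simp add: u0_def)
  have "u0 \<noteq> Q powi m" for m
  proof
   assume "u0 = Q powi m"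
   hence "complex_of_real (\<rho> * norm a) = of_real (q powi m)" by (simp add: u0_def)
   thus False using gen[of m] by (simp only: of_real_eq_iff)
  qed
  thus "u0 \<notin> qZ q" by (auto simp: qZ_def)
 qed
 have u1: "1 / u0 \<noteq> 0" "1 / u0 \<notin> qZ q" using u0 qZ_inverse[of "1 / u0"] by auto
 obtain \<delta> where d: "\<delta> > 0" "\<And>m. \<delta> \<le> norm (1 - 1 / u0 * Q powi m)" using lattice_gap_int[OF u1] by blast
 define K where "K = max 1 ((1 / \<rho> + norm b) / (norm a * \<delta>))"
 have "norm (qp (b * x) k / qp (a * x) k) \<le> K ^ k" if x: "norm x = \<rho> / q ^ k" for k x
 proof -
  have "norm (qp (b * x) k / qp (a * x) k) = (\<Prod>j<k. norm (1 - b * x * Q ^ j) / norm (1 - a * x * Q ^ j))"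
   by (simp add: qpoch_def norm_divide prod_norm prod_dividef)
  also have "\<dots> \<le> (\<Prod>j<k. K)"
  proof (intro prod_mono conjI)
   fix j assume "j \<in> {..<k}"
   hence j: "j < k" by simp
   define u where "u = norm (x * Q ^ j)"
   have u: "u = \<rho> / q ^ (k - j)" using j q0 x by (simp add: u_def norm_mult norm_power power_diff)
   have u\<rho>: "u \<ge> \<rho>" using q0 qpow_le1[of "k - j"] \<rho> by (simp add: u field_simps)
   have upos: "u > 0" using u\<rho> \<rho> by simp
   have "norm (1 - b * x * Q ^ j) \<le> 1 + norm b * u"
    using norm_triangle_ineq4[of 1 "b * x * Q ^ j"] by (simp add: u_def norm_mult mult_ac)
   also have "\<dots> \<le> u * (1 / \<rho> + norm b)" using u\<rho> \<rho> by (simp add: field_simps)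
   finally have num: "norm (1 - b * x * Q ^ j) \<le> u * (1 / \<rho> + norm b)" .
   have "norm a * u * \<delta> \<le> norm a * u * norm (1 - 1 / u0 * Q powi int (k - j))"
    using d(2)[of "int (k - j)"] upos by (intro mult_left_mono) auto
   also have "\<dots> = \<bar>norm a * u - 1\<bar>"
   proof -
    have "1 / u0 * Q powi int (k - j) = of_real (1 / (norm a * u))"
     using q0 \<rho> by (simp add: u0_def u mult.commute)
    hence "norm (1 - 1 / u0 * Q powi int (k - j)) = \<bar>1 - 1 / (norm a * u)\<bar>"
     by (metis (no_types, opaque_lifting) norm_of_real of_real_1 of_real_diff)
    moreover have "norm a * u * \<bar>1 - 1 / (norm a * u)\<bar> = \<bar>norm a * u * (1 - 1 / (norm a * u))\<bar>"
     using upos by (simp add: abs_mult)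
    moreover have "norm a * u * (1 - 1 / (norm a * u)) = norm a * u - 1"
     using upos a by (simp add: field_simps)
    ultimately show ?thesis by simp
   qed
   also have "\<dots> \<le> norm (1 - a * x * Q ^ j)"
    using norm_triangle_ineq3[of "a * x * Q ^ j" 1] by (simp add: u_def norm_mult norm_minus_commute mult_ac)
   finally have den: "norm a * u * \<delta> \<le> norm (1 - a * x * Q ^ j)" .
   have "norm (1 - b * x * Q ^ j) / norm (1 - a * x * Q ^ j) \<le> (u * (1 / \<rho> + norm b)) / (norm a * u * \<delta>)"
    using num den upos a d(1) \<rho> by (intro frac_le) auto
   also have "\<dots> \<le> K" using upos by (simp add: K_def)
   finally show "norm (1 - b * x * Q ^ j) / norm (1 - a * x * Q ^ j) \<le> K" .
  qed auto
  finally show ?thesis by simp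
 qed
 thus ?thesis by (intro exI[of _ K]) (auto simp: K_def)
qed

end

section \<open>The connection formula for generic parameters\<close>

text \<open>The first condition keeps the spiral of 1/c away from the poles of the
  \<open>bi i\<close>; the second makes \<open>AA\<close> finite and free of poles at the points
  q^k.\<close>

locale qgen = qconf +
 assumes c_gen: "c \<notin> qZ q" and a_qN: "\<And>l. l \<in> {1..<n} ==> a l \<notin> q_minusN q"

context qconf begin

lemma prod_list_filter: "(\<Prod>l\<leftarrow>filter (%l. l \<noteq> i) [1..<n]. f l) = (\<Prod>l\<in>{1..<n} - {i}. (f l :: complex))"
proof -
 have "(\<Prod>l\<leftarrow>filter (%l. l \<noteq> i) [1..<n]. f l) = (\<Prod>l\<in>set (filter (%l. l \<noteq> i) [1..<n]). f l)"
  by (rule prod.distinct_set_conv_list[symmetric]) simp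
 also have "set (filter (%l. l \<noteq> i) [1..<n]) = {1..<n} - {i}" by auto
 finally show ?thesis .
qed

text \<open>Its values at q^k are, up to \<open>kapC\<close> and (q; q)_k, the coefficients of the
  series at the origin, see \<open>uk_AA\<close>.\<close>

definition AA where "AA x = (\<Prod>l\<in>{1..<n}. qi (b l * x)) / (\<Prod>l\<in>{1..<n}. qi (a l * x))"
definition gi where "gi i = hcoef (map (%l. a i * Q / b l) [1..<n]) (Bsi i)"
definition A0 where "A0 i = (\<Prod>s\<in>{1..<n}. qi (b s / a i)) / ((\<Prod>s\<in>{1..<n} - {i}. qi (a s / a i)) * qi Q)"

lemma gi_eq: "gi i l = (\<Prod>s\<in>{1..<n}. qp (a i * Q / b s) l) / (qp Q l * (\<Prod>s\<in>{1..<n} - {i}. qp (a i * Q / a s) l))"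
 unfolding gi_def hcoef_def Bsi_def map_map o_def prod_list_range prod_list_filter ..

lemma hcoef_Asi: "hcoef (Asi i) (Bsi i) l = qp (a i) l * gi i l"
 by (simp add: gi_def hcoef_def Asi_def)

lemma gi_bounded: "i \<in> {1..<n} ==> \<exists>C. \<forall>k. norm (gi i k) \<le> C"
 unfolding gi_def by (rule hcoef_bounded[OF Bsi_ok])

lemma a_ratio: "i \<in> {1..<n} ==> s \<in> {1..<n} - {i} ==> a s / a i \<notin> qZ q"
 using a_gen[of s i] by auto

lemma qi_backward: "y \<noteq> 0 ==> qi (y / Q ^ l) = (- y) ^ l * qp (Q / y) l / Q powi tri (- int l) * qi y"
 using qi_split[of "y / Q ^ l" l] qp_backward[of y l] by simp

text \<open>The factor l = i contributes -1 to the product of the -a_s/a_i; this accounts for the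
  sign. The quotient 1/c enters the residues of \<open>AA\<close> here.\<close>

lemma prod_neg_ratio:
 assumes i: "i \<in> {1..<n}"
 shows "(\<Prod>s\<in>{1..<n}. - (b s / a i)) = - (1 / c * (\<Prod>s\<in>{1..<n} - {i}. - (a s / a i)))"
proof -
 have ai: "a i \<noteq> 0" using a_nz[OF i] .
 have "(\<Prod>s\<in>{1..<n}. - (a s / a i)) = - (\<Prod>s\<in>{1..<n} - {i}. - (a s / a i))"
  by (subst prod.remove[OF _ i]) (use ai in auto)
 moreover have "(\<Prod>s\<in>{1..<n}. - (b s / a i)) = 1 / c * (\<Prod>s\<in>{1..<n}. - (a s / a i))"
 proof -
  have "(\<Prod>s\<in>{1..<n}. - (b s / a i)) = (\<Prod>s\<in>{1..<n}. b s * (- 1 / a i))" by (intro prod.cong) auto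
  also have "\<dots> = PB * (\<Prod>s\<in>{1..<n}. - 1 / a i)" unfolding prod.distrib PB_def ..
  finally have 1: "(\<Prod>s\<in>{1..<n}. - (b s / a i)) = PB * (\<Prod>s\<in>{1..<n}. - 1 / a i)" .
  have "(\<Prod>s\<in>{1..<n}. - (a s / a i)) = (\<Prod>s\<in>{1..<n}. a s * (- 1 / a i))" by (intro prod.cong) auto
  also have "\<dots> = PA * (\<Prod>s\<in>{1..<n}. - 1 / a i)" unfolding prod.distrib PA_def ..
  finally show ?thesis using 1 PA_nz by (simp add: c_def)
 qed
 ultimately show ?thesis by simp
qed

text \<open>At the pole all arguments are q^(-l) times a ratio of parameters; turning the first l
  factors of each product over yields the coefficients \<open>gi\<close> and the power
  (1/c)^l.\<close>

lemma AA_residue: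
 assumes i: "i \<in> {1..<n}" and p: "a i * Q ^ l * p = 1"
 shows "((%x. (1 - a i * Q ^ l * x) * AA x) \<longlongrightarrow> A0 i * (1 / c) ^ l * gi i l) (at p)"
proof -
 let ?I = "{1..<n}"
 let ?D = "%x. qp (a i * x) l * qi (a i * x * Q ^ Suc l)"
 have ai: "a i \<noteq> 0" using i a_nz by auto
 have peq: "p = 1 / (a i * Q ^ l)" using p ai by (simp add: field_simps)
 let ?P = "Q powi tri (- int l)"
 have P: "?P \<noteq> 0" by simp
 have Dp: "?D p = (- 1) ^ l * qp Q l / ?P * qi Q"
 proof -
  have "a i * p = 1 / Q ^ l" using ai by (simp add: peq)
  thus ?thesis using qp_backward[of 1 l] by simp
 qed
 have as_p: "qi (a s * p) = (- (a s / a i)) ^ l * qp (a i * Q / a s) l / ?P * qi (a s / a i)" if "s \<in> ?I" for s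
 proof -
  have "a s * p = (a s / a i) / Q ^ l" by (simp add: peq)
  thus ?thesis using qi_backward[of "a s / a i" l] ai a_nz[OF that] by (simp add: mult.commute)
 qed
 have bs_p: "qi (b s * p) = (- (b s / a i)) ^ l * qp (a i * Q / b s) l / ?P * qi (b s / a i)" if "s \<in> ?I" for s
 proof -
  have "b s * p = (b s / a i) / Q ^ l" by (simp add: peq)
  thus ?thesis using qi_backward[of "b s / a i" l] ai b_nz[OF that] by (simp add: mult.commute)
 qed
 have nz1: "qi (a s * p) \<noteq> 0" if "s \<in> ?I - {i}" for s
 proof -
  have s: "s \<in> ?I" using that by auto
  have "a s / a i \<notin> qZ q" using a_ratio[OF i that] .
  moreover have "a s * p * Q ^ l = a s / a i" using ai by (simp add: peq)
  moreover have "Q ^ l \<in> qZ q" using qZ_powi[of "int l"] by simp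
  ultimately have "a s * p \<notin> qZ q" using qZ_mult_iff[of "Q ^ l" "a s * p"] by simp
  thus ?thesis using q_minusN_qZ qi_nz by blast
 qed
 have Dnz: "?D p \<noteq> 0" unfolding Dp using P by simp
 have "((%x. (\<Prod>s\<in>?I. qi (b s * x)) / ((\<Prod>s\<in>?I - {i}. qi (a s * x)) * ?D x)) \<longlongrightarrow>
   (\<Prod>s\<in>?I. qi (b s * p)) / ((\<Prod>s\<in>?I - {i}. qi (a s * p)) * ?D p)) (at p)"
  using nz1 Dnz by (intro tendsto_intros) (auto simp: qpoch_def intro!: tendsto_intros)
 moreover have "\<forall>\<^sub>F x in at p. (\<Prod>s\<in>?I. qi (b s * x)) / ((\<Prod>s\<in>?I - {i}. qi (a s * x)) * ?D x) = (1 - a i * Q ^ l * x) * AA x"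
 proof -
  have "\<forall>\<^sub>F x in at p. x \<noteq> p" by (rule eventually_neq_at_within)
  thus ?thesis
  proof eventually_elim
   case (elim x)
   have e: "1 - a i * Q ^ l * x \<noteq> 0" using elim p ai by (simp add: peq field_simps)
   have "qi (a i * x) = ?D x * (1 - a i * Q ^ l * x)"
    using qi_split[of "a i * x" l] qi_rec[of "a i * x * Q ^ l"] by (simp add: mult_ac)
   hence "(\<Prod>s\<in>?I. qi (a s * x)) = (\<Prod>s\<in>?I - {i}. qi (a s * x)) * ?D x * (1 - a i * Q ^ l * x)"
    by (subst prod.remove[OF _ i]) (simp_all add: mult_ac)
   thus ?case using e by (simp add: AA_def)
  qed
 qed
 moreover have "(\<Prod>s\<in>?I. qi (b s * p)) / ((\<Prod>s\<in>?I - {i}. qi (a s * p)) * ?D p) = A0 i * (1 / c) ^ l * gi i l"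
 proof -
  have B: "(\<Prod>s\<in>?I. qi (b s * p)) = (\<Prod>s\<in>?I. - (b s / a i)) ^ l * (\<Prod>s\<in>?I. qp (a i * Q / b s) l) / ?P ^ card ?I * (\<Prod>s\<in>?I. qi (b s / a i))"
   by (simp add: bs_p prod.distrib prod_dividef prod_power_distrib)
  have A: "(\<Prod>s\<in>?I - {i}. qi (a s * p)) = (\<Prod>s\<in>?I - {i}. - (a s / a i)) ^ l * (\<Prod>s\<in>?I - {i}. qp (a i * Q / a s) l) / ?P ^ card (?I - {i}) * (\<Prod>s\<in>?I - {i}. qi (a s / a i))"
   by (simp add: as_p prod.distrib prod_dividef prod_power_distrib)
  \<comment> \<open>The n - 1 numerator factors and the n - 2 denominator factors together with
    \<open>?D p\<close> carry the same power of \<open>?P\<close>, so all triangular exponents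
    cancel.\<close>
  have cd: "?P ^ card ?I = ?P ^ card (?I - {i}) * ?P"
   using card_Suc_Diff1[OF _ i] by (metis finite_atLeastLessThan power_Suc2)
  note cc = prod_neg_ratio[OF i]
  have nzA: "(\<Prod>s\<in>?I - {i}. - (a s / a i)) \<noteq> 0" using ai a_nz by auto
  have gen: "(- (r * X)) ^ l * B1 / (Pc * P') * B2 / ((X ^ l * A1 / Pc * A2) * ((- 1) ^ l * G / P' * W))
   = B2 / (A2 * W) * r ^ l * (B1 / (G * A1))" if "X \<noteq> 0" "Pc \<noteq> 0" "P' \<noteq> 0" for r X B1 Pc P' B2 A1 A2 G W :: complex
  proof -
   have "(- (r * X)) ^ l = r ^ l * X ^ l * (-1) ^ l" by (simp add: power_minus[of "r * X"] power_mult_distrib)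
   thus ?thesis using that by (simp add: mult_ac)
  qed
  show ?thesis unfolding B A Dp cc cd A0_def gi_eq by (rule gen[OF nzA]) (use P in auto)
 qed
 ultimately show ?thesis by (simp add: Lim_transform_eventually)
qed

definition kapC where "kapC = (\<Prod>l\<in>{1..<n}. qi (a l)) / (\<Prod>l\<in>{1..<n}. qi (b l))"
definition Ci where "Ci i = ((\<Prod>l\<in>{1..<n} - {i}. qi (a l)) * (\<Prod>l\<in>{1..<n}. qi (b l / a i)))
 / ((\<Prod>l\<in>{1..<n}. qi (b l)) * (\<Prod>l\<in>{1..<n} - {i}. qi (a l / a i)))"

lemma bs_ok: "\<forall>B\<in>set bs. B \<notin> q_minusN q" using b_gen by (auto simp: bs_def)

text \<open>Only countably many radii are excluded, while an interval is uncountable.\<close>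

lemma generic_radius: "\<exists>\<rho>>0. \<forall>i\<in>{1..<n}. \<forall>m. \<rho> * norm (a i) \<noteq> q powi m"
proof -
 let ?B = "\<Union>i\<in>{1..<n}. range (%m::int. q powi m / norm (a i))"
 have "countable ?B" by auto
 moreover have "uncountable {0<..<(1::real)}" by (simp add: uncountable_open_interval)
 ultimately have "\<not> {0<..<(1::real)} \<subseteq> ?B" using countable_subset by blast
 then obtain \<rho> where "\<rho> \<in> {0<..<1}" and \<rho>B: "\<rho> \<notin> ?B" by (meson subsetI)
 hence \<rho>: "\<rho> > 0" "\<rho> \<notin> ?B" by (simp, intro \<rho>B)
 have "\<rho> * norm (a i) \<noteq> q powi m" if "i \<in> {1..<n}" for i m
 proof
  assume "\<rho> * norm (a i) = q powi m"
  hence "\<rho> = q powi m / norm (a i)" using a_nz[OF that] by (simp add: field_simps)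
  thus False using \<rho>(2) that by blast
 qed
 thus ?thesis using \<rho>(1) by blast
qed

lemma circle_gap:
 assumes a: "\<alpha> \<noteq> 0" and \<rho>: "\<rho> > 0" and gen: "\<And>m. \<rho> * norm \<alpha> \<noteq> q powi m"
 shows "\<exists>\<delta>>0. \<forall>k x. norm x = \<rho> / q ^ k \<longrightarrow> (\<forall>l. \<delta> \<le> norm (1 - Q ^ l * (\<alpha> * x)))"
proof -
 define u0 where "u0 = complex_of_real (\<rho> * norm \<alpha>)"
 have u0: "u0 \<noteq> 0" using a \<rho> by (simp add: u0_def)
 have "u0 \<noteq> Q powi m" for m
 proof
  assume "u0 = Q powi m"
  hence "complex_of_real (\<rho> * norm \<alpha>) = of_real (q powi m)" by (simp add: u0_def)
  thus False using gen[of m] by (simp only: of_real_eq_iff)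
 qed
 hence "u0 \<notin> qZ q" by (auto simp: qZ_def)
 then obtain \<delta> where d: "\<delta> > 0" "\<And>m. \<delta> \<le> norm (1 - u0 * Q powi m)" using lattice_gap_int[OF u0] by blast
 have "\<delta> \<le> norm (1 - Q ^ l * (\<alpha> * x))" if x: "norm x = \<rho> / q ^ k" for k x l
 proof -
  have "u0 * Q powi (int l - int k) = of_real (norm (Q ^ l * (\<alpha> * x)))"
   using q0 by (simp add: u0_def x norm_mult norm_power power_int_diff)
  hence "norm (1 - u0 * Q powi (int l - int k)) = \<bar>1 - norm (Q ^ l * (\<alpha> * x))\<bar>"
   by (metis norm_of_real of_real_1 of_real_diff)
  also have "\<dots> \<le> norm (1 - Q ^ l * (\<alpha> * x))"
   using norm_triangle_ineq3[of 1 "Q ^ l * (\<alpha> * x)"] by simp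
  finally show ?thesis using d(2)[of "int l - int k"] by linarith
 qed
 thus ?thesis using d(1) by blast
qed

lemma qi_ratio_circle:
 assumes a: "\<alpha> \<noteq> 0" and \<rho>: "\<rho> > 0" and gen: "\<And>m. \<rho> * norm \<alpha> \<noteq> q powi m"
 shows "\<exists>C K. C \<ge> 0 \<and> K \<ge> 1 \<and> (\<forall>k x. norm x = \<rho> / q ^ k \<longrightarrow> norm (qi (\<beta> * x) / qi (\<alpha> * x)) \<le> C * K ^ k)"
proof -
 obtain K where K: "K \<ge> 1" "\<And>k x. norm x = \<rho> / q ^ k ==> norm (qp (\<beta> * x) k / qp (\<alpha> * x) k) \<le> K ^ k"
  using qp_ratio_bound[OF assms, of \<beta>] by blast
 have nz: "qi (\<alpha> * u) \<noteq> 0" if "norm u = \<rho>" for u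
 proof
  assume "qi (\<alpha> * u) = 0"
  then obtain l where "\<alpha> * u * Q ^ l = 1" unfolding qi_eq_0_iff by blast
  hence "norm (\<alpha> * u * Q ^ l) = 1" by simp
  hence "\<rho> * norm \<alpha> = q powi (- int l)" using that q0 by (simp add: norm_mult norm_power power_int_minus field_simps)
  thus False using gen by blast
 qed
 have "continuous_on (sphere 0 \<rho>) (%u. qi (\<beta> * u) / qi (\<alpha> * u))"
  by (intro holomorphic_on_imp_continuous_on holomorphic_intros) (use nz in auto)
 hence "bounded ((%u. qi (\<beta> * u) / qi (\<alpha> * u)) ` sphere 0 \<rho>)"
  by (intro compact_imp_bounded compact_continuous_image) auto
 then obtain C where C0: "\<forall>y\<in>(%u. qi (\<beta> * u) / qi (\<alpha> * u)) ` sphere 0 \<rho>. norm y \<le> C"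
  unfolding bounded_iff by blast
 have C: "norm (qi (\<beta> * u) / qi (\<alpha> * u)) \<le> C" if "norm u = \<rho>" for u using C0 that by auto
 have "norm (qi (\<beta> * x) / qi (\<alpha> * x)) \<le> max C 0 * K ^ k" if x: "norm x = \<rho> / q ^ k" for k x
 proof -
  have u: "norm (x * Q ^ k) = \<rho>" using x q0 by (simp add: norm_mult norm_power)
  have "qi (\<beta> * x) / qi (\<alpha> * x) = (qp (\<beta> * x) k / qp (\<alpha> * x) k) * (qi (\<beta> * (x * Q ^ k)) / qi (\<alpha> * (x * Q ^ k)))"
   using qi_split[of "\<beta> * x" k] qi_split[of "\<alpha> * x" k] by (simp add: mult.assoc)
  also have "norm \<dots> \<le> K ^ k * max C 0" unfolding norm_mult
   using C[OF u] K(1) by (intro mult_mono K(2)[OF x]) auto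
  finally show ?thesis by (simp add: mult.commute)
 qed
 thus ?thesis using K(1) by (intro exI[of _ "max C 0"] exI[of _ K]) auto
qed

lemma AA_circle:
 assumes \<rho>: "\<rho> > 0" and gen: "\<forall>i\<in>{1..<n}. \<forall>m. \<rho> * norm (a i) \<noteq> q powi m"
 shows "\<exists>C K. C \<ge> 0 \<and> K \<ge> 1 \<and> (\<forall>k x. norm x = \<rho> / q ^ k \<longrightarrow> norm (AA x) \<le> C * K ^ k)"
proof -
 have "\<forall>l\<in>{1..<n}. \<exists>CK. fst CK \<ge> 0 \<and> snd CK \<ge> 1 \<and> (\<forall>k x. norm x = \<rho> / q ^ k \<longrightarrow> norm (qi (b l * x) / qi (a l * x)) \<le> fst CK * snd CK ^ k)"
 proof
  fix l assume l: "l \<in> {1..<n}"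
  obtain C K where "C \<ge> 0" "K \<ge> 1" "\<forall>k x. norm x = \<rho> / q ^ k \<longrightarrow> norm (qi (b l * x) / qi (a l * x)) \<le> C * K ^ k"
   using qi_ratio_circle[OF a_nz[OF l] \<rho>, of "b l"] gen l by blast
  thus "\<exists>CK. fst CK \<ge> 0 \<and> snd CK \<ge> 1 \<and> (\<forall>k x. norm x = \<rho> / q ^ k \<longrightarrow> norm (qi (b l * x) / qi (a l * x)) \<le> fst CK * snd CK ^ k)"
   by (intro exI[of _ "(C, K)"]) auto
 qed
 then obtain f where f: "\<And>l. l \<in> {1..<n} ==> fst (f l) \<ge> 0 \<and> snd (f l) \<ge> 1 \<and> (\<forall>k x. norm x = \<rho> / q ^ k \<longrightarrow> norm (qi (b l * x) / qi (a l * x)) \<le> fst (f l) * snd (f l) ^ k)"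
  by metis
 have "norm (AA x) \<le> (\<Prod>l\<in>{1..<n}. fst (f l)) * (\<Prod>l\<in>{1..<n}. snd (f l)) ^ k" if x: "norm x = \<rho> / q ^ k" for k x
 proof -
  have "norm (AA x) = (\<Prod>l\<in>{1..<n}. norm (qi (b l * x) / qi (a l * x)))"
   by (simp add: AA_def prod_dividef[symmetric] prod_norm)
  also have "\<dots> \<le> (\<Prod>l\<in>{1..<n}. fst (f l) * snd (f l) ^ k)"
   by (intro prod_mono) (use f x in auto)
  finally show ?thesis by (simp add: prod.distrib prod_power_distrib)
 qed
 moreover have "(\<Prod>l\<in>{1..<n}. fst (f l)) \<ge> 0" by (intro prod_nonneg) (use f in auto)
 moreover have "(\<Prod>l\<in>{1..<n}. snd (f l)) \<ge> 1" by (intro prod_ge_1) (use f in auto)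
 ultimately show ?thesis by blast
qed

end

context qgen begin

text \<open>Residues with convergence factors: outside the sum stands x^m0, whose value at the pole
  is cancelled by (a_i q^l)^m0. This damps the possible growth of (1/c)^l.\<close>

definition wi where "wi m0 i l = A0 i * (1 / c) ^ l * gi i l * (a i * Q ^ l) ^ m0"

lemma wi_summable:
 assumes m0: "q ^ m0 < norm c" and i: "i \<in> {1..<n}"
 shows "summable (%l. norm (wi m0 i l))"
proof -
 obtain C where C: "\<And>k. norm (gi i k) \<le> C" using gi_bounded[OF i] by blast
 have "q ^ m0 / norm c < 1" using m0 c_nz by simp
 hence s: "summable (%l. norm (A0 i) * C * norm (a i) ^ m0 * (q ^ m0 / norm c) ^ l)"
  using q0 by (intro summable_mult summable_geometric) auto
 show ?thesis
 proof (rule summable_comparison_test'[OF s, of 0])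
  fix l
  have "norm (wi m0 i l) = norm (A0 i) * norm (gi i l) * norm (a i) ^ m0 * (q ^ m0 / norm c) ^ l"
   using q0 by (simp add: wi_def norm_mult norm_divide norm_power power_mult_distrib power_divide power_mult[symmetric] mult_ac)
  also have "\<dots> \<le> norm (A0 i) * C * norm (a i) ^ m0 * (q ^ m0 / norm c) ^ l"
   using C[of l] q0 by (intro mult_right_mono mult_left_mono) auto
  finally show "norm (norm (wi m0 i l)) \<le> norm (A0 i) * C * norm (a i) ^ m0 * (q ^ m0 / norm c) ^ l" by simp
 qed
qed

text \<open>Removing the partial fractions leaves an entire function that grows polynomially on a
  sequence of circles avoiding the poles; it is therefore a polynomial.\<close>

theorem mittag_leffler:
 "\<exists>p \<alpha> m0. (\<forall>i\<in>{1..<n}. summable (%l. norm (wi m0 i l))) \<and>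
  (\<forall>x. (\<forall>i\<in>{1..<n}. a i * x \<notin> q_minusN q) \<longrightarrow>
    AA x = (\<Sum>j\<le>p. \<alpha> j * x ^ j) + x ^ m0 * (\<Sum>i\<in>{1..<n}. PS (wi m0 i) (a i * x)))"
proof -
 let ?I = "{1..<n}"
 obtain m0 where m0: "q ^ m0 < norm c"
  using real_arch_pow_inv[of "norm c" q] q1 c_nz by auto
 have ws: "summable (%l. norm (wi m0 i l))" if "i \<in> ?I" for i by (rule wi_summable[OF m0 that])
 define P where "P = {x. \<exists>i\<in>?I. a i * x \<in> q_minusN q}"
 define h where "h x = AA x - x ^ m0 * (\<Sum>i\<in>?I. PS (wi m0 i) (a i * x))" for x
 have PSan: "(%x. PS (wi m0 i) (a i * x)) analytic_on {x}" if "i \<in> ?I" "a i * x \<notin> q_minusN q" for i x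
 proof -
  have "PS (wi m0 i) analytic_on (%x. a i * x) ` {x}" using PS_analytic'[OF ws[OF that(1)] that(2)] by simp
  thus ?thesis using analytic_on_compose[of "%x. a i * x" "{x}" "PS (wi m0 i)"] by (simp add: o_def analytic_intros)
 qed
 have hol: "h holomorphic_on (UNIV - P)"
 proof -
  have "(%x. PS (wi m0 i) (a i * x)) holomorphic_on (UNIV - P)" if "i \<in> ?I" for i
   by (intro analytic_imp_holomorphic, subst analytic_on_analytic_at) (use that PSan[OF that] in \<open>auto simp: P_def\<close>)
  moreover have "qi (a i * x) \<noteq> 0" if "i \<in> ?I" "x \<notin> P" for i x using that by (intro qi_nz) (auto simp: P_def)
  ultimately show ?thesis unfolding h_def AA_def by (intro holomorphic_intros) auto
 qed
 have disc: "\<forall>\<^sub>F y in at x. y \<notin> P" for x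
 proof -
  have "\<forall>\<^sub>F y in at x. a i * y \<notin> q_minusN q" if i: "i \<in> ?I" for i
  proof (cases "x = 0")
   case True
   have "((%y. a i * y) \<longlongrightarrow> a i * x) (at x)" by (intro tendsto_intros)
   thus ?thesis using topological_tendstoD[OF _ open_compl_q_minusN, of "%y. a i * y" "a i * x" "at x"] True by simp
  next
   case False
   have "\<forall>\<^sub>F y in at (a i * x). y \<notin> qZ q" by (rule qZ_discrete) (use False a_nz[OF i] in auto)
   hence "\<forall>\<^sub>F y in at x. a i * y \<notin> qZ q" by (rule eventually_compose_filterlim[OF _ filterlim_mult_at[OF a_nz[OF i]]])
   thus ?thesis by eventually_elim (use q_minusN_qZ in blast)
  qed
  hence "\<forall>\<^sub>F y in at x. \<forall>i\<in>?I. a i * y \<notin> q_minusN q" by (intro eventually_ball_finite) auto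
  thus ?thesis by eventually_elim (auto simp: P_def)
 qed
 have "\<exists>g. g holomorphic_on UNIV \<and> (\<forall>x\<in>UNIV - P. g x = h x)"
 proof (rule removable_discrete[OF open_UNIV hol disc])
  fix p assume "p \<in> P"
  then obtain i l where i: "i \<in> ?I" and l': "a i * p * Q ^ l = 1" by (auto simp: P_def q_minusN_iff)
  have ai: "a i \<noteq> 0" using a_nz[OF i] .
  have l: "a i * Q ^ l * p = 1" "Q ^ l * (a i * p) = 1" using l' by (simp_all add: mult_ac)
  let ?e = "%x. 1 - a i * Q ^ l * x"
  have "((%x. (1 - Q ^ l * (a i * x)) * PS (wi m0 i) (a i * x)) \<longlongrightarrow> wi m0 i l) (at p)"
   by (rule filterlim_compose[OF PS_pole[OF ws[OF i] l(2)] filterlim_mult_at[OF ai]])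
  hence t1: "((%x. ?e x * PS (wi m0 i) (a i * x)) \<longlongrightarrow> wi m0 i l) (at p)" by (simp add: mult_ac)
  \<comment> \<open>Distinct i give disjoint sets of poles, since no ratio of the a_i lies in q^Z;
    the other partial fraction series are analytic at p.\<close>
  have t2: "((%x. ?e x * PS (wi m0 j) (a j * x)) \<longlongrightarrow> 0) (at p)" if j: "j \<in> ?I - {i}" for j
  proof -
   have "a j * p \<notin> qZ q"
   proof
    assume "a j * p \<in> qZ q"
    moreover have "Q ^ l \<in> qZ q" using qZ_powi[of "int l"] by simp
    ultimately have "a j * p * Q ^ l \<in> qZ q" by (rule qZ_mult)
    moreover have "a j * p * Q ^ l = a j / a i" using l(1) ai by (simp add: field_simps)
    ultimately show False using a_ratio[OF i j] by simp
   qed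
   hence "a j * p \<notin> q_minusN q" using q_minusN_qZ by blast
   hence "isCont (%x. PS (wi m0 j) (a j * x)) p" by (intro analytic_at_imp_isCont PSan) (use j in auto)
   hence "((%x. ?e x * PS (wi m0 j) (a j * x)) \<longlongrightarrow> ?e p * PS (wi m0 j) (a j * p)) (at p)"
    by (intro tendsto_intros) (auto simp: isCont_def)
   thus ?thesis using l(1) by simp
  qed
  have t3: "((%x. \<Sum>j\<in>?I. ?e x * PS (wi m0 j) (a j * x)) \<longlongrightarrow> (\<Sum>j\<in>?I. if j = i then wi m0 i l else 0)) (at p)"
   by (intro tendsto_sum) (use t1 t2 in auto)
  have "((%x. ?e x * AA x - x ^ m0 * (\<Sum>j\<in>?I. ?e x * PS (wi m0 j) (a j * x))) \<longlongrightarrow>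
    A0 i * (1 / c) ^ l * gi i l - p ^ m0 * (\<Sum>j\<in>?I. if j = i then wi m0 i l else 0)) (at p)"
   by (intro tendsto_intros AA_residue[OF i l(1)] t3)
  moreover have "p ^ m0 * (\<Sum>j\<in>?I. if j = i then wi m0 i l else 0) = A0 i * (1 / c) ^ l * gi i l"
  proof -
   have "p ^ m0 * wi m0 i l = A0 i * (1 / c) ^ l * gi i l * (a i * Q ^ l * p) ^ m0"
    unfolding wi_def power_mult_distrib by simp
   thus ?thesis using i l(1) by (simp add: sum.delta)
  qed
  moreover have "?e x * AA x - x ^ m0 * (\<Sum>j\<in>?I. ?e x * PS (wi m0 j) (a j * x)) = ?e x * h x" for x
   unfolding h_def sum_distrib_left[symmetric] right_diff_distrib by (simp only: mult.left_commute)
  ultimately have "((%x. ?e x * h x) \<longlongrightarrow> 0) (at p)" by simp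
  hence "((%x. - (1 / (a i * Q ^ l)) * (?e x * h x)) \<longlongrightarrow> - (1 / (a i * Q ^ l)) * 0) (at p)" by (intro tendsto_intros)
  moreover have "- (1 / (a i * Q ^ l)) * (?e x * h x) = (x - p) * h x" for x
  proof -
   have p: "p = 1 / (a i * Q ^ l)" using l(1) ai by (simp add: field_simps)
   have "- (1 / (a i * Q ^ l)) * ?e x = x - p" using ai by (simp add: p field_simps)
   thus ?thesis by (simp only: mult.assoc[symmetric])
  qed
  ultimately show "((%x. (x - p) * h x) \<longlongrightarrow> 0) (at p)" by simp
 qed
 then obtain g where g: "g holomorphic_on UNIV" "\<And>x. x \<notin> P ==> g x = h x" by auto
 obtain \<rho> where \<rho>: "\<rho> > 0" "\<forall>i\<in>?I. \<forall>m. \<rho> * norm (a i) \<noteq> q powi m" using generic_radius by blast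
 have "\<forall>i\<in>?I. \<exists>\<delta>>0. \<forall>k x. norm x = \<rho> / q ^ k \<longrightarrow> (\<forall>l. \<delta> \<le> norm (1 - Q ^ l * (a i * x)))"
  using circle_gap[OF a_nz \<rho>(1)] \<rho>(2) by blast
 then obtain \<delta> where d: "\<And>i. i \<in> ?I ==> \<delta> i > 0"
  "\<And>i k x l. i \<in> ?I ==> norm x = \<rho> / q ^ k ==> \<delta> i \<le> norm (1 - Q ^ l * (a i * x))" by metis
 obtain C K where CK: "C \<ge> 0" "K \<ge> 1" "\<And>k x. norm x = \<rho> / q ^ k ==> norm (AA x) \<le> C * K ^ k"
  using AA_circle[OF \<rho>] by blast
 \<comment> \<open>With this p the exponential bound K^k becomes a multiple of the p-th power of the
   radius rho q^(-k).\<close>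
 obtain p where p: "K < (1 / q) ^ p" using real_arch_pow[of "1 / q" K] q0 q1 by auto
 define S where "S = (\<Sum>i\<in>?I. (\<Sum>l. norm (wi m0 i l)) / \<delta> i)"
 have S0: "S \<ge> 0" unfolding S_def by (intro sum_nonneg divide_nonneg_pos suminf_nonneg ws d(1)) auto
 have Rlim: "filterlim (%k. \<rho> / q ^ k) at_top sequentially"
 proof -
  have "filterlim (%k. (1 / q) ^ k) at_top sequentially"
   by (rule filterlim_at_infinity_imp_filterlim_at_top[OF filterlim_realpow_sequentially_gt1]) (use q0 q1 in auto)
  from filterlim_tendsto_pos_mult_at_top[OF tendsto_const \<rho>(1) this] show ?thesis by (simp add: power_divide)
 qed
 have "norm (g x) \<le> (C / \<rho> ^ p + S) * (1 + \<rho> / q ^ k) ^ (p + m0)" if x: "norm x = \<rho> / q ^ k" for k x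
 proof -
  let ?R = "\<rho> / q ^ k"
  have R: "?R > 0" using \<rho> q0 by simp
  have "x \<notin> P"
  proof
   assume "x \<in> P"
   then obtain i l where i: "i \<in> ?I" and "a i * x * Q ^ l = 1" by (auto simp: P_def q_minusN_iff)
   hence "norm (1 - Q ^ l * (a i * x)) = 0" by (simp add: mult_ac)
   thus False using d(2)[OF i x, of l] d(1)[OF i] by linarith
  qed
  have "norm (g x) \<le> norm (AA x) + norm (x ^ m0 * (\<Sum>i\<in>?I. PS (wi m0 i) (a i * x)))"
   unfolding g(2)[OF \<open>x \<notin> P\<close>] h_def by (rule norm_triangle_ineq4)
  also have "norm (x ^ m0 * (\<Sum>i\<in>?I. PS (wi m0 i) (a i * x))) \<le> ?R ^ m0 * S"
  proof -
   have "norm (\<Sum>i\<in>?I. PS (wi m0 i) (a i * x)) \<le> S" unfolding S_def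
    by (intro sum_norm_le PS_bound(2)[OF ws d(1)] d(2)[OF _ x])
   thus ?thesis using R by (simp add: norm_mult norm_power x mult_left_mono)
  qed
  also have "norm (AA x) \<le> C / \<rho> ^ p * ?R ^ p"
  proof -
   have "K ^ k \<le> ((1 / q) ^ p) ^ k" using p CK(2) by (intro power_mono) auto
   also have "\<dots> = ?R ^ p / \<rho> ^ p" using \<rho>(1) by (simp add: power_divide power_mult[symmetric] mult.commute)
   finally have "C * K ^ k \<le> C * (?R ^ p / \<rho> ^ p)" using CK(1) by (intro mult_left_mono) auto
   thus ?thesis using CK(3)[OF x] by simp
  qed
  also have "C / \<rho> ^ p * ?R ^ p + ?R ^ m0 * S \<le> C / \<rho> ^ p * (1 + ?R) ^ (p + m0) + (1 + ?R) ^ (p + m0) * S"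
  proof -
   have "?R ^ p \<le> (1 + ?R) ^ (p + m0)" "?R ^ m0 \<le> (1 + ?R) ^ (p + m0)"
    using R by (meson le_add_same_cancel2 less_eq_real_def order_trans power_increasing power_mono zero_le_one le_add1 le_add2 le_add_same_cancel1)+
   thus ?thesis using CK(1) \<rho>(1) S0 by (intro add_mono mult_left_mono mult_right_mono) auto
  qed
  finally show ?thesis by (simp add: algebra_simps)
 qed
 then obtain \<alpha> where \<alpha>: "\<And>x. g x = (\<Sum>j\<le>p + m0. \<alpha> j * x ^ j)"
  using entire_polynomial_growth[OF g(1) Rlim] by metis
 have "AA x = (\<Sum>j\<le>p + m0. \<alpha> j * x ^ j) + x ^ m0 * (\<Sum>i\<in>?I. PS (wi m0 i) (a i * x))" if "\<forall>i\<in>?I. a i * x \<notin> q_minusN q" for x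
 proof -
  have "x \<notin> P" using that by (auto simp: P_def)
  thus ?thesis using g(2)[of x] \<alpha>[of x] by (simp add: h_def algebra_simps)
 qed
 thus ?thesis using ws by blast
qed

definition uk where "uk = hcoef as bs"
definition ek where "ek k = uk k * (-1) ^ k * Q ^ (k * (k + 1) div 2)"
text \<open>The sequence for which theta(-z) times the series at the origin equals
  \<open>T vv (- z)\<close>, see \<open>theta_series\<close>. It converges for all m, since
  \<open>ek\<close> contains a Gaussian factor.\<close>

definition vv where "vv m = (\<Sum>k. ek k * (Q powi (- m)) ^ k)"

lemma uk_bounded: "\<exists>C. \<forall>k. norm (uk k) \<le> C"
 unfolding uk_def by (rule hcoef_bounded[OF bs_ok])

lemma tri_up: "k * (k + 1) div 2 = k * (k - 1) div 2 + (k::nat)"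
proof -
 have "Suc k * (Suc k - 1) = k * (k + 1)" by simp
 thus ?thesis using nat_tri_Suc[of k] by simp
qed

lemma ek_summable: "summable (%k. norm (ek k * r ^ k))"
proof -
 obtain C where C: "\<And>k. norm (uk k) \<le> C" using uk_bounded by blast
 have s: "summable (%k. C * (q ^ (k * (k - 1) div 2) * (q * norm r) ^ k))"
  using q0 by (intro summable_mult gauss_summable_nat) auto
 show ?thesis
 proof (rule summable_comparison_test'[OF s, of 0])
  fix k
  have "norm (ek k * r ^ k) = norm (uk k) * (q ^ (k * (k - 1) div 2) * (q * norm r) ^ k)"
   using q0 unfolding ek_def tri_up by (simp add: norm_mult norm_power power_add power_mult_distrib)
  also have "\<dots> \<le> C * (q ^ (k * (k - 1) div 2) * (q * norm r) ^ k)"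
   using q0 by (intro mult_right_mono C) auto
  finally show "norm (norm (ek k * r ^ k)) \<le> C * (q ^ (k * (k - 1) div 2) * (q * norm r) ^ k)" by simp
 qed
qed

lemma opr_vv: "(%k. ek k * (\<Prod>x\<leftarrow>cs. 1 - x * Q ^ k) * (Q powi (- m)) ^ k) sums opr shf cs vv m"
proof (induction cs arbitrary: m)
 case Nil
 show ?case using summable_sums[OF summable_norm_cancel[OF ek_summable]] by (simp add: vv_def)
next
 case (Cons x cs)
 have "(%k. ek k * (\<Prod>x\<leftarrow>cs. 1 - x * Q ^ k) * (Q powi (- m)) ^ k - x * (ek k * (\<Prod>x\<leftarrow>cs. 1 - x * Q ^ k) * (Q powi (- (m - 1))) ^ k)) sums opr shf (x # cs) vv m"
  unfolding opr_Cons by (intro sums_diff sums_mult Cons.IH)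
 moreover have "(Q powi (- (m - 1))) ^ k = Q ^ k * (Q powi (- m)) ^ k" for k
 proof -
  have "Q powi (- (m - 1)) = Q powi 1 * Q powi (- m)" by (subst power_int_add[symmetric]) auto
  thus ?thesis by (simp add: power_mult_distrib)
 qed
 ultimately show ?case by (simp add: algebra_simps)
qed

text \<open>This is the coefficient recursion of the series. The parameter -1 fits the factor
  1/theta(-z), which is multiplied by -z under z -> q z.\<close>

lemma vv_Rec: "Rec (-1) vv"
 unfolding Rec_def
proof
 fix m
 have "(%k. ek k * (\<Prod>x\<leftarrow>bs1. 1 - x * Q ^ k) * (Q powi (- m)) ^ k) sums opr shf bs1 vv m" by (rule opr_vv)
 hence "(%k. ek (Suc k) * (\<Prod>x\<leftarrow>bs1. 1 - x * Q ^ Suc k) * (Q powi (- m)) ^ Suc k) sums opr shf bs1 vv m"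
  by (subst sums_Suc_iff) (simp add: bs1_def)
 moreover have "ek (Suc k) * (\<Prod>x\<leftarrow>bs1. 1 - x * Q ^ Suc k) * (Q powi (- m)) ^ Suc k
  = 1 / (-1) * Q powi (1 - m) * (ek k * (\<Prod>x\<leftarrow>as. 1 - x * Q ^ k) * (Q powi (- (m - 1))) ^ k)" for k
 proof -
  have p1: "(\<Prod>x\<leftarrow>bs1. 1 - x * Q ^ Suc k) = (1 - Q ^ Suc k) * (\<Prod>x\<leftarrow>bs. 1 - x * Q ^ k)"
   by (simp add: bs1_def o_def)
  have p2: "uk (Suc k) * ((1 - Q ^ Suc k) * (\<Prod>x\<leftarrow>bs. 1 - x * Q ^ k)) = uk k * (\<Prod>x\<leftarrow>as. 1 - x * Q ^ k)"
   unfolding uk_def by (rule hcoef_Suc[OF bs_ok])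
  have p3: "Suc k * (Suc k + 1) div 2 = k * (k + 1) div 2 + Suc k"
   using nat_tri_Suc[of "Suc k"] by (simp add: mult.commute)
  have p4: "Q ^ Suc k * (Q powi (- m)) ^ Suc k = Q powi (1 - m) * (Q powi (- (m - 1))) ^ k"
  proof -
   have e: "Q powi (1 - m) = Q * Q powi (- m)" using power_int_add[of Q 1 "- m"] Q_nz by simp
   have "- (m - 1) = 1 - m" by simp
   thus ?thesis unfolding \<open>- (m - 1) = 1 - m\<close> e by (simp add: power_mult_distrib)
  qed
  have "ek (Suc k) * (\<Prod>x\<leftarrow>bs1. 1 - x * Q ^ Suc k) * (Q powi (- m)) ^ Suc k
   = - ((uk (Suc k) * ((1 - Q ^ Suc k) * (\<Prod>x\<leftarrow>bs. 1 - x * Q ^ k))) * ((-1) ^ k * Q ^ (k * (k + 1) div 2)) * (Q ^ Suc k * (Q powi (- m)) ^ Suc k))"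
   unfolding ek_def p1 p3 power_add by simp
  also have "\<dots> = - ((uk k * (\<Prod>x\<leftarrow>as. 1 - x * Q ^ k)) * ((-1) ^ k * Q ^ (k * (k + 1) div 2)) * (Q powi (1 - m) * (Q powi (- (m - 1))) ^ k))"
   unfolding p2 p4 ..
  finally show ?thesis by (simp add: ek_def)
 qed
 ultimately have "(%k. 1 / (-1) * Q powi (1 - m) * (ek k * (\<Prod>x\<leftarrow>as. 1 - x * Q ^ k) * (Q powi (- (m - 1))) ^ k)) sums opr shf bs1 vv m"
  by (simp only:)
 moreover have "(%k. 1 / (-1) * Q powi (1 - m) * (ek k * (\<Prod>x\<leftarrow>as. 1 - x * Q ^ k) * (Q powi (- (m - 1))) ^ k)) sums
  (1 / (-1) * Q powi (1 - m) * opr shf as vv (m - 1))"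
  by (intro sums_mult opr_vv)
 ultimately show "1 / (-1) * Q powi (1 - m) * opr shf as vv (m - 1) = opr shf bs1 vv m" by (rule sums_unique2[symmetric])
qed

lemma uk_AA: "uk k = kapC * AA (Q ^ k) / qp Q k"
proof -
 have A: "(\<Prod>l\<in>{1..<n}. qi (a l)) = (\<Prod>l\<in>{1..<n}. qp (a l) k) * (\<Prod>l\<in>{1..<n}. qi (a l * Q ^ k))"
  unfolding prod.distrib[symmetric] by (intro prod.cong refl qi_split)
 have B: "(\<Prod>l\<in>{1..<n}. qi (b l)) = (\<Prod>l\<in>{1..<n}. qp (b l) k) * (\<Prod>l\<in>{1..<n}. qi (b l * Q ^ k))"
  unfolding prod.distrib[symmetric] by (intro prod.cong refl qi_split)
 have nz: "(\<Prod>l\<in>{1..<n}. qi (a l * Q ^ k)) \<noteq> 0" "(\<Prod>l\<in>{1..<n}. qi (b l * Q ^ k)) \<noteq> 0"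
  using a_qN b_gen q_minusN_mult by (auto intro!: qi_nz simp: prod_zero_iff)
 have u: "uk k = (\<Prod>l\<in>{1..<n}. qp (a l) k) / (qp Q k * (\<Prod>l\<in>{1..<n}. qp (b l) k))"
  unfolding uk_def hcoef_def as_def bs_def map_map o_def prod_list_range ..
 have gen: "x / (y * z) = (x * X) / (z * Z) * (Z / X) / y" if "X \<noteq> 0" "Z \<noteq> 0" for x y z X Z :: complex
  using that by simp
 show ?thesis unfolding u kapC_def A B AA_def by (rule gen) (use nz in auto)
qed

lemma Ci_eq: assumes i: "i \<in> {1..<n}" shows "Ci i = kapC * A0 i * qi Q / qi (a i)"
proof -
 have p: "(\<Prod>l\<in>{1..<n}. qi (a l)) = qi (a i) * (\<Prod>l\<in>{1..<n} - {i}. qi (a l))"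
  by (rule prod.remove[OF _ i]) simp
 have gen: "(A * X) / (B * Y) = (w * A) / B * (X / (Y * Z)) * Z / w" if "w \<noteq> 0" "Z \<noteq> 0" for A X B Y w Z :: complex
  using that by simp
 show ?thesis unfolding Ci_def kapC_def A0_def p by (rule gen) (use qi_nz[OF a_qN[OF i]] in auto)
qed

lemma bi_small_series:
 assumes i: "i \<in> {1..<n}" and x: "norm x < 1"
 shows "(%l. qp (a i) l * gi i l * x ^ l) sums bi i x"
proof -
 obtain C where C: "\<And>k. norm (hcoef (Asi i) (Bsi i) k) \<le> C" using hcoef_bounded[OF Bsi_ok[OF i]] by blast
 have "summable (%k. hcoef (Asi i) (Bsi i) k * x ^ k)"
  by (rule summable_norm_cancel, rule bounded_series_summable[OF C x])
 thus ?thesis using ph_series[OF Bsi_ok[OF i] x] unfolding bi_def hcoef_Asi[symmetric] by (simp add: summable_sums)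
qed

text \<open>The expansion of \<open>AA\<close> is inserted into the coefficients at q^k. The sum
  over k of each partial fraction is evaluated by \<open>PS_ec\<close>, and the remaining sum over l
  is the power series of \<open>bi i\<close> at q^m / c.\<close>

lemma vv_large:
 "\<exists>M0. \<forall>m\<ge>M0. vv m = (\<Sum>i\<in>{1..<n}. Ci i * (a i powi m * bi i (Q powi m / c)))"
proof -
 let ?I = "{1..<n}"
 obtain p \<alpha> m0 where w0: "\<forall>i\<in>?I. summable (%l. norm (wi m0 i l))"
  and ml: "\<forall>x. (\<forall>i\<in>?I. a i * x \<notin> q_minusN q) \<longrightarrow> AA x = (\<Sum>j\<le>p. \<alpha> j * x ^ j) + x ^ m0 * (\<Sum>i\<in>?I. PS (wi m0 i) (a i * x))"
  using mittag_leffler by blast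
 have w: "summable (%l. norm (wi m0 i l))" if "i \<in> ?I" for i using w0 that by blast
 obtain mc where mc: "q ^ mc < norm c" using real_arch_pow_inv[of "norm c" q] q1 c_nz by auto
 have AAk: "AA (Q ^ k) = (\<Sum>j\<le>p. \<alpha> j * (Q ^ k) ^ j) + (Q ^ k) ^ m0 * (\<Sum>i\<in>?I. PS (wi m0 i) (a i * Q ^ k))" for k
  by (rule ml[rule_format]) (use a_qN q_minusN_mult in auto)
 have "vv m = (\<Sum>i\<in>?I. Ci i * (a i powi m * bi i (Q powi m / c)))" if m: "m \<ge> int (p + m0 + mc + 1)" for m
 proof -
  define s where "s = nat (m - int m0)"
  have s: "m = int s + int m0" using m by (simp add: s_def)
  define R where "R = Q powi (1 - m)"
  have RQ: "R * Q ^ j = Q powi (1 - m + int j)" for j unfolding R_def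
   by (subst power_int_add) (use Q_nz in auto)
  \<comment> \<open>By Euler's series the sum is \<open>qi\<close> at a nonpositive power of q,
    hence 0.\<close>
  have t1: "(%k. ec k * R ^ k * (Q ^ k) ^ j) sums 0" if "j \<le> p" for j
  proof -
   have "(%k. ec k * (R * Q ^ j) ^ k) sums qi (R * Q ^ j)" by (rule qi_series)
   moreover have "qi (R * Q ^ j) = 0" unfolding RQ by (rule qi_powi_zero) (use m that in auto)
   moreover have "ec k * (R * Q ^ j) ^ k = ec k * R ^ k * (Q ^ k) ^ j" for k
    by (simp add: power_mult_distrib power_mult[symmetric] mult.commute)
   ultimately show ?thesis by simp
  qed
  have t2: "(%k. ec k * R ^ k * ((Q ^ k) ^ m0 * PS (wi m0 i) (a i * Q ^ k))) sums
    (A0 i * qi Q / qi (a i) * (a i powi m * bi i (Q powi m / c)))" if i: "i \<in> ?I" for i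
  proof -
   have ai: "a i \<noteq> 0" "qi (a i) \<noteq> 0" using a_nz[OF i] qi_nz[OF a_qN[OF i]] by auto
   obtain \<delta> where d: "\<delta> > 0" "\<And>l. \<delta> \<le> norm (1 - Q ^ l * a i)" using lattice_gap'[OF a_qN[OF i]] by blast
   let ?f = "%k l. ec k * (R * Q ^ m0) ^ k * (wi m0 i l / (1 - Q ^ l * (a i * Q ^ k)))"
   have fb: "norm (?f k l) \<le> norm (ec k * (R * Q ^ m0) ^ k) * (norm (wi m0 i l) / \<delta>)" for k l
   proof -
    have "Q ^ l * (a i * Q ^ k) = Q ^ (l + k) * a i" by (simp add: power_add)
    hence "\<delta> \<le> norm (1 - Q ^ l * (a i * Q ^ k))" using d(2)[of "l + k"] by (simp only:)
    thus ?thesis unfolding norm_mult using PS_term_bound[of "wi m0 i" l \<delta> "a i * Q ^ k"] d(1) by (intro mult_left_mono) auto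
   qed
   have swap: "(\<Sum>k. \<Sum>l. ?f k l) = (\<Sum>l. \<Sum>k. ?f k l)"
    by (rule suminf_swap_bounded[OF ec_summable summable_divide[OF w[OF i]] _ _ fb]) (use d(1) in auto)
   have sml: "summable (%l. wi m0 i l / (1 - Q ^ l * (a i * Q ^ k)))" for k
   proof (rule summable_norm_cancel, rule PS_bound(1)[OF w[OF i] d(1)])
    fix l
    have "Q ^ l * (a i * Q ^ k) = Q ^ (l + k) * a i" by (simp add: power_add)
    thus "\<delta> \<le> norm (1 - Q ^ l * (a i * Q ^ k))" using d(2)[of "l + k"] by (simp only:)
   qed
   have in1: "(\<Sum>l. ?f k l) = ec k * R ^ k * ((Q ^ k) ^ m0 * PS (wi m0 i) (a i * Q ^ k))" for k
   proof -
    have "(\<Sum>l. ?f k l) = ec k * (R * Q ^ m0) ^ k * PS (wi m0 i) (a i * Q ^ k)"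
     unfolding PS_def by (rule suminf_mult[OF sml])
    thus ?thesis by (simp add: power_mult_distrib power_mult[symmetric] mult.commute)
   qed
   have in2: "(\<Sum>k. ?f k l) = A0 i * qi Q / qi (a i) * a i powi m * (qp (a i) l * gi i l * (Q powi m / c) ^ l)" for l
   proof -
    have y: "a i * Q ^ l \<notin> q_minusN q" using a_qN[OF i] by (rule q_minusN_mult)
    obtain \<delta>' where d': "\<delta>' > 0" "\<And>k. \<delta>' \<le> norm (1 - Q ^ k * (a i * Q ^ l))" using lattice_gap'[OF y] by blast
    have RQ0: "R * Q ^ m0 = Q powi (1 - int s)" unfolding RQ by (simp add: s)
    have "summable (%k. ec k * (R * Q ^ m0) ^ k / (1 - Q ^ k * (a i * Q ^ l)))"
     by (rule summable_norm_cancel, rule PS_bound(1)[OF ec_summable d'(1)]) (use d' in auto)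
    hence "(\<Sum>k. wi m0 i l * (ec k * (R * Q ^ m0) ^ k / (1 - Q ^ k * (a i * Q ^ l)))) = wi m0 i l * PS (%k. ec k * (R * Q ^ m0) ^ k) (a i * Q ^ l)"
     unfolding PS_def by (rule suminf_mult)
    moreover have "?f k l = wi m0 i l * (ec k * (R * Q ^ m0) ^ k / (1 - Q ^ k * (a i * Q ^ l)))" for k by (simp add: mult_ac)
    ultimately have "(\<Sum>k. ?f k l) = wi m0 i l * ((a i * Q ^ l) ^ s * qi Q / qi (a i * Q ^ l))"
     unfolding RQ0 PS_ec[OF y] by simp
    also have "\<dots> = A0 i * (1 / c) ^ l * gi i l * ((a i * Q ^ l) ^ m0 * (a i * Q ^ l) ^ s) * qi Q / qi (a i * Q ^ l)"
     by (simp add: wi_def)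
    also have "(a i * Q ^ l) ^ m0 * (a i * Q ^ l) ^ s = a i powi m * (Q powi m) ^ l"
    proof -
     have "m = int (m0 + s)" using s by simp
     thus ?thesis by (simp add: power_int_add power_mult_distrib power_add distrib_left ai(1) mult_ac flip: power_mult)
    qed
    also have "A0 i * (1 / c) ^ l * gi i l * (a i powi m * (Q powi m) ^ l) * qi Q / qi (a i * Q ^ l)
     = A0 i * (1 / c) ^ l * gi i l * (a i powi m * (Q powi m) ^ l) * qi Q * (qp (a i) l / qi (a i))"
    proof -
     have "1 / qi (a i * Q ^ l) = qp (a i) l / qi (a i)"
      using qi_split[of "a i" l] ai(2) by (auto simp: field_simps)
     hence "x * (1 / qi (a i * Q ^ l)) = x * (qp (a i) l / qi (a i))" for x by (simp only:)
     thus ?thesis by simp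
    qed
    finally show ?thesis by (simp add: power_divide mult_ac)
   qed
   have small: "norm (Q powi m / c) < 1"
   proof -
    have "q powi m = q ^ (s + m0)" using s by (metis of_nat_add power_int_of_nat)
    also have "\<dots> \<le> q ^ mc" by (rule power_decreasing) (use m q0 q1 in \<open>auto simp: s_def\<close>)
    finally show ?thesis using mc c_nz q0 by (simp add: norm_divide norm_power_int)
   qed
   have "summable (%k. \<Sum>l. ?f k l)"
   proof (rule summable_norm_cancel, rule summable_comparison_test'[of "%k. norm (ec k * (R * Q ^ m0) ^ k) * (\<Sum>l. norm (wi m0 i l) / \<delta>)" 0])
    show "summable (%k. norm (ec k * (R * Q ^ m0) ^ k) * (\<Sum>l. norm (wi m0 i l) / \<delta>))" by (intro summable_mult2 ec_summable)
    fix k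
    have s2: "summable (%l. norm (ec k * (R * Q ^ m0) ^ k) * (norm (wi m0 i l) / \<delta>))" by (intro summable_mult summable_divide w i)
    have "norm (\<Sum>l. ?f k l) \<le> (\<Sum>l. norm (ec k * (R * Q ^ m0) ^ k) * (norm (wi m0 i l) / \<delta>))"
     by (rule norm_suminf_le[OF fb s2])
    thus "norm (norm (\<Sum>l. ?f k l)) \<le> norm (ec k * (R * Q ^ m0) ^ k) * (\<Sum>l. norm (wi m0 i l) / \<delta>)"
     unfolding suminf_mult[OF summable_divide[OF w[OF i]]] by simp
   qed
   hence "(%k. ec k * R ^ k * ((Q ^ k) ^ m0 * PS (wi m0 i) (a i * Q ^ k))) sums (\<Sum>l. \<Sum>k. ?f k l)"
    unfolding swap[symmetric] unfolding in1 by (rule summable_sums)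
   moreover have "(%l. A0 i * qi Q / qi (a i) * a i powi m * (qp (a i) l * gi i l * (Q powi m / c) ^ l)) sums (A0 i * qi Q / qi (a i) * a i powi m * bi i (Q powi m / c))"
    by (intro sums_mult bi_small_series i small)
   ultimately show ?thesis unfolding in2 by (simp add: sums_iff mult.assoc)
  qed
  have "(%k. (\<Sum>j\<le>p. \<alpha> j * (ec k * R ^ k * (Q ^ k) ^ j)) + (\<Sum>i\<in>?I. ec k * R ^ k * ((Q ^ k) ^ m0 * PS (wi m0 i) (a i * Q ^ k))))
   sums ((\<Sum>j\<le>p. \<alpha> j * 0) + (\<Sum>i\<in>?I. A0 i * qi Q / qi (a i) * (a i powi m * bi i (Q powi m / c))))"
   by (intro sums_add sums_sum sums_mult t1 t2) auto
  hence "(%k. kapC * ((\<Sum>j\<le>p. \<alpha> j * (ec k * R ^ k * (Q ^ k) ^ j)) + (\<Sum>i\<in>?I. ec k * R ^ k * ((Q ^ k) ^ m0 * PS (wi m0 i) (a i * Q ^ k)))))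
   sums (kapC * ((\<Sum>j\<le>p. \<alpha> j * 0) + (\<Sum>i\<in>?I. A0 i * qi Q / qi (a i) * (a i powi m * bi i (Q powi m / c)))))"
   by (rule sums_mult)
  moreover have "kapC * ((\<Sum>j\<le>p. \<alpha> j * (ec k * R ^ k * (Q ^ k) ^ j)) + (\<Sum>i\<in>?I. ec k * R ^ k * ((Q ^ k) ^ m0 * PS (wi m0 i) (a i * Q ^ k))))
   = ek k * (Q powi (- m)) ^ k" for k
  proof -
   have "kapC * ((\<Sum>j\<le>p. \<alpha> j * (ec k * R ^ k * (Q ^ k) ^ j)) + (\<Sum>i\<in>?I. ec k * R ^ k * ((Q ^ k) ^ m0 * PS (wi m0 i) (a i * Q ^ k))))
    = kapC * (ec k * R ^ k * AA (Q ^ k))"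
    unfolding AAk by (simp add: distrib_left sum_distrib_left mult_ac)
   also have "\<dots> = uk k * ((-1) ^ k * Q ^ (k * (k - 1) div 2)) * R ^ k"
    by (simp add: uk_AA ec_def)
   also have "\<dots> = ek k * (Q powi (- m)) ^ k"
   proof -
    have "Q powi (1 + (- m)) = Q powi 1 * Q powi (- m)" by (rule power_int_add) (use Q_nz in auto)
    hence "R ^ k = Q ^ k * (Q powi (- m)) ^ k" by (simp add: R_def power_mult_distrib)
    thus ?thesis unfolding ek_def tri_up power_add by simp
   qed
   finally show ?thesis .
  qed
  ultimately have "vv m = kapC * (\<Sum>i\<in>?I. A0 i * qi Q / qi (a i) * (a i powi m * bi i (Q powi m / c)))"
   by (simp add: vv_def sums_iff)
  thus ?thesis by (simp add: sum_distrib_left Ci_eq mult.assoc)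
 qed
 thus ?thesis by blast
qed

end

context qconf begin

lemma RecS_sum:
 assumes "\<And>i. i \<in> I ==> RecS t (x i)"
 shows "RecS t (%m. \<Sum>i\<in>I. C i * x i m)"
 unfolding RecS_def
proof
 fix M
 have "(Q powi M - 1 / t) * (\<Sum>i\<in>I. C i * x i M) = (\<Sum>i\<in>I. C i * ((Q powi M - 1 / t) * x i M))"
  by (simp add: sum_distrib_left mult_ac)
 also have "\<dots> = (\<Sum>i\<in>I. C i * (\<Sum>j=1..n. (kap j * Q powi M + kap' j / t) * x i (M + int j)))"
  using assms by (intro sum.cong refl arg_cong2[of _ _ _ _ times]) (auto simp: RecS_def)
 also have "\<dots> = (\<Sum>j=1..n. (kap j * Q powi M + kap' j / t) * (\<Sum>i\<in>I. C i * x i (M + int j)))"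
  by (subst sum_distrib_left, subst sum.swap, subst sum_distrib_left) (simp add: sum_distrib_left mult_ac)
 finally show "(Q powi M - 1 / t) * (\<Sum>i\<in>I. C i * x i M) = (\<Sum>j=1..n. (kap j * Q powi M + kap' j / t) * (\<Sum>i\<in>I. C i * x i (M + int j)))" .
qed

text \<open>Off the lattice the leading coefficient never vanishes, so a solution is determined by
  its values at all large indices.\<close>

lemma RecS_eq_down:
 assumes x: "RecS t x" and y: "RecS t y" and M0: "\<And>m. m \<ge> M0 ==> x m = y m" and t: "t \<noteq> 0" "t \<notin> qZ q"
 shows "x m = y m"
proof -
 have nz: "Q powi M - 1 / t \<noteq> 0" for M
 proof
  assume "Q powi M - 1 / t = 0"
  hence "1 / t \<in> qZ q" using qZ_powi[of M] by simp
  thus False using qZ_inverse[of "1 / t"] t by simp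
 qed
 have "\<forall>m \<ge> M0 - int k. x m = y m" for k
 proof (induction k)
  case (Suc k)
  show ?case
  proof (intro allI impI)
   fix m assume m: "M0 - int (Suc k) \<le> m"
   show "x m = y m"
   proof (cases "m \<ge> M0 - int k")
    case False
    have "x (m + int j) = y (m + int j)" if "j \<in> {1..n}" for j
     using Suc.IH False m that by auto
    hence "(\<Sum>j=1..n. (kap j * Q powi m + kap' j / t) * x (m + int j)) = (\<Sum>j=1..n. (kap j * Q powi m + kap' j / t) * y (m + int j))"
     by (intro sum.cong) auto
    hence "(Q powi m - 1 / t) * x m = (Q powi m - 1 / t) * y m"
     using x y by (simp only: RecS_def)
    thus ?thesis using nz by simp
   qed (use Suc in blast)
  qed
 qed (use M0 in auto)
 from this[of "nat (M0 - m)"] show ?thesis using M0[of m] by (cases "m \<ge> M0") auto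
qed

end

context qgen begin

text \<open>Both sides satisfy \<open>RecS (1 / c)\<close> and agree for large m by
  \<open>vv_large\<close>; downward recursion gives the identity for indices where the power series
  of \<open>bi i\<close> diverges.\<close>

lemma vv_all: "vv m = (\<Sum>i\<in>{1..<n}. Ci i * (a i powi m * bi i ((1 / c) * Q powi m)))"
proof -
 obtain M0 where M0: "\<And>m. m \<ge> M0 ==> vv m = (\<Sum>i\<in>{1..<n}. Ci i * (a i powi m * bi i (Q powi m / c)))"
  using vv_large by blast
 have t: "1 / c \<noteq> 0" "1 / c \<notin> qZ q" using c_nz c_gen qZ_inverse[of "1 / c"] by auto
 show ?thesis
 proof (rule RecS_eq_down[OF _ _ _ t])
  show "RecS (1 / c) vv" using vv_Rec Rec_iff_RecS[OF t(1)] c_nz by simp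
  show "RecS (1 / c) (%m. \<Sum>i\<in>{1..<n}. Ci i * (a i powi m * bi i ((1 / c) * Q powi m)))"
   by (intro RecS_sum bi_RecS t)
 qed (use M0 in simp)
qed

lemma uk_series: "norm z < 1 ==> ph as bs z = (\<Sum>k. uk k * z ^ k)"
 unfolding uk_def by (rule ph_series[OF bs_ok])

text \<open>The product of the bilateral theta series with the power series, rearranged by the
  exponent of z; the triangular exponent of m - k separates into a part in m and the weights of
  \<open>ek\<close>.\<close>

lemma theta_series:
 assumes z: "z \<noteq> 0" "norm z < 1"
 shows "th (- z) * ph as bs z = T vv (- z)"
proof -
 obtain C where C: "\<And>k. norm (uk k) \<le> C" using uk_bounded by blast
 have C0: "C \<ge> 0" using C[of 0] norm_ge_zero order_trans by blast
 let ?g = "%m::int. Q powi tri m * (- z) powi m"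
 let ?F = "%k m. ?g (m - int k) * (uk k * z ^ k)"
 have gs: "(%m. norm (?g m)) summable_on UNIV" using T_abs_summable[of "%_. 1" "- z"] z by simp
 have bij: "bij_betw (%m. m - int k) UNIV UNIV" for k
  by (rule bij_betw_byWitness[of _ "%m. m + int k"]) auto
 have gsk: "(%m. norm (?g (m - int k))) summable_on UNIV" for k
  using summable_on_reindex_bij_betw[OF bij, of "%m. norm (?g m)" k] gs by simp
 have us: "summable (%k. norm (uk k * z ^ k))" by (rule bounded_series_summable[OF C z(2)])
 have Fk: "(\<Sum>\<^sub>\<infinity>m. ?F k m) = th (- z) * (uk k * z ^ k)" for k
 proof -
  have "(\<Sum>\<^sub>\<infinity>m. ?F k m) = (\<Sum>\<^sub>\<infinity>m. ?g (m - int k)) * (uk k * z ^ k)"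
   by (rule infsum_cmult_left) (rule abs_summable_summable[OF gsk])
  also have "(\<Sum>\<^sub>\<infinity>m. ?g (m - int k)) = (\<Sum>\<^sub>\<infinity>m. ?g m)" by (rule infsum_reindex_bij_betw[OF bij])
  finally show ?thesis by (simp add: th_T T_def)
 qed
 have nF: "norm (?F k m) = norm (?g (m - int k)) * norm (uk k * z ^ k)" for k m by (rule norm_mult)
 have abs: "(%x. norm (case x of (k, m) \<Rightarrow> ?F k m)) summable_on UNIV \<times> UNIV"
 proof (rule Infinite_Sum.abs_summable_on_Sigma_iff[THEN iffD2], intro conjI ballI)
  fix k :: nat
  show "(%m. norm (case (k, m) of (k, m) \<Rightarrow> ?F k m)) summable_on UNIV"
   unfolding prod.case nF by (intro summable_on_cmult_left gsk)
 next
  have "(\<Sum>\<^sub>\<infinity>m. norm (?F k m)) = (\<Sum>\<^sub>\<infinity>m. norm (?g m)) * norm (uk k * z ^ k)" for k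
  proof -
   have "(\<Sum>\<^sub>\<infinity>m. norm (?F k m)) = (\<Sum>\<^sub>\<infinity>m. norm (?g (m - int k))) * norm (uk k * z ^ k)"
    unfolding nF by (rule infsum_cmult_left) (rule gsk)
   also have "(\<Sum>\<^sub>\<infinity>m. norm (?g (m - int k))) = (\<Sum>\<^sub>\<infinity>m. norm (?g m))" by (rule infsum_reindex_bij_betw[OF bij])
   finally show ?thesis .
  qed
  moreover have "(%k. norm (uk k * z ^ k)) summable_on UNIV"
   using us by (subst summable_on_UNIV_nonneg_real_iff) auto
  ultimately have "(%k. \<Sum>\<^sub>\<infinity>m. norm (?F k m)) summable_on UNIV" by (simp only: summable_on_cmult_right)
  hence "(%k. norm (\<Sum>\<^sub>\<infinity>m. norm (?F k m))) summable_on UNIV" by (simp only: real_norm_def abs_of_nonneg infsum_nonneg norm_ge_zero)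
  thus "(%k. norm (\<Sum>\<^sub>\<infinity>m. norm (case (k, m) of (k, m) \<Rightarrow> ?F k m))) summable_on UNIV" unfolding prod.case .
 qed
 have eq: "?F k m = Q powi tri m * (- z) powi m * (ek k * (Q powi (- m)) ^ k)" for k m
 proof -
  have t: "tri (m - int k) = tri m + (int k * (int k + 1) div 2 - m * int k)"
  proof -
   have "2 * tri (m - int k) = 2 * tri m + (int k * (int k + 1) - 2 * (m * int k))"
    unfolding tri2 by (simp add: algebra_simps)
   moreover have "2 * (int k * (int k + 1) div 2) = int k * (int k + 1)" by simp
   ultimately show ?thesis by linarith
  qed
  have k2: "int k * (int k + 1) div 2 = int (k * (k + 1) div 2)" by (simp only: zdiv_int of_nat_mult of_nat_add of_nat_1 of_nat_numeral)
  have q: "Q powi tri (m - int k) = Q powi tri m * (Q ^ (k * (k + 1) div 2) * (Q powi (- m)) ^ k)"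
  proof -
   have "Q powi (int (k * (k + 1) div 2) - m * int k) = Q powi int (k * (k + 1) div 2) * Q powi (- (m * int k))"
    by (subst power_int_add[symmetric]) (use Q_nz in auto)
   moreover have "(Q powi (- m)) ^ k = Q powi (- (m * int k))" by (simp add: powi_nf)
   moreover have "Q powi (tri m + (int (k * (k + 1) div 2) - m * int k)) = Q powi tri m * Q powi (int (k * (k + 1) div 2) - m * int k)"
    by (rule power_int_add) (use Q_nz in auto)
   ultimately show ?thesis unfolding t k2 by simp
  qed
  have "(- z) powi (m - int k) = (- z) powi m / (- z) ^ k" by (simp add: power_int_diff z)
  moreover have "z ^ k = (-1) ^ k * (- z) ^ k" using power_minus[of "- z" k] by simp
  moreover have "(- z) ^ k \<noteq> 0" using z by simp
  ultimately have "(- z) powi (m - int k) * z ^ k = (- z) powi m * (-1) ^ k"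
   using z by (simp only: times_divide_eq_left) simp
  hence zz: "(- z) powi (m - int k) * z ^ k = (- z) powi m * (-1) ^ k" .
  have gen: "A * B * (u * Z) = A * u * (B * Z)" for A B u Z :: complex by simp
  show ?thesis unfolding gen zz q ek_def by (simp add: mult_ac)
 qed
 have Fm: "(\<Sum>\<^sub>\<infinity>k. ?F k m) = Q powi tri m * (- z) powi m * vv m" for m
 proof -
  have "(\<Sum>\<^sub>\<infinity>k. ek k * (Q powi (- m)) ^ k) = vv m"
   unfolding vv_def by (rule suminf_infsum[OF ek_summable, symmetric])
  moreover have "(%k. ek k * (Q powi (- m)) ^ k) summable_on UNIV"
   by (rule norm_summable_imp_summable_on[OF ek_summable])
  ultimately show ?thesis unfolding eq by (subst infsum_cmult_right) auto
 qed
 have "th (- z) * ph as bs z = th (- z) * (\<Sum>\<^sub>\<infinity>k. uk k * z ^ k)"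
  unfolding uk_series[OF z(2)] by (simp only: suminf_infsum[OF us])
 also have "\<dots> = (\<Sum>\<^sub>\<infinity>k. th (- z) * (uk k * z ^ k))"
  by (rule infsum_cmult_right[symmetric]) (rule norm_summable_imp_summable_on[OF us])
 also have "\<dots> = (\<Sum>\<^sub>\<infinity>k. \<Sum>\<^sub>\<infinity>m. ?F k m)" unfolding Fk ..
 also have "\<dots> = (\<Sum>\<^sub>\<infinity>m. \<Sum>\<^sub>\<infinity>k. ?F k m)"
  by (rule infsum_swap_banach) (rule abs_summable_summable[OF abs])
 finally show ?thesis unfolding Fm T_def .
qed

text \<open>The connection formula on the spiral of 1/c; no contribution of f_n appears
  there.\<close>

theorem natural_formula:
 assumes z: "z \<noteq> 0" "norm z < 1"
 shows "th (- z) * ph as bs z = (\<Sum>i\<in>{1..<n}. Ci i * psum (bi i) (1 / c) (- (c * a i * z)))"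
proof -
 have t: "1 / c \<noteq> 0" "1 / c \<notin> qZ q" using c_nz c_gen qZ_inverse[of "1 / c"] by auto
 let ?x = "%i m. a i powi m * bi i ((1 / c) * Q powi m)"
 have tm: "tempered (?x i)" if "i \<in> {1..<n}" for i
  by (intro tempered_mult tempered_powi bi_tempered t a_nz that)
 have "T vv (- z) = T (%m. \<Sum>i\<in>{1..<n}. Ci i * ?x i m) (- z)" using vv_all by presburger
 also have "\<dots> = (\<Sum>i\<in>{1..<n}. T (%m. Ci i * ?x i m) (- z))"
  by (intro T_sum tempered_cmult tm) (use z in auto)
 also have "\<dots> = (\<Sum>i\<in>{1..<n}. Ci i * psum (bi i) (1 / c) (- (c * a i * z)))"
 proof (rule sum.cong[OF refl])
  fix i assume i: "i \<in> {1..<n}"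
  have "?x i m = (c * a i) powi m * ((1 / c) powi m * bi i ((1 / c) * Q powi m))" for m
   using c_nz by (simp add: power_int_mult_distrib power_int_divide_distrib)
  hence "T (?x i) (- z) = T (%m. (1 / c) powi m * bi i ((1 / c) * Q powi m)) (c * a i * (- z))"
   by (simp only: T_scale)
  thus "T (%m. Ci i * ?x i m) (- z) = Ci i * psum (bi i) (1 / c) (- (c * a i * z))"
   unfolding T_cmult psum_def by simp
 qed
 finally show ?thesis using theta_series[OF z] by simp
qed

end

section \<open>Partial fractions of theta quotients and the change of spiral\<close>

context qconf begin

text \<open>The residue coefficients of the theta quotient; \<open>Ci_Gam\<close> matches them with
  the connection coefficients.\<close>

definition Ki where "Ki i = (\<Prod>l\<in>{1..<n}. th (- (b l / a i))) / (\<Prod>l\<in>{1..<n} - {i}. th (- (a l / a i)))"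

lemma th_ratio_nz: "i \<in> {1..<n} ==> l \<in> {1..<n} - {i} ==> th (- (a l / a i)) \<noteq> 0"
 using a_ratio[of i l] a_nz[of i] a_nz[of l] by (subst th_m_eq_0_iff) auto

lemma Ki_eq: assumes i: "i \<in> {1..<n}"
 shows "c * Ki i * (\<Prod>s\<in>{1..<n} - {i}. th (- (a i / a s))) = - (\<Prod>s\<in>{1..<n}. th (- (a i / b s)))"
proof -
 have inv: "th (- (x / a i)) = - (x / a i) * th (- (a i / x))" if "x \<noteq> 0" for x
  using th_inv[of "- (x / a i)"] a_nz[OF i] that by simp
 have "(\<Prod>l\<in>{1..<n}. th (- (b l / a i))) = (\<Prod>l\<in>{1..<n}. - (b l / a i)) * (\<Prod>s\<in>{1..<n}. th (- (a i / b s)))"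
  unfolding prod.distrib[symmetric] by (intro prod.cong inv refl b_nz)
 moreover have e: "(\<Prod>l\<in>{1..<n} - {i}. th (- (a l / a i))) = (\<Prod>s\<in>{1..<n} - {i}. - (a s / a i)) * (\<Prod>s\<in>{1..<n} - {i}. th (- (a i / a s)))"
  unfolding prod.distrib[symmetric] by (intro prod.cong inv refl a_nz) auto
 moreover have "(\<Prod>l\<in>{1..<n} - {i}. th (- (a l / a i))) \<noteq> 0" using th_ratio_nz[OF i] by auto
 moreover have gen: "c * (- (1 / c * X) * B / (X * A)) * A = - B" if "X * A \<noteq> 0" for X A B :: complex
  using that c_nz by simp
 ultimately show ?thesis unfolding Ki_def prod_neg_ratio[OF i] by (simp only:)
qed

text \<open>All summands have the multiplier PB / t^(n-1). Their sum vanishes on each -a_j q^Z, so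
  it is divisible by the product of the theta(t / a_s), and the quotient has multiplier 1/c. As 1/c
  is not in q^Z, it is 0.\<close>

theorem theta_partial_fractions:
 assumes cg: "c \<notin> qZ q" and t: "t \<noteq> 0"
 shows "th (- c) * (\<Prod>s\<in>{1..<n}. th (t / b s)) + c * (\<Sum>i\<in>{1..<n}. Ki i * th (t * c / a i) * (\<Prod>s\<in>{1..<n} - {i}. th (t / a s))) = 0"
proof -
 let ?I = "{1..<n}"
 define g where "g t = th (- c) * (\<Prod>s\<in>?I. th (t / b s)) + c * (\<Sum>i\<in>?I. Ki i * th (t * c / a i) * (\<Prod>s\<in>?I - {i}. th (t / a s)))" for t
 have gh: "g holomorphic_on -{0}"
  unfolding g_def by (intro holomorphic_intros) (use a_nz b_nz c_nz in auto)
 have gq: "g (Q * t) = PB / t ^ (n - 1) * g t" if t: "t \<noteq> 0" for t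
 proof -
  have sh: "th (Q * t / x) = th (t / x) * (x / t)" if "x \<noteq> 0" for x
   using th_Q'[of "t / x"] t that by simp
  have 1: "(\<Prod>s\<in>?I. th (Q * t / b s)) = PB / t ^ (n - 1) * (\<Prod>s\<in>?I. th (t / b s))"
  proof -
   have "(\<Prod>s\<in>?I. th (Q * t / b s)) = (\<Prod>s\<in>?I. th (t / b s) * (b s / t))" by (intro prod.cong sh refl b_nz)
   also have "\<dots> = (\<Prod>s\<in>?I. th (t / b s)) * (PB / t ^ (n - 1))" unfolding prod.distrib prod_dividef PB_def by simp
   finally show ?thesis by simp
  qed
  have 2: "th (Q * t * c / a i) * (\<Prod>s\<in>?I - {i}. th (Q * t / a s)) = PB / t ^ (n - 1) * (th (t * c / a i) * (\<Prod>s\<in>?I - {i}. th (t / a s)))" if i: "i \<in> ?I" for i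
  proof -
   have A: "th (Q * t * c / a i) = th (t * c / a i) * (a i / (t * c))"
    using th_Q'[of "t * c / a i"] t a_nz[OF i] c_nz by (simp add: mult.assoc)
   have B: "(\<Prod>s\<in>?I - {i}. th (Q * t / a s)) = (\<Prod>s\<in>?I - {i}. th (t / a s)) * (\<Prod>s\<in>?I - {i}. a s / t)"
    unfolding prod.distrib[symmetric] by (intro prod.cong sh refl a_nz) auto
   have C: "a i / (t * c) * (\<Prod>s\<in>?I - {i}. a s / t) = PB / t ^ (n - 1)"
   proof -
    have "a i / t * (\<Prod>s\<in>?I - {i}. a s / t) = (\<Prod>s\<in>?I. a s / t)" by (rule prod.remove[OF _ i, symmetric]) simp
    also have "\<dots> = PA / t ^ (n - 1)" unfolding prod_dividef PA_def by simp
    finally have "a i / t * (\<Prod>s\<in>?I - {i}. a s / t) / c = PB / t ^ (n - 1)"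
     using PA_nz PB_nz by (simp add: c_def)
    thus ?thesis by simp
   qed
   have gen: "x * r * (y * r') = (r * r') * (x * y)" for x y r r' :: complex by simp
   show ?thesis unfolding A B by (rule trans[OF gen]) (simp only: C)
  qed
  have "(\<Sum>i\<in>?I. Ki i * th (Q * t * c / a i) * (\<Prod>s\<in>?I - {i}. th (Q * t / a s))) = (\<Sum>i\<in>?I. PB / t ^ (n - 1) * (Ki i * th (t * c / a i) * (\<Prod>s\<in>?I - {i}. th (t / a s))))"
   unfolding mult.assoc[of "Ki _"] by (intro sum.cong refl) (simp only: 2 mult.left_commute)
  thus ?thesis unfolding g_def 1 by (simp add: sum_distrib_left distrib_left mult_ac)
 qed
 \<comment> \<open>At -a_j every summand with i different from j contains the factor theta(-1) = 0;
   the term i = j cancels the first product by \<open>Ki_eq\<close>.\<close>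
 have g0: "g (- a j) = 0" if j: "j \<in> ?I" for j
 proof -
  have m1: "th (- 1) = 0" using th_m_eq_0_iff[of 1] by simp
  have "Ki i * th (- a j * c / a i) * (\<Prod>s\<in>?I - {i}. th (- a j / a s)) = 0" if "i \<in> ?I - {j}" for i
  proof -
   have "j \<in> ?I - {i}" using j that by auto
   moreover have "- a j / a j = - 1" using a_nz[OF j] by simp
   hence "th (- a j / a j) = 0" using m1 by (simp only:)
   ultimately have "(\<Prod>s\<in>?I - {i}. th (- a j / a s)) = 0" by (intro prod_zero bexI[of _ j]) (simp, simp only:)
   thus ?thesis by simp
  qed
  hence "(\<Sum>i\<in>?I. Ki i * th (- a j * c / a i) * (\<Prod>s\<in>?I - {i}. th (- a j / a s))) = Ki j * th (- a j * c / a j) * (\<Prod>s\<in>?I - {j}. th (- a j / a s))"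
   using sum.remove[OF _ j, of "%i. Ki i * th (- a j * c / a i) * (\<Prod>s\<in>?I - {i}. th (- a j / a s))"] sum.neutral[of "?I - {j}"]
   by (metis (no_types, lifting) add.right_neutral finite_atLeastLessThan)
  moreover have "- a j * c / a j = - c" using a_nz[OF j] by simp
  ultimately have "g (- a j) = th (- c) * ((\<Prod>s\<in>?I. th (- (a j / b s))) + c * Ki j * (\<Prod>s\<in>?I - {j}. th (- (a j / a s))))"
   unfolding g_def by (simp add: distrib_left mult_ac)
  thus ?thesis using Ki_eq[OF j] by simp
 qed
 have g0': "g x = 0" if j: "j \<in> ?I" and x: "x \<noteq> 0" "th (x / a j) = 0" for j x
 proof -
  have "\<exists>m::int. x = - a j * Q powi m"
   using x a_nz[OF j] th_eq_0_iff[of "x / a j"] by (auto simp: field_simps)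
  then obtain m where m: "x = - a j * Q powi m" by blast
  have s: "g (- a j * Q ^ k) = 0" for k
  proof (induction k)
   case (Suc k)
   show ?case using gq[of "- a j * Q ^ k"] Suc a_nz[OF j] by (simp add: mult_ac)
  qed (use g0[OF j] in simp)
  have s': "g (- a j * Q powi (- int k)) = 0" for k
  proof (induction k)
   case (Suc k)
   have "Q * (- a j * Q powi (- int (Suc k))) = - a j * Q powi (- int k)"
   proof -
    have "Q powi (1 + (- int (Suc k))) = Q powi 1 * Q powi (- int (Suc k))" by (rule power_int_add) (use Q_nz in auto)
    thus ?thesis by (simp add: mult_ac)
   qed
   moreover have w: "- a j * Q powi (- int (Suc k)) \<noteq> 0" using a_nz[OF j] by simp
   ultimately have "PB / (- a j * Q powi (- int (Suc k))) ^ (n - 1) * g (- a j * Q powi (- int (Suc k))) = 0"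
    using gq[OF w] Suc by (simp only:)
   moreover have "PB / (- a j * Q powi (- int (Suc k))) ^ (n - 1) \<noteq> 0" using PB_nz w by (simp only: divide_eq_0_iff power_eq_0_iff) simp
   ultimately show ?case by (simp only: mult_eq_0_iff) simp
  qed (use g0[OF j] in simp)
  show ?thesis
  proof (cases "m \<ge> 0")
   case True
   thus ?thesis using s[of "nat m"] m by (simp add: power_int_def)
  next
   case False
   thus ?thesis using s'[of "nat (- m)"] m by simp
  qed
 qed
 \<comment> \<open>The theta factors are divided out one at a time; their zero sets are disjoint
   because no ratio of the a_s lies in q^Z.\<close>
 have div: "\<exists>h. h holomorphic_on -{0} \<and> (\<forall>x. x \<noteq> 0 \<longrightarrow> g x = h x * (\<Prod>s\<in>J. th (x / a s)))" if "J \<subseteq> ?I" for J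
 proof -
  have "finite J" using that finite_subset by blast
  thus ?thesis using that
  proof (induction J)
   case empty
   show ?case using gh by (intro exI[of _ g]) auto
  next
   case (insert j J)
   then obtain h where h: "h holomorphic_on -{0}" "\<And>x. x \<noteq> 0 ==> g x = h x * (\<Prod>s\<in>J. th (x / a s))" by auto
   have j: "j \<in> ?I" using insert by auto
   have "h x = 0" if x: "x \<noteq> 0" "th (1 / a j * x) = 0" for x
   proof -
    have xj: "th (x / a j) = 0" using x(2) by simp
    have "th (x / a s) \<noteq> 0" if s: "s \<in> J" for s
    proof
     assume "th (x / a s) = 0"
     hence 1: "- (x / a s) \<in> qZ q" using th_eq_0_iff'[of "x / a s"] x(1) a_nz s insert.prems by auto
     have 2: "- (x / a j) \<in> qZ q" using th_eq_0_iff'[of "x / a j"] xj x(1) a_nz[OF j] by auto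
     have "- (x / a s) * (1 / (- (x / a j))) \<in> qZ q" by (rule qZ_mult[OF 1 qZ_inverse[OF 2]])
     hence "a j / a s \<in> qZ q" using x(1) by simp
     moreover have "s \<in> ?I" "s \<noteq> j" using s insert by auto
     ultimately show False using a_gen[OF j] by blast
    qed
    hence "(\<Prod>s\<in>J. th (x / a s)) \<noteq> 0" using insert.hyps by simp
    thus ?thesis using h(2)[OF x(1)] g0'[OF j x(1) xj] by simp
   qed
   then obtain h' where h': "h' holomorphic_on -{0}" "\<And>x. x \<noteq> 0 ==> h x = h' x * th (1 / a j * x)"
    using th_divide[OF h(1), of "1 / a j"] a_nz[OF j] by auto
   show ?case using h' h(2) insert.hyps by (intro exI[of _ h']) (auto simp: mult_ac)
  qed
 qed
 then obtain h where h: "h holomorphic_on -{0}" "\<And>x. x \<noteq> 0 ==> g x = h x * (\<Prod>s\<in>?I. th (x / a s))" by blast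
 have h0: "h (Q * x) = 1 / c * h x" if x: "x \<noteq> 0" "\<forall>s\<in>?I. th (x / a s) \<noteq> 0" for x
 proof -
  have P: "(\<Prod>s\<in>?I. th (Q * x / a s)) = PA / x ^ (n - 1) * (\<Prod>s\<in>?I. th (x / a s))"
  proof -
   have "(\<Prod>s\<in>?I. th (Q * x / a s)) = (\<Prod>s\<in>?I. th (x / a s) * (a s / x))"
   proof (intro prod.cong refl)
    fix s assume "s \<in> ?I"
    thus "th (Q * x / a s) = th (x / a s) * (a s / x)" using th_Q'[of "x / a s"] x(1) a_nz[of s] by simp
   qed
   also have "\<dots> = (\<Prod>s\<in>?I. th (x / a s)) * (PA / x ^ (n - 1))" unfolding prod.distrib prod_dividef PA_def by simp
   finally show ?thesis by simp
  qed
  have "h (Q * x) * (PA / x ^ (n - 1) * (\<Prod>s\<in>?I. th (x / a s))) = PB / x ^ (n - 1) * (h x * (\<Prod>s\<in>?I. th (x / a s)))"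
  proof -
   have "Q * x \<noteq> 0" using x(1) by simp
   from h(2)[OF this] have "h (Q * x) * (\<Prod>s\<in>?I. th (Q * x / a s)) = PB / x ^ (n - 1) * g x" unfolding gq[OF x(1)] by (rule sym)
   thus ?thesis unfolding P h(2)[OF x(1)] .
  qed
  moreover have "(\<Prod>s\<in>?I. th (x / a s)) \<noteq> 0" using x(2) by simp
  moreover have "u = 1 / c * v" if "u * (PA / X * P) = PB / X * (v * P)" "P \<noteq> 0" "X \<noteq> 0" for u v X P
   using that PA_nz PB_nz by (simp add: c_def field_simps)
  ultimately show ?thesis using x(1) by (metis power_not_zero)
 qed
 have hq: "h (Q * x) = 1 / c * h x" if x: "x \<noteq> 0" for x
 proof (rule tendsto_unique)
  have c1: "isCont h x" "isCont h (Q * x)" using hol_isCont[OF h(1)] x by auto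
  show "((%y. 1 / c * h y) \<longlongrightarrow> 1 / c * h x) (at x)" by (intro tendsto_intros) (use c1 in \<open>simp add: isCont_def\<close>)
  have l: "((%y. h (Q * y)) \<longlongrightarrow> h (Q * x)) (at x)"
   by (rule isCont_tendsto_compose[OF c1(2)]) (intro tendsto_intros)
  have "\<forall>\<^sub>F y in at x. y \<noteq> 0" using t1_space_nhds[OF x] by (auto simp: eventually_at_filter elim: eventually_mono)
  moreover have "\<forall>\<^sub>F y in at x. th (y / a s) \<noteq> 0" if s: "s \<in> ?I" for s
  proof -
   have k: "- (1 / a s) \<noteq> 0" using a_nz[OF s] by simp
   have "\<forall>\<^sub>F y in at (- (1 / a s) * x). y \<notin> qZ q" by (rule qZ_discrete) (use x k in auto)
   hence "\<forall>\<^sub>F y in at x. - (1 / a s) * y \<notin> qZ q" by (rule eventually_compose_filterlim[OF _ filterlim_mult_at[OF k]])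
   thus ?thesis using calculation
   proof eventually_elim
    case (elim y)
    thus ?case using th_eq_0_iff'[of "y / a s"] a_nz[OF s] by auto
   qed
  qed
  hence "\<forall>\<^sub>F y in at x. \<forall>s\<in>?I. th (y / a s) \<noteq> 0" by (intro eventually_ball_finite) auto
  ultimately have "\<forall>\<^sub>F y in at x. h (Q * y) = 1 / c * h y" by eventually_elim (use h0 in auto)
  thus "((%y. 1 / c * h y) \<longlongrightarrow> h (Q * x)) (at x)" using l by (rule Lim_transform_eventually[rotated])
 qed simp
 have "1 / c \<noteq> 0" "1 / c \<notin> qZ q" using c_nz cg qZ_inverse[of "1 / c"] by auto
 hence "h t = 0" using multiplicative_zero[OF h(1) _ _ hq t] by blast
 thus ?thesis using h(2)[OF t] by (simp add: g_def)
qed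

text \<open>By the triple product each theta factor of \<open>Ki\<close> splits into a part
  belonging to \<open>Ci\<close> and a part belonging to \<open>Gam\<close>.\<close>

lemma Ci_Gam: assumes i: "i \<in> {1..<n}" shows "Ci i * Gam i * qi Q ^ 2 = Ki i * kapC"
proof -
 let ?I = "{1..<n}" and ?J = "{1..<n} - {i}"
 have tp: "th (- (x / a i)) = qi Q * qi (x / a i) * qi (a i * Q / x)" if "x \<noteq> 0" for x
  using th_product[of "- (x / a i)"] a_nz[OF i] that by (simp add: mult.commute)
 have k1: "(\<Prod>l\<in>?I. th (- (b l / a i))) = qi Q ^ card ?I * (\<Prod>l\<in>?I. qi (b l / a i)) * (\<Prod>l\<in>?I. qi (a i * Q / b l))"
  unfolding prod_constant[symmetric] prod.distrib[symmetric] by (intro prod.cong tp refl b_nz)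
 have k2: "(\<Prod>l\<in>?J. th (- (a l / a i))) = qi Q ^ card ?J * (\<Prod>l\<in>?J. qi (a l / a i)) * (\<Prod>l\<in>?J. qi (a i * Q / a l))"
  unfolding prod_constant[symmetric] prod.distrib[symmetric] by (intro prod.cong tp refl a_nz) auto
 have cd: "qi Q ^ card ?I = qi Q ^ card ?J * qi Q"
  using card_Suc_Diff1[OF _ i] by (metis finite_atLeastLessThan power_Suc2)
 have g: "Gam i = qi (a i) * (\<Prod>l\<in>?I. qi (a i * Q / b l)) / (qi Q * (\<Prod>l\<in>?J. qi (a i * Q / a l)))"
  unfolding Gam_def Asi_def Bsi_def list.map prod_list.Cons map_map o_def prod_list_range prod_list_filter ..
 have p: "(\<Prod>l\<in>?I. qi (a l)) = qi (a i) * (\<Prod>l\<in>?J. qi (a l))" by (rule prod.remove[OF _ i]) simp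
 have gen: "(X * B1) / (PBt * A1) * (u * B2 / (w * A2)) * w ^ 2 = (W * w * B1 * B2) / (W * A1 * A2) * (u * X / PBt)"
  if "w \<noteq> 0" "W \<noteq> 0" for X B1 PBt A1 u B2 w A2 W :: complex
  using that by (simp add: power2_eq_square mult_ac)
 show ?thesis unfolding Ci_def g Ki_def k1 k2 cd kapC_def p by (rule gen) auto
qed

definition DD where "DD lam = (\<Prod>s\<in>{1..<n}. th (c * b s / lam)) / (\<Prod>s\<in>{1..<n}. th (c * a s / lam))"

text \<open>The connection formula in a form without logarithms, cleared of the denominators in \<open>z\<close>.\<close>
definition star where
 "star lam z \<longleftrightarrow> th (- z) * th (lam * z) * ph as bs z =
  (\<Sum>i\<in>{1..<n}. Ci i * th (- (a i * z)) * psum (bi i) (- (lam / (a i * c))) (- (c * a i * z)))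
  + kapC * qi Q * DD lam * th (lam * z / c) * T sseq (- (c * z))"

text \<open>The previous expansion at t = lam / c, divided by the product of the theta(t / a_s);
  inversion of theta converts it to the arguments used in \<open>DD\<close>.\<close>

lemma DD_partial_fractions:
 assumes cg: "c \<notin> qZ q" and lam: "lam \<noteq> 0" "\<And>i. i \<in> {1..<n} ==> - (lam / (a i * c)) \<notin> qZ q"
 shows "(\<Sum>i\<in>{1..<n}. Ki i * (th (lam / a i) / th (lam / (a i * c)))) = - (th (- c) * DD lam)"
proof -
 let ?I = "{1..<n}"
 define t where "t = lam / c"
 have t: "t \<noteq> 0" using lam c_nz by (simp add: t_def)
 have tn: "th (t / a i) \<noteq> 0" if "i \<in> ?I" for i
  using lam(2)[OF that] th_eq_0_iff'[of "t / a i"] t a_nz[OF that] by (simp add: t_def mult.commute)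
 have D: "DD lam = (1 / c) * ((\<Prod>s\<in>?I. th (t / b s)) / (\<Prod>s\<in>?I. th (t / a s)))"
 proof -
  have inv: "th (c * x / lam) = x / t * th (t / x)" if "x \<noteq> 0" for x
   using th_inv[of "x / t"] that t lam c_nz by (simp add: t_def mult.commute)
  have "(\<Prod>s\<in>?I. th (c * b s / lam)) = PB / t ^ (n - 1) * (\<Prod>s\<in>?I. th (t / b s))"
  proof -
   have "(\<Prod>s\<in>?I. th (c * b s / lam)) = (\<Prod>s\<in>?I. b s / t * th (t / b s))" by (intro prod.cong inv refl b_nz)
   thus ?thesis unfolding prod.distrib prod_dividef PB_def by simp
  qed
  moreover have "(\<Prod>s\<in>?I. th (c * a s / lam)) = PA / t ^ (n - 1) * (\<Prod>s\<in>?I. th (t / a s))"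
  proof -
   have "(\<Prod>s\<in>?I. th (c * a s / lam)) = (\<Prod>s\<in>?I. a s / t * th (t / a s))" by (intro prod.cong inv refl a_nz)
   thus ?thesis unfolding prod.distrib prod_dividef PA_def by simp
  qed
  ultimately show ?thesis using t PA_nz PB_nz by (simp add: DD_def c_def)
 qed
 have An: "(\<Prod>s\<in>?I. th (t / a s)) \<noteq> 0" using tn by simp
 have "Ki i * th (t * c / a i) * (\<Prod>s\<in>?I - {i}. th (t / a s)) = Ki i * (th (lam / a i) / th (lam / (a i * c))) * (\<Prod>s\<in>?I. th (t / a s))" if i: "i \<in> ?I" for i
 proof -
  have 1: "(\<Prod>s\<in>?I. th (t / a s)) = th (t / a i) * (\<Prod>s\<in>?I - {i}. th (t / a s))" by (rule prod.remove[OF _ i]) simp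
  have 2: "t * c / a i = lam / a i" "t / a i = lam / (a i * c)" using c_nz by (simp_all add: t_def mult.commute)
  have gen: "k * X * P = k * (X / Y) * (Y * P)" if "Y \<noteq> 0" for k X P Y :: complex using that by simp
  show ?thesis unfolding 1 2 by (rule gen) (use tn[OF i] in \<open>simp add: 2\<close>)
 qed
 hence "(\<Sum>i\<in>?I. Ki i * th (t * c / a i) * (\<Prod>s\<in>?I - {i}. th (t / a s))) = (\<Sum>i\<in>?I. Ki i * (th (lam / a i) / th (lam / (a i * c)))) * (\<Prod>s\<in>?I. th (t / a s))"
  by (simp add: sum_distrib_right)
 hence "th (- c) * (\<Prod>s\<in>?I. th (t / b s)) + c * ((\<Sum>i\<in>?I. Ki i * (th (lam / a i) / th (lam / (a i * c)))) * (\<Prod>s\<in>?I. th (t / a s))) = 0"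
  using theta_partial_fractions[OF cg t] by simp
 moreover have "S = - (u * (1 / c * (B / A)))" if "u * B + c * (S * A) = 0" "A \<noteq> 0" for S u B A
 proof -
  have "c * (S * A) = - (u * B)" using that by (simp add: add_eq_0_iff)
  thus ?thesis using that(2) c_nz by (simp add: field_simps)
 qed
 ultimately show ?thesis unfolding D using An by blast
qed

end

context qgen begin

text \<open>Each sum in \<open>natural_formula\<close> is moved from the spiral of 1/c to that
  prescribed by lam. All corrections are multiples of one function, and their coefficients are added
  by \<open>DD_partial_fractions\<close>.\<close>

theorem star_generic:
 assumes z: "z \<noteq> 0" "norm z < 1" and lam: "lam \<noteq> 0" "\<And>i. i \<in> {1..<n} ==> - (lam / (a i * c)) \<notin> qZ q"
 shows "star lam z"
proof -
 let ?I = "{1..<n}"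
 let ?t = "%i. - (lam / (a i * c))" and ?y = "%i. - (c * a i * z)"
 have t': "1 / c \<noteq> 0" "1 / c \<notin> qZ q" using c_nz c_gen qZ_inverse[of "1 / c"] by auto
 have thc: "th (- c) \<noteq> 0" using c_gen c_nz th_m_eq_0_iff by simp
 have st: "Ci i * (psum (bi i) (1 / c) (?y i) * th (lam * z)) = Ci i * th (- (a i * z)) * psum (bi i) (?t i) (?y i)
   - kapC * qi Q / th (- c) * th (lam * z / c) * T sseq (- (c * z)) * (Ki i * (th (lam / a i) / th (lam / (a i * c))))" if i: "i \<in> ?I" for i
 proof -
  have ai: "a i \<noteq> 0" using a_nz[OF i] .
  have t: "?t i \<noteq> 0" "?t i \<notin> qZ q" using lam ai c_nz i by auto
  have y: "?y i \<noteq> 0" using ai c_nz z by simp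
  \<comment> \<open>With these arguments the theta factor of the correction and the argument of
    \<open>T sseq\<close> no longer depend on i.\<close>
  have e: "1 / c * ?y i = - (a i * z)" "?t i * ?y i = lam * z" "?t i * (1 / c) * ?y i = lam * z / c" "?y i / a i = - (c * z)"
   using ai c_nz by simp_all
  have "psum (bi i) (?t i) (?y i) * th (- (a i * z)) - psum (bi i) (1 / c) (?y i) * th (lam * z)
   = stokes (?t i) (1 / c) * th (lam * z / c) * (Gam i * T sseq (- (c * z)))"
   using bi_stokes[OF i t t' y] unfolding e .
  moreover have "stokes (?t i) (1 / c) = qi Q ^ 3 / th (- c) * (th (lam / a i) / th (lam / (a i * c)))"
  proof -
   have e2: "- ?t i / (1 / c) = lam / a i" "- ?t i = lam / (a i * c)" using ai c_nz by simp_all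
   have "th (- c) = - c * th (- (1 / c))" using th_inv[of "- c"] c_nz by simp
   hence "1 / c / th (- (1 / c)) = - 1 / th (- c)" using thc c_nz by (simp add: field_simps)
   moreover have "- W * (1 / c) * X / (Y * Z) = - W * (1 / c / Y) * (X / Z)" for W X Y Z by simp
   moreover have "- W * (- 1 / v) * r = W / v * r" for W v r :: complex by simp
   moreover have "lam / (a i * c) / (1 / c) = lam / a i" using c_nz by simp
   ultimately show ?thesis unfolding stokes_def e2 by (simp only:)
  qed
  ultimately have 1: "psum (bi i) (1 / c) (?y i) * th (lam * z) = psum (bi i) (?t i) (?y i) * th (- (a i * z))
   - qi Q ^ 3 / th (- c) * (th (lam / a i) / th (lam / (a i * c))) * th (lam * z / c) * (Gam i * T sseq (- (c * z)))"
   by (simp only: diff_eq_eq eq_diff_eq) (simp only: add.commute)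
  have 2: "Ci i * (Gam i * qi Q ^ 2) = Ki i * kapC" using Ci_Gam[OF i] by (simp add: mult.assoc)
  have gen: "C * (P * X - w ^ 3 / u * r * v * (G * S)) = C * X * P - (C * (G * w ^ 2)) * w / u * v * S * r" for C P X w u r v G S :: complex
   by (simp add: algebra_simps power2_eq_square power3_eq_cube)
  have gen2: "K * k * w / u * v * S * r = k * w / u * v * S * (K * r)" for K k w u v S r :: complex by simp
  show ?thesis unfolding 1 gen 2 gen2 ..
 qed
 have "th (- z) * th (lam * z) * ph as bs z = (\<Sum>i\<in>?I. Ci i * (psum (bi i) (1 / c) (?y i) * th (lam * z)))"
 proof -
  have "th (- z) * th (lam * z) * ph as bs z = (th (- z) * ph as bs z) * th (lam * z)" by simp
  thus ?thesis unfolding natural_formula[OF z] sum_distrib_right mult.assoc .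
 qed
 also have "\<dots> = (\<Sum>i\<in>?I. Ci i * th (- (a i * z)) * psum (bi i) (?t i) (?y i))
  - kapC * qi Q / th (- c) * th (lam * z / c) * T sseq (- (c * z)) * (\<Sum>i\<in>?I. Ki i * (th (lam / a i) / th (lam / (a i * c))))"
  unfolding sum_distrib_left sum_subtractf[symmetric] by (intro sum.cong refl st)
 also have "kapC * qi Q / th (- c) * th (lam * z / c) * T sseq (- (c * z)) * (\<Sum>i\<in>?I. Ki i * (th (lam / a i) / th (lam / (a i * c))))
  = - (kapC * qi Q * DD lam * th (lam * z / c) * T sseq (- (c * z)))"
 proof -
  have "(\<Sum>i\<in>?I. Ki i * (th (lam / a i) / th (lam / (a i * c)))) = - (th (- c) * DD lam)"
   by (rule DD_partial_fractions[OF c_gen lam(1)]) (rule lam(2))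
  moreover have "X / v * Y * Z * (- (v * D)) = - (X * D * Y * Z)" if "v \<noteq> 0" for X v Y Z D :: complex using that by simp
  ultimately show ?thesis using thc by (simp only:)
 qed
 finally show ?thesis by (simp add: star_def)
qed

end

section \<open>Passage to all parameters\<close>

context qbase begin

lemma prod_list_bound:
 assumes e: "norm (e::complex) \<le> 2"
 shows "norm (\<Prod>x\<leftarrow>map (%x. e * x) As. qp x k) \<le> (\<Prod>x\<leftarrow>As. exp (2 * norm x / (1 - q)))"
proof (induction As)
 case (Cons y As)
 have "norm (e * y) \<le> 2 * norm y" using e by (simp add: norm_mult mult_right_mono)
 hence "norm (qp (e * y) k) \<le> exp (2 * norm y / (1 - q))" by (rule qp_bound)
 thus ?case using Cons by (simp add: norm_mult mult_mono)
qed simp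

text \<open>Only the numerator parameters are scaled, because the ratios a_i / a_l and the b_l stay
  fixed; hence one bound for all |e| <= 2.\<close>

lemma hcoef_scaled_bounded:
 assumes Bs: "\<forall>B\<in>set Bs. B \<notin> q_minusN q"
 obtains C where "\<And>e k. norm (e::complex) \<le> 2 ==> norm (hcoef (map (%x. e * x) As) Bs k) \<le> C"
proof -
 obtain d where d: "d > 0" "\<And>k. d \<le> norm (\<Prod>x\<leftarrow>Bs. qp x k)" using list_bounds(2)[OF Bs] by blast
 obtain d' where d': "d' > 0" "\<And>k. d' \<le> norm (qp Q k)" using qp_lower[of Q] by auto
 have "norm (hcoef (map (%x. e * x) As) Bs k) \<le> (\<Prod>x\<leftarrow>As. exp (2 * norm x / (1 - q))) / (d' * d)" if "norm e \<le> 2" for e k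
  unfolding hcoef_def norm_divide norm_mult using d d'
  by (intro frac_le prod_list_bound that mult_mono mult_pos_pos order_trans[OF norm_ge_zero prod_list_bound[OF that]]) auto
 thus ?thesis using that by blast
qed

lemma qp_tendsto: "(f \<longlongrightarrow> a) F ==> ((%x. qp (f x) k) \<longlongrightarrow> qp a k) F"
 unfolding qpoch_def by (intro tendsto_intros)

lemma hcoef_tendsto:
 assumes Bs: "\<forall>B\<in>set Bs. B \<notin> q_minusN q" and e: "(e \<longlongrightarrow> 1) F"
 shows "((%j. hcoef (map (%x. e j * x) As) Bs k) \<longlongrightarrow> hcoef As Bs k) F"
proof -
 have "((%j. \<Prod>x\<leftarrow>map (%x. e j * x) As. qp x k) \<longlongrightarrow> (\<Prod>x\<leftarrow>As. qp x k)) F"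
 proof (induction As)
  case (Cons y As)
  have "((%j. e j * y) \<longlongrightarrow> 1 * y) F" by (intro tendsto_intros e)
  hence "((%j. qp (e j * y) k) \<longlongrightarrow> qp y k) F" by (intro qp_tendsto) simp
  from tendsto_mult[OF this Cons] show ?case by simp
 qed simp
 moreover have "qp Q k * (\<Prod>x\<leftarrow>Bs. qp x k) \<noteq> 0" using prod_list_qp_nz[OF Bs] by simp
 ultimately show ?thesis unfolding hcoef_def by (intro tendsto_divide tendsto_const)
qed

lemma ph_scaled_bound:
 assumes Bs: "\<forall>B\<in>set Bs. B \<notin> q_minusN q" and C: "\<And>k. norm (hcoef As Bs k) \<le> C" and x: "norm x < 1"
 shows "norm (ph As Bs x) \<le> C * (1 / (1 - norm x))"
proof -
 have s: "summable (%k. C * norm x ^ k)" using x by (intro summable_mult summable_geometric) auto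
 have "norm (hcoef As Bs k * x ^ k) \<le> C * norm x ^ k" for k
  using C[of k] by (simp add: norm_mult norm_power mult_right_mono)
 hence "norm (ph As Bs x) \<le> (\<Sum>k. C * norm x ^ k)"
  unfolding ph_series[OF Bs x] by (rule norm_suminf_le[OF _ s])
 also have "\<dots> = C * (1 / (1 - norm x))"
  using x by (subst suminf_mult) (auto simp: suminf_geometric intro!: summable_geometric)
 finally show ?thesis .
qed

lemma ph_scaled_tendsto:
 assumes Bs: "\<forall>B\<in>set Bs. B \<notin> q_minusN q" and e: "e \<longlonglongrightarrow> 1" "\<And>j. norm (e j) \<le> 2" and x: "norm x < 1"
 shows "(%j. ph (map (%x. e j * x) As) Bs x) \<longlonglongrightarrow> ph As Bs x"
proof -
 obtain C where C: "\<And>e k. norm (e::complex) \<le> 2 ==> norm (hcoef (map (%x. e * x) As) Bs k) \<le> C"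
  using hcoef_scaled_bounded[OF Bs] by blast
 have C1: "norm (hcoef As Bs k) \<le> C" for k using C[of 1 k] by simp
 have ser: "ph As' Bs x = (\<Sum>\<^sub>\<infinity>k. hcoef As' Bs k * x ^ k)" if "\<And>k. norm (hcoef As' Bs k) \<le> C" for As'
  unfolding ph_series[OF Bs x] by (rule suminf_infsum) (rule bounded_series_summable[OF that x])
 have "(%j. \<Sum>\<^sub>\<infinity>k. hcoef (map (%x. e j * x) As) Bs k * x ^ k) \<longlonglongrightarrow> (\<Sum>\<^sub>\<infinity>k. hcoef As Bs k * x ^ k)"
 proof (rule tannery_infsum(2))
  have "summable (%k. C * norm x ^ k)" using x by (intro summable_mult summable_geometric) auto
  moreover have "C \<ge> 0" using C1[of 0] norm_ge_zero order_trans by blast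
  ultimately show "(%k. C * norm x ^ k) summable_on UNIV" by (subst summable_on_UNIV_nonneg_real_iff) auto
  show "(%j. hcoef (map (%x. e j * x) As) Bs k * x ^ k) \<longlonglongrightarrow> hcoef As Bs k * x ^ k" for k
   by (intro tendsto_mult hcoef_tendsto Bs e(1) tendsto_const)
  show "\<forall>\<^sub>F j in sequentially. \<forall>k. norm (hcoef (map (%x. e j * x) As) Bs k * x ^ k) \<le> C * norm x ^ k"
   using C[OF e(2)] by (intro always_eventually allI) (simp add: norm_mult norm_power mult_right_mono)
 qed simp
 moreover have "ph (map (%x. e j * x) As) Bs x = (\<Sum>\<^sub>\<infinity>k. hcoef (map (%x. e j * x) As) Bs k * x ^ k)" for j
  by (rule ser) (rule C[OF e(2)])
 ultimately show ?thesis using ser[OF C1] by simp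
qed

text \<open>Continuations are hard to compare directly. Convergence and boundedness are known for
  large M, where the samples lie in the disc of convergence, and the recursion transports both to
  all M, with at most one factor \<open>A\<close> per step.\<close>

lemma down_limit:
 fixes X :: "nat \<Rightarrow> int \<Rightarrow> complex"
 assumes rec: "\<And>k M. (Q powi M - s) * X k M = (\<Sum>j=1..n. (P k j * Q powi M + R k j) * X k (M + int j))"
  and recL: "\<And>M. (Q powi M - s) * Y M = (\<Sum>j=1..n. (p j * Q powi M + r j) * Y (M + int j))"
  and P: "\<And>j. (%k. P k j) \<longlonglongrightarrow> p j" and R: "\<And>j. (%k. R k j) \<longlonglongrightarrow> r j"
  and s: "s \<noteq> 0" "s \<notin> qZ q"
  and lim: "\<And>M. M \<ge> M0 ==> (%k. X k M) \<longlonglongrightarrow> Y M"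
  and bd: "\<And>k M. M \<ge> M0 ==> norm (X k M) \<le> C"
 shows "(%k. X k M) \<longlonglongrightarrow> Y M" and "\<exists>C K. K \<ge> 1 \<and> (\<forall>k M. norm (X k M) \<le> C * K ^ nat \<bar>M\<bar>)"
proof -
 have nz: "Q powi M - s \<noteq> 0" for M using s qZ_powi[of M] by auto
 have "\<forall>M \<ge> M0 - int i. (%k. X k M) \<longlonglongrightarrow> Y M" for i
 proof (induction i)
  case (Suc i)
  show ?case
  proof (intro allI impI)
   fix M assume M: "M0 - int (Suc i) \<le> M"
   show "(%k. X k M) \<longlonglongrightarrow> Y M"
   proof (cases "M \<ge> M0 - int i")
    case False
    have "(%k. (\<Sum>j=1..n. (P k j * Q powi M + R k j) * X k (M + int j)) / (Q powi M - s)) \<longlonglongrightarrow>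
     (\<Sum>j=1..n. (p j * Q powi M + r j) * Y (M + int j)) / (Q powi M - s)"
    proof (intro tendsto_divide tendsto_sum tendsto_mult tendsto_add P R tendsto_const nz)
     fix j assume "j \<in> {1..n}"
     hence "M0 - int i \<le> M + int j" using M by auto
     thus "(%k. X k (M + int j)) \<longlonglongrightarrow> Y (M + int j)" using Suc by blast
    qed
    thus ?thesis unfolding rec[symmetric] recL[symmetric] using nz by simp
   qed (use Suc in blast)
  qed
 qed (use lim in auto)
 from this[of "nat (M0 - M)"] show "(%k. X k M) \<longlonglongrightarrow> Y M" using lim[of M] by (cases "M \<ge> M0") auto
next
 have nz: "Q powi M - s \<noteq> 0" for M using s qZ_powi[of M] by auto
 obtain \<delta> where d: "\<delta> > 0" "\<And>m. \<delta> \<le> norm (1 - s * Q powi m)" using lattice_gap_int[OF s] by blast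
 have "1 / s \<noteq> 0" "1 / s \<notin> qZ q" using s qZ_inverse[of "1 / s"] by auto
 then obtain \<delta>' where d': "\<delta>' > 0" "\<And>m. \<delta>' \<le> norm (1 - 1 / s * Q powi m)" using lattice_gap_int by blast
 \<comment> \<open>Each step divides by q^M - s. For the coefficient bounds this must be compared
   both with q^M, which explodes as M decreases, and with 1.\<close>
 have g1: "q powi M \<le> norm (Q powi M - s) / \<delta>" for M
 proof -
  have "Q powi M - s = Q powi M * (1 - s * Q powi (- M))"
   by (simp add: right_diff_distrib power_int_minus)
  hence "norm (Q powi M - s) = q powi M * norm (1 - s * Q powi (- M))" using q0 by (simp add: norm_mult norm_power_int)
  also have "\<dots> \<ge> q powi M * \<delta>" using d q0 by (intro mult_left_mono) auto
  finally show ?thesis using d(1) by (simp add: field_simps)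
 qed
 have g2: "1 \<le> norm (Q powi M - s) / (norm s * \<delta>')" for M
 proof -
  have "Q powi M - s = - s * (1 - 1 / s * Q powi M)" using s by (simp add: right_diff_distrib)
  hence "norm (Q powi M - s) = norm s * norm (1 - 1 / s * Q powi M)" by (simp only: norm_mult norm_minus_cancel)
  also have "\<dots> \<ge> norm s * \<delta>'" by (intro mult_left_mono d') auto
  finally show ?thesis using d'(1) s by (simp add: field_simps)
 qed
 have "\<exists>B. \<forall>k. norm (P k j) \<le> B" "\<exists>B. \<forall>k. norm (R k j) \<le> B" for j
  using convergent_imp_Bseq[OF convergentI[OF P[of j]]] convergent_imp_Bseq[OF convergentI[OF R[of j]]]
  unfolding Bseq_def by blast+
 then obtain BP BR where B: "\<And>k j. norm (P k j) \<le> BP j" "\<And>k j. norm (R k j) \<le> BR j" by metis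
 have B0: "BP j \<ge> 0" "BR j \<ge> 0" for j using B[of 0 j] by (auto intro: order_trans[OF norm_ge_zero])
 define A where "A = max 1 (\<Sum>j=1..n. BP j / \<delta> + BR j / (norm s * \<delta>'))"
 have A1: "A \<ge> 1" by (simp add: A_def)
 define C' where "C' = max C 0"
 have step: "norm (X k M) \<le> A * W" if W: "\<And>j. j \<in> {1..n} ==> norm (X k (M + int j)) \<le> W" "W \<ge> 0" for k M W
 proof -
  let ?D = "norm (Q powi M - s)"
  have "norm (X k M) * ?D = norm (\<Sum>j=1..n. (P k j * Q powi M + R k j) * X k (M + int j))"
   unfolding rec[symmetric] by (simp add: norm_mult)
  also have "\<dots> \<le> (\<Sum>j=1..n. (BP j / \<delta> + BR j / (norm s * \<delta>')) * ?D * W)"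
  proof (intro sum_norm_le)
   fix j assume j: "j \<in> {1..n}"
   have "norm (P k j * Q powi M + R k j) \<le> BP j * q powi M + BR j * 1"
   proof (rule order_trans[OF norm_triangle_ineq add_mono])
    show "norm (P k j * Q powi M) \<le> BP j * q powi M"
     using q0 B(1)[of k j] by (simp add: norm_mult norm_power_int mult_right_mono)
   qed (use B(2)[of k j] in simp)
   also have "\<dots> \<le> BP j * (?D / \<delta>) + BR j * (?D / (norm s * \<delta>'))"
    by (intro add_mono mult_left_mono g1 g2 B0)
   finally have "norm (P k j * Q powi M + R k j) \<le> (BP j / \<delta> + BR j / (norm s * \<delta>')) * ?D"
    by (simp add: distrib_right)
   thus "norm ((P k j * Q powi M + R k j) * X k (M + int j)) \<le> (BP j / \<delta> + BR j / (norm s * \<delta>')) * ?D * W"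
    unfolding norm_mult by (intro mult_mono W j) (use order_trans[OF norm_ge_zero] in auto)
  qed
  also have "\<dots> = (\<Sum>j=1..n. BP j / \<delta> + BR j / (norm s * \<delta>')) * (?D * W)" by (simp add: sum_distrib_right mult.assoc)
  also have "\<dots> \<le> A * (?D * W)" using W(2) by (intro mult_right_mono) (auto simp: A_def)
  finally have "norm (X k M) * ?D \<le> A * W * ?D" by (simp add: mult_ac)
  moreover have "?D > 0" using nz by simp
  ultimately show ?thesis by simp
 qed
 have ind: "\<forall>M \<ge> M0 - int i. norm (X k M) \<le> C' * A ^ i" for i k
 proof (induction i)
  case (Suc i)
  show ?case
  proof (intro allI impI)
   fix M assume M: "M0 - int (Suc i) \<le> M"
   have "norm (X k M) \<le> A * (C' * A ^ i)"
   proof (cases "M \<ge> M0 - int i")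
    case True
    hence "norm (X k M) \<le> 1 * (C' * A ^ i)" using Suc by auto
    also have "\<dots> \<le> A * (C' * A ^ i)" using A1 by (intro mult_right_mono) (auto simp: C'_def)
    finally show ?thesis .
   next
    case False
    show ?thesis by (rule step) (use Suc M A1 in \<open>auto simp: C'_def\<close>)
   qed
   thus "norm (X k M) \<le> C' * A ^ Suc i" by (simp add: mult_ac)
  qed
 next
  case 0
  show ?case using bd by (auto simp: C'_def le_max_iff_disj)
 qed
 have "norm (X k M) \<le> (C' * A ^ nat \<bar>M0\<bar>) * A ^ nat \<bar>M\<bar>" for k M
 proof -
  have "norm (X k M) \<le> C' * A ^ nat (M0 - M)" using ind[of "nat (M0 - M)" k] by auto
  also have "A ^ nat (M0 - M) \<le> A ^ (nat \<bar>M0\<bar> + nat \<bar>M\<bar>)" using A1 by (intro power_increasing) auto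
  finally show ?thesis by (simp add: power_add mult.assoc C'_def mult_left_mono)
 qed
 thus "\<exists>C K. K \<ge> 1 \<and> (\<forall>k M. norm (X k M) \<le> C * K ^ nat \<bar>M\<bar>)" using A1 by blast
qed

lemma coeff_pc_scaled: "coeff (pc (map (%x. e * x) cs)) j = e ^ j * coeff (pc cs) j"
proof (induction cs arbitrary: j)
 case (Cons y cs)
 show ?case
 proof (cases j)
  case (Suc i)
  show ?thesis unfolding Suc list.map coeff_pc_Cons_Suc Cons.IH by (simp add: algebra_simps)
 qed simp
next
 case Nil
 show ?case by (cases j) simp_all
qed

end

context qconf begin

lemma scaled_qconf: "e \<noteq> 0 ==> qconf q n (%l. e * a l) b"
 using n1 a_nz a_gen b_gen by unfold_locales auto

context
 fixes e :: complex assumes e: "e \<noteq> 0"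
begin

interpretation E: qconf q n "%l. e * a l" b by (rule scaled_qconf[OF e])

lemma scaled_basic:
 "E.as = map (%x. e * x) as" "E.c = e ^ (n - 1) * c"
 "E.bi i = ph (map (%x. e * x) (Asi i)) (Bsi i)"
 "j \<in> {1..n} ==> E.kap' j = kap' j / e ^ j"
proof -
 show as: "E.as = map (%x. e * x) as" by (simp add: E.as_def as_def o_def)
 show c: "E.c = e ^ (n - 1) * c"
  unfolding E.c_def c_def E.PA_def E.PB_def PA_def PB_def prod.distrib by simp
 have "E.Bsi i = Bsi i" using e by (simp add: E.Bsi_def Bsi_def mult.assoc)
 moreover have "E.Asi i = map (%x. e * x) (Asi i)" by (simp add: E.Asi_def Asi_def o_def)
 ultimately show "E.bi i = ph (map (%x. e * x) (Asi i)) (Bsi i)" by (simp add: E.bi_def)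
 show "E.kap' j = kap' j / e ^ j" if j: "j \<in> {1..n}"
 proof (cases "j \<le> n - 1")
  case True
  have "e ^ (n - 1) = e ^ (n - 1 - j) * e ^ j" unfolding power_add[symmetric] le_add_diff_inverse2[OF True] ..
  thus ?thesis unfolding E.kap'_def kap'_def c as coeff_pc_scaled using e True by simp
 qed (simp add: E.kap'_def kap'_def)
qed

text \<open>Dividing by the weight (e a_i)^M gives a recursion for the plain samples on a spiral
  independent of e, with coefficients continuous in e.\<close>

lemma scaled_rec:
 assumes i: "i \<in> {1..<n}" and t: "t \<noteq> 0" "t \<notin> qZ q"
 defines "X \<equiv> %m. ph (map (%x. e * x) (Asi i)) (Bsi i) (t * Q powi m)"
 shows "(Q powi M - 1 / t) * X M = (\<Sum>j=1..n. (kap j * (e * a i) ^ j * Q powi M + kap' j * a i ^ j / t) * X (M + int j))"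
proof -
 have ea: "e * a i \<noteq> 0" using e a_nz[OF i] by simp
 have "(Q powi M - 1 / t) * ((e * a i) powi M * X M) = (\<Sum>j=1..n. (kap j * Q powi M + kap' j / e ^ j / t) * ((e * a i) powi (M + int j) * X (M + int j)))"
  using E.bi_RecS[OF i t] unfolding E.RecS_def scaled_basic(3) X_def
  by (simp add: scaled_basic(4))
 also have "\<dots> = (\<Sum>j=1..n. (e * a i) powi M * ((kap j * (e * a i) ^ j * Q powi M + kap' j * a i ^ j / t) * X (M + int j)))"
 proof (intro sum.cong refl)
  fix j
  have gen: "(k * P + k' / e ^ j / t) * (Y * (e * a i) ^ j * x) = Y * ((k * (e * a i) ^ j * P + k' * a i ^ j / t) * x)" for k k' P Y x
   using e t by (simp add: power_mult_distrib field_simps)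
  have p: "(e * a i) powi (M + int j) = (e * a i) powi M * (e * a i) ^ j" using ea by (simp add: power_int_add)
  show "(kap j * Q powi M + kap' j / e ^ j / t) * ((e * a i) powi (M + int j) * X (M + int j)) = (e * a i) powi M * ((kap j * (e * a i) ^ j * Q powi M + kap' j * a i ^ j / t) * X (M + int j))"
   unfolding p by (rule gen)
 qed
 finally have "(e * a i) powi M * ((Q powi M - 1 / t) * X M) = (e * a i) powi M * (\<Sum>j=1..n. (kap j * (e * a i) ^ j * Q powi M + kap' j * a i ^ j / t) * X (M + int j))"
  by (simp only: sum_distrib_left mult.left_commute)
 thus ?thesis using ea by simp
qed

text \<open>Here \<open>star\<close> for the parameters e a_l is used with e^n lam in place of lam.
  The spiral base is e^n lam / (e a_i e^(n-1) c), so e cancels and only weights and arguments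
  vary.\<close>

lemma scaled_formula:
 assumes g: "e ^ (n - 1) * c \<notin> qZ q" "\<forall>l\<in>{1..<n}. e * a l \<notin> q_minusN q"
  and z: "z \<noteq> 0" "norm z < 1" and lam: "lam \<noteq> 0" "\<forall>i\<in>{1..<n}. - (lam / (a i * c)) \<notin> qZ q"
 shows "th (- z) * th (e ^ n * lam * z) * ph (map (%x. e * x) as) bs z =
  (\<Sum>i\<in>{1..<n}. ((\<Prod>l\<in>{1..<n} - {i}. qi (e * a l)) * (\<Prod>l\<in>{1..<n}. qi (b l / (e * a i)))
 / ((\<Prod>l\<in>{1..<n}. qi (b l)) * (\<Prod>l\<in>{1..<n} - {i}. qi (a l / a i)))) * th (- (e * a i * z))
   * psum (ph (map (%x. e * x) (Asi i)) (Bsi i)) (- (lam / (a i * c))) (- (e ^ n * c * a i * z)))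
  + (\<Prod>l\<in>{1..<n}. qi (e * a l)) / (\<Prod>l\<in>{1..<n}. qi (b l)) * qi Q
   * ((\<Prod>s\<in>{1..<n}. th (c * b s / (e * lam))) / (\<Prod>s\<in>{1..<n}. th (c * a s / lam)))
   * th (e * lam * z / c)
   * T (%m. if m \<le> 0 then sqn q n kap (%j. kap' j / e ^ j) (nat (- m)) else 0) (- (e ^ (n - 1) * c * z))"
proof -
 interpret G: qgen q n "%l. e * a l" b by unfold_locales (use g in \<open>auto simp: scaled_basic\<close>)
 have en: "e ^ n = e * e ^ (n - 1)" by (rule power_n)
 have t: "- (e ^ n * lam / (e * a i * (e ^ (n - 1) * c))) = - (lam / (a i * c))" for i
  unfolding en using e by (simp add: mult_ac)
 have "E.star (e ^ n * lam) z"
 proof (rule G.star_generic[OF z])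
  show "- (e ^ n * lam / (e * a i * E.c)) \<notin> qZ q" if "i \<in> {1..<n}" for i
   unfolding scaled_basic(2) t using lam(2) that by blast
 qed (use lam e in simp)
 moreover have "E.sseq = (%m. if m \<le> 0 then sqn q n kap (%j. kap' j / e ^ j) (nat (- m)) else 0)"
 proof -
  have "sqn q n kap E.kap' k = sqn q n kap (%j. kap' j / e ^ j) k" for k
  proof (induction k rule: less_induct)
   case (less k)
   have "(\<Sum>i<k. (if k - i \<le> n then kap (k - i) * Q powi (- int k) + E.kap' (k - i) else 0) * sqn q n kap E.kap' i)
    = (\<Sum>i<k. (if k - i \<le> n then kap (k - i) * Q powi (- int k) + kap' (k - i) / e ^ (k - i) else 0) * sqn q n kap (%j. kap' j / e ^ j) i)"
    by (intro sum.cong refl) (auto simp: less scaled_basic(4))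
   thus ?case by (simp add: sqn.simps[of q n _ _ k])
  qed
  thus ?thesis by (auto simp: E.sseq_def)
 qed
 moreover have "E.DD (e ^ n * lam) = (\<Prod>s\<in>{1..<n}. th (c * b s / (e * lam))) / (\<Prod>s\<in>{1..<n}. th (c * a s / lam))"
 proof -
  have "e ^ (n - 1) * c * b s / (e ^ n * lam) = c * b s / (e * lam)" "e ^ (n - 1) * c * (e * a s) / (e ^ n * lam) = c * a s / lam" for s
   unfolding en using e by simp_all
  thus ?thesis unfolding E.DD_def scaled_basic by simp
 qed
 moreover have "e ^ n * lam * z / (e ^ (n - 1) * c) = e * lam * z / c" unfolding en using e by simp
 moreover have "e ^ (n - 1) * c * (e * a i) * z = e ^ n * c * a i * z" for i unfolding en by simp
 moreover have "E.Ci i = (\<Prod>l\<in>{1..<n} - {i}. qi (e * a l)) * (\<Prod>l\<in>{1..<n}. qi (b l / (e * a i)))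
 / ((\<Prod>l\<in>{1..<n}. qi (b l)) * (\<Prod>l\<in>{1..<n} - {i}. qi (a l / a i)))" for i
  unfolding E.Ci_def using e by simp
 ultimately show ?thesis unfolding E.star_def scaled_basic(1,2,3) t E.kapC_def by (simp only:)
qed

end

text \<open>For n >= 2 each equation e^(n-1) = q^m / c has finitely many roots, so the bad scalings
  form a countable set and every ball around 1 contains a good one.\<close>

lemma generic_seq:
 assumes n: "n \<ge> 2"
 obtains e :: "nat \<Rightarrow> complex" where "e \<longlonglongrightarrow> 1" "\<And>k. e k \<noteq> 0" "\<And>k. norm (e k) \<le> 2"
  "\<And>k. e k ^ (n - 1) * c \<notin> qZ q" "\<And>k l. l \<in> {1..<n} ==> e k * a l \<notin> q_minusN q"
proof -
 define Bad where "Bad = {0} \<union> (\<Union>m. {e::complex. e ^ (n - 1) = Q powi m / c}) \<union> (\<Union>l\<in>{1..<n}. \<Union>k. {Q powi (- int k) / a l})"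
 have "countable (\<Union>m. {e::complex. e ^ (n - 1) = Q powi m / c})"
  by (rule countable_UN[OF countableI_type], rule countable_finite[OF finite_nth_roots]) (use n in simp)
 hence cb: "countable Bad" unfolding Bad_def by auto
 have "\<exists>x. x \<in> ball 1 (inverse (real (Suc k))) \<and> x \<notin> Bad" for k
 proof (rule ccontr)
  assume "\<nexists>x. x \<in> ball 1 (inverse (real (Suc k))) \<and> x \<notin> Bad"
  hence "ball 1 (inverse (real (Suc k))) \<subseteq> Bad" by blast
  hence "countable (ball (1::complex) (inverse (real (Suc k))))" using cb countable_subset by blast
  thus False using uncountable_ball_complex[of "inverse (real (Suc k))" 1] by simp
 qed
 then obtain e where e: "\<And>k. e k \<in> ball 1 (inverse (real (Suc k)))" "\<And>k. e k \<notin> Bad" by metis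
 show ?thesis
 proof
  have "dist (e k) 1 \<le> inverse (real (Suc k))" for k using e(1)[of k] by (simp add: dist_commute)
  hence "(%k. dist (e k) 1) \<longlonglongrightarrow> 0"
   by (intro tendsto_sandwich[OF _ _ tendsto_const LIMSEQ_inverse_real_of_nat] always_eventually allI) auto
  thus "e \<longlonglongrightarrow> 1" using tendsto_dist_iff by blast
  fix k
  show "e k \<noteq> 0" using e(2)[of k] by (auto simp: Bad_def)
  have "dist 1 (e k) < 1" using e(1)[of k] by (auto intro: less_le_trans simp: inverse_le_1_iff)
  thus "norm (e k) \<le> 2" using norm_triangle_ineq2[of "e k" 1] by (simp add: dist_norm norm_minus_commute)
  show "e k ^ (n - 1) * c \<notin> qZ q" using e(2)[of k] c_nz by (auto simp: Bad_def qZ_def field_simps)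
  show "e k * a l \<notin> q_minusN q" if "l \<in> {1..<n}" for l
  proof
   assume "e k * a l \<in> q_minusN q"
   then obtain j where "e k * a l = Q powi (- int j)" by (auto simp: q_minusN_def)
   hence "e k = Q powi (- int j) / a l" using a_nz[OF that] by (simp add: field_simps)
   thus False using e(2)[of k] that by (auto simp: Bad_def)
  qed
 qed
qed

lemma psum_scaled_tendsto:
 assumes i: "i \<in> {1..<n}" and t: "t \<noteq> 0" "t \<notin> qZ q"
  and e: "e \<longlonglongrightarrow> 1" "\<And>k. e k \<noteq> 0" "\<And>k. norm (e k) \<le> 2"
  and y: "(y \<longlongrightarrow> w) sequentially" "w \<noteq> 0"
 shows "(%k. psum (ph (map (%x. e k * x) (Asi i)) (Bsi i)) t (y k)) \<longlonglongrightarrow> psum (bi i) t w"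
proof -
 let ?X = "%k M. ph (map (%x. e k * x) (Asi i)) (Bsi i) (t * Q powi M)"
 note Bs = Bsi_ok[OF i]
 obtain C where C: "\<And>e k. norm (e::complex) \<le> 2 ==> norm (hcoef (map (%x. e * x) (Asi i)) (Bsi i) k) \<le> C"
  using hcoef_scaled_bounded[OF Bs] by blast
 have C0: "C \<ge> 0" using C[of 1 0] by (simp add: order_trans[OF norm_ge_zero])
 \<comment> \<open>Beyond N the samples lie in the disc of radius 1/2, where the power series
   converge uniformly in the scaling.\<close>
 obtain N where N: "q ^ N < 1 / (2 * norm t)"
  using real_arch_pow_inv[of "1 / (2 * norm t)" q] q1 t by auto
 have small: "norm (t * Q powi M) \<le> 1 / 2" if "M \<ge> int N" for M
 proof -
  have "q powi M = q ^ nat M" using that by (simp add: power_int_def)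
  also have "\<dots> \<le> q ^ N" by (rule power_decreasing) (use that q0 q1 in auto)
  finally have "norm t * q powi M \<le> norm t * (1 / (2 * norm t))" using N by (intro mult_left_mono) auto
  thus ?thesis using t q0 by (simp add: norm_mult norm_power_int)
 qed
 have rec: "(Q powi M - 1 / t) * ?X k M = (\<Sum>j=1..n. (kap j * (e k * a i) ^ j * Q powi M + kap' j * a i ^ j / t) * ?X k (M + int j))" for k M
  by (rule scaled_rec[OF e(2) i t])
 have recL: "(Q powi M - 1 / t) * bi i (t * Q powi M) = (\<Sum>j=1..n. (kap j * a i ^ j * Q powi M + kap' j * a i ^ j / t) * bi i (t * Q powi (M + int j)))" for M
  using scaled_rec[of 1, OF _ i t, of M] by (simp add: bi_def)
 have P: "(%k. kap j * (e k * a i) ^ j) \<longlonglongrightarrow> kap j * a i ^ j" for j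
  using tendsto_mult[OF tendsto_const[of "kap j"] tendsto_power[OF tendsto_mult[OF e(1) tendsto_const[of "a i"]], of j]] by simp
 have s: "1 / t \<noteq> 0" "1 / t \<notin> qZ q" using t qZ_inverse[of "1 / t"] by auto
 have lim: "(%k. ?X k M) \<longlonglongrightarrow> bi i (t * Q powi M)" if "M \<ge> int N" for M
  unfolding bi_def by (rule ph_scaled_tendsto[OF Bs e(1,3)]) (use small[OF that] in simp)
 have bd: "norm (?X k M) \<le> C * 2" if M: "M \<ge> int N" for k M
 proof -
  have "norm (?X k M) \<le> C * (1 / (1 - norm (t * Q powi M)))"
   by (rule ph_scaled_bound[OF Bs C[OF e(3)]]) (use small[OF M] in simp)
  also have "\<dots> \<le> C * 2" using small[OF M] C0 by (intro mult_left_mono) (auto simp: field_simps)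
  finally show ?thesis .
 qed
 note dl = down_limit[where X = ?X and Y = "%M. bi i (t * Q powi M)", OF rec recL P tendsto_const s lim bd]
 obtain C1 K where K: "K \<ge> 1" "\<And>k M. norm (?X k M) \<le> C1 * K ^ nat \<bar>M\<bar>" using dl(2) by blast
 obtain L where L: "L \<ge> 1" "norm t \<le> L" "1 / L \<le> norm t" using powi_bounds_exist[OF t(1)] by blast
 have C10: "C1 \<ge> 0" using K(2)[of 0 0] by (simp add: order_trans[OF norm_ge_zero])
 show ?thesis unfolding psum_def
 proof (rule T_tendsto[OF _ y])
  show "(%k. t powi m * ?X k m) \<longlonglongrightarrow> t powi m * bi i (t * Q powi m)" for m
   by (intro tendsto_mult tendsto_const dl(1))
  show "1 \<le> L * K" using L(1) K(1) mult_mono[of 1 L 1 K] by simp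
  have "norm (t powi m * ?X k m) \<le> C1 * (L * K) ^ nat \<bar>m\<bar>" for k m
  proof -
   have "norm (t powi m * ?X k m) \<le> L ^ nat \<bar>m\<bar> * (C1 * K ^ nat \<bar>m\<bar>)"
    unfolding norm_mult by (intro mult_mono norm_powi_le t L K) (use L in auto)
   thus ?thesis by (simp add: power_mult_distrib mult_ac)
  qed
  thus "\<forall>\<^sub>F k in sequentially. \<forall>m. norm (t powi m * ?X k m) \<le> C1 * (L * K) ^ nat \<bar>m\<bar>" by simp
 qed simp
qed

text \<open>Convergent coefficients have a common bound, so \<open>sqn_bound\<close> holds with one
  \<open>A\<close> for the whole sequence and \<open>T_tendsto\<close> applies.\<close>

lemma sseq_scaled_tendsto:
 assumes e: "e \<longlonglongrightarrow> 1" "\<And>k. e k \<noteq> 0" and y: "(y \<longlongrightarrow> w) sequentially" "w \<noteq> 0"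
 shows "(%k. T (%m. if m \<le> 0 then sqn q n kap (%j. kap' j / e k ^ j) (nat (- m)) else 0) (y k)) \<longlonglongrightarrow> T sseq w"
proof -
 let ?k' = "%k j. kap' j / e k ^ j"
 have k': "(%k. ?k' k j) \<longlonglongrightarrow> kap' j" for j
  using tendsto_divide[OF tendsto_const[of "kap' j"] tendsto_power[OF e(1), of j]] by simp
 have "(%k. \<Sum>j=1..n. norm (kap j) + norm (?k' k j)) \<longlonglongrightarrow> (\<Sum>j=1..n. norm (kap j) + norm (kap' j))"
  by (intro tendsto_sum tendsto_add tendsto_norm k' tendsto_const)
 from convergent_imp_Bseq[OF convergentI[OF this]] obtain B where B: "\<And>k. norm (\<Sum>j=1..n. norm (kap j) + norm (?k' k j)) \<le> B"
  unfolding Bseq_def by blast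
 define A where "A = max 1 (B / (1 - q))"
 have A: "(\<Sum>j=1..n. norm (kap j) + norm (?k' k j)) / (1 - q) \<le> A" for k
 proof -
  have "(\<Sum>j=1..n. norm (kap j) + norm (?k' k j)) / (1 - q) \<le> B / (1 - q)"
   using B[of k] q1 by (intro divide_right_mono) auto
  thus ?thesis by (simp add: A_def)
 qed
 have A1: "A \<ge> 1" by (simp add: A_def)
 have sq: "(%k. sqn q n kap (?k' k) m) \<longlonglongrightarrow> sqn q n kap kap' m" for m
 proof (induction m rule: less_induct)
  case (less m)
  show ?case
  proof (cases "m = 0")
   case False
   have "(%k. (\<Sum>i<m. (if m - i \<le> n then kap (m - i) * Q powi (- int m) + ?k' k (m - i) else 0) * sqn q n kap (?k' k) i) / (Q powi (- int m) - 1))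
    \<longlonglongrightarrow> (\<Sum>i<m. (if m - i \<le> n then kap (m - i) * Q powi (- int m) + kap' (m - i) else 0) * sqn q n kap kap' i) / (Q powi (- int m) - 1)"
   proof (intro tendsto_divide tendsto_sum tendsto_mult tendsto_const)
    show "Q powi (- int m) - 1 \<noteq> 0" using Qpowi_ne1[of m] False by simp
    fix i assume "i \<in> {..<m}"
    thus "(%k. sqn q n kap (?k' k) i) \<longlonglongrightarrow> sqn q n kap kap' i" using less by simp
    show "(%k. if m - i \<le> n then kap (m - i) * Q powi (- int m) + ?k' k (m - i) else 0) \<longlonglongrightarrow> (if m - i \<le> n then kap (m - i) * Q powi (- int m) + kap' (m - i) else 0)"
     by (cases "m - i \<le> n") (auto intro!: tendsto_intros k')
   qed
   thus ?thesis using False by (subst (1 2) sqn.simps) simp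
  qed simp
 qed
 show ?thesis
 proof (rule T_tendsto[OF _ y A1])
  show "(%k. if m \<le> 0 then sqn q n kap (?k' k) (nat (- m)) else 0) \<longlonglongrightarrow> sseq m" for m
   unfolding sseq_def by (cases "m \<le> 0") (use sq in auto)
  have "norm (if m \<le> 0 then sqn q n kap (?k' k) (nat (- m)) else 0) \<le> 1 * A ^ nat \<bar>m\<bar>" for k m
   using sqn_bound[OF A A1, of k "nat (- m)"] A1 by auto
  thus "\<forall>\<^sub>F k in sequentially. \<forall>m. norm (if m \<le> 0 then sqn q n kap (?k' k) (nat (- m)) else 0) \<le> 1 * A ^ nat \<bar>m\<bar>" by simp
 qed simp
qed

theorem star_two:
 assumes n: "n \<ge> 2" and z: "z \<noteq> 0" "norm z < 1"
  and lam: "lam \<noteq> 0" "\<And>i. i \<in> {1..<n} ==> - (lam / (a i * c)) \<notin> qZ q"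
 shows "star lam z"
proof -
 obtain e :: "nat \<Rightarrow> complex" where e: "e \<longlonglongrightarrow> 1" "\<And>k. e k \<noteq> 0" "\<And>k. norm (e k) \<le> 2"
  "\<And>k. e k ^ (n - 1) * c \<notin> qZ q" "\<And>k l. l \<in> {1..<n} ==> e k * a l \<notin> q_minusN q"
  using generic_seq[OF n] by metis
 have "\<forall>l\<in>{1..<n}. e k * a l \<notin> q_minusN q" for k using e(5) by blast
 moreover have "\<forall>i\<in>{1..<n}. - (lam / (a i * c)) \<notin> qZ q" using lam(2) by blast
 ultimately have F: "th (- z) * th (e k ^ n * lam * z) * ph (map (%x. e k * x) as) bs z = rhs k" if "rhs = (%k. (\<Sum>i\<in>{1..<n}. ((\<Prod>l\<in>{1..<n} - {i}. qi (e k * a l)) * (\<Prod>l\<in>{1..<n}. qi (b l / (e k * a i)))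
 / ((\<Prod>l\<in>{1..<n}. qi (b l)) * (\<Prod>l\<in>{1..<n} - {i}. qi (a l / a i)))) * th (- (e k * a i * z))
   * psum (ph (map (%x. e k * x) (Asi i)) (Bsi i)) (- (lam / (a i * c))) (- (e k ^ n * c * a i * z)))
  + (\<Prod>l\<in>{1..<n}. qi (e k * a l)) / (\<Prod>l\<in>{1..<n}. qi (b l)) * qi Q
   * ((\<Prod>s\<in>{1..<n}. th (c * b s / (e k * lam))) / (\<Prod>s\<in>{1..<n}. th (c * a s / lam)))
   * th (e k * lam * z / c)
   * T (%m. if m \<le> 0 then sqn q n kap (%j. kap' j / e k ^ j) (nat (- m)) else 0) (- (e k ^ (n - 1) * c * z)))" for k rhs
  unfolding that by (intro scaled_formula e z lam)
 have em: "(%k. e k ^ m) \<longlonglongrightarrow> 1" for m using tendsto_power[OF e(1), of m] by simp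
 have nzA: "qi (a l / a i) \<noteq> 0" if "i \<in> {1..<n}" "l \<in> {1..<n} - {i}" for i l
  using a_ratio[OF that] q_minusN_qZ qi_nz by blast
 have nzB: "qi (b l) \<noteq> 0" if "l \<in> {1..<n}" for l using b_gen[OF that] qi_nz by auto
 have nzt: "th (c * a s / lam) \<noteq> 0" if s: "s \<in> {1..<n}" for s
 proof
  assume "th (c * a s / lam) = 0"
  hence "- (c * a s / lam) \<in> qZ q" using th_eq_0_iff'[of "c * a s / lam"] c_nz a_nz[OF s] lam by simp
  from qZ_inverse[OF this] have "- (lam / (a s * c)) \<in> qZ q" by (simp add: mult.commute)
  thus False using lam(2)[OF s] by simp
 qed
 have "(%k. th (- z) * th (e k ^ n * lam * z) * ph (map (%x. e k * x) as) bs z) \<longlonglongrightarrow> th (- z) * th (1 * lam * z) * ph as bs z"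
  by (intro tendsto_mult tendsto_const th_tendsto em ph_scaled_tendsto bs_ok e z) (use lam z in auto)
 moreover have "(%k. (\<Sum>i\<in>{1..<n}. ((\<Prod>l\<in>{1..<n} - {i}. qi (e k * a l)) * (\<Prod>l\<in>{1..<n}. qi (b l / (e k * a i)))
 / ((\<Prod>l\<in>{1..<n}. qi (b l)) * (\<Prod>l\<in>{1..<n} - {i}. qi (a l / a i)))) * th (- (e k * a i * z))
   * psum (ph (map (%x. e k * x) (Asi i)) (Bsi i)) (- (lam / (a i * c))) (- (e k ^ n * c * a i * z)))
  + (\<Prod>l\<in>{1..<n}. qi (e k * a l)) / (\<Prod>l\<in>{1..<n}. qi (b l)) * qi Q
   * ((\<Prod>s\<in>{1..<n}. th (c * b s / (e k * lam))) / (\<Prod>s\<in>{1..<n}. th (c * a s / lam)))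
   * th (e k * lam * z / c)
   * T (%m. if m \<le> 0 then sqn q n kap (%j. kap' j / e k ^ j) (nat (- m)) else 0) (- (e k ^ (n - 1) * c * z)))
  \<longlonglongrightarrow> (\<Sum>i\<in>{1..<n}. ((\<Prod>l\<in>{1..<n} - {i}. qi (1 * a l)) * (\<Prod>l\<in>{1..<n}. qi (b l / (1 * a i)))
 / ((\<Prod>l\<in>{1..<n}. qi (b l)) * (\<Prod>l\<in>{1..<n} - {i}. qi (a l / a i)))) * th (- (1 * a i * z))
   * psum (bi i) (- (lam / (a i * c))) (- (1 * c * a i * z)))
  + (\<Prod>l\<in>{1..<n}. qi (1 * a l)) / (\<Prod>l\<in>{1..<n}. qi (b l)) * qi Q
   * ((\<Prod>s\<in>{1..<n}. th (c * b s / (1 * lam))) / (\<Prod>s\<in>{1..<n}. th (c * a s / lam)))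
   * th (1 * lam * z / c)
   * T sseq (- (1 * c * z))"
  by (intro tendsto_add tendsto_sum tendsto_mult tendsto_divide tendsto_prod tendsto_minus tendsto_const th_tendsto qi_tendsto
    em e psum_scaled_tendsto sseq_scaled_tendsto)
   (use lam z a_nz b_nz c_nz nzA nzB nzt in \<open>auto simp: prod_zero_iff\<close>)
 ultimately have "th (- z) * th (1 * lam * z) * ph as bs z = (\<Sum>i\<in>{1..<n}. ((\<Prod>l\<in>{1..<n} - {i}. qi (1 * a l)) * (\<Prod>l\<in>{1..<n}. qi (b l / (1 * a i)))
 / ((\<Prod>l\<in>{1..<n}. qi (b l)) * (\<Prod>l\<in>{1..<n} - {i}. qi (a l / a i)))) * th (- (1 * a i * z))
   * psum (bi i) (- (lam / (a i * c))) (- (1 * c * a i * z)))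
  + (\<Prod>l\<in>{1..<n}. qi (1 * a l)) / (\<Prod>l\<in>{1..<n}. qi (b l)) * qi Q
   * ((\<Prod>s\<in>{1..<n}. th (c * b s / (1 * lam))) / (\<Prod>s\<in>{1..<n}. th (c * a s / lam)))
   * th (1 * lam * z / c)
   * T sseq (- (1 * c * z))"
  unfolding F[OF refl] by (rule LIMSEQ_unique)
 thus ?thesis unfolding star_def Ci_def kapC_def DD_def by (simp only: mult_1)
qed

text \<open>Since the support is one-sided, \<open>T sseq\<close> is an everywhere convergent power
  series in 1/w.\<close>

lemma T_sseq_series:
 assumes w: "w \<noteq> 0"
 shows "summable (%k. norm (sseq (- int k) * Q ^ (k * (k + 1) div 2) * (1 / w) ^ k))"
  and "(%k. sseq (- int k) * Q ^ (k * (k + 1) div 2) * (1 / w) ^ k) sums T sseq w"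
proof -
 let ?f = "%m. Q powi tri m * w powi m * sseq m"
 have ab: "(%m. norm (?f m)) summable_on UNIV" by (rule T_abs_summable[OF sseq_tempered w])
 have inj: "inj (%k::nat. - int k)" by (auto simp: inj_def)
 have f: "?f (- int k) = sseq (- int k) * Q ^ (k * (k + 1) div 2) * (1 / w) ^ k" for k
 proof -
  have "tri (- int k) = int (k * (k + 1) div 2)"
  proof -
   have "tri (- int k) = (- int k) * (- int k - 1) div 2" by (simp add: tri_def)
   also have "(- int k) * (- int k - 1) = int (k * (k + 1))" by (simp add: algebra_simps)
   finally show ?thesis by (simp only: zdiv_int of_nat_numeral)
  qed
  thus ?thesis by (simp add: power_int_minus power_divide inverse_eq_divide mult_ac)
 qed
 have "(%m. norm (?f m)) summable_on range (%k::nat. - int k)" by (rule summable_on_subset_banach[OF ab]) simp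
 hence "(%k. norm (?f (- int k))) summable_on UNIV" by (subst (asm) summable_on_reindex[OF inj]) (simp add: o_def)
 thus s: "summable (%k. norm (sseq (- int k) * Q ^ (k * (k + 1) div 2) * (1 / w) ^ k))"
  unfolding f by (subst (asm) summable_on_UNIV_nonneg_real_iff) auto
 have "T sseq w = (\<Sum>\<^sub>\<infinity>m\<in>range (%k::nat. - int k). ?f m)"
  unfolding T_def
 proof (rule infsum_cong_neutral)
  fix m :: int assume m: "m \<in> UNIV - range (%k::nat. - int k)"
  have "m > 0"
  proof (rule ccontr)
   assume "\<not> m > 0"
   hence "m = - int (nat (- m))" by simp
   thus False using m by blast
  qed
  thus "?f m = 0" by (simp add: sseq_pos)
 qed auto
 also have "\<dots> = (\<Sum>\<^sub>\<infinity>k. ?f (- int k))" by (subst infsum_reindex[OF inj]) (simp add: o_def)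
 also have "\<dots> = (\<Sum>k. sseq (- int k) * Q ^ (k * (k + 1) div 2) * (1 / w) ^ k)"
  unfolding f by (rule suminf_infsum[OF s, symmetric])
 finally show "(%k. sseq (- int k) * Q ^ (k * (k + 1) div 2) * (1 / w) ^ k) sums T sseq w"
  using summable_sums[OF summable_norm_cancel[OF s]] by simp
qed

lemma star_one:
 assumes n: "n = 1" and z: "z \<noteq> 0" "norm z < 1"
 shows "star lam z"
proof -
 have e0: "{1..<n} = {}" "{1..n} = {1}" using n by auto
 have e: "as = []" "bs = []" "c = 1"
  by (simp_all only: as_def bs_def c_def PA_def PB_def e0) (simp_all add: n)
 have b1: "bs1 = [1]" unfolding bs1_def e by simp
 have pc: "coeff (pc bs1) (n - 1) = 1" "coeff (pc bs1) n = - 1"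
  by (simp_all only: b1) (simp_all add: n coeff_pc_Cons_Suc coeff_pc_Cons_0)
 have kap: "kap 1 = 1" "kap' 1 = 0" unfolding kap_def kap'_def pc by (simp_all add: n)
 have ss: "sseq (- int k) * qp Q k = 1" for k
 proof (induction k)
  case (Suc k)
  have "(Q powi (- int (Suc k)) - 1) * sseq (- int (Suc k)) = Q powi (- int (Suc k)) * sseq (- int (Suc k) + 1)"
   using sseq_RecS unfolding RecS_def e0 by (simp add: kap del: of_nat_Suc One_nat_def)
  also have "- int (Suc k) + 1 = - int k" by simp
  finally have R: "(Q powi (- int (Suc k)) - 1) * sseq (- int (Suc k)) = Q powi (- int (Suc k)) * sseq (- int k)" .
  have gen: "(1 - X) * S = S'" if "(P - 1) * S = P * S'" "P * X = 1" for P X S S' :: complex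
  proof -
   have "(1 - X) * S = (P * X - X) * S" using that by simp
   also have "\<dots> = X * ((P - 1) * S)" by (simp add: algebra_simps)
   also have "\<dots> = (P * X) * S'" unfolding that(1) by simp
   finally show ?thesis using that by simp
  qed
  have "(1 - Q ^ Suc k) * sseq (- int (Suc k)) = sseq (- int k)" by (rule gen[OF R Q_powi_cancel])
  thus ?case using Suc by (simp add: qp_Suc mult_ac)
 qed simp
 have T: "T sseq (- z) = qi (Q / z)"
 proof -
  have "sseq (- int k) * Q ^ (k * (k + 1) div 2) * (1 / - z) ^ k = ec k * (Q / z) ^ k" for k
  proof -
   have "sseq (- int k) = 1 / qp Q k" using ss[of k] by (simp add: field_simps)
   moreover have "k * (k + 1) div 2 = k * (k - 1) div 2 + k"
   proof -
    have "Suc k * (Suc k - 1) = k * (k + 1)" by simp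
    thus ?thesis using nat_tri_Suc[of k] by simp
   qed
   moreover have "(1 / - z) ^ k = (-1) ^ k * (1 / z) ^ k" using power_minus[of "1 / z" k] by simp
   ultimately show ?thesis by (simp only: ec_def power_add power_divide) (simp add: mult_ac)
  qed
  hence "(%k. ec k * (Q / z) ^ k) sums T sseq (- z)" using T_sseq_series(2)[of "- z"] z by simp
  thus ?thesis using qi_series sums_unique2 by blast
 qed
 define f where "f = ph [] []"
 have fe: "f (Q * x) = (1 - x) * f x" if x: "x \<notin> q_minusN q" for x
  using ph_equation[of "[]" x "[]"] x by (simp add: f_def opr_Cons algebra_simps)
 have "isCont f 0" unfolding f_def by (intro analytic_at_imp_isCont ph_analytic) auto
 hence "f 0 = qi z * f z"
 proof (rule qfun_eq)
  fix k
  have "f (Q * (z * Q ^ k)) = (1 - z * Q ^ k) * f (z * Q ^ k)"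
   by (intro fe q_minusN_mult small_notin_q_minusN z)
  thus "f (z * Q ^ Suc k) = (1 - z * Q ^ k) * f (z * Q ^ k)" by (simp add: mult_ac)
 qed
 moreover have "f 0 = 1" unfolding f_def by (subst ph_series) (simp_all add: powser_zero)
 ultimately have "th (- z) * f z = qi Q * qi (Q / z)" using th_product[of "- z"] z by simp
 moreover have k1: "kapC = 1" "DD lam = 1" unfolding kapC_def DD_def e0 by simp_all
 moreover have "x * y * w = k * y * T'" if "x * w = k * T'" for x y w k T' :: complex
  using that by (metis mult.assoc mult.commute)
 ultimately show ?thesis unfolding star_def e e0 f_def[symmetric] by (simp add: T k1)
qed

theorem star_holds:
 assumes "z \<noteq> 0" "norm z < 1" "lam \<noteq> 0" "\<And>i. i \<in> {1..<n} ==> - (lam / (a i * c)) \<notin> qZ q"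
 shows "star lam z"
proof (cases "n = 1")
 case True
 thus ?thesis using star_one assms by blast
next
 case False
 thus ?thesis using star_two[OF _ assms] n1 by simp
qed

end

section \<open>Solutions of the difference equation\<close>

lemma opr_sum:
 assumes "finite I"
 shows "opr s cs (%z. \<Sum>i\<in>I. C i * f i z) u = (\<Sum>i\<in>I. C i * opr s cs (f i) u)"
proof (induction cs arbitrary: u)
 case (Cons x cs)
 show ?case unfolding opr_Cons Cons
  by (simp add: sum_distrib_left sum_subtractf[symmetric] right_diff_distrib mult.left_commute)
qed simp

lemma opr_add: "opr s cs (%z. f z + g z) u = opr s cs f u + opr s cs g u"
proof (induction cs arbitrary: u)
 case (Cons x cs)
 show ?case unfolding opr_Cons Cons by (simp add: algebra_simps)
qed simp

lemma opr_cmult: "opr s cs (%z. k * f z) u = k * opr s cs f u"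
proof (induction cs arbitrary: u)
 case (Cons x cs)
 show ?case unfolding opr_Cons Cons by (simp add: algebra_simps)
qed simp

lemma opr_diff: "opr s cs (%z. f z - g z) u = opr s cs f u - opr s cs g u"
proof (induction cs arbitrary: u)
 case (Cons x cs)
 show ?case unfolding opr_Cons Cons by (simp add: algebra_simps)
qed simp

lemma blog_scale:
 assumes "0 < q" "z \<noteq> 0" shows "blog \<phi> (of_real q * z) = blog \<phi> z + of_real (ln q)"
proof -
 have "z * cis (- \<phi>) \<noteq> 0" using assms(2) cis_neq_zero by auto
 hence "Ln (of_real q * (z * cis (- \<phi>))) = of_real (ln q) + Ln (z * cis (- \<phi>))" by (simp add: Ln_times_of_real Ln_of_real assms(1))
 thus ?thesis by (simp add: blog_def mult_ac)
qed

lemma exp_blog: "x \<noteq> 0 ==> exp (blog \<phi> x) = x"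
proof -
 assume x: "x \<noteq> 0"
 have "x * cis (- \<phi>) \<noteq> 0" using x cis_neq_zero by auto
 hence "exp (blog \<phi> x) = x * cis (- \<phi>) * cis \<phi>"
  unfolding blog_def exp_add by (simp add: cis_conv_exp)
 thus ?thesis by (simp add: mult.assoc cis_mult)
qed

lemma open_slit_plane: "open (slit_plane \<phi>)"
proof -
 have "slit_plane \<phi> = (%z. z * cis (- \<phi>)) -` (- \<real>\<^sub>\<le>\<^sub>0)" by (auto simp: slit_plane_def)
 moreover have "open \<dots>" by (intro continuous_open_vimage continuous_intros) (auto simp: closed_nonpos_Reals_complex)
 ultimately show ?thesis by simp
qed

lemma slit_plane_nz: "z \<in> slit_plane \<phi> ==> z \<noteq> 0" by (auto simp: slit_plane_def)

lemma blog_holomorphic: "blog \<phi> holomorphic_on slit_plane \<phi>"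
 unfolding blog_def by (intro holomorphic_intros) (auto simp: slit_plane_def)

lemma bpow_holomorphic: "(%z. bpow \<phi> z s) holomorphic_on slit_plane \<phi>"
 unfolding bpow_def by (intro holomorphic_intros blog_holomorphic)

lemma bpow_nz [simp]: "bpow \<phi> z s \<noteq> 0" by (simp add: bpow_def)

context qbase begin

lemma bpow_scale: "z \<noteq> 0 ==> bpow \<phi> (Q * z) s = exp (s * of_real (ln q)) * bpow \<phi> z s"
 unfolding bpow_def blog_scale[OF q0] by (simp add: distrib_left exp_add)

lemma exp_qlog: "x \<noteq> 0 ==> exp (qlog \<phi> q x * of_real (ln q)) = x"
proof -
 have "ln q \<noteq> 0" using q0 q1 by simp
 thus "x \<noteq> 0 ==> ?thesis" by (simp add: qlog_def exp_blog)
qed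

lemma eventually_notin_q_minusN: "\<forall>\<^sub>F y in at x. y \<notin> q_minusN q"
proof (cases "x = 0")
 case True
 have "((%y. y) \<longlongrightarrow> x) (at x)" by (intro tendsto_intros)
 thus ?thesis using topological_tendstoD[OF _ open_compl_q_minusN, of "%y. y" x "at x"] True by simp
next
 case False
 show ?thesis using qZ_discrete[OF False] by eventually_elim (use q_minusN_qZ in blast)
qed

lemma th_shift_div: assumes w: "w \<noteq> 0" shows "1 / th (Q powi m * w) = Q powi tri m * w powi m / th w"
 using th_shift[OF w, of m] w by simp

end

context qconf begin

lemma confluent_iff: "confluent_eq q n a b y z \<longleftrightarrow> z * opr (%z. Q * z) as y z = opr (%z. Q * z) bs1 y z"
 unfolding confluent_eq_def qdiff_op_opr as_def bs1_def bs_def by (simp add: o_def)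

text \<open>The image of lam under the rescaling of the Borel variable by -1/(a_i c), that is, the
  base point of the spiral on which \<open>bi i\<close> is sampled.\<close>

abbreviation tt where "tt lam i \<equiv> - (lam / (a i * c))"

definition FF where "FF lam i z = psum (bi i) (tt lam i) (- (c * a i * z)) / th (lam * z)"

lemma length_Bsi: "i \<in> {1..<n} ==> length (filter (%l. l \<noteq> i) [1..<n]) = n - 2"
proof -
 assume i: "i \<in> {1..<n}"
 have "length (filter (%l. l \<noteq> i) [1..<n]) = card (set (filter (%l. l \<noteq> i) [1..<n]))"
  by (rule distinct_card[symmetric]) simp
 also have "set (filter (%l. l \<noteq> i) [1..<n]) = {1..<n} - {i}" by auto
 finally show ?thesis using i by simp
qed

text \<open>The series h_i carries the bracket with exponent -1; the q-Borel weight cancels its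
  Gaussian part and leaves only the sign.\<close>

lemma qborel_h_hat:
 assumes i: "i \<in> {1..<n}"
 shows "qborel q (h_hat q n a b i) = Abs_fps (%k. hcoef (Asi i) (Bsi i) k * (- (1 / (a i * c))) ^ k)"
proof (rule fps_ext)
 fix k
 let ?t = "Q ^ (k * (k - 1) div 2)"
 have len: "1 + int (length (Bsi i)) - int (length (Asi i)) = - 1"
  using length_Bsi[OF i] i by (simp add: Bsi_def Asi_def)
 have cc: "(\<Prod>l\<in>{1..<n}. b l) / (a i * (\<Prod>l\<in>{1..<n}. a l)) = 1 / (a i * c)"
  unfolding c_def PA_def PB_def by simp
 have "fps_nth (qborel q (h_hat q n a b i)) k = hcoef (Asi i) (Bsi i) k * ((-1) ^ k * ?t) powi (- 1) * (1 / (a i * c)) ^ k * ?t"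
  unfolding qborel_def h_hat_def bhs_fps_def fps_nth_Abs_fps cc
  unfolding Asi_def[symmetric] Bsi_def[symmetric] len hcoef_def by simp
 also have "((-1) ^ k * ?t) powi (- 1) = (-1) ^ k / ?t"
  by (simp add: power_int_minus field_simps flip: power_mult_distrib)
 also have "hcoef (Asi i) (Bsi i) k * ((-1) ^ k / ?t) * (1 / (a i * c)) ^ k * ?t = hcoef (Asi i) (Bsi i) k * ((-1) ^ k * (1 / (a i * c)) ^ k)"
  by simp
 also have "(-1) ^ k * (1 / (a i * c)) ^ k = (- (1 / (a i * c))) ^ k" by (simp add: power_minus[of "1 / (a i * c)"])
 finally show "fps_nth (qborel q (h_hat q n a b i)) k = fps_nth (Abs_fps (%k. hcoef (Asi i) (Bsi i) k * (- (1 / (a i * c))) ^ k)) k"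
  by simp
qed

text \<open>Quasi-periodicity pulls 1/theta(lam z) out of the q-Laplace sum and leaves Gaussian
  weights. As the spiral avoids q^Z, only analytic points of the continued Borel transform are
  sampled.\<close>

lemma qborel_sum_FF:
 assumes i: "i \<in> {1..<n}" and lam: "lam \<noteq> 0" "tt lam i \<notin> qZ q" and z: "z \<noteq> 0"
 shows "qborel_sum q lam (h_hat q n a b i) z = FF lam i z"
proof -
 let ?r = "- (1 / (a i * c))" and ?w = "lam * z"
 have w: "?w \<noteq> 0" using lam z by simp
 have ai: "a i \<noteq> 0" using a_nz[OF i] .
 have r: "?r \<noteq> 0" using ai c_nz by simp
 have rl: "?r * lam = tt lam i" by simp
 have g: "mero_sum (qborel q (h_hat q n a b i)) (lam * Q powi m) = bi i (tt lam i * Q powi m)" for m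
 proof -
  have e: "?r * (lam * Q powi m) = tt lam i * Q powi m" unfolding mult.assoc[symmetric] rl ..
  have "?r * (lam * Q powi m) \<notin> q_minusN q" unfolding e by (rule orbit_notin[OF lam(2)])
  from mero_sum_scaled[OF Bsi_ok[OF i] r this, of "Asi i"] show ?thesis unfolding qborel_h_hat[OF i] bi_def e .
 qed
 have y: "tt lam i powi m * (- (c * a i * z)) powi m = ?w powi m" for m
 proof -
  have "tt lam i * (- (c * a i * z)) = ?w" using ai c_nz by simp
  thus ?thesis by (simp only: power_int_mult_distrib[symmetric])
 qed
 have "qborel_sum q lam (h_hat q n a b i) z = (\<Sum>\<^sub>\<infinity>m. bi i (tt lam i * Q powi m) / th (lam * Q powi m * z))"
  unfolding qborel_sum_def qlaplace_def g ..
 also have "\<dots> = (\<Sum>\<^sub>\<infinity>m. 1 / th ?w * (Q powi tri m * (- (c * a i * z)) powi m * (tt lam i powi m * bi i (tt lam i * Q powi m))))"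
 proof (rule infsum_cong)
  fix m
  have e: "lam * Q powi m * z = Q powi m * ?w" by simp
  have "bi i (tt lam i * Q powi m) / th (lam * Q powi m * z) = bi i (tt lam i * Q powi m) * (1 / th (Q powi m * ?w))"
   unfolding e by simp
  hence "bi i (tt lam i * Q powi m) / th (lam * Q powi m * z) = bi i (tt lam i * Q powi m) * (Q powi tri m * ?w powi m / th ?w)"
   unfolding th_shift_div[OF w] .
  thus "bi i (tt lam i * Q powi m) / th (lam * Q powi m * z) = 1 / th ?w * (Q powi tri m * (- (c * a i * z)) powi m * (tt lam i powi m * bi i (tt lam i * Q powi m)))"
   unfolding y[symmetric] by (simp add: mult_ac)
 qed
 also have "\<dots> = 1 / th ?w * psum (bi i) (tt lam i) (- (c * a i * z))"
  unfolding psum_def T_def by (rule infsum_cmult_right')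
 finally show ?thesis by (simp add: FF_def)
qed

lemma psum_T:
 assumes i: "i \<in> {1..<n}"
 shows "psum (bi i) (tt lam i) (- (c * a i * z)) = T (%m. a i powi m * bi i (tt lam i * Q powi m)) (lam / a i * z)"
proof -
 have ai: "a i \<noteq> 0" using a_nz[OF i] .
 have "tt lam i powi m * x = (tt lam i / a i) powi m * (a i powi m * x)" for m x
 proof -
  have "tt lam i = tt lam i / a i * a i" using ai by simp
  hence "tt lam i powi m = (tt lam i / a i) powi m * a i powi m" by (metis power_int_mult_distrib)
  thus ?thesis by simp
 qed
 hence "psum (bi i) (tt lam i) (- (c * a i * z)) = T (%m. a i powi m * bi i (tt lam i * Q powi m)) (tt lam i / a i * (- (c * a i * z)))"
  unfolding psum_def by (simp only: T_scale)
 also have "tt lam i / a i * (- (c * a i * z)) = lam / a i * z" using ai c_nz by simp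
 finally show ?thesis .
qed

lemma solution_i:
 assumes i: "i \<in> {1..<n}" and lam: "lam \<noteq> 0" "tt lam i \<notin> qZ q"
  and E: "\<And>z. z \<noteq> 0 ==> E (Q * z) = lam / a i * z * E z"
  and y: "\<And>z. z \<noteq> 0 ==> y z = E z * psum (bi i) (tt lam i) (- (c * a i * z))" and z: "z \<noteq> 0"
 shows "confluent_eq q n a b y z"
 unfolding confluent_iff
proof (rule Rec_solution[OF _ _ _ E _ z])
 have t: "tt lam i \<noteq> 0" using lam a_nz[OF i] c_nz by simp
 have "- c * tt lam i = lam / a i" using c_nz by simp
 thus "Rec (lam / a i) (%m. a i powi m * bi i (tt lam i * Q powi m))"
  using bi_orbit_Rec[OF i t lam(2)] by simp
 show "tempered (%m. a i powi m * bi i (tt lam i * Q powi m))"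
  by (intro tempered_mult tempered_powi bi_tempered t lam i a_nz)
 show "lam / a i \<noteq> 0" using lam a_nz[OF i] by simp
 show "y z = E z * T (%m. a i powi m * bi i (tt lam i * Q powi m)) (lam / a i * z)" if "z \<noteq> 0" for z
  unfolding y[OF that] psum_T[OF i] ..
qed

lemma solution_last:
 assumes E: "\<And>z. z \<noteq> 0 ==> E (Q * z) = - c * z * E z"
  and y: "\<And>z. z \<noteq> 0 ==> y z = E z * T sseq (- (c * z))" and z: "z \<noteq> 0"
 shows "confluent_eq q n a b y z"
 unfolding confluent_iff
proof (rule Rec_solution[OF _ sseq_tempered _ E _ z])
 show "Rec (- c) sseq" using sseq_RecS Rec_iff_RecS[of 1 sseq] by simp
qed (use y c_nz in auto)

text \<open>The difference of the two sides solves the equation. It vanishes for |z| < 1, and the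
  equation transports this outwards by a factor 1/q at a time.\<close>

theorem star_everywhere:
 assumes z: "z \<noteq> 0" "z \<notin> qZ q" "- (lam * z) \<notin> qZ q"
  and lam: "lam \<noteq> 0" "\<And>i. i \<in> {1..<n} ==> tt lam i \<notin> qZ q"
 shows "star lam z"
proof -
 let ?I = "{1..<n}"
 define e1 where "e1 i z = th (- (a i * z)) / (th (- z) * th (lam * z)) * psum (bi i) (tt lam i) (- (c * a i * z))" for i z
 define e2 where "e2 z = th (lam * z / c) / (th (- z) * th (lam * z)) * T sseq (- (c * z))" for z
 define \<Delta> where "\<Delta> z = ph as bs z - ((\<Sum>i\<in>?I. Ci i * e1 i z) + kapC * qi Q * DD lam * e2 z)" for z
 have thq: "th (Q * (x * z)) = th (x * z) / (x * z)" if "x * z \<noteq> 0" for x z using th_Q'[OF that] .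
 have s1: "confluent_eq q n a b (e1 i) z" if i: "i \<in> ?I" and z: "z \<noteq> 0" for i z
 proof (rule solution_i[OF i lam(1) lam(2)[OF i] _ _ z])
  fix z :: complex assume z: "z \<noteq> 0"
  have ai: "a i \<noteq> 0" using a_nz[OF i] .
  have "th (- (a i * (Q * z))) = th (- (a i * z)) / - (a i * z)" "th (- (Q * z)) = th (- z) / - z" "th (lam * (Q * z)) = th (lam * z) / (lam * z)"
   using thq[of "- a i" z] thq[of "-1" z] thq[of lam z] z ai lam by (simp_all add: mult_ac)
  thus "th (- (a i * (Q * z))) / (th (- (Q * z)) * th (lam * (Q * z))) = lam / a i * z * (th (- (a i * z)) / (th (- z) * th (lam * z)))"
   using z ai lam by simp
 qed (simp add: e1_def)
 have s2: "confluent_eq q n a b e2 z" if z: "z \<noteq> 0" for z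
 proof (rule solution_last[OF _ _ z])
  fix z :: complex assume z: "z \<noteq> 0"
  have "th (lam * (Q * z) / c) = th (lam * z / c) / (lam * z / c)" "th (- (Q * z)) = th (- z) / - z" "th (lam * (Q * z)) = th (lam * z) / (lam * z)"
   using thq[of "lam / c" z] thq[of "-1" z] thq[of lam z] z c_nz lam by (simp_all add: mult_ac)
  thus "th (lam * (Q * z) / c) / (th (- (Q * z)) * th (lam * (Q * z))) = - c * z * (th (lam * z / c) / (th (- z) * th (lam * z)))"
   using z c_nz lam by simp
 qed (simp add: e2_def)
 have sd: "z * opr (%z. Q * z) as \<Delta> z = opr (%z. Q * z) bs1 \<Delta> z" if z: "z \<noteq> 0" "z \<notin> q_minusN q" for z
 proof -
  have ops: "opr (%z. Q * z) cs \<Delta> z = opr (%z. Q * z) cs (ph as bs) z - ((\<Sum>i\<in>?I. Ci i * opr (%z. Q * z) cs (e1 i) z) + kapC * qi Q * DD lam * opr (%z. Q * z) cs e2 z)" for cs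
   unfolding \<Delta>_def opr_diff opr_add opr_cmult by (subst opr_sum) simp_all
  have p: "z * opr (%z. Q * z) as (ph as bs) z = opr (%z. Q * z) bs1 (ph as bs) z"
   unfolding bs1_def by (rule ph_equation[OF bs_ok z(2)])
  have "z * (\<Sum>i\<in>?I. Ci i * opr (%z. Q * z) as (e1 i) z) = (\<Sum>i\<in>?I. Ci i * opr (%z. Q * z) bs1 (e1 i) z)"
   unfolding sum_distrib_left by (intro sum.cong refl) (use s1[OF _ z(1)] in \<open>simp add: confluent_iff mult.left_commute\<close>)
  thus ?thesis unfolding ops using p s2[OF z(1)] unfolding confluent_iff by (simp add: right_diff_distrib distrib_left mult.left_commute)
 qed
 have nz: "th (- z) \<noteq> 0" "th (lam * z) \<noteq> 0" if "z \<noteq> 0" "z \<notin> qZ q" "- (lam * z) \<notin> qZ q" for z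
  using that th_m_eq_0_iff[of z] th_eq_0_iff'[of "lam * z"] lam by auto
 have dz: "\<Delta> z = 0 \<longleftrightarrow> star lam z" if z: "z \<noteq> 0" "z \<notin> qZ q" "- (lam * z) \<notin> qZ q" for z
 proof -
  define P where "P = th (- z) * th (lam * z)"
  have P: "P \<noteq> 0" using nz[OF z] by (simp add: P_def)
  have "P * \<Delta> z = P * ph as bs z - ((\<Sum>i\<in>?I. P * (Ci i * e1 i z)) + P * (kapC * qi Q * DD lam * e2 z))"
   by (simp add: \<Delta>_def right_diff_distrib distrib_left sum_distrib_left)
  also have "(\<Sum>i\<in>?I. P * (Ci i * e1 i z)) = (\<Sum>i\<in>?I. Ci i * th (- (a i * z)) * psum (bi i) (tt lam i) (- (c * a i * z)))"
   using P by (intro sum.cong refl) (simp add: e1_def flip: P_def)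
  also have "P * (kapC * qi Q * DD lam * e2 z) = kapC * qi Q * DD lam * th (lam * z / c) * T sseq (- (c * z))"
   using P by (simp add: e2_def flip: P_def)
  finally have fin: "P * \<Delta> z = P * ph as bs z - ((\<Sum>i\<in>?I. Ci i * th (- (a i * z)) * psum (bi i) (tt lam i) (- (c * a i * z)))
   + kapC * qi Q * DD lam * th (lam * z / c) * T sseq (- (c * z)))" .
  have "\<Delta> z = 0 \<longleftrightarrow> P * \<Delta> z = 0" using P by simp
  hence "\<Delta> z = 0 \<longleftrightarrow> P * ph as bs z = (\<Sum>i\<in>?I. Ci i * th (- (a i * z)) * psum (bi i) (tt lam i) (- (c * a i * z)))
   + kapC * qi Q * DD lam * th (lam * z / c) * T sseq (- (c * z))" unfolding fin right_minus_eq .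
  thus ?thesis unfolding star_def P_def[symmetric] .
 qed
 have orb: "Q ^ j * z \<noteq> 0" "Q ^ j * z \<notin> qZ q" "- (lam * (Q ^ j * z)) \<notin> qZ q" if "z \<noteq> 0" "z \<notin> qZ q" "- (lam * z) \<notin> qZ q" for j z
 proof -
  have h: "Q ^ j \<in> qZ q" using qZ_powi[of "int j"] by simp
  have e: "Q ^ j * z = z * Q ^ j" "- (lam * (Q ^ j * z)) = - (lam * z) * Q ^ j" by simp_all
  show "Q ^ j * z \<noteq> 0" using that by simp
  show "Q ^ j * z \<notin> qZ q" unfolding e(1) qZ_mult_iff[OF h] by (rule that)
  show "- (lam * (Q ^ j * z)) \<notin> qZ q" unfolding e(2) qZ_mult_iff[OF h] by (rule that)
 qed
 have "\<forall>z. z \<noteq> 0 \<longrightarrow> z \<notin> qZ q \<longrightarrow> - (lam * z) \<notin> qZ q \<longrightarrow> q ^ k * norm z < 1 \<longrightarrow> \<Delta> z = 0" for k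
 proof (induction k)
  case 0
  show ?case
  proof (intro allI impI)
   fix z :: complex assume z: "z \<noteq> 0" "z \<notin> qZ q" "- (lam * z) \<notin> qZ q" "q ^ 0 * norm z < 1"
   have "star lam z" by (rule star_holds) (use z lam in auto)
   thus "\<Delta> z = 0" using dz z by simp
  qed
 next
  case (Suc k)
  show ?case
  proof (intro allI impI)
   fix z :: complex assume z: "z \<noteq> 0" "z \<notin> qZ q" "- (lam * z) \<notin> qZ q" and k: "q ^ Suc k * norm z < 1"
   have d0: "\<Delta> (Q ^ j * z) = 0" if j: "j > 0" for j
   proof -
    have "q ^ k * norm (Q ^ j * z) = q ^ (k + j) * norm z" using q0 by (simp add: norm_mult norm_power power_add)
    also have "\<dots> \<le> q ^ Suc k * norm z" using j q0 q1 by (intro mult_right_mono power_decreasing) auto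
    finally have "q ^ k * norm (Q ^ j * z) < 1" using k by simp
    thus ?thesis using Suc.IH orb[OF z, of j] by blast
   qed
   \<comment> \<open>When the values at q^j z with j > 0 vanish, only the constant coefficient 1 of
     each operator survives, so the equation reads (z - 1) Delta(z) = 0.\<close>
   have ops: "opr (%z. Q * z) cs \<Delta> z = \<Delta> z" for cs
   proof -
    have "opr (%z. Q * z) cs \<Delta> z = (\<Sum>j\<le>length cs. coeff (pc cs) j * \<Delta> (Q ^ j * z))"
     unfolding opr_eq_sum funpow_Q ..
    also have "\<dots> = (\<Sum>j\<in>{0}. coeff (pc cs) j * \<Delta> (Q ^ j * z))"
     by (rule sum.mono_neutral_right) (use d0 in auto)
    finally show ?thesis by simp
   qed
   have "z \<notin> q_minusN q" using z q_minusN_qZ by blast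
   from sd[OF z(1) this] have "(z - 1) * \<Delta> z = 0" unfolding ops by (simp add: left_diff_distrib)
   moreover have "z \<noteq> 1" using z(2) qZ_1 by blast
   ultimately show "\<Delta> z = 0" by simp
  qed
 qed
 moreover obtain k where "q ^ k < 1 / norm z" using real_arch_pow_inv[of "1 / norm z" q] q1 z by auto
 hence "q ^ k * norm z < 1" using z by (simp add: field_simps)
 ultimately have "\<Delta> z = 0" using z by blast
 thus ?thesis using dz z by blast
qed

lemma bhs_ph: "bhs (map a [1..<n] @ [0]) (map b [1..<n]) q = ph as bs"
proof -
 have "bhs_fps (map a [1..<n] @ [0]) (map b [1..<n]) q 1 = Abs_fps (hcoef as bs)"
 proof (rule fps_ext)
  fix k
  have "1 + int (length (map b [1..<n])) - int (length (map a [1..<n] @ [0])) = 0" using n1 by simp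
  thus "fps_nth (bhs_fps (map a [1..<n] @ [0]) (map b [1..<n]) q 1) k = fps_nth (Abs_fps (hcoef as bs)) k"
   unfolding bhs_fps_def fps_nth_Abs_fps hcoef_def as_def[symmetric] bs_def[symmetric] by simp
 qed
 thus ?thesis by (simp add: bhs_def ph_def)
qed

lemma bhs_mero_solution: "mero_solution q n a b UNIV (bhs (map a [1..<n] @ [0]) (map b [1..<n]) q)"
 unfolding mero_solution_def bhs_ph
proof
 obtain k0 w where w: "summable (%j. norm (w j))" "\<And>x. x \<notin> q_minusN q ==> ph as bs x = pfun k0 (hcoef as bs) w x"
  using ph_pfun[OF bs_ok, of as] by metis
 show "ph as bs meromorphic_on UNIV"
 proof (subst meromorphic_on_cong[OF _ refl])
  show "pfun k0 (hcoef as bs) w meromorphic_on UNIV" by (rule pfun_meromorphic[OF w(1)])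
  fix z :: complex
  show "\<forall>\<^sub>F x in at z. ph as bs x = pfun k0 (hcoef as bs) w x"
   using eventually_notin_q_minusN by eventually_elim (rule w(2))
 qed
 show "\<forall>\<^sub>\<approx>z\<in>UNIV. confluent_eq q n a b (ph as bs) z"
 proof (subst eventually_cosparse_open_eq, simp, intro ballI)
  fix z :: complex
  show "\<forall>\<^sub>F x in at z. confluent_eq q n a b (ph as bs) x"
   using eventually_notin_q_minusN
   by eventually_elim (unfold confluent_iff bs1_def, rule ph_equation[OF bs_ok])
 qed
qed

end

section \<open>Tools for linear independence and asymptotics\<close>

lemma unit_powers_tendsto_zero:
 fixes u x :: "'i \<Rightarrow> complex"
 assumes "finite J" "\<And>i. i \<in> J ==> norm (u i) = 1" "inj_on u J" "(%k. \<Sum>i\<in>J. x i * u i ^ k) \<longlonglongrightarrow> 0"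
 shows "\<forall>i\<in>J. x i = 0"
 using assms
proof (induction J arbitrary: x)
 case (insert j J)
 let ?s = "%k. \<Sum>i\<in>insert j J. x i * u i ^ k"
 have "(%k. ?s (Suc k) - u j * ?s k) \<longlonglongrightarrow> 0 - u j * 0"
  by (intro tendsto_diff tendsto_mult tendsto_const insert.prems(3) LIMSEQ_Suc)
 moreover have "?s (Suc k) - u j * ?s k = (\<Sum>i\<in>J. x i * (u i - u j) * u i ^ k)" for k
  using insert.hyps by (simp add: sum_distrib_left sum_subtractf[symmetric] algebra_simps)
 ultimately have "(%k. \<Sum>i\<in>J. x i * (u i - u j) * u i ^ k) \<longlonglongrightarrow> 0" by (simp only:) simp
 hence "\<forall>i\<in>J. x i * (u i - u j) = 0" using insert.prems by (intro insert.IH) auto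
 moreover have "u i \<noteq> u j" if "i \<in> J" for i using insert.prems(2) insert.hyps that by (auto simp: inj_on_def)
 ultimately have J: "\<forall>i\<in>J. x i = 0" by auto
 have "?s k = x j * u j ^ k" for k using insert.hyps J by simp
 hence "(%k. norm (x j * u j ^ k)) \<longlonglongrightarrow> 0" using insert.prems(3) by (simp add: tendsto_norm_zero_iff)
 hence "x j = 0" using insert.prems(1)[of j] by (simp add: norm_mult norm_power LIMSEQ_const_iff)
 thus ?case using J by auto
qed simp

text \<open>Among the terms of maximal modulus the previous lemma applies after division by that modulus.\<close>
lemma exponential_sum_zero:
 fixes a x :: "'i \<Rightarrow> complex"
 assumes I: "finite I" "\<And>i. i \<in> I ==> a i \<noteq> 0" "inj_on a I" and g: "\<And>i. i \<in> I ==> g i \<longlonglongrightarrow> 1"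
  and s: "\<And>k. (\<Sum>i\<in>I. x i * a i ^ k * g i k) + r k = 0" and r: "\<And>\<rho>. \<rho> > 0 ==> (%k. r k / of_real \<rho> ^ k) \<longlonglongrightarrow> 0"
 shows "\<forall>i\<in>I. x i = 0"
proof (rule ccontr)
 assume "\<not> (\<forall>i\<in>I. x i = 0)"
 define J where "J = {i \<in> I. x i \<noteq> 0}"
 have J: "finite J" "J \<noteq> {}" "J \<subseteq> I" using I \<open>\<not> _\<close> by (auto simp: J_def)
 define M where "M = Max ((%i. norm (a i)) ` J)"
 have le: "norm (a i) \<le> M" if "i \<in> J" for i unfolding M_def using J that by (intro Max_ge) auto
 have "M \<in> (%i. norm (a i)) ` J" unfolding M_def using J by (intro Max_in) auto
 then obtain j where j: "j \<in> J" "norm (a j) = M" by auto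
 have M0: "M > 0" using j I(2) J(3) by auto
 define J1 where "J1 = {i \<in> J. norm (a i) = M}"
 have J1: "finite J1" "J1 \<subseteq> J" "j \<in> J1" using J j by (auto simp: J1_def)
 let ?u = "%i. a i / of_real M"
 have "(%k. (\<Sum>i\<in>J1. x i * ?u i ^ k * (1 - g i k)) - (\<Sum>i\<in>J - J1. x i * (?u i ^ k * g i k)) - r k / of_real M ^ k) \<longlonglongrightarrow> (\<Sum>i\<in>J1. 0) - (\<Sum>i\<in>J - J1. x i * (0 * 1)) - 0"
 proof (intro tendsto_diff tendsto_sum tendsto_mult tendsto_const r M0)
  fix i assume i: "i \<in> J1"
  have "(%k. norm (x i) * norm (1 - g i k)) \<longlonglongrightarrow> norm (x i) * norm (1 - 1 :: complex)"
   by (intro tendsto_intros g) (use i J1 J in auto)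
  moreover have "norm (x i * ?u i ^ k * (1 - g i k)) = norm (x i) * norm (1 - g i k)" for k
   using i M0 by (simp add: norm_mult norm_power norm_divide J1_def)
  ultimately have "(%k. norm (x i * ?u i ^ k * (1 - g i k))) \<longlonglongrightarrow> 0" by (simp only:) simp
  thus "(%k. x i * ?u i ^ k * (1 - g i k)) \<longlonglongrightarrow> 0" by (rule tendsto_norm_zero_cancel)
 next
  fix i assume i: "i \<in> J - J1"
  hence "norm (?u i) < 1" using le[of i] M0 by (auto simp: J1_def norm_divide)
  thus "(%k. ?u i ^ k) \<longlonglongrightarrow> 0" by (rule LIMSEQ_power_zero)
  show "g i \<longlonglongrightarrow> 1" using i J by (intro g) auto
 qed
 moreover have "(\<Sum>i\<in>J1. x i * ?u i ^ k * (1 - g i k)) - (\<Sum>i\<in>J - J1. x i * (?u i ^ k * g i k)) - r k / of_real M ^ k = (\<Sum>i\<in>J1. x i * ?u i ^ k)" for k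
 proof -
  have "(\<Sum>i\<in>I. x i * a i ^ k * g i k) = (\<Sum>i\<in>J. x i * a i ^ k * g i k)"
   by (rule sum.mono_neutral_right) (use I J in \<open>auto simp: J_def\<close>)
  hence "(\<Sum>i\<in>J. x i * a i ^ k * g i k) + r k = 0" using s[of k] by simp
  hence "((\<Sum>i\<in>J. x i * a i ^ k * g i k) + r k) / of_real M ^ k = 0" by simp
  hence 1: "(\<Sum>i\<in>J. x i * ?u i ^ k * g i k) + r k / of_real M ^ k = 0"
   by (simp add: add_divide_distrib sum_divide_distrib power_divide)
  have 2: "(\<Sum>i\<in>J. x i * ?u i ^ k * g i k) = (\<Sum>i\<in>J - J1. x i * ?u i ^ k * g i k) + (\<Sum>i\<in>J1. x i * ?u i ^ k * g i k)"
   by (rule sum.subset_diff) (use J J1 in auto)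
  have 3: "(\<Sum>i\<in>J1. x i * ?u i ^ k * (1 - g i k)) = (\<Sum>i\<in>J1. x i * ?u i ^ k) - (\<Sum>i\<in>J1. x i * ?u i ^ k * g i k)"
   by (simp add: right_diff_distrib sum_subtractf)
  have gen: "U - G1 - G2 - R = U" if "G2 + G1 + R = 0" for U G1 G2 R :: complex
   using that by (simp add: diff_diff_eq add.commute add.left_commute)
  show ?thesis unfolding 3 mult.assoc[symmetric] by (rule gen) (use 1 2 in simp)
 qed
 ultimately have t1: "(%k. \<Sum>i\<in>J1. x i * ?u i ^ k) \<longlonglongrightarrow> 0" by (simp only:) simp
 have t2: "inj_on ?u J1"
 proof (rule inj_onI)
  fix i i' assume "i \<in> J1" "i' \<in> J1" "?u i = ?u i'"
  thus "i = i'" using I(3) J1 J M0 by (simp add: inj_on_def subset_iff)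
 qed
 have t3: "norm (?u i) = 1" if "i \<in> J1" for i using that M0 by (auto simp: J1_def norm_divide)
 have "\<forall>i\<in>J1. x i = 0" by (rule unit_powers_tendsto_zero[OF J1(1) t3 t2 t1])
 thus False using J1 J_def by auto
qed

lemma frequently_notin_countable: "countable C ==> \<exists>\<^sub>F w in at (z::complex). w \<notin> C"
proof (rule ccontr)
 assume C: "countable C" and "\<not> (\<exists>\<^sub>F w in at z. w \<notin> C)"
 hence "\<forall>\<^sub>F w in at z. w \<in> C" by (simp add: frequently_def)
 then obtain d where d: "d > 0" "\<And>x. x \<noteq> z ==> dist x z < d ==> x \<in> C" unfolding eventually_at by blast
 have "ball z d \<subseteq> insert z C"
 proof
  fix x assume "x \<in> ball z d"
  hence "dist x z < d" by (simp add: dist_commute)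
  thus "x \<in> insert z C" using d(2)[of x] by blast
 qed
 hence "countable (ball z d)" by (rule countable_subset) (simp add: C)
 thus False using uncountable_ball_complex[OF d(1)] by blast
qed

lemma slit_plane_scale: "r > 0 ==> of_real r * z \<in> slit_plane \<phi> \<longleftrightarrow> z \<in> slit_plane \<phi>"
proof -
 assume r: "r > 0"
 have "of_real r * w \<in> \<real>\<^sub>\<le>\<^sub>0 \<longleftrightarrow> w \<in> \<real>\<^sub>\<le>\<^sub>0" for w :: complex
  unfolding complex_nonpos_Reals_iff using r by (simp add: mult_le_0_iff)
 thus ?thesis unfolding slit_plane_def mem_Collect_eq mult.assoc by blast
qed

context qbase begin

lemma countable_qZ: "countable (qZ q)" by (simp add: qZ_def)

lemma ratio_power_quotient: "n' > 0 ==> k \<le> n' ==> filterlim z at_infinity F ==>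
 ((%m. (z m :: complex) ^ k / z m ^ n') \<longlongrightarrow> (if k = n' then 1 else 0)) F"
proof -
 assume n': "n' > 0" and k: "k \<le> n'" and z: "filterlim z at_infinity F"
 have nz: "\<forall>\<^sub>F m in F. z m \<noteq> 0" using z by (rule filterlim_at_infinity_imp_eventually_ne)
 have "((%m. inverse (z m) ^ (n' - k)) \<longlongrightarrow> 0 ^ (n' - k)) F"
  by (intro tendsto_power filterlim_compose[OF tendsto_inverse_0 z])
 moreover have "\<forall>\<^sub>F m in F. inverse (z m) ^ (n' - k) = z m ^ k / z m ^ n'"
  using nz
 proof eventually_elim
  case (elim m)
  have "z m ^ n' = z m ^ k * z m ^ (n' - k)" unfolding power_add[symmetric] using k by simp
  thus ?case using elim by (simp add: power_divide inverse_eq_divide)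
 qed
 ultimately have "((%m. z m ^ k / z m ^ n') \<longlongrightarrow> 0 ^ (n' - k)) F" by (rule Lim_transform_eventually)
 moreover have "(0::complex) ^ (n' - k) = (if k = n' then 1 else 0)" using k by (auto simp: power_0_left)
 ultimately show ?thesis by (simp only:)
qed

end

context qconf begin

text \<open>The exponent of z in f_n; multiplying z by q multiplies the corresponding power by
  c.\<close>

definition SS where "SS \<phi> = (\<Sum>l\<in>{1..<n}. qlog \<phi> q (a l) - qlog \<phi> q (b l))"

lemma exp_SS: "exp (SS \<phi> * of_real (ln q)) = c"
proof -
 have "exp (SS \<phi> * of_real (ln q)) = (\<Prod>l\<in>{1..<n}. exp ((qlog \<phi> q (a l) - qlog \<phi> q (b l)) * of_real (ln q)))"
  unfolding SS_def sum_distrib_right by (rule exp_sum) simp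
 also have "\<dots> = (\<Prod>l\<in>{1..<n}. a l / b l)"
 proof (intro prod.cong refl)
  fix l assume l: "l \<in> {1..<n}"
  show "exp ((qlog \<phi> q (a l) - qlog \<phi> q (b l)) * of_real (ln q)) = a l / b l"
   by (simp only: left_diff_distrib exp_diff exp_qlog[OF a_nz[OF l]] exp_qlog[OF b_nz[OF l]])
 qed
 finally show ?thesis by (simp add: c_def PA_def PB_def prod_dividef)
qed

definition GE where "GE \<phi> z = qi Q * bpow \<phi> z (SS \<phi>) / th (- z)"
text \<open>A closed form of f_n. Compared with 1 / (z; q)_infinity, the theta denominator in
  \<open>GE\<close> has the additional factor (q/z; q)_infinity, which is a power series in 1/z and
  is absorbed in \<open>hh\<close>.\<close>

definition GG where "GG \<phi> z = GE \<phi> z * T sseq (- (c * z))"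

lemma GE_shift: "z \<noteq> 0 ==> GE \<phi> (Q * z) = - c * z * GE \<phi> z"
 using th_Q'[of "- z"] by (simp add: GE_def bpow_scale exp_SS)

lemma GG_solution: "z \<noteq> 0 ==> confluent_eq q n a b (GG \<phi>) z"
 by (rule solution_last[OF GE_shift]) (auto simp: GG_def)

definition eta where "eta w = (\<Sum>k. (sseq (- int k) * Q ^ (k * (k + 1) div 2) * (- 1 / c) ^ k) * w ^ k)"

lemma eta_sums: assumes z: "z \<noteq> 0"
 shows "(%k. (sseq (- int k) * Q ^ (k * (k + 1) div 2) * (- 1 / c) ^ k) * (1 / z) ^ k) sums T sseq (- (c * z))"
proof -
 have "(- 1 / c) ^ k * (1 / z) ^ k = (1 / - (c * z)) ^ k" for k
  unfolding power_mult_distrib[symmetric] by (rule arg_cong[of _ _ "%x. x ^ k"]) simp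
 thus ?thesis using T_sseq_series(2)[of "- (c * z)"] z c_nz by (simp only: mult.assoc) simp
qed

lemma eta_T: "z \<noteq> 0 ==> eta (1 / z) = T sseq (- (c * z))"
 using sums_unique[OF eta_sums] by (simp add: eta_def)

lemma eta_holomorphic: "eta holomorphic_on UNIV"
 unfolding holomorphic_on_def field_differentiable_def
proof
 fix w :: complex
 define K :: complex where "K = of_real (norm w + 1)"
 have nK: "norm K = norm w + 1" unfolding K_def norm_of_real by simp
 have K: "K \<noteq> 0" "norm w < norm K" using nK norm_ge_zero[of w] by (auto simp del: norm_ge_zero)
 have "summable (%k. (sseq (- int k) * Q ^ (k * (k + 1) div 2) * (- 1 / c) ^ k) * K ^ k)"
  using sums_summable[OF eta_sums[of "1 / K"]] K by simp
 from termdiffs_strong[OF this K(2)] show "\<exists>f'. (eta has_field_derivative f') (at w within UNIV)"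
  unfolding eta_def by auto
qed

lemma eta_0 [simp]: "eta 0 = 1" by (simp add: eta_def powser_zero)

text \<open>The sum of h_n in the variable w = 1/z: the entire function \<open>eta\<close> divided
  by (q w; q)_infinity.\<close>

definition hh where "hh w = eta w / qi (Q * w)"
definition hF where "hF = fps_expansion hh 0"

lemma hh_analytic: "qi (Q * w) \<noteq> 0 ==> hh analytic_on {w}"
 unfolding hh_def using eta_holomorphic qi_holomorphic
 by (intro analytic_on_divide) (auto intro!: holomorphic_on_imp_analytic_at[of _ UNIV] holomorphic_intros)

lemma hh_meromorphic: "hh meromorphic_on UNIV"
 unfolding hh_def using eta_holomorphic
 by (intro meromorphic_on_divide analytic_on_imp_meromorphic_on) (auto simp: analytic_on_open intro!: holomorphic_intros)

lemma hh_fps: "hh has_fps_expansion hF"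
 unfolding hF_def by (intro analytic_at_imp_has_fps_expansion_0 hh_analytic) simp

lemma hh_GG: assumes z: "z \<noteq> 0" shows "hh (1 / z) * last_factor \<phi> q n a b z = GG \<phi> z"
proof -
 have "th (- z) = qi Q * qi z * qi (Q / z)" using th_product[of "- z"] z by simp
 thus ?thesis unfolding hh_def last_factor_def GG_def GE_def eta_T[OF z] SS_def by (simp add: mult_ac)
qed

lemma GG_meromorphic: "GG \<phi> meromorphic_on slit_plane \<phi>"
proof -
 have "(%z. T sseq (- (c * z))) holomorphic_on slit_plane \<phi>"
  by (rule holomorphic_compose_nz[OF T_holomorphic[OF sseq_tempered]]) (auto intro!: holomorphic_intros simp: slit_plane_nz c_nz)
 moreover have "(%z. th (- z)) holomorphic_on slit_plane \<phi>" by (intro holomorphic_intros) (auto simp: slit_plane_nz)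
 ultimately show ?thesis unfolding GG_def GE_def
  by (intro meromorphic_on_mult meromorphic_on_divide analytic_on_imp_meromorphic_on)
   (auto simp: analytic_on_open open_slit_plane intro!: holomorphic_intros bpow_holomorphic)
qed

lemma confluent_cong:
 assumes "\<And>k. k \<le> n ==> f (Q ^ k * z) = g (Q ^ k * z)"
 shows "confluent_eq q n a b f z \<longleftrightarrow> confluent_eq q n a b g z"
proof -
 have "opr (%z. Q * z) as f z = opr (%z. Q * z) as g z" "opr (%z. Q * z) bs1 f z = opr (%z. Q * z) bs1 g z"
  by (rule opr_cong; use assms in \<open>simp add: funpow_Q\<close>)+
 thus ?thesis by (simp add: confluent_iff)
qed

lemma hF_solution: "\<exists>R>0. mero_solution q n a b (slit_plane \<phi> \<inter> {z. norm z > R}) (%z. eval_fps hF (1 / z) * last_factor \<phi> q n a b z)"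
proof -
 have "\<forall>\<^sub>F w in nhds 0. eval_fps hF w = hh w" using hh_fps by (simp add: has_fps_expansion_def)
 then obtain \<epsilon> where \<epsilon>: "\<epsilon> > 0" "\<And>w. norm w < \<epsilon> ==> eval_fps hF w = hh w"
  unfolding eventually_nhds_metric by auto
 \<comment> \<open>The equation at z involves the points up to q^n z, and all of them must satisfy
   |1 / (q^k z)| < epsilon.\<close>
 define R where "R = 1 / (\<epsilon> * q ^ n)"
 have R0: "R > 0" using \<epsilon> q0 by (simp add: R_def)
 let ?\<Omega> = "slit_plane \<phi> \<inter> {z. norm z > R}"
 let ?y = "%z. eval_fps hF (1 / z) * last_factor \<phi> q n a b z"
 have yG: "?y (Q ^ k * z) = GG \<phi> (Q ^ k * z)" if z: "z \<in> ?\<Omega>" and k: "k \<le> n" for k z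
 proof -
  have nz: "Q ^ k * z \<noteq> 0" using z slit_plane_nz by auto
  have "1 < \<epsilon> * q ^ n * norm z" using z \<epsilon> q0 by (simp add: R_def field_simps)
  also have "\<dots> \<le> \<epsilon> * q ^ k * norm z" using k \<epsilon> q0 q1 by (intro mult_right_mono mult_left_mono power_decreasing) auto
  finally have "norm (1 / (Q ^ k * z)) < \<epsilon>" using nz q0 by (simp add: norm_divide norm_mult norm_power field_simps)
  show ?thesis unfolding \<epsilon>(2)[OF \<open>norm (1 / (Q ^ k * z)) < \<epsilon>\<close>] by (rule hh_GG[OF nz])
 qed
 have op: "open ?\<Omega>" by (intro open_Int open_slit_plane open_Collect_less continuous_intros)
 have "mero_solution q n a b ?\<Omega> ?y" unfolding mero_solution_def
 proof
  show "?y meromorphic_on ?\<Omega>"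
  proof (subst meromorphic_on_cong[OF _ refl])
   show "GG \<phi> meromorphic_on ?\<Omega>" using GG_meromorphic by (rule meromorphic_on_subset) auto
   fix z assume "z \<in> ?\<Omega>"
   hence "\<forall>\<^sub>F w in at z. w \<in> ?\<Omega>" using op by (auto simp: eventually_at_topological)
   thus "\<forall>\<^sub>F w in at z. ?y w = GG \<phi> w" by eventually_elim (use yG[of _ 0] in simp)
  qed
  have "confluent_eq q n a b ?y z" if z: "z \<in> ?\<Omega>" for z
   using confluent_cong[of ?y z "GG \<phi>", OF yG[OF z]] GG_solution[of z \<phi>] z slit_plane_nz by auto
  thus "\<forall>\<^sub>\<approx>z\<in>?\<Omega>. confluent_eq q n a b ?y z"
   unfolding eventually_cosparse_open_eq[OF op]
  proof (intro ballI)
   fix x assume "x \<in> ?\<Omega>"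
   hence "\<forall>\<^sub>F w in at x. w \<in> ?\<Omega>" using op by (auto simp: eventually_at_topological)
   thus "\<forall>\<^sub>F w in at x. confluent_eq q n a b ?y w" by eventually_elim (rule \<open>\<And>z. z \<in> ?\<Omega> ==> confluent_eq q n a b ?y z\<close>)
  qed
 qed
 thus ?thesis using R0 by blast
qed

lemma last_factor_scale:
 assumes z: "z \<noteq> 0" "z \<notin> qZ q"
 shows "last_factor \<phi> q n a b (Q ^ k * z) = c ^ k * qp z k * last_factor \<phi> q n a b z" "last_factor \<phi> q n a b z \<noteq> 0"
proof -
 have qz: "qi z \<noteq> 0" using z q_minusN_qZ qi_nz by blast
 show "last_factor \<phi> q n a b z \<noteq> 0" using qz by (simp add: last_factor_def)
 have "bpow \<phi> (Q ^ k * z) (SS \<phi>) = c ^ k * bpow \<phi> z (SS \<phi>)"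
 proof (induction k)
  case (Suc k)
  have "bpow \<phi> (Q * (Q ^ k * z)) (SS \<phi>) = c * bpow \<phi> (Q ^ k * z) (SS \<phi>)" using z by (subst bpow_scale) (auto simp: exp_SS)
  thus ?case using Suc by (simp add: mult.assoc)
 qed simp
 moreover have "qi z = qp z k * qi (Q ^ k * z)" using qi_split[of z k] by (simp add: mult.commute)
 ultimately show "last_factor \<phi> q n a b (Q ^ k * z) = c ^ k * qp z k * last_factor \<phi> q n a b z"
  using qz unfolding last_factor_def SS_def[symmetric] by auto
qed

lemma qp_asymp:
 assumes z: "filterlim z at_infinity F"
 shows "((%m. qp (z m) k / z m ^ k) \<longlongrightarrow> (\<Prod>l<k. - (Q ^ l))) F"
proof (induction k)
 case (Suc k)
 have nz: "\<forall>\<^sub>F m in F. z m \<noteq> 0" using z by (rule filterlim_at_infinity_imp_eventually_ne)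
 have "((%m. qp (z m) k / z m ^ k * (inverse (z m) - Q ^ k)) \<longlongrightarrow> (\<Prod>l<k. - (Q ^ l)) * (0 - Q ^ k)) F"
  by (intro tendsto_intros Suc filterlim_compose[OF tendsto_inverse_0 z])
 moreover have "\<forall>\<^sub>F m in F. qp (z m) k / z m ^ k * (inverse (z m) - Q ^ k) = qp (z m) (Suc k) / z m ^ Suc k"
  using nz by eventually_elim (simp add: qp_Suc field_simps)
 ultimately show ?case by (auto elim!: Lim_transform_eventually)
qed simp

lemma fps_leading:
 fixes D :: "complex fps"
 assumes "fps_conv_radius D > 0" "D \<noteq> 0"
 shows "((%w. eval_fps D w / w ^ subdegree D) \<longlongrightarrow> fps_nth D (subdegree D)) (at 0)"
proof -
 let ?j = "subdegree D"
 obtain r where r: "0 < r" "ereal r < fps_conv_radius D" using assms(1) ereal_dense2[of 0 "fps_conv_radius D"] by auto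
 have sm: "summable (%k. fps_nth D k * w ^ k)" if "norm w \<le> r" for w
  by (rule summable_fps, rule le_less_trans[of _ "ereal r"]) (use that r in auto)
 let ?G = "%w. \<Sum>k. fps_nth D (k + ?j) * w ^ k"
 have sG: "summable (%k. fps_nth D (k + ?j) * w ^ k)" if "norm w \<le> r" "w \<noteq> 0" for w
 proof -
  have "summable (%k. fps_nth D (k + ?j) * w ^ (k + ?j))" using sm[OF that(1)] by (subst summable_iff_shift[of "%k. fps_nth D k * w ^ k"])
  hence "summable (%k. fps_nth D (k + ?j) * w ^ (k + ?j) / w ^ ?j)" by (rule summable_divide)
  thus ?thesis using that by (simp add: power_add)
 qed
 have ev: "eval_fps D w = w ^ ?j * ?G w" if w: "norm w \<le> r" "w \<noteq> 0" for w
 proof -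
  have "eval_fps D w = (\<Sum>k. fps_nth D (k + ?j) * w ^ (k + ?j)) + (\<Sum>k<?j. fps_nth D k * w ^ k)"
   unfolding eval_fps_def by (rule suminf_split_initial_segment[OF sm[OF w(1)]])
  also have "(\<Sum>k<?j. fps_nth D k * w ^ k) = 0" by (intro sum.neutral) auto
  also have "(\<Sum>k. fps_nth D (k + ?j) * w ^ (k + ?j)) = w ^ ?j * ?G w"
  proof -
   have "(%k. w ^ ?j * (fps_nth D (k + ?j) * w ^ k)) sums (w ^ ?j * ?G w)"
    by (intro sums_mult summable_sums sG w)
   moreover have "w ^ ?j * (x * w ^ k) = x * w ^ (k + ?j)" for x k by (simp add: power_add)
   ultimately show ?thesis by (simp add: sums_iff)
  qed
  finally show ?thesis by simp
 qed
 have "isCont ?G 0" by (rule isCont_powser[of _ "of_real r"]) (use sG[of "of_real r"] r in auto)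
 hence "(?G \<longlongrightarrow> ?G 0) (at 0)" by (simp add: isCont_def)
 moreover have "?G 0 = fps_nth D ?j" by (simp add: powser_zero)
 moreover have "\<forall>\<^sub>F w in at 0. ?G w = eval_fps D w / w ^ ?j"
  unfolding eventually_at by (rule exI[of _ r]) (use r ev in auto)
 ultimately show ?thesis by (auto elim!: Lim_transform_eventually)
qed

text \<open>If the difference of two candidates starts with w^j, then j > 0 by the common constant
  term. Inserted into the equation at points tending to infinity, its leading terms on the two sides
  differ by the factor q^(-j), which is impossible.\<close>

lemma h_last_unique:
 assumes c1: "fps_nth c1 0 = 1" "fps_conv_radius c1 > 0" "R1 > 0"
   "mero_solution q n a b (slit_plane \<phi> \<inter> {z. norm z > R1}) (%z. eval_fps c1 (1 / z) * last_factor \<phi> q n a b z)"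
  and c2: "fps_nth c2 0 = 1" "fps_conv_radius c2 > 0" "R2 > 0"
   "mero_solution q n a b (slit_plane \<phi> \<inter> {z. norm z > R2}) (%z. eval_fps c2 (1 / z) * last_factor \<phi> q n a b z)"
 shows "c1 = c2"
proof (rule ccontr)
 assume ne: "c1 \<noteq> c2"
 define D where "D = c1 - c2"
 have D0: "D \<noteq> 0" using ne by (simp add: D_def)
 define j where "j = subdegree D"
 have "fps_nth D j \<noteq> 0" using D0 by (simp add: j_def)
 moreover have "fps_nth D 0 = 0" by (simp add: D_def c1(1) c2(1))
 ultimately have j0: "j > 0" by (cases j) auto
 define d where "d = fps_nth D j"
 have d0: "d \<noteq> 0" using D0 by (simp add: d_def j_def)
 have cr: "fps_conv_radius D > 0" unfolding D_def
  using fps_conv_radius_diff[of c1 c2] c1(2) c2(2) by (auto simp: min_def split: if_splits intro: less_le_trans)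
 let ?L = "last_factor \<phi> q n a b"
 let ?y1 = "%z. eval_fps c1 (1 / z) * ?L z" and ?y2 = "%z. eval_fps c2 (1 / z) * ?L z"
 have cb: "countable ((slit_plane \<phi> \<inter> {z. norm z > R}) \<inter> {z. \<not> confluent_eq q n a b y z})"
  if "mero_solution q n a b (slit_plane \<phi> \<inter> {z. norm z > R}) y" for R y
  by (rule sparse_imp_countable) (use that in \<open>auto simp: mero_solution_def eventually_cosparse intro!: open_Int open_slit_plane open_Collect_less continuous_intros\<close>)
 define B where "B = ((slit_plane \<phi> \<inter> {z. norm z > R1}) \<inter> {z. \<not> confluent_eq q n a b ?y1 z}) \<union> ((slit_plane \<phi> \<inter> {z. norm z > R2}) \<inter> {z. \<not> confluent_eq q n a b ?y2 z}) \<union> qZ q"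
 have B: "countable B" unfolding B_def using cb[OF c1(4)] cb[OF c2(4)] countable_qZ by auto
 define R where "R = max R1 R2"
 \<comment> \<open>The equations hold only off sparse sets. On the ray of argument phi, which lies
   in the slit plane, uncountably many points remain beyond any radius.\<close>
 have "\<exists>r. real m + R < r \<and> of_real r * cis \<phi> \<notin> B" for m :: nat
 proof (rule ccontr)
  assume "\<not> ?thesis"
  hence "(%r. of_real r * cis \<phi>) ` {real m + R<..<real m + R + 1} \<subseteq> B" by auto
  hence "countable ((%r. of_real r * cis \<phi>) ` {real m + R<..<real m + R + 1})" using B countable_subset by blast
  moreover have "inj_on (%r. of_real r * cis \<phi>) {real m + R<..<real m + R + 1}" by (auto simp: inj_on_def cis_neq_zero)
  ultimately have "countable {real m + R<..<real m + R + 1}" by (rule countable_image_inj_on)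
  thus False using uncountable_open_interval[of "real m + R" "real m + R + 1"] by simp
 qed
 then obtain r where r: "\<And>m. real m + R < r m" "\<And>m. of_real (r m) * cis \<phi> \<notin> B" by metis
 define z where "z m = of_real (r m) * cis \<phi>" for m
 have R0: "R > 0" using c1(3) by (simp add: R_def)
 have rpos: "r m > 0" "r m > real m" for m using r(1)[of m] R0 by auto
 have nz: "norm (z m) = r m" for m using rpos(1)[of m] by (simp add: z_def norm_mult)
 have z0: "z m \<noteq> 0" for m using nz[of m] rpos[of m] by auto
 have zB: "z m \<notin> B" "z m \<notin> qZ q" for m using r(2)[of m] by (auto simp: z_def B_def)
 have "z m * cis (- \<phi>) = of_real (r m)" for m by (simp add: z_def mult.assoc cis_mult)
 hence zS: "z m \<in> slit_plane \<phi>" for m using rpos[of m] by (simp add: slit_plane_def)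
 have zinf: "filterlim z at_infinity sequentially"
  unfolding filterlim_at_infinity_conv_norm_at_top nz
  by (rule filterlim_at_top_mono[OF filterlim_real_sequentially], intro always_eventually allI less_imp_le rpos(2))
 have eq: "confluent_eq q n a b ?y1 (z m)" "confluent_eq q n a b ?y2 (z m)" for m
  using zB(1)[of m] zS[of m] nz[of m] r(1)[of m] by (auto simp: B_def R_def)
 let ?G = "%m k. eval_fps D (1 / (Q ^ k * z m))"
 let ?y = "%z. ?y1 z - ?y2 z"
 have w0: "filterlim (%m. 1 / (Q ^ k * z m)) (at 0) sequentially" for k
 proof -
  have "filterlim (%m. Q ^ k * z m) at_infinity sequentially"
   by (rule tendsto_mult_filterlim_at_infinity[OF tendsto_const _ zinf]) simp
  hence "filterlim (%m. inverse (Q ^ k * z m)) (at 0) sequentially" by (rule filterlim_inverse_at_iff[THEN iffD2])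
  thus ?thesis by (simp only: inverse_eq_divide)
 qed
 have evy: "\<forall>\<^sub>F m in sequentially. ?y (Q ^ k * z m) = ?G m k * ?L (Q ^ k * z m)" for k
 proof -
  have "\<forall>\<^sub>F w in at (0::complex). norm w < fps_conv_radius c1 \<and> norm w < fps_conv_radius c2"
  proof -
   have "0 < min (fps_conv_radius c1) (fps_conv_radius c2)" using c1(2) c2(2) by simp
   from ereal_dense2[OF this] obtain s where s: "0 < ereal s" "ereal s < min (fps_conv_radius c1) (fps_conv_radius c2)" by blast
   have "norm w < fps_conv_radius c1 \<and> norm w < fps_conv_radius c2" if "norm w < s" for w :: complex
    using less_trans[of "ereal (norm w)" "ereal s"] that s by auto
   moreover have "s > 0" using s(1) by simp
   ultimately show ?thesis unfolding eventually_at by (intro exI[of _ s]) auto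
  qed
  from eventually_compose_filterlim[OF this w0[of k]] show ?thesis
   by eventually_elim (simp add: D_def eval_fps_diff left_diff_distrib)
 qed
 let ?\<rho> = "%k. \<Prod>l<k. - (Q ^ l)"
 \<comment> \<open>The prefactor at q^k z is c^k (z; q)_k times that at z and so grows like z^k.
   Dividing by this power and by the order z^(-j) of the difference leaves a convergent
   quantity.\<close>
 define X where "X k m = (?G m k * z m ^ j) * (c ^ k * (qp (z m) k / z m ^ k))" for k m
 have Xlim: "X k \<longlonglongrightarrow> (d / (Q ^ k) ^ j) * (c ^ k * ?\<rho> k)" for k
 proof -
  have "(%m. ?G m k / (1 / (Q ^ k * z m)) ^ j) \<longlonglongrightarrow> d"
   unfolding d_def j_def by (rule filterlim_compose[OF fps_leading[OF cr D0] w0])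
  hence "(%m. ?G m k / (1 / (Q ^ k * z m)) ^ j / (Q ^ k) ^ j) \<longlonglongrightarrow> d / (Q ^ k) ^ j" by (intro tendsto_divide tendsto_const) auto
  moreover have "?G m k / (1 / (Q ^ k * z m)) ^ j / (Q ^ k) ^ j = ?G m k * z m ^ j" for m
   using z0[of m] by (simp add: power_divide power_mult_distrib)
  ultimately have "(%m. ?G m k * z m ^ j) \<longlonglongrightarrow> d / (Q ^ k) ^ j" by simp
  thus ?thesis unfolding X_def by (intro tendsto_mult tendsto_const qp_asymp zinf)
 qed
 let ?\<alpha> = "%k. coeff (pc as) k" and ?\<beta> = "%k. coeff (pc bs1) k"
 have "\<forall>\<^sub>F m in sequentially. \<forall>k\<in>{..n}. ?y (Q ^ k * z m) = ?G m k * ?L (Q ^ k * z m)"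
  by (intro eventually_ball_finite ballI evy) simp
 hence E: "\<forall>\<^sub>F m in sequentially. (\<Sum>k\<le>n - 1. ?\<alpha> k * X k m * (z m ^ Suc k / z m ^ n)) = (\<Sum>k\<le>n. ?\<beta> k * X k m * (z m ^ k / z m ^ n))"
 proof eventually_elim
  case (elim m)
  have Ln: "?L (z m) \<noteq> 0" by (rule last_factor_scale(2)[OF z0 zB(2)])
  have yk: "?y (Q ^ k * z m) = X k m * z m ^ k * (?L (z m) / z m ^ j)" if "k \<le> n" for k
  proof -
   have "?y (Q ^ k * z m) = ?G m k * (c ^ k * qp (z m) k * ?L (z m))"
    using elim that unfolding last_factor_scale(1)[OF z0 zB(2)] by blast
   also have "\<dots> = X k m * z m ^ k * (?L (z m) / z m ^ j)" using z0[of m] by (simp add: X_def)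
   finally show ?thesis .
  qed
  have "z m * opr (%z. Q * z) as ?y (z m) = opr (%z. Q * z) bs1 ?y (z m)"
   unfolding opr_diff right_diff_distrib using eq[of m] by (simp add: confluent_iff)
  hence "z m * (\<Sum>k\<le>n - 1. ?\<alpha> k * ?y (Q ^ k * z m)) = (\<Sum>k\<le>n. ?\<beta> k * ?y (Q ^ k * z m))"
   unfolding opr_eq_sum funpow_Q length_as length_bs1 .
  moreover have "(\<Sum>k\<le>n - 1. ?\<alpha> k * ?y (Q ^ k * z m)) = (\<Sum>k\<le>n - 1. ?\<alpha> k * (X k m * z m ^ k * (?L (z m) / z m ^ j)))"
   by (intro sum.cong refl arg_cong2[of _ _ _ _ times] yk) auto
  moreover have "(\<Sum>k\<le>n. ?\<beta> k * ?y (Q ^ k * z m)) = (\<Sum>k\<le>n. ?\<beta> k * (X k m * z m ^ k * (?L (z m) / z m ^ j)))"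
   by (intro sum.cong refl arg_cong2[of _ _ _ _ times] yk) auto
  ultimately have "z m * (\<Sum>k\<le>n - 1. ?\<alpha> k * (X k m * z m ^ k * (?L (z m) / z m ^ j))) = (\<Sum>k\<le>n. ?\<beta> k * (X k m * z m ^ k * (?L (z m) / z m ^ j)))"
   by (simp only:)
  hence "(\<Sum>k\<le>n - 1. ?\<alpha> k * X k m * z m ^ Suc k) * (?L (z m) / z m ^ j) = (\<Sum>k\<le>n. ?\<beta> k * X k m * z m ^ k) * (?L (z m) / z m ^ j)"
   unfolding sum_distrib_left sum_distrib_right by (simp add: mult_ac)
  hence "(\<Sum>k\<le>n - 1. ?\<alpha> k * X k m * z m ^ Suc k) = (\<Sum>k\<le>n. ?\<beta> k * X k m * z m ^ k)" using Ln z0[of m] by (simp only: mult_cancel_right divide_eq_0_iff power_eq_0_iff simp_thms)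
  hence "(\<Sum>k\<le>n - 1. ?\<alpha> k * X k m * z m ^ Suc k) / z m ^ n = (\<Sum>k\<le>n. ?\<beta> k * X k m * z m ^ k) / z m ^ n" by (simp only:)
  thus ?case unfolding sum_divide_distrib times_divide_eq_right .
 qed
 \<comment> \<open>After division by z^n only the terms of top order survive: k = n - 1 on the left,
   because of the factor z, and k = n on the right.\<close>
 have l1: "(%m. \<Sum>k\<le>n - 1. ?\<alpha> k * X k m * (z m ^ Suc k / z m ^ n)) \<longlonglongrightarrow> (\<Sum>k\<le>n - 1. ?\<alpha> k * ((d / (Q ^ k) ^ j) * (c ^ k * ?\<rho> k)) * (if Suc k = n then 1 else 0))"
  by (intro tendsto_sum tendsto_mult tendsto_const Xlim ratio_power_quotient zinf) (use n1 in auto)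
 have l2: "(%m. \<Sum>k\<le>n. ?\<beta> k * X k m * (z m ^ k / z m ^ n)) \<longlonglongrightarrow> (\<Sum>k\<le>n. ?\<beta> k * ((d / (Q ^ k) ^ j) * (c ^ k * ?\<rho> k)) * (if k = n then 1 else 0))"
  by (intro tendsto_sum tendsto_mult tendsto_const Xlim ratio_power_quotient zinf) (use n1 in auto)
 have "(\<Sum>k\<le>n - 1. ?\<alpha> k * ((d / (Q ^ k) ^ j) * (c ^ k * ?\<rho> k)) * (if Suc k = n then 1 else 0)) = (\<Sum>k\<le>n. ?\<beta> k * ((d / (Q ^ k) ^ j) * (c ^ k * ?\<rho> k)) * (if k = n then 1 else 0))"
  by (rule LIMSEQ_unique[OF l1]) (rule Lim_transform_eventually[OF l2], use E in \<open>auto elim: eventually_mono\<close>)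
 moreover obtain N where N: "n = Suc N" using n1 by (cases n) auto
 ultimately have "?\<alpha> N * ((d / (Q ^ N) ^ j) * (c ^ N * ?\<rho> N)) = ?\<beta> n * ((d / (Q ^ n) ^ j) * (c ^ n * ?\<rho> n))"
  by (simp add: N if_distrib[of "%x. _ * x"] sum.delta cong: if_cong)
 moreover have "?\<alpha> N = (-1) ^ N * PA" using pa_n by (simp add: N)
 moreover have "?\<beta> n = - ((-1) ^ N * PB / Q ^ N)" using pb_n N by simp
 moreover have "c ^ n * ?\<rho> n = c ^ N * ?\<rho> N * (- c * Q ^ N)" by (simp add: N)
 moreover have "(Q ^ n) ^ j = (Q ^ N) ^ j * Q ^ j" by (simp add: N power_mult_distrib)
 ultimately have "(-1) ^ N * PA * ((d / (Q ^ N) ^ j) * (c ^ N * ?\<rho> N)) = - ((-1) ^ N * PB / Q ^ N) * ((d / ((Q ^ N) ^ j * Q ^ j)) * (c ^ N * ?\<rho> N * (- c * Q ^ N)))"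
  by (simp only:)
 also have "\<dots> = (-1) ^ N * (PB * c) * ((d / (Q ^ N) ^ j) * (c ^ N * ?\<rho> N)) / Q ^ j" by simp
 also have "PB * c = PA" using PB_nz by (simp add: c_def)
 finally have "u = u / Q ^ j" if "u = (-1) ^ N * PA * ((d / (Q ^ N) ^ j) * (c ^ N * ?\<rho> N))" for u using that by simp
 moreover have "(-1) ^ N * PA * ((d / (Q ^ N) ^ j) * (c ^ N * ?\<rho> N)) \<noteq> 0" using PA_nz d0 c_nz by simp
 ultimately have "Q ^ j = 1" by (metis divide_self_if eq_divide_eq mult_cancel_left mult.right_neutral)
 thus False using Q_pow_ne1[OF j0] by simp
qed

lemma h_last_hF: "h_last_fps \<phi> q n a b = hF"
 unfolding h_last_fps_def
proof (rule the_equality)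
 have "fps_nth hF 0 = 1" using has_fps_expansion_imp_0_eq_fps_nth_0[OF hh_fps] by (simp add: hh_def)
 moreover have "fps_conv_radius hF > 0" using hh_fps by (simp add: has_fps_expansion_def)
 ultimately show P: "fps_nth hF 0 = 1 \<and> fps_conv_radius hF > 0 \<and> (\<exists>R>0. mero_solution q n a b (slit_plane \<phi> \<inter> {z. norm z > R})
       (%z. eval_fps hF (1 / z) * last_factor \<phi> q n a b z))" using hF_solution by blast
 fix c'
 assume "fps_nth c' 0 = 1 \<and> fps_conv_radius c' > 0 \<and> (\<exists>R>0. mero_solution q n a b (slit_plane \<phi> \<inter> {z. norm z > R})
       (%z. eval_fps c' (1 / z) * last_factor \<phi> q n a b z))"
 thus "c' = hF" using P h_last_unique by blast
qed

text \<open>Off q^Z the denominator of \<open>hh\<close> at 1/z does not vanish, so the continued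
  series takes the value of \<open>hh\<close> there.\<close>

lemma f_inf_last_GG: assumes z: "z \<noteq> 0" "z \<notin> qZ q" shows "f_inf_last \<phi> q n a b z = GG \<phi> z"
proof -
 have "Q / z \<notin> qZ q"
 proof
  assume "Q / z \<in> qZ q"
  hence "1 / z \<in> qZ q" using qZ_mult_iff[OF qZ_powi[of 1], of "1 / z"] by simp
  thus False using qZ_inverse[of "1 / z"] z by simp
 qed
 hence "qi (Q * (1 / z)) \<noteq> 0" using q_minusN_qZ[of "Q / z"] qi_nz[of "Q / z"] by auto
 hence "mero_sum hF (1 / z) = hh (1 / z)" by (intro mero_sum_eq hh_meromorphic hh_fps hh_analytic)
 thus ?thesis unfolding f_inf_last_def h_last_hF using hh_GG[OF z(1)] by simp
qed

end

section \<open>Asymptotics along spirals, the fundamental system and the connection formula\<close>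

context qconf begin

lemma bi_tendsto: assumes i: "i \<in> {1..<n}" shows "(%l. bi i (t * Q ^ l)) \<longlonglongrightarrow> 1"
proof -
 have "isCont (bi i) 0" unfolding bi_def by (intro analytic_at_imp_isCont ph_analytic Bsi_ok i) simp
 moreover have "bi i 0 = 1" unfolding bi_def by (subst ph_series[OF Bsi_ok[OF i]]) (simp_all add: powser_zero)
 ultimately show ?thesis using isCont_tendsto_compose[of 0 "bi i" "%l. t * Q ^ l"] tendsto_mult_right_zero[OF Qpow_to_0] by simp
qed

lemma psum_T': "psum g t y = T (%m. g (t * Q powi m)) (t * y)"
 unfolding psum_def by (rule T_scale)

text \<open>Replacing z by q^(-k) z translates the samples of \<open>bi i\<close> towards 0, where
  \<open>bi i\<close> equals 1; in the limit the numerator becomes theta(lam z) itself.\<close>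

lemma FF_spiral:
 assumes i: "i \<in> {1..<n}" and lam: "lam \<noteq> 0" "tt lam i \<notin> qZ q" and z: "z \<noteq> 0" "th (lam * z) \<noteq> 0"
 shows "(%k. FF lam i (Q powi (- int k) * z)) \<longlonglongrightarrow> 1"
proof -
 let ?t = "tt lam i" and ?w = "lam * z"
 let ?x = "%m. bi i (?t * Q powi m)"
 have ai: "a i \<noteq> 0" using a_nz[OF i] .
 have w: "?w \<noteq> 0" using lam z by simp
 have t: "?t \<noteq> 0" using lam ai c_nz by simp
 have F: "FF lam i (Q powi (- int k) * z) = T (%m. ?x (m + int k)) ?w / th ?w" for k
 proof -
  have e: "?t * (- (c * a i * (Q powi (- int k) * z))) = Q powi (- int k) * ?w" using ai c_nz by simp
  have 1: "FF lam i (Q powi (- int k) * z) = T ?x (Q powi (- int k) * ?w) / th (Q powi (- int k) * ?w)"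
   unfolding FF_def psum_T' e by (simp only: mult.left_commute)
  have 2: "T (%m. ?x (m + int k)) ?w = (Q powi tri (- int k) * ?w powi (- int k)) * T ?x (Q powi (- int k) * ?w)"
   using T_shift[OF w, of ?x "- int k"] by simp
  have 3: "th ?w = (Q powi tri (- int k) * ?w powi (- int k)) * th (Q powi (- int k) * ?w)" by (rule th_shift[OF w])
  have nz: "Q powi tri (- int k) * ?w powi (- int k) \<noteq> 0" using w by simp
  show ?thesis unfolding 1 2 by (subst 3) (rule mult_divide_mult_cancel_left[OF nz, symmetric])
 qed
 obtain C0 K where K: "K \<ge> 1" "\<And>m. norm (?x m) \<le> C0 * K ^ nat \<bar>m\<bar>"
  using bi_tempered[OF i t lam(2)] unfolding tempered_def by blast
 obtain C1 where C1: "\<And>l. norm (bi i (?t * Q ^ l)) \<le> C1"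
  using convergent_imp_Bseq[OF convergentI[OF bi_tendsto[OF i, of ?t]]] unfolding Bseq_def by blast
 define C where "C = max \<bar>C0\<bar> C1"
 \<comment> \<open>For m + k >= 0 the samples tend to 1 and are bounded; for m + k < 0 one has |m +
   k| <= |m|. This makes the growth bound uniform in k.\<close>
 have bd: "norm (?x (m + int k)) \<le> C * K ^ nat \<bar>m\<bar>" for m k
 proof (cases "m + int k \<ge> 0")
  case True
  have "norm (?x (m + int k)) \<le> C1" using C1[of "nat (m + int k)"] True by (simp add: power_int_def)
  also have "\<dots> \<le> C * 1" by (simp add: C_def)
  also have "\<dots> \<le> C * K ^ nat \<bar>m\<bar>" using K(1) by (intro mult_left_mono one_le_power) (auto simp: C_def)
  finally show ?thesis .
 next
  case False
  have "norm (?x (m + int k)) \<le> C0 * K ^ nat \<bar>m + int k\<bar>" by (rule K(2))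
  also have "\<dots> \<le> C * K ^ nat \<bar>m\<bar>"
   by (intro mult_mono power_increasing) (use K(1) False in \<open>auto simp: C_def\<close>)
  finally show ?thesis .
 qed
 have "(%k. T (%m. ?x (m + int k)) ?w) \<longlonglongrightarrow> T (%_. 1) ?w"
 proof (rule T_tendsto[OF _ tendsto_const w K(1)])
  fix m
  have "(%k. bi i ((?t * Q powi m) * Q ^ k)) \<longlonglongrightarrow> 1" by (rule bi_tendsto[OF i])
  moreover have "(?t * Q powi m) * Q ^ k = ?t * Q powi (m + int k)" for k by (simp add: power_int_add)
  ultimately show "(%k. ?x (m + int k)) \<longlonglongrightarrow> 1" by (simp only:)
  show "\<forall>\<^sub>F k in sequentially. \<forall>m. norm (?x (m + int k)) \<le> C * K ^ nat \<bar>m\<bar>" using bd by simp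
 qed simp
 hence "(%k. T (%m. ?x (m + int k)) ?w / th ?w) \<longlonglongrightarrow> th ?w / th ?w"
  unfolding th_T[symmetric] by (intro tendsto_divide tendsto_const z)
 thus ?thesis unfolding F using z by simp
qed

lemma spiral_Suc: "Q * (Q powi (- int (Suc k)) * z) = Q powi (- int k) * z"
proof -
 have "Q powi (1 + - int (Suc k)) = Q powi 1 * Q powi (- int (Suc k))" by (rule power_int_add) (use Q_nz in auto)
 thus ?thesis by (simp add: mult.assoc[symmetric])
qed

lemma spiral_infinity: "z \<noteq> 0 ==> (%k. 1 / (Q powi (- int k) * z)) \<longlonglongrightarrow> 0"
proof -
 assume "z \<noteq> 0"
 have "1 / (Q powi (- int k) * z) = 1 / z * Q ^ k" for k by (simp add: power_int_minus field_simps)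
 thus ?thesis using tendsto_mult_right_zero[OF Qpow_to_0, of "1 / z"] by simp
qed

lemma eta_spiral: "z \<noteq> 0 ==> (%k. T sseq (- (c * (Q powi (- int k) * z)))) \<longlonglongrightarrow> 1"
proof -
 assume z: "z \<noteq> 0"
 have "isCont eta 0" using eta_holomorphic by (auto intro!: continuous_on_interior holomorphic_on_imp_continuous_on)
 hence "(%k. eta (1 / (Q powi (- int k) * z))) \<longlonglongrightarrow> eta 0" by (rule isCont_tendsto_compose[OF _ spiral_infinity[OF z]])
 moreover have "eta (1 / (Q powi (- int k) * z)) = T sseq (- (c * (Q powi (- int k) * z)))" for k
  by (rule eta_T) (use z in simp)
 ultimately show ?thesis by simp
qed

text \<open>Every step along the spiral multiplies \<open>GE\<close> by a further power q^(k+1) up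
  to a constant, so the decay is faster than exponential; the remaining factor tends to 1.\<close>

lemma GG_spiral:
 assumes z: "z \<noteq> 0" and \<rho>: "\<rho> > 0"
 shows "(%k. GG \<phi> (Q powi (- int k) * z) / of_real \<rho> ^ k) \<longlonglongrightarrow> 0"
proof -
 let ?f = "%k. GE \<phi> (Q powi (- int k) * z) / of_real \<rho> ^ k"
 let ?N = "norm c * norm z * \<rho>"
 have N: "?N > 0" using z c_nz \<rho> by simp
 have step: "norm (?f (Suc k)) = q ^ Suc k / ?N * norm (?f k)" for k
 proof -
  let ?w = "Q powi (- int (Suc k)) * z"
  have "GE \<phi> (Q powi (- int k) * z) = - c * ?w * GE \<phi> ?w"
   using GE_shift[of ?w \<phi>] z unfolding spiral_Suc by simp
  hence "norm (GE \<phi> (Q powi (- int k) * z)) = norm c * (norm z / q ^ Suc k) * norm (GE \<phi> ?w)"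
   using q0 by (simp add: norm_mult norm_power_int power_int_minus divide_inverse norm_inverse norm_power del: power_Suc of_nat_Suc)
  hence "norm (GE \<phi> ?w) = norm (GE \<phi> (Q powi (- int k) * z)) * q ^ Suc k / (norm c * norm z)"
   using q0 z c_nz by (simp add: field_simps del: of_nat_Suc)
  thus ?thesis using \<rho> by (simp add: norm_divide norm_mult norm_power mult_ac del: of_nat_Suc)
 qed
 obtain M where M: "q ^ M < ?N / 2" using real_arch_pow_inv[of "?N / 2" q] q1 N by auto
 have "summable ?f"
 proof (rule summable_ratio_test[of "1 / 2" M])
  fix k assume k: "k \<ge> M"
  have "q ^ Suc k \<le> q ^ M" using k q0 q1 by (intro power_decreasing) auto
  hence "q ^ Suc k / ?N \<le> 1 / 2" using M N by (simp add: field_simps)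
  thus "norm (?f (Suc k)) \<le> 1 / 2 * norm (?f k)" unfolding step by (intro mult_right_mono) auto
 qed simp
 hence "?f \<longlonglongrightarrow> 0" by (rule summable_LIMSEQ_zero)
 hence "(%k. ?f k * T sseq (- (c * (Q powi (- int k) * z)))) \<longlonglongrightarrow> 0 * 1"
  by (intro tendsto_mult eta_spiral z)
 thus ?thesis by (simp add: GG_def)
qed

context
 fixes lam :: complex and \<phi> :: real
 assumes lam: "lam \<noteq> 0" "\<And>i. i \<in> {1..<n} ==> tt lam i \<notin> qZ q"
begin

lemma f_inf_FF: "i \<in> {1..<n} ==> z \<noteq> 0 ==> f_inf \<phi> q n a b lam i z = bpow \<phi> z (- qlog \<phi> q (a i)) * FF lam i z"
proof -
 assume i: "i \<in> {1..<n}" and z: "z \<noteq> 0"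
 show ?thesis unfolding f_inf_def qborel_sum_FF[OF i lam(1) lam(2)[OF i] z] ..
qed

lemma bpow_a: "i \<in> {1..<n} ==> z \<noteq> 0 ==> bpow \<phi> z (- qlog \<phi> q (a i)) = a i * bpow \<phi> (Q * z) (- qlog \<phi> q (a i))"
 using exp_qlog[of "a i" \<phi>] a_nz[of i] by (simp add: bpow_scale exp_minus)

lemma f_inf_solution:
 assumes i: "i \<in> {1..<n}" and z: "z \<noteq> 0"
 shows "confluent_eq q n a b (f_inf \<phi> q n a b lam i) z"
proof (rule solution_i[OF i lam(1) lam(2)[OF i] _ _ z])
 fix z :: complex assume z: "z \<noteq> 0"
 show "bpow \<phi> (Q * z) (- qlog \<phi> q (a i)) / th (lam * (Q * z)) = lam / a i * z * (bpow \<phi> z (- qlog \<phi> q (a i)) / th (lam * z))"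
  using bpow_a[OF i z] th_Q'[of "lam * z"] z lam a_nz[OF i] by (simp add: mult_ac)
 show "f_inf \<phi> q n a b lam i z = bpow \<phi> z (- qlog \<phi> q (a i)) / th (lam * z) * psum (bi i) (tt lam i) (- (c * a i * z))"
  using f_inf_FF[OF i z] by (simp add: FF_def)
qed

lemma f_inf_meromorphic:
 assumes i: "i \<in> {1..<n}" shows "f_inf \<phi> q n a b lam i meromorphic_on slit_plane \<phi>"
proof (subst meromorphic_on_cong[OF _ refl])
 fix z assume "z \<in> slit_plane \<phi>"
 hence "\<forall>\<^sub>F w in at z. w \<in> slit_plane \<phi>" using open_slit_plane by (auto simp: eventually_at_topological)
 thus "\<forall>\<^sub>F w in at z. f_inf \<phi> q n a b lam i w = bpow \<phi> w (- qlog \<phi> q (a i)) * (T (%m. bi i (tt lam i * Q powi m)) (tt lam i * (- (c * a i * w))) / th (lam * w))"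
  by eventually_elim (simp only: f_inf_FF[OF i slit_plane_nz] FF_def psum_T')
next
 have t: "tt lam i \<noteq> 0" "tt lam i \<notin> qZ q" using lam(1) lam(2)[OF i] a_nz[OF i] c_nz by auto
 have "(%w. T (%m. bi i (tt lam i * Q powi m)) (tt lam i * (- (c * a i * w)))) holomorphic_on slit_plane \<phi>"
  by (rule holomorphic_compose_nz[OF T_holomorphic[OF bi_tempered[OF i t]]])
   (auto intro!: holomorphic_intros simp: slit_plane_nz c_nz lam(1) a_nz[OF i])
 moreover have "(%w. th (lam * w)) holomorphic_on slit_plane \<phi>" by (intro holomorphic_intros) (auto simp: slit_plane_nz lam(1))
 ultimately show "(%w. bpow \<phi> w (- qlog \<phi> q (a i)) * (T (%m. bi i (tt lam i * Q powi m)) (tt lam i * (- (c * a i * w))) / th (lam * w))) meromorphic_on slit_plane \<phi>"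
  by (intro meromorphic_on_mult meromorphic_on_divide analytic_on_imp_meromorphic_on)
   (auto simp: analytic_on_open open_slit_plane intro!: bpow_holomorphic)
qed

lemma f_inf_last_eventually: "z \<in> slit_plane \<phi> ==> \<forall>\<^sub>F w in at z. w \<in> slit_plane \<phi> \<and> w \<notin> qZ q"
proof (rule eventually_conj)
 assume z: "z \<in> slit_plane \<phi>"
 show "\<forall>\<^sub>F w in at z. w \<in> slit_plane \<phi>" using open_slit_plane z by (auto simp: eventually_at_topological)
 show "\<forall>\<^sub>F w in at z. w \<notin> qZ q" by (rule qZ_discrete[OF slit_plane_nz[OF z]])
qed

lemma f_inf_last_mero: "mero_solution q n a b (slit_plane \<phi>) (f_inf_last \<phi> q n a b)"
 unfolding mero_solution_def eventually_cosparse_open_eq[OF open_slit_plane]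
proof (intro conjI ballI)
 show "f_inf_last \<phi> q n a b meromorphic_on slit_plane \<phi>"
 proof (subst meromorphic_on_cong[OF _ refl])
  fix z assume "z \<in> slit_plane \<phi>"
  from f_inf_last_eventually[OF this] show "\<forall>\<^sub>F w in at z. f_inf_last \<phi> q n a b w = GG \<phi> w"
   by eventually_elim (use f_inf_last_GG slit_plane_nz in blast)
 qed (rule GG_meromorphic)
 fix z assume "z \<in> slit_plane \<phi>"
 from f_inf_last_eventually[OF this] show "\<forall>\<^sub>F w in at z. confluent_eq q n a b (f_inf_last \<phi> q n a b) w"
 proof eventually_elim
  case (elim w)
  have w: "w \<noteq> 0" using elim slit_plane_nz by blast
  have "f_inf_last \<phi> q n a b (Q ^ k * w) = GG \<phi> (Q ^ k * w)" for k
  proof (rule f_inf_last_GG)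
   have "Q ^ k \<in> qZ q" using qZ_powi[of "int k"] by simp
   thus "Q ^ k * w \<notin> qZ q" using qZ_mult_iff[of "Q ^ k" w] elim by (simp add: mult.commute)
  qed (use w in simp)
  thus ?case using confluent_cong[of "f_inf_last \<phi> q n a b" w "GG \<phi>"] GG_solution[OF w] by blast
 qed
qed

text \<open>Along the spiral the i-th solution behaves like a_i^k times a nonzero constant, with
  distinct a_i, while f_n is negligible against every exponential. Hence all coefficients with i < n
  vanish, and then the last one does.\<close>

lemma coefficients_zero:
 assumes z: "z \<noteq> 0" "z \<notin> qZ q" "th (lam * z) \<noteq> 0"
  and rel: "\<And>k. (\<Sum>i=1..n. x i * (if i < n then f_inf \<phi> q n a b lam i else f_inf_last \<phi> q n a b) (Q powi (- int k) * z)) = 0"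
 shows "\<forall>i\<in>{1..n}. x i = 0"
proof -
 let ?z = "%k. Q powi (- int k) * z"
 have z0: "?z k \<noteq> 0" for k using z by simp
 have zq: "?z k \<notin> qZ q" for k using qZ_mult_iff[OF qZ_powi[of "- int k"], of z] z(2) by (simp add: mult.commute)
 have bp: "bpow \<phi> (?z k) (- qlog \<phi> q (a i)) = a i ^ k * bpow \<phi> z (- qlog \<phi> q (a i))" if i: "i \<in> {1..<n}" for i k
 proof (induction k)
  case (Suc k)
  show ?case using bpow_a[OF i z0[of "Suc k"]] Suc unfolding spiral_Suc by simp
 qed simp
 have ins: "{1..n} = insert n {1..<n}" using n1 by auto
 have s: "(\<Sum>i\<in>{1..<n}. (x i * bpow \<phi> z (- qlog \<phi> q (a i))) * a i ^ k * FF lam i (?z k)) + x n * GG \<phi> (?z k) = 0" for k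
 proof -
  have "(\<Sum>i=1..n. x i * (if i < n then f_inf \<phi> q n a b lam i else f_inf_last \<phi> q n a b) (?z k))
   = (\<Sum>i\<in>{1..<n}. x i * f_inf \<phi> q n a b lam i (?z k)) + x n * f_inf_last \<phi> q n a b (?z k)"
   unfolding ins by (subst sum.insert) (auto intro!: sum.cong)
  moreover have "(\<Sum>i\<in>{1..<n}. x i * f_inf \<phi> q n a b lam i (?z k)) = (\<Sum>i\<in>{1..<n}. (x i * bpow \<phi> z (- qlog \<phi> q (a i))) * a i ^ k * FF lam i (?z k))"
  proof (intro sum.cong refl)
   fix i assume i: "i \<in> {1..<n}"
   show "x i * f_inf \<phi> q n a b lam i (?z k) = x i * bpow \<phi> z (- qlog \<phi> q (a i)) * a i ^ k * FF lam i (?z k)"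
    unfolding f_inf_FF[OF i z0] bp[OF i] by simp
  qed
  ultimately show ?thesis using rel[of k] f_inf_last_GG[OF z0 zq] by simp
 qed
 have inj: "inj_on a {1..<n}"
 proof (rule inj_onI, rule ccontr)
  fix i j assume ij: "i \<in> {1..<n}" "j \<in> {1..<n}" "a i = a j" "i \<noteq> j"
  thus False using a_gen[OF ij(1,2,4)] a_nz[OF ij(2)] by simp
 qed
 have r: "(%k. x n * GG \<phi> (?z k) / of_real \<rho> ^ k) \<longlonglongrightarrow> 0" if "\<rho> > 0" for \<rho>
  using tendsto_mult[OF tendsto_const[of "x n"] GG_spiral[OF z(1) that]] by simp
 have "\<forall>i\<in>{1..<n}. x i * bpow \<phi> z (- qlog \<phi> q (a i)) = 0"
  by (rule exponential_sum_zero[OF _ a_nz inj FF_spiral[OF _ lam(1) lam(2) z(1,3)] s r]) auto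
 hence x0: "\<forall>i\<in>{1..<n}. x i = 0" by simp
 hence xG: "x n * GG \<phi> (?z k) = 0" for k using s[of k] by simp
 \<comment> \<open>Far out on the spiral \<open>T sseq\<close> is close to 1, so f_n is nonzero at
   some point of it.\<close>
 have "\<forall>\<^sub>F k in sequentially. T sseq (- (c * ?z k)) \<noteq> 0"
  by (rule tendsto_imp_eventually_ne[OF eta_spiral[OF z(1)]]) simp
 then obtain k where k: "T sseq (- (c * ?z k)) \<noteq> 0" by (meson eventually_happens' sequentially_bot)
 have "th (- ?z k) \<noteq> 0" using th_m_eq_0_iff[OF z0] zq by blast
 hence "GG \<phi> (?z k) \<noteq> 0" using k by (simp add: GG_def GE_def)
 hence "x n = 0" using xG[of k] by simp
 thus ?thesis using x0 unfolding ins by auto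
qed

text \<open>A q-invariant coefficient is constant along a spiral, so
  \<open>coefficients_zero\<close> applies pointwise at almost every z; a meromorphic function that
  vanishes outside a countable set vanishes near every point up to isolated exceptions.\<close>

theorem fundamental: "fundamental_system q n a b (slit_plane \<phi>)
      (%i. if i < n then f_inf \<phi> q n a b lam i else f_inf_last \<phi> q n a b)"
 unfolding fundamental_system_def
proof (intro conjI allI impI)
 let ?S = "slit_plane \<phi>"
 let ?f = "%i. if i < n then f_inf \<phi> q n a b lam i else f_inf_last \<phi> q n a b"
 show "\<forall>i\<in>{1..n}. mero_solution q n a b ?S (?f i)"
 proof
  fix i assume i: "i \<in> {1..n}"
  show "mero_solution q n a b ?S (?f i)"
  proof (cases "i < n")
   case True
   hence i': "i \<in> {1..<n}" using i by simp
   have "\<forall>\<^sub>F w in at x. confluent_eq q n a b (f_inf \<phi> q n a b lam i) w" if "x \<in> ?S" for x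
    using f_inf_last_eventually[OF that] by eventually_elim (use f_inf_solution[OF i'] slit_plane_nz in blast)
   thus ?thesis using True f_inf_meromorphic[OF i']
    unfolding mero_solution_def eventually_cosparse_open_eq[OF open_slit_plane] by simp
  qed (use f_inf_last_mero in simp)
 qed
 fix p
 assume p: "\<forall>i\<in>{1..n}. p i meromorphic_on ?S \<and> (\<forall>\<^sub>\<approx>z\<in>?S. p i (Q * z) = p i z)"
  and rel: "\<forall>\<^sub>\<approx>z\<in>?S. (\<Sum>i = 1..n. p i z * ?f i z) = 0"
 have cnt: "countable (?S \<inter> {z. \<not> P z})" if "\<forall>\<^sub>\<approx>z\<in>?S. P z" for P
  using sparse_imp_countable[OF open_slit_plane] that by (simp add: eventually_cosparse)
 \<comment> \<open>The points where the relation or an invariance fails, together with the lattices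
   on which theta(-z) or theta(lam z) vanishes; a sparse exceptional set is countable.\<close>
 define B where "B = (?S \<inter> {z. (\<Sum>i = 1..n. p i z * ?f i z) \<noteq> 0}) \<union> (\<Union>i\<in>{1..n}. ?S \<inter> {z. p i (Q * z) \<noteq> p i z}) \<union> qZ q \<union> (%x. - x / lam) ` qZ q"
 have c1: "countable (?S \<inter> {z. \<not> (\<Sum>i = 1..n. p i z * ?f i z) = 0})" by (rule cnt[OF rel])
 have c2: "countable (?S \<inter> {z. \<not> p i (Q * z) = p i z})" if "i \<in> {1..n}" for i by (rule cnt) (use p that in blast)
 have cn: "countable {1..n}" by simp
 have cB: "countable B" unfolding B_def by (intro countable_Un countable_UN countable_image c1 c2 cn countable_qZ)
 \<comment> \<open>Saturation under q^Z: if z avoids it, the whole spiral through z avoids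
   \<open>B\<close>, and \<open>C\<close> is still countable.\<close>
 define C where "C = (\<Union>m::int. (%z. Q powi m * z) ` B)"
 have cC: "countable C" unfolding C_def using cB by auto
 have pz: "\<forall>i\<in>{1..n}. p i z = 0" if z: "z \<in> ?S" "z \<notin> C" for z
 proof -
  let ?z = "%k. Q powi (- int k) * z"
  have good: "?z k \<in> ?S" "?z k \<notin> B" for k
  proof -
   have e: "Q powi (- int k) = of_real (q powi (- int k))" by simp
   show "?z k \<in> ?S" unfolding e by (rule iffD2[OF slit_plane_scale z(1)]) (use q0 in simp)
   show "?z k \<notin> B"
   proof
    assume "?z k \<in> B"
    moreover have "z = Q powi int k * ?z k" by (simp add: power_int_minus)
    ultimately have "z \<in> (%z. Q powi int k * z) ` B" by blast
    thus False using z(2) unfolding C_def by blast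
   qed
  qed
  have z0: "z \<noteq> 0" using z slit_plane_nz by blast
  have zB: "z \<notin> B" using good(2)[of 0] by simp
  have zq: "z \<notin> qZ q" using zB by (simp add: B_def)
  have lz: "th (lam * z) \<noteq> 0"
  proof
   assume "th (lam * z) = 0"
   hence "- (lam * z) \<in> qZ q" using th_eq_0_iff'[of "lam * z"] z0 lam(1) by simp
   moreover have "z = - (- (lam * z)) / lam" using lam(1) by simp
   ultimately show False using zB unfolding B_def by blast
  qed
  have pk: "p i (?z k) = p i z" if i: "i \<in> {1..n}" for i k
  proof (induction k)
   case (Suc k)
   have "p i (Q * ?z (Suc k)) = p i (?z (Suc k))" using good[of "Suc k"] i unfolding B_def by blast
   thus ?case using Suc unfolding spiral_Suc by simp
  qed simp
  show ?thesis
  proof (rule coefficients_zero[OF z0 zq lz])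
   fix k
   have "(\<Sum>i = 1..n. p i (?z k) * ?f i (?z k)) = 0" using good[of k] unfolding B_def by blast
   moreover have "(\<Sum>i = 1..n. p i (?z k) * ?f i (?z k)) = (\<Sum>i = 1..n. p i z * ?f i (?z k))"
    by (intro sum.cong refl) (simp only: pk)
   ultimately show "(\<Sum>i = 1..n. p i z * ?f i (?z k)) = 0" by simp
  qed
 qed
 show "\<forall>i\<in>{1..n}. \<forall>\<^sub>\<approx>z\<in>?S. p i z = 0"
  unfolding eventually_cosparse_open_eq[OF open_slit_plane]
 proof (intro ballI)
  fix i z assume i: "i \<in> {1..n}" and z: "z \<in> ?S"
  have m: "p i meromorphic_on {z}" using p i z by (meson empty_subsetI insert_subset meromorphic_on_subset)
  show "\<forall>\<^sub>F w in at z. p i w = 0"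
  proof (rule not_essential_frequently_0_imp_eventually_0)
   have "\<forall>\<^sub>F w in at z. w \<in> ?S" using open_slit_plane z by (auto simp: eventually_at_topological)
   hence "\<forall>\<^sub>F w in at z. w \<notin> C \<longrightarrow> p i w = 0" by eventually_elim (use pz i in blast)
   thus "\<exists>\<^sub>F w in at z. p i w = 0" by (rule frequently_rev_mp[OF frequently_notin_countable[OF cC]])
  qed (use m meromorphic_on_isolated_singularity meromorphic_on_not_essential in blast)+
 qed
qed

text \<open>The identity \<open>star\<close> divided by theta(-z) theta(lam z). The powers of z in
  the coefficients cancel those inside the solutions, since all are taken with the same
  branch.\<close>

theorem connection_formula:
 assumes z: "z \<noteq> 0" "z \<notin> qZ q" "- (lam * z) \<notin> qZ q"
 shows "ph as bs z = (\<Sum>i\<in>{1..<n}. Ci i * (th (- a i * z) / th (- z)) * bpow \<phi> z (qlog \<phi> q (a i)) * f_inf \<phi> q n a b lam i z)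
  + kapC * DD lam * (th (lam * z / c) / th (lam * z))
   * ((\<Prod>l\<in>{1..<n}. bpow \<phi> z (qlog \<phi> q (b l))) / (\<Prod>l\<in>{1..<n}. bpow \<phi> z (qlog \<phi> q (a l)))) * f_inf_last \<phi> q n a b z"
proof -
 have nz: "th (- z) \<noteq> 0" "th (lam * z) \<noteq> 0"
  using z th_m_eq_0_iff[of z] th_eq_0_iff'[of "lam * z"] lam by auto
 have t1: "Ci i * (th (- a i * z) / th (- z)) * bpow \<phi> z (qlog \<phi> q (a i)) * f_inf \<phi> q n a b lam i z
  = Ci i * th (- (a i * z)) * psum (bi i) (tt lam i) (- (c * a i * z)) / (th (- z) * th (lam * z))" if i: "i \<in> {1..<n}" for i
 proof -
  have "bpow \<phi> z (qlog \<phi> q (a i)) * bpow \<phi> z (- qlog \<phi> q (a i)) = 1"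
   unfolding bpow_def by (simp flip: exp_add)
  hence "x * bpow \<phi> z (qlog \<phi> q (a i)) * (bpow \<phi> z (- qlog \<phi> q (a i)) * y) = x * y" for x y
   by (metis mult.assoc mult.right_neutral)
  thus ?thesis unfolding f_inf_FF[OF i z(1)] by (simp add: FF_def)
 qed
 have B: "(\<Prod>l\<in>{1..<n}. bpow \<phi> z (qlog \<phi> q (b l))) / (\<Prod>l\<in>{1..<n}. bpow \<phi> z (qlog \<phi> q (a l))) * bpow \<phi> z (SS \<phi>) = 1"
 proof -
  have "bpow \<phi> z (SS \<phi>) = (\<Prod>l\<in>{1..<n}. bpow \<phi> z (qlog \<phi> q (a l) - qlog \<phi> q (b l)))"
   unfolding bpow_def SS_def sum_distrib_right by (rule exp_sum) simp
  also have "\<dots> = (\<Prod>l\<in>{1..<n}. bpow \<phi> z (qlog \<phi> q (a l))) / (\<Prod>l\<in>{1..<n}. bpow \<phi> z (qlog \<phi> q (b l)))"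
   unfolding prod_dividef[symmetric] by (intro prod.cong refl) (simp add: bpow_def left_diff_distrib exp_diff)
  finally show ?thesis by simp
 qed
 have t2: "kapC * DD lam * (th (lam * z / c) / th (lam * z))
   * ((\<Prod>l\<in>{1..<n}. bpow \<phi> z (qlog \<phi> q (b l))) / (\<Prod>l\<in>{1..<n}. bpow \<phi> z (qlog \<phi> q (a l)))) * f_inf_last \<phi> q n a b z
  = kapC * qi Q * DD lam * th (lam * z / c) * T sseq (- (c * z)) / (th (- z) * th (lam * z))"
 proof -
  have gen: "X * DL * (U / V) * Y * (W * P / R * TT) = (Y * P) * (X * W * DL * U * TT / (R * V))" for X DL U V Y W P R TT :: complex
   by (simp add: mult_ac)
  show ?thesis unfolding f_inf_last_GG[OF z(1,2)] GG_def GE_def gen B by simp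
 qed
 have "th (- z) * th (lam * z) * ph as bs z = (\<Sum>i\<in>{1..<n}. Ci i * th (- (a i * z)) * psum (bi i) (tt lam i) (- (c * a i * z)))
  + kapC * qi Q * DD lam * th (lam * z / c) * T sseq (- (c * z))"
  using star_everywhere[OF z lam] unfolding star_def .
 moreover have "x = s / P + r / P" if "P * x = s + r" "P \<noteq> 0" for P x s r :: complex
  using that by (simp add: field_simps)
 ultimately have "ph as bs z = (\<Sum>i\<in>{1..<n}. Ci i * th (- (a i * z)) * psum (bi i) (tt lam i) (- (c * a i * z))) / (th (- z) * th (lam * z))
  + kapC * qi Q * DD lam * th (lam * z / c) * T sseq (- (c * z)) / (th (- z) * th (lam * z))" using nz by simp
 thus ?thesis unfolding t2 sum_divide_distrib using t1 by simp
qed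

end

end

text \<open>Excluding lam from -a_i c q^Z keeps the sampled spirals off the poles of the Borel
  transforms. Excluding lam z from -q^Z keeps theta(lam z), which stands in the denominators,
  different from 0.\<close>

theorem theorem1p2:
  fixes q \<phi> :: real and n :: nat and a b :: "nat \<Rightarrow> complex" and lam :: complex
  assumes "0 < q" and "q < 1" and "n \<ge> 1"
    and "\<forall>i\<in>{1..<n}. a i \<noteq> 0"
    and "\<forall>i\<in>{1..<n}. \<forall>j\<in>{1..<n}. i \<noteq> j \<longrightarrow> a i / a j \<notin> qZ q"
    and "\<forall>l\<in>{1..<n}. b l \<notin> {0} \<union> q_minusN q"
    and "lam \<noteq> 0"
    and "\<forall>i\<in>{1..<n}. lam \<notin> (\<lambda>x. - a i * x) ` qZ q"
    and "\<forall>i\<in>{1..<n}. lam \<notin> (\<lambda>x. - a i * ((\<Prod>l\<in>{1..<n}. a l) / (\<Prod>l\<in>{1..<n}. b l)) * x) ` qZ q"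
  shows "(\<forall>z. z \<noteq> 0 \<and> z \<notin> qZ q
            \<and> z \<notin> (\<lambda>x. - ((\<Prod>l\<in>{1..<n}. b l) / (lam * (\<Prod>l\<in>{1..<n}. a l))) * x) ` qZ q
            \<and> lam * z \<notin> uminus ` qZ q \<longrightarrow>
          bhs (map a [1..<n] @ [0]) (map b [1..<n]) q z =
            (\<Sum>i\<in>{1..<n}.
               ((\<Prod>l\<in>{1..<n} - {i}. qpoch_inf (a l) q) * (\<Prod>l\<in>{1..<n}. qpoch_inf (b l / a i) q))
               / ((\<Prod>l\<in>{1..<n}. qpoch_inf (b l) q) * (\<Prod>l\<in>{1..<n} - {i}. qpoch_inf (a l / a i) q))
               * (qtheta q (- a i * z) / qtheta q (- z))
               * bpow \<phi> z (qlog \<phi> q (a i))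
               * f_inf \<phi> q n a b lam i z)
            + (\<Prod>l\<in>{1..<n}. qpoch_inf (a l) q) / (\<Prod>l\<in>{1..<n}. qpoch_inf (b l) q)
              * ((\<Prod>s\<in>{1..<n}. qtheta q ((\<Prod>l\<in>{1..<n}. a l) / (lam * (\<Prod>l\<in>{1..<n} - {s}. b l))))
                 / (\<Prod>s\<in>{1..<n}. qtheta q (a s * (\<Prod>l\<in>{1..<n}. a l) / (lam * (\<Prod>l\<in>{1..<n}. b l)))))
              * (qtheta q (lam * z * (\<Prod>l\<in>{1..<n}. b l) / (\<Prod>l\<in>{1..<n}. a l)) / qtheta q (lam * z))
              * ((\<Prod>l\<in>{1..<n}. bpow \<phi> z (qlog \<phi> q (b l))) / (\<Prod>l\<in>{1..<n}. bpow \<phi> z (qlog \<phi> q (a l))))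
              * f_inf_last \<phi> q n a b z)
       \<and> mero_solution q n a b UNIV (bhs (map a [1..<n] @ [0]) (map b [1..<n]) q)
       \<and> fundamental_system q n a b (slit_plane \<phi>)
            (\<lambda>i. if i < n then f_inf \<phi> q n a b lam i else f_inf_last \<phi> q n a b)"
proof -
  interpret qconf q n a b by unfold_locales (use assms in blast)+
  have lam: "- (lam / (a i * c)) \<notin> qZ q" if i: "i \<in> {1..<n}" for i
  proof
    assume m: "- (lam / (a i * c)) \<in> qZ q"
    have "lam = - a i * ((\<Prod>l\<in>{1..<n}. a l) / (\<Prod>l\<in>{1..<n}. b l)) * - (lam / (a i * c))"
      using a_nz[OF i] c_nz unfolding PA_def[symmetric] PB_def[symmetric] c_def[symmetric] by simp
    thus False using assms(9) i m by blast
  qed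
  have D: "(\<Prod>s\<in>{1..<n}. th ((\<Prod>l\<in>{1..<n}. a l) / (lam * (\<Prod>l\<in>{1..<n} - {s}. b l))))
                 / (\<Prod>s\<in>{1..<n}. th (a s * (\<Prod>l\<in>{1..<n}. a l) / (lam * (\<Prod>l\<in>{1..<n}. b l)))) = DD lam"
  proof -
    have "(\<Prod>l\<in>{1..<n}. a l) / (lam * (\<Prod>l\<in>{1..<n} - {s}. b l)) = c * b s / lam" if s: "s \<in> {1..<n}" for s
    proof -
      have "(\<Prod>l\<in>{1..<n}. b l) = b s * (\<Prod>l\<in>{1..<n} - {s}. b l)" by (rule prod.remove[OF _ s]) simp
      thus ?thesis using b_nz[OF s] by (simp add: c_def PA_def PB_def)
    qed
    moreover have "a s * (\<Prod>l\<in>{1..<n}. a l) / (lam * (\<Prod>l\<in>{1..<n}. b l)) = c * a s / lam" for s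
      by (simp add: c_def PA_def PB_def mult.commute)
    ultimately show ?thesis by (simp add: DD_def)
  qed
  have A: "lam * z * (\<Prod>l\<in>{1..<n}. b l) / (\<Prod>l\<in>{1..<n}. a l) = lam * z / c" for z
    by (simp add: c_def PA_def PB_def)
  show ?thesis
  proof (intro conjI allI impI)
    fix z assume z: "z \<noteq> 0 \<and> z \<notin> qZ q
            \<and> z \<notin> (\<lambda>x. - ((\<Prod>l\<in>{1..<n}. b l) / (lam * (\<Prod>l\<in>{1..<n}. a l))) * x) ` qZ q
            \<and> lam * z \<notin> uminus ` qZ q"
    have "- (lam * z) \<notin> qZ q"
    proof
      assume "- (lam * z) \<in> qZ q"
      hence "- (- (lam * z)) \<in> uminus ` qZ q" by (rule imageI)
      thus False using z by simp
    qed
    thus "bhs (map a [1..<n] @ [0]) (map b [1..<n]) q z =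
            (\<Sum>i\<in>{1..<n}.
               ((\<Prod>l\<in>{1..<n} - {i}. qpoch_inf (a l) q) * (\<Prod>l\<in>{1..<n}. qpoch_inf (b l / a i) q))
               / ((\<Prod>l\<in>{1..<n}. qpoch_inf (b l) q) * (\<Prod>l\<in>{1..<n} - {i}. qpoch_inf (a l / a i) q))
               * (qtheta q (- a i * z) / qtheta q (- z))
               * bpow \<phi> z (qlog \<phi> q (a i))
               * f_inf \<phi> q n a b lam i z)
            + (\<Prod>l\<in>{1..<n}. qpoch_inf (a l) q) / (\<Prod>l\<in>{1..<n}. qpoch_inf (b l) q)
              * ((\<Prod>s\<in>{1..<n}. qtheta q ((\<Prod>l\<in>{1..<n}. a l) / (lam * (\<Prod>l\<in>{1..<n} - {s}. b l))))
                 / (\<Prod>s\<in>{1..<n}. qtheta q (a s * (\<Prod>l\<in>{1..<n}. a l) / (lam * (\<Prod>l\<in>{1..<n}. b l)))))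
              * (qtheta q (lam * z * (\<Prod>l\<in>{1..<n}. b l) / (\<Prod>l\<in>{1..<n}. a l)) / qtheta q (lam * z))
              * ((\<Prod>l\<in>{1..<n}. bpow \<phi> z (qlog \<phi> q (b l))) / (\<Prod>l\<in>{1..<n}. bpow \<phi> z (qlog \<phi> q (a l))))
              * f_inf_last \<phi> q n a b z"
      using connection_formula[OF assms(7) lam, of z \<phi>] z unfolding D A bhs_ph Ci_def kapC_def by blast
  next
    show "mero_solution q n a b UNIV (bhs (map a [1..<n] @ [0]) (map b [1..<n]) q)" by (rule bhs_mero_solution)
    show "fundamental_system q n a b (slit_plane \<phi>) (\<lambda>i. if i < n then f_inf \<phi> q n a b lam i else f_inf_last \<phi> q n a b)"
      by (rule fundamental[OF assms(7) lam])
  qed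
qed

end
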